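(* Let $\Bbbk$ be a field, $Q$ a commutative Noetherian monoid, and $I\subset\Bbbk[Q]$ a binomial ideal. For each monoid prime $P\subset Q$ and each essential $I$-witness $w$ for $P$, consider the irreducible closure $\operatorname{Irr}(W_w^P(I))$ of the $P$-coprincipal component of $I$ at $w$, and the components of its (unique) minimal primary decomposition. The intersection of all these primary components, over all such $P$ and $w$, is an irreducible decomposition of $I$; that is, all these components are irreducible ideals of $\Bbbk[Q]$ and their intersection equals $I$.
   Context: Monoids. $Q$ is commutative, Noetherian (equivalently finitely generated), written additively. An ideal of a monoid is a subset closed under adding arbitrary elements; $\langle q\rangle$ is the ideal generated by $q$. A nil is an absorbing element $\infty$; nilpotent means some positive multiple is nil; $c$ is cancellative if $a+c=b+c\Rightarrow a=b$. A prime $P\subset Q$ is a proper, possibly empty, ideal whose complement is a submonoid. $Q_P$ is the localization inverting $Q\smallsetminus P$, with unit group $G_P$. For a congruence $\sim$ on $Q$ (also denoting the congruence it generates on $Q_P$), $\overline Q=Q/{\sim}$, $\overline Q_P=Q_P/{\sim}$, and $\bar q$ is the image of $q$ in $\overline Q_P$. Green's preorder: $a\le b$ iff $\langle b\rangle\subseteq\langle a\rangle$. $q$ is a key aide for $w$ (with respect to $\sim$, $P$) if $\bar w\ne\bar q$, $\bar w+\bar p=\bar q+\bar p$ for all $p\in P$, and not $\bar q<\bar w$ strictly in Green's preorder; $w$ is a key $\sim$-witness for $P$ if it has a key aide; a key witness $w$ is a cogenerator of $\sim$ if $w+p$ is nil modulo $\sim$ for all $p\in P$. $\sim$ is $P$-primary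 if each $p\in P$ is nilpotent and each $f\in Q\smallsetminus P$ cancellative in $\overline Q$; $P$-mesoprimary if moreover $q+a=q+b\ne\infty\Rightarrow a=b$ for all $q\in\overline Q$ and cancellative $a,b\in\overline Q$; $P$-coprincipal if moreover all cogenerators of $\sim$ generate the same ideal of $\overline Q_P$. Binomial ideals. $\Bbbk[Q]$ has basis $\mathbf t^a$, $a\in Q$. A binomial is $\mathbf t^a-\lambda\mathbf t^b$ with $\lambda\in\Bbbk$ (possibly $0$); an ideal is binomial if generated by binomials. $I$ induces the congruence $a\sim_I b$ iff $\mathbf t^a-\lambda\mathbf t^b\in I$ for some $\lambda\ne0$. $\mathfrak m_P=\langle\mathbf t^p:p\in P\rangle$. Subscript $P$ denotes inverting all monomials outside $\mathfrak m_P$, so $\Bbbk[Q]_P=\Bbbk[Q_P]$; $\Bbbk[Q_P]/I_P$ is graded by $Q_P/{\sim_I}$. $I$ is $P$-coprincipal if $\sim_I$ is and $I$ is maximal among proper binomial ideals inducing $\sim_I$; it is cogenerated by $w\in Q$ if $\mathbf t^w\notin I_P$ and $\mathbf t^{w+p}\in I_P$ for all $p\in P$. Essential witnesses. $w\in Q$ is an essential $I$-witness for $P$ if $w$ is a key $\sim_I$-witness for $P$, or some element of $\Bbbk[Q_P]/I_P$ annihilated by $\mathfrak m_P$ has $\mathbf t^w$ minimal (Green's preorder) among its nonzero monomials. Coprincipal components. For such $w$, let $K_w^P\subset G_P$ be the stabilizer of the class of $w$ modulo $\sim_I$, $\rho:K_w^P\to\Bbbk^*$ the homomorphism with $(\mathbf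 t^u-\rho(u))\mathbf t^w=0$ in $\Bbbk[Q_P]/I_P$, $I_\rho=\langle\mathbf t^u-\rho(u-v)\mathbf t^v : u,v\in G_P,\ u-v\in K_w^P\rangle\subset\Bbbk[Q]_P$, and $M_w^P(I)$ the ideal generated by monomials $\mathbf t^u$, $u\in Q$, with $\bar w\notin\langle\bar u\rangle\subseteq Q_P/{\sim_I}$. The $P$-coprincipal component $W_w^P(I)$ is the preimage in $\Bbbk[Q]$ of $I_P+I_\rho+M_w^P(I)$; it is $P$-coprincipal cogenerated by $w$. Irreducible closure. Let $J$ be $P$-coprincipal cogenerated by $w$. Put $R_P=\Bbbk[Q_P]/J_P$, graded by $Q_P/{\sim_J}$. Let $\bar w^\perp$ be the unique graded $\Bbbk$-subspace of $R_P$ with $R_P=(\Bbbk[G_P]\cdot\mathbf t^{\bar w})\oplus\bar w^\perp$, let $\bar w^\perp_\infty$ be the largest $\Bbbk[Q_P]$-submodule of $R_P$ contained in $\bar w^\perp$, and $\overline R_P=R_P/\bar w^\perp_\infty$. Then $\operatorname{Irr}(J)=\ker(\Bbbk[Q]\to\overline R_P)$. It is known that $\operatorname{Irr}(J)$ has a unique minimal primary decomposition. An ideal is irreducible if it is not an intersection of two ideals properly containing it. An empty intersection of ideals is $\Bbbk[Q]$. *)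

theory Defs
  imports
    "HOL-Algebra.QuotRing"
    "HOL-Algebra.Embedded_Algebras"
    "HOL-Library.Poly_Mapping"
begin

text \<open>
  Monoids are HOL-Algebra records, so the additively written operation of a commutative monoid
  appears as \<open>\<otimes>\<close> and its neutral element as \<open>\<one>\<close>.
\<close>

section \<open>Commutative monoids\<close>

definition finitely_generated_monoid :: "('a, 'm) monoid_scheme \<Rightarrow> bool" where
  "finitely_generated_monoid M \<longleftrightarrow>
     (\<exists>S. finite S \<and> S \<subseteq> carrier M \<and> \<Inter>{H. submonoid H M \<and> S \<subseteq> H} = carrier M)"

definition monoid_prime :: "('a, 'm) monoid_scheme \<Rightarrow> 'a set \<Rightarrow> bool" where
  "monoid_prime M P \<longleftrightarrow>
     P \<subset> carrier M \<and>
     (\<forall>p\<in>P. \<forall>q\<in>carrier M. p \<otimes>\<^bsub>M\<^esub> q \<in> P) \<and>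
     submonoid (carrier M - P) M"

definition principal_monoid_ideal :: "('a, 'm) monoid_scheme \<Rightarrow> 'a \<Rightarrow> 'a set" where
  "principal_monoid_ideal M a = {a \<otimes>\<^bsub>M\<^esub> x | x. x \<in> carrier M}"

definition green_le :: "('a, 'm) monoid_scheme \<Rightarrow> 'a \<Rightarrow> 'a \<Rightarrow> bool" where
  "green_le M a b \<longleftrightarrow> principal_monoid_ideal M b \<subseteq> principal_monoid_ideal M a"

definition green_less :: "('a, 'm) monoid_scheme \<Rightarrow> 'a \<Rightarrow> 'a \<Rightarrow> bool" where
  "green_less M a b \<longleftrightarrow> green_le M a b \<and> \<not> green_le M b a"

definition monoid_congruence :: "('a, 'm) monoid_scheme \<Rightarrow> ('a \<times> 'a) set \<Rightarrow> bool" where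
  "monoid_congruence M r \<longleftrightarrow>
     equiv (carrier M) r \<and>
     (\<forall>a b. (a, b) \<in> r \<longrightarrow> (\<forall>c\<in>carrier M. (a \<otimes>\<^bsub>M\<^esub> c, b \<otimes>\<^bsub>M\<^esub> c) \<in> r))"

definition generated_congruence ::
  "('a, 'm) monoid_scheme \<Rightarrow> ('a \<times> 'a) set \<Rightarrow> ('a \<times> 'a) set" where
  "generated_congruence M r = \<Inter>{s. monoid_congruence M s \<and> r \<subseteq> s}"

definition quotient_monoid ::
  "('a, 'm) monoid_scheme \<Rightarrow> ('a \<times> 'a) set \<Rightarrow> 'a set monoid" where
  "quotient_monoid M r =
     \<lparr> carrier = carrier M // r,
       mult = (\<lambda>A B. \<Union>a\<in>A. \<Union>b\<in>B. r `` {a \<otimes>\<^bsub>M\<^esub> b}),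
       one = r `` {\<one>\<^bsub>M\<^esub>} \<rparr>"

text \<open>
  The localization \<open>Q\<^sub>P\<close> consists of classes of pairs \<open>(a, s)\<close>, standing for \<open>a - s\<close>, with
  \<open>a\<close> in \<open>Q\<close> and \<open>s\<close> in \<open>Q\<close> but not in \<open>P\<close>.
\<close>

definition localization_rel ::
  "('a, 'm) monoid_scheme \<Rightarrow> 'a set \<Rightarrow> (('a \<times> 'a) \<times> ('a \<times> 'a)) set" where
  "localization_rel Q P =
     {((a, s), (b, t)) | a s b t.
        a \<in> carrier Q \<and> b \<in> carrier Q \<and> s \<in> carrier Q - P \<and> t \<in> carrier Q - P \<and>
        (\<exists>u\<in>carrier Q - P. u \<otimes>\<^bsub>Q\<^esub> (a \<otimes>\<^bsub>Q\<^esub> t) = u \<otimes>\<^bsub>Q\<^esub> (b \<otimes>\<^bsub>Q\<^esub> s))}"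

definition localization :: "('a, 'm) monoid_scheme \<Rightarrow> 'a set \<Rightarrow> ('a \<times> 'a) set monoid" where
  "localization Q P =
     quotient_monoid (Q \<times>\<times> (Q\<lparr>carrier := carrier Q - P\<rparr>)) (localization_rel Q P)"

definition to_loc :: "('a, 'm) monoid_scheme \<Rightarrow> 'a set \<Rightarrow> 'a \<Rightarrow> ('a \<times> 'a) set" where
  "to_loc Q P a = localization_rel Q P `` {(a, \<one>\<^bsub>Q\<^esub>)}"

text \<open>The congruence on \<open>Q\<^sub>P\<close> generated by a congruence \<open>r\<close> on \<open>Q\<close>, and \<open>Q\<^sub>P\<close> modulo it.\<close>

definition loc_congruence ::
  "('a, 'm) monoid_scheme \<Rightarrow> ('a \<times> 'a) set \<Rightarrow> 'a set \<Rightarrow> (('a \<times> 'a) set \<times> ('a \<times> 'a) set) set"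
  where
  "loc_congruence Q r P =
     generated_congruence (localization Q P) (map_prod (to_loc Q P) (to_loc Q P) ` r)"

definition loc_quotient ::
  "('a, 'm) monoid_scheme \<Rightarrow> ('a \<times> 'a) set \<Rightarrow> 'a set \<Rightarrow> ('a \<times> 'a) set set monoid" where
  "loc_quotient Q r P = quotient_monoid (localization Q P) (loc_congruence Q r P)"

definition loc_class ::
  "('a, 'm) monoid_scheme \<Rightarrow> ('a \<times> 'a) set \<Rightarrow> 'a set \<Rightarrow> 'a \<Rightarrow> ('a \<times> 'a) set set" where
  "loc_class Q r P a = loc_congruence Q r P `` {to_loc Q P a}"

definition key_aide ::
  "('a, 'm) monoid_scheme \<Rightarrow> ('a \<times> 'a) set \<Rightarrow> 'a set \<Rightarrow> 'a \<Rightarrow> 'a \<Rightarrow> bool" where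
  "key_aide Q r P w q \<longleftrightarrow>
     loc_class Q r P w \<noteq> loc_class Q r P q \<and>
     (\<forall>p\<in>P. loc_class Q r P w \<otimes>\<^bsub>loc_quotient Q r P\<^esub> loc_class Q r P p =
            loc_class Q r P q \<otimes>\<^bsub>loc_quotient Q r P\<^esub> loc_class Q r P p) \<and>
     \<not> green_less (loc_quotient Q r P) (loc_class Q r P q) (loc_class Q r P w)"

definition key_witness ::
  "('a, 'm) monoid_scheme \<Rightarrow> ('a \<times> 'a) set \<Rightarrow> 'a set \<Rightarrow> 'a \<Rightarrow> bool" where
  "key_witness Q r P w \<longleftrightarrow> w \<in> carrier Q \<and> (\<exists>q\<in>carrier Q. key_aide Q r P w q)"


section \<open>Monoid algebras and binomial ideals\<close>

definition monoid_algebra :: "('a, 'm) monoid_scheme \<Rightarrow> ('a \<Rightarrow>\<^sub>0 'k::field) ring" where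
  "monoid_algebra M =
     \<lparr> carrier = {f. Poly_Mapping.keys f \<subseteq> carrier M},
       mult = (\<lambda>f g. \<Sum>a\<in>Poly_Mapping.keys f. \<Sum>b\<in>Poly_Mapping.keys g.
                 Poly_Mapping.single (a \<otimes>\<^bsub>M\<^esub> b)
                   (Poly_Mapping.lookup f a * Poly_Mapping.lookup g b)),
       one = Poly_Mapping.single \<one>\<^bsub>M\<^esub> 1,
       zero = 0,
       add = (+) \<rparr>"

abbreviation monomial :: "'a \<Rightarrow> 'a \<Rightarrow>\<^sub>0 'k::field" where
  "monomial a \<equiv> Poly_Mapping.single a 1"

definition binomials :: "('a, 'm) monoid_scheme \<Rightarrow> ('a \<Rightarrow>\<^sub>0 'k::field) set" where
  "binomials M =
     {monomial a - Poly_Mapping.single b c | a b c. a \<in> carrier M \<and> b \<in> carrier M}"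

definition binomial_ideal :: "('a, 'm) monoid_scheme \<Rightarrow> ('a \<Rightarrow>\<^sub>0 'k::field) set \<Rightarrow> bool" where
  "binomial_ideal M I \<longleftrightarrow> (\<exists>B \<subseteq> binomials M. I = Idl\<^bsub>monoid_algebra M\<^esub> B)"

definition ideal_congruence ::
  "('a, 'm) monoid_scheme \<Rightarrow> ('a \<Rightarrow>\<^sub>0 'k::field) set \<Rightarrow> ('a \<times> 'a) set" where
  "ideal_congruence M I =
     {(a, b). a \<in> carrier M \<and> b \<in> carrier M \<and>
              (\<exists>c. c \<noteq> 0 \<and> monomial a - Poly_Mapping.single b c \<in> I)}"

definition monomial_prime ::
  "('a, 'm) monoid_scheme \<Rightarrow> 'a set \<Rightarrow> ('a \<Rightarrow>\<^sub>0 'k::field) set" where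
  "monomial_prime Q P = Idl\<^bsub>monoid_algebra Q\<^esub> (monomial ` P)"

text \<open>
  \<open>loc_algebra Q P\<close> is \<open>\<bbbk>[Q\<^sub>P]\<close>, \<open>loc_map Q P\<close> is the canonical map \<open>\<bbbk>[Q] \<rightarrow> \<bbbk>[Q\<^sub>P]\<close>,
  and \<open>loc_ideal Q P I\<close> is \<open>I\<^sub>P\<close>.
\<close>

abbreviation loc_algebra ::
  "('a, 'm) monoid_scheme \<Rightarrow> 'a set \<Rightarrow> (('a \<times> 'a) set \<Rightarrow>\<^sub>0 'k::field) ring" where
  "loc_algebra Q P \<equiv> monoid_algebra (localization Q P)"

definition loc_map ::
  "('a, 'm) monoid_scheme \<Rightarrow> 'a set \<Rightarrow> ('a \<Rightarrow>\<^sub>0 'k::field) \<Rightarrow> (('a \<times> 'a) set \<Rightarrow>\<^sub>0 'k)" where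
  "loc_map Q P f =
     (\<Sum>a\<in>Poly_Mapping.keys f. Poly_Mapping.single (to_loc Q P a) (Poly_Mapping.lookup f a))"

definition loc_ideal ::
  "('a, 'm) monoid_scheme \<Rightarrow> 'a set \<Rightarrow> ('a \<Rightarrow>\<^sub>0 'k::field) set \<Rightarrow> (('a \<times> 'a) set \<Rightarrow>\<^sub>0 'k) set"
  where
  "loc_ideal Q P I = Idl\<^bsub>loc_algebra Q P\<^esub> (loc_map Q P ` I)"

definition loc_residue_ring ::
  "('a, 'm) monoid_scheme \<Rightarrow> 'a set \<Rightarrow> ('a \<Rightarrow>\<^sub>0 'k::field) set
     \<Rightarrow> (('a \<times> 'a) set \<Rightarrow>\<^sub>0 'k) set ring" where
  "loc_residue_ring Q P I = loc_algebra Q P Quot loc_ideal Q P I"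

definition loc_residue ::
  "('a, 'm) monoid_scheme \<Rightarrow> 'a set \<Rightarrow> ('a \<Rightarrow>\<^sub>0 'k::field) set
     \<Rightarrow> (('a \<times> 'a) set \<Rightarrow>\<^sub>0 'k) \<Rightarrow> (('a \<times> 'a) set \<Rightarrow>\<^sub>0 'k) set" where
  "loc_residue Q P I f = loc_ideal Q P I +>\<^bsub>loc_algebra Q P\<^esub> f"

text \<open>
  The homogeneous component of degree \<open>d\<close> of an element \<open>x\<close> (a coset) of \<open>\<bbbk>[Q\<^sub>P]/I\<^sub>P\<close>. A degree
  is an element of \<open>Q\<^sub>P\<close> modulo the congruence of \<open>I\<close>, that is, a set of exponents; the component is
  the residue of the part of any representative supported on this set. For a binomial ideal \<open>I\<close>
  it does not depend on the representative.
\<close>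

definition restrict_support :: "('a \<Rightarrow>\<^sub>0 'k::field) \<Rightarrow> 'a set \<Rightarrow> ('a \<Rightarrow>\<^sub>0 'k)" where
  "restrict_support f d =
     (\<Sum>a\<in>Poly_Mapping.keys f \<inter> d. Poly_Mapping.single a (Poly_Mapping.lookup f a))"

definition homogeneous_component ::
  "('a, 'm) monoid_scheme \<Rightarrow> 'a set \<Rightarrow> ('a \<Rightarrow>\<^sub>0 'k::field) set
     \<Rightarrow> ('a \<times> 'a) set set \<Rightarrow> (('a \<times> 'a) set \<Rightarrow>\<^sub>0 'k) set \<Rightarrow> (('a \<times> 'a) set \<Rightarrow>\<^sub>0 'k) set" where
  "homogeneous_component Q P I d x = (\<Union>f\<in>x. loc_residue Q P I (restrict_support f d))"

definition nonzero_degrees ::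
  "('a, 'm) monoid_scheme \<Rightarrow> 'a set \<Rightarrow> ('a \<Rightarrow>\<^sub>0 'k::field) set
     \<Rightarrow> (('a \<times> 'a) set \<Rightarrow>\<^sub>0 'k) set \<Rightarrow> ('a \<times> 'a) set set set" where
  "nonzero_degrees Q P I x =
     {d \<in> carrier (loc_quotient Q (ideal_congruence Q I) P).
        homogeneous_component Q P I d x \<noteq> \<zero>\<^bsub>loc_residue_ring Q P I\<^esub>}"

definition graded_subspace ::
  "('a, 'm) monoid_scheme \<Rightarrow> 'a set \<Rightarrow> ('a \<Rightarrow>\<^sub>0 'k::field) set
     \<Rightarrow> (('a \<times> 'a) set \<Rightarrow>\<^sub>0 'k) set set \<Rightarrow> bool" where
  "graded_subspace Q P I V \<longleftrightarrow>
     subalgebra (range (\<lambda>c. loc_residue Q P I (Poly_Mapping.single \<one>\<^bsub>localization Q P\<^esub> c))) V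
       (loc_residue_ring Q P I) \<and>
     (\<forall>x\<in>V. \<forall>d\<in>carrier (loc_quotient Q (ideal_congruence Q I) P).
        homogeneous_component Q P I d x \<in> V)"


section \<open>Essential witnesses and coprincipal components\<close>

definition essential_witness ::
  "('a, 'm) monoid_scheme \<Rightarrow> ('a \<Rightarrow>\<^sub>0 'k::field) set \<Rightarrow> 'a set \<Rightarrow> 'a \<Rightarrow> bool" where
  "essential_witness Q I P w \<longleftrightarrow>
     w \<in> carrier Q \<and>
     (key_witness Q (ideal_congruence Q I) P w \<or>
      (\<exists>x\<in>carrier (loc_residue_ring Q P I).
         (\<forall>g\<in>monomial_prime Q P.
            loc_residue Q P I (loc_map Q P g) \<otimes>\<^bsub>loc_residue_ring Q P I\<^esub> x =
              \<zero>\<^bsub>loc_residue_ring Q P I\<^esub>) \<and>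
         loc_class Q (ideal_congruence Q I) P w \<in> nonzero_degrees Q P I x \<and>
         (\<forall>d\<in>nonzero_degrees Q P I x.
            \<not> green_less (loc_quotient Q (ideal_congruence Q I) P) d
                (loc_class Q (ideal_congruence Q I) P w))))"

definition witness_stabilizer ::
  "('a, 'm) monoid_scheme \<Rightarrow> ('a \<Rightarrow>\<^sub>0 'k::field) set \<Rightarrow> 'a set \<Rightarrow> 'a \<Rightarrow> ('a \<times> 'a) set set" where
  "witness_stabilizer Q I P w =
     {u \<in> Units (localization Q P).
        loc_congruence Q (ideal_congruence Q I) P `` {u}
          \<otimes>\<^bsub>loc_quotient Q (ideal_congruence Q I) P\<^esub> loc_class Q (ideal_congruence Q I) P w =
        loc_class Q (ideal_congruence Q I) P w}"

text \<open>
  The defining equation determines each value of the character separately, because the monomial of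
  an essential witness is nonzero in \<open>\<bbbk>[Q\<^sub>P]/I\<^sub>P\<close>.
\<close>

definition witness_character ::
  "('a, 'm) monoid_scheme \<Rightarrow> ('a \<Rightarrow>\<^sub>0 'k::field) set \<Rightarrow> 'a set \<Rightarrow> 'a \<Rightarrow> ('a \<times> 'a) set \<Rightarrow> 'k" where
  "witness_character Q I P w u =
     (THE c. c \<noteq> 0 \<and>
        loc_residue Q P I (monomial u - Poly_Mapping.single \<one>\<^bsub>localization Q P\<^esub> c)
          \<otimes>\<^bsub>loc_residue_ring Q P I\<^esub> loc_residue Q P I (monomial (to_loc Q P w)) =
        \<zero>\<^bsub>loc_residue_ring Q P I\<^esub>)"

definition character_ideal ::
  "('a, 'm) monoid_scheme \<Rightarrow> ('a \<Rightarrow>\<^sub>0 'k::field) set \<Rightarrow> 'a set \<Rightarrow> 'a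
     \<Rightarrow> (('a \<times> 'a) set \<Rightarrow>\<^sub>0 'k) set" where
  "character_ideal Q I P w =
     Idl\<^bsub>loc_algebra Q P\<^esub>
       {monomial u - Poly_Mapping.single v
            (witness_character Q I P w (u \<otimes>\<^bsub>localization Q P\<^esub> inv\<^bsub>localization Q P\<^esub> v)) | u v.
          u \<in> Units (localization Q P) \<and> v \<in> Units (localization Q P) \<and>
          u \<otimes>\<^bsub>localization Q P\<^esub> inv\<^bsub>localization Q P\<^esub> v \<in> witness_stabilizer Q I P w}"

definition witness_monomial_ideal ::
  "('a, 'm) monoid_scheme \<Rightarrow> ('a \<Rightarrow>\<^sub>0 'k::field) set \<Rightarrow> 'a set \<Rightarrow> 'a
     \<Rightarrow> (('a \<times> 'a) set \<Rightarrow>\<^sub>0 'k) set" where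
  "witness_monomial_ideal Q I P w =
     Idl\<^bsub>loc_algebra Q P\<^esub>
       {monomial (to_loc Q P u) | u.
          u \<in> carrier Q \<and>
          loc_class Q (ideal_congruence Q I) P w \<notin>
            principal_monoid_ideal (loc_quotient Q (ideal_congruence Q I) P)
              (loc_class Q (ideal_congruence Q I) P u)}"

definition coprincipal_component ::
  "('a, 'm) monoid_scheme \<Rightarrow> ('a \<Rightarrow>\<^sub>0 'k::field) set \<Rightarrow> 'a set \<Rightarrow> 'a \<Rightarrow> ('a \<Rightarrow>\<^sub>0 'k) set" where
  "coprincipal_component Q I P w =
     {f \<in> carrier (monoid_algebra Q).
        loc_map Q P f \<in>
          loc_ideal Q P I <+>\<^bsub>loc_algebra Q P\<^esub> character_ideal Q I P w
            <+>\<^bsub>loc_algebra Q P\<^esub> witness_monomial_ideal Q I P w}"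


section \<open>Irreducible closure\<close>

definition witness_submodule ::
  "('a, 'm) monoid_scheme \<Rightarrow> ('a \<Rightarrow>\<^sub>0 'k::field) set \<Rightarrow> 'a set \<Rightarrow> 'a
     \<Rightarrow> (('a \<times> 'a) set \<Rightarrow>\<^sub>0 'k) set set" where
  "witness_submodule Q J P w =
     {loc_residue Q P J (g \<otimes>\<^bsub>loc_algebra Q P\<^esub> monomial (to_loc Q P w)) | g.
        g \<in> carrier (monoid_algebra (units_of (localization Q P)))}"

definition witness_perp ::
  "('a, 'm) monoid_scheme \<Rightarrow> ('a \<Rightarrow>\<^sub>0 'k::field) set \<Rightarrow> 'a set \<Rightarrow> 'a
     \<Rightarrow> (('a \<times> 'a) set \<Rightarrow>\<^sub>0 'k) set set" where
  "witness_perp Q J P w =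
     (THE V. graded_subspace Q P J V \<and>
        witness_submodule Q J P w <+>\<^bsub>loc_residue_ring Q P J\<^esub> V =
          carrier (loc_residue_ring Q P J) \<and>
        witness_submodule Q J P w \<inter> V = {\<zero>\<^bsub>loc_residue_ring Q P J\<^esub>})"

text \<open>The \<open>\<bbbk>[Q\<^sub>P]\<close>-submodules of the quotient ring \<open>\<bbbk>[Q\<^sub>P]/J\<^sub>P\<close> are its ideals.\<close>

definition witness_perp_core ::
  "('a, 'm) monoid_scheme \<Rightarrow> ('a \<Rightarrow>\<^sub>0 'k::field) set \<Rightarrow> 'a set \<Rightarrow> 'a
     \<Rightarrow> (('a \<times> 'a) set \<Rightarrow>\<^sub>0 'k) set set" where
  "witness_perp_core Q J P w =
     (GREATEST N. ideal N (loc_residue_ring Q P J) \<and> N \<subseteq> witness_perp Q J P w)"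

text \<open>Meaningful for \<open>J\<close> a \<open>P\<close>-coprincipal binomial ideal cogenerated by \<open>w\<close>.\<close>

definition irreducible_closure ::
  "('a, 'm) monoid_scheme \<Rightarrow> ('a \<Rightarrow>\<^sub>0 'k::field) set \<Rightarrow> 'a set \<Rightarrow> 'a \<Rightarrow> ('a \<Rightarrow>\<^sub>0 'k) set" where
  "irreducible_closure Q J P w =
     a_kernel (monoid_algebra Q) (loc_residue_ring Q P J Quot witness_perp_core Q J P w)
       (\<lambda>f. witness_perp_core Q J P w +>\<^bsub>loc_residue_ring Q P J\<^esub>
              loc_residue Q P J (loc_map Q P f))"


section \<open>Primary decomposition and irreducible ideals\<close>

definition primary_ideal :: "('r, 'm) ring_scheme \<Rightarrow> 'r set \<Rightarrow> bool" where
  "primary_ideal R C \<longleftrightarrow>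
     ideal C R \<and> C \<noteq> carrier R \<and>
     (\<forall>a\<in>carrier R. \<forall>b\<in>carrier R.
        a \<otimes>\<^bsub>R\<^esub> b \<in> C \<longrightarrow> a \<in> C \<or> (\<exists>n::nat. b [^]\<^bsub>R\<^esub> n \<in> C))"

definition ideal_radical :: "('r, 'm) ring_scheme \<Rightarrow> 'r set \<Rightarrow> 'r set" where
  "ideal_radical R C = {a \<in> carrier R. \<exists>n::nat. a [^]\<^bsub>R\<^esub> n \<in> C}"

text \<open>The empty intersection of ideals of \<open>R\<close> is \<open>R\<close>.\<close>

definition ideal_Inter :: "('r, 'm) ring_scheme \<Rightarrow> 'r set set \<Rightarrow> 'r set" where
  "ideal_Inter R \<C> = carrier R \<inter> \<Inter>\<C>"

definition minimal_primary_decomposition ::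
  "('r, 'm) ring_scheme \<Rightarrow> 'r set \<Rightarrow> 'r set set \<Rightarrow> bool" where
  "minimal_primary_decomposition R A \<C> \<longleftrightarrow>
     finite \<C> \<and> (\<forall>C\<in>\<C>. primary_ideal R C) \<and> ideal_Inter R \<C> = A \<and>
     inj_on (ideal_radical R) \<C> \<and>
     (\<forall>C\<in>\<C>. \<not> ideal_Inter R (\<C> - {C}) \<subseteq> C)"

text \<open>Meaningful only for ideals with exactly one minimal primary decomposition.\<close>

definition primary_components :: "('r, 'm) ring_scheme \<Rightarrow> 'r set \<Rightarrow> 'r set set" where
  "primary_components R A = (THE \<C>. minimal_primary_decomposition R A \<C>)"

definition irreducible_ideal :: "('r, 'm) ring_scheme \<Rightarrow> 'r set \<Rightarrow> bool" where
  "irreducible_ideal R C \<longleftrightarrow>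
     ideal C R \<and> \<not> (\<exists>A B. ideal A R \<and> ideal B R \<and> C \<subset> A \<and> C \<subset> B \<and> C = A \<inter> B)"

definition witness_components ::
  "('a, 'm) monoid_scheme \<Rightarrow> ('a \<Rightarrow>\<^sub>0 'k::field) set \<Rightarrow> ('a \<Rightarrow>\<^sub>0 'k) set set" where
  "witness_components Q I =
     (\<Union>P\<in>{P. monoid_prime Q P}. \<Union>w\<in>{w. essential_witness Q I P w}.
        primary_components (monoid_algebra Q)
          (irreducible_closure Q (coprincipal_component Q I P w) P w))"

end

theory Submission
  imports Defs
begin

text \<open>
  Let \<open>W\<close> be the coprincipal component at an essential witness \<open>w\<close>. Reading off the coefficient of
  \<open>t\<^sup>w\<close> modulo \<open>I\<^sub>P\<close> gives a functional \<open>\<psi>\<close> on the localized monoid algebra, and \<open>Irr(W)\<close> is the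
  contraction of the kernel of the pairing \<open>(x, f) \<mapsto> \<psi>(t\<^sup>x f)\<close>.

  Let \<open>R\<close> be the localized monoid algebra modulo this kernel. The units that are torsion modulo the
  stabilizer \<open>K\<close> of \<open>w\<close> span an Artinian subring \<open>A\<close> of \<open>R\<close>, on which \<open>\<psi>\<close> is a Frobenius form.
  Ordering the torsion-free part of the unit group and comparing leading terms shows that the
  annihilators of the primitive idempotents of \<open>A\<close> are primary, with incomparable radicals, and
  that each is irreducible because the socle of a local factor of \<open>A\<close> is simple. Hence they are the
  primary components of \<open>Irr(W)\<close>.

  For the intersection, each \<open>Irr(W)\<close> contains \<open>I\<close> because \<open>\<psi>\<close> vanishes on \<open>I\<^sub>P\<close>. Conversely, if
  \<open>f \<notin> I\<close>, choose a monomial multiple \<open>h \<notin> I\<close> of \<open>f\<close> for which the set \<open>P\<close> of monomials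
  multiplying it into \<open>I\<close> is maximal. Then \<open>P\<close> is prime, any Green-minimal monomial \<open>t\<^sup>w\<close>
  of \<open>h\<close> modulo \<open>I\<^sub>P\<close> is an essential witness, and \<open>\<psi> h \<noteq> 0\<close>, so \<open>f \<notin> Irr(W)\<close>.
\<close>

section \<open>Monoid algebras\<close>

text \<open>The obstacle is that \<open>primary_components\<close> is a definite description, so the
  components of each closure must be exhibited and shown to form the only minimal primary
  decomposition. The field is arbitrary: the group algebra of the torsion units modulo
  \<open>K\<close> need neither split into characters nor be reduced, so primitive idempotents of a
  finite-dimensional algebra take the place of characters. Only the torsion part has finite
  dimension, which forces the division of the units into torsion and torsion-free parts. Chain
  conditions outside this algebra are not derived from Noetherian rings: they come from divisibility
  in the monoid being a well-quasi-order, applied to exponents. Of an essential witness just two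
  facts are carried along: \<open>t^w\<close> is nonzero in the localized quotient, and no nonunit
  fixes the class of \<open>w\<close>. The second puts \<open>t^w\<close> into the socle of
  \<open>R\<close>; every nonzero element of \<open>R\<close> has a nonzero multiple
  \<open>b t^w\<close> with \<open>b\<close> supported on units, so primariness and irreducibility
  are decided inside the group algebra of the units.\<close>

definition keysum :: "('a \<Rightarrow> 'k::zero \<Rightarrow> 'b::comm_monoid_add) \<Rightarrow> ('a \<Rightarrow>\<^sub>0 'k) \<Rightarrow> 'b" where
  "keysum h f = (\<Sum>a\<in>Poly_Mapping.keys f. h a (Poly_Mapping.lookup f a))"

text \<open>Keys outside the support carry coefficient 0, so \<open>h a 0 = 0\<close> lets the sum
  run over any finite superset. Additivity then follows by summing two elements over a common index
  set.\<close>

lemma keysum_superset: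
  assumes "finite A" "Poly_Mapping.keys f \<subseteq> A" "\<And>a. h a 0 = 0"
  shows "keysum h f = (\<Sum>a\<in>A. h a (Poly_Mapping.lookup f a))"
  unfolding keysum_def using assms
  by (intro sum.mono_neutral_left) (auto simp: in_keys_iff)

lemma keysum_zero [simp]: "keysum h 0 = 0"
  by (simp add: keysum_def)

lemma keysum_single:
  assumes "\<And>a. h a 0 = 0"
  shows "keysum h (Poly_Mapping.single a c) = h a c"
  by (subst keysum_superset[where A = "{a}"]) (use assms in auto)

lemma keysum_add:
  assumes "\<And>a. h a 0 = 0" "\<And>a x y. h a (x + y) = h a x + h a y"
  shows "keysum h (f + g) = keysum h f + keysum h g"
proof -
  let ?A = "Poly_Mapping.keys f \<union> Poly_Mapping.keys g"
  have "finite ?A" by simp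
  moreover have "Poly_Mapping.keys (f + g) \<subseteq> ?A" by (rule keys_add)
  ultimately show ?thesis
    using assms by (simp add: keysum_superset[where A = ?A] lookup_add sum.distrib)
qed

lemma keysum_cong:
  assumes "\<And>a x. a \<in> Poly_Mapping.keys f \<Longrightarrow> h a x = h' a x"
  shows "keysum h f = keysum h' f"
  unfolding keysum_def using assms by (intro sum.cong) auto

lemma keysum_fun_add: "keysum (\<lambda>a x. h a x + h' a x) f = keysum h f + keysum h' f"
  by (simp add: keysum_def sum.distrib)

lemma poly_mapping_sum_singles:
  "keysum Poly_Mapping.single f = f"
proof (rule poly_mapping_eqI)
  fix a
  have "Poly_Mapping.lookup (keysum Poly_Mapping.single f) a
      = (\<Sum>b\<in>Poly_Mapping.keys f. if b = a then Poly_Mapping.lookup f b else 0)"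
    by (auto simp: keysum_def lookup_sum lookup_single when_def intro!: sum.cong)
  also have "\<dots> = Poly_Mapping.lookup f a"
    by (auto simp: in_keys_iff)
  finally show "Poly_Mapping.lookup (keysum Poly_Mapping.single f) a = Poly_Mapping.lookup f a" .
qed

text \<open>The element is built up one monomial at a time with support inside \<open>A\<close>
  throughout. Carrying this bound makes closure conditions on exponents available in every case of
  the later inductions.\<close>

lemma poly_mapping_keys_induct [consumes 1, case_names zero single add]:
  fixes f :: "'a \<Rightarrow>\<^sub>0 'k::comm_monoid_add"
  assumes "Poly_Mapping.keys f \<subseteq> A"
    and "P 0"
    and "\<And>a c. a \<in> A \<Longrightarrow> P (Poly_Mapping.single a c)"
    and "\<And>f g. Poly_Mapping.keys f \<subseteq> A \<Longrightarrow> Poly_Mapping.keys g \<subseteq> A \<Longrightarrow> P f \<Longrightarrow> P g \<Longrightarrow> P (f + g)"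
  shows "P f"
proof -
  have "P (\<Sum>a\<in>B. Poly_Mapping.single a (Poly_Mapping.lookup f a)) \<and>
     Poly_Mapping.keys (\<Sum>a\<in>B. Poly_Mapping.single a (Poly_Mapping.lookup f a)) \<subseteq> A"
    if "finite B" "B \<subseteq> A" for B
    using that
  proof (induction rule: finite_induct)
    case empty
    then show ?case using assms by simp
  next
    case (insert b B)
    have b: "Poly_Mapping.keys (Poly_Mapping.single b (Poly_Mapping.lookup f b)) \<subseteq> A"
      using insert.prems by simp
    have IH: "P (\<Sum>a\<in>B. Poly_Mapping.single a (Poly_Mapping.lookup f a))"
      "Poly_Mapping.keys (\<Sum>a\<in>B. Poly_Mapping.single a (Poly_Mapping.lookup f a)) \<subseteq> A"
      using insert by auto
    have "P (Poly_Mapping.single b (Poly_Mapping.lookup f b))"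
      using assms(3) insert.prems by blast
    then show ?case
      using assms(4)[OF b IH(2) _ IH(1)] order_trans[OF keys_add Un_least[OF b IH(2)]] insert.hyps
      by simp
  qed
  from this[of "Poly_Mapping.keys f"] show ?thesis
    using assms(1) poly_mapping_sum_singles[of f] by (simp add: keysum_def)
qed

lemma monoid_algebra_simps [simp]:
  "carrier (monoid_algebra M) = {f. Poly_Mapping.keys f \<subseteq> carrier M}"
  "\<zero>\<^bsub>monoid_algebra M\<^esub> = 0"
  "f \<oplus>\<^bsub>monoid_algebra M\<^esub> g = f + g"
  "\<one>\<^bsub>monoid_algebra M\<^esub> = Poly_Mapping.single \<one>\<^bsub>M\<^esub> 1"
  by (simp_all add: monoid_algebra_def)

abbreviation conv :: "('a, 'm) monoid_scheme \<Rightarrow> ('a \<Rightarrow>\<^sub>0 'k::field) \<Rightarrow> ('a \<Rightarrow>\<^sub>0 'k) \<Rightarrow> ('a \<Rightarrow>\<^sub>0 'k)" where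
  "conv M f g \<equiv> f \<otimes>\<^bsub>monoid_algebra M\<^esub> g"

text \<open>Writing the product as a double \<open>keysum\<close> reduces bilinearity to additivity
  of \<open>keysum\<close>, whatever the exponents are; carrier conditions enter with associativity,
  commutativity and the unit.\<close>

lemma conv_keysum:
  "conv M f g = keysum (\<lambda>a x. keysum (\<lambda>b y. Poly_Mapping.single (a \<otimes>\<^bsub>M\<^esub> b) (x * y)) g) f"
  by (simp add: monoid_algebra_def keysum_def)

lemma conv_zero_left [simp]: "conv M 0 g = 0"
  by (simp add: conv_keysum)

lemma conv_zero_right [simp]: "conv M f 0 = 0"
  by (simp add: conv_keysum) (simp add: keysum_def)

lemma conv_add_left: "conv M (f + f') g = conv M f g + conv M f' g"
  unfolding conv_keysum
  by (rule keysum_add) (simp_all add: keysum_def single_add distrib_right sum.distrib)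

lemma conv_add_right: "conv M f (g + g') = conv M f g + conv M f g'"
proof -
  have "keysum (\<lambda>b y. Poly_Mapping.single (a \<otimes>\<^bsub>M\<^esub> b) (x * y)) (g + g') =
    keysum (\<lambda>b y. Poly_Mapping.single (a \<otimes>\<^bsub>M\<^esub> b) (x * y)) g +
    keysum (\<lambda>b y. Poly_Mapping.single (a \<otimes>\<^bsub>M\<^esub> b) (x * y)) g'" for a x
    by (rule keysum_add) (simp_all add: single_add distrib_left)
  then show ?thesis
    by (simp add: conv_keysum keysum_fun_add)
qed

lemma conv_single [simp]:
  "conv M (Poly_Mapping.single a x) (Poly_Mapping.single b y) = Poly_Mapping.single (a \<otimes>\<^bsub>M\<^esub> b) (x * y)"
  by (simp add: conv_keysum keysum_single keysum_def)

lemma conv_uminus_left: "conv M (- f) g = - conv M f g"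
  using conv_add_left[of M f "- f" g] by (simp add: eq_neg_iff_add_eq_0 add.commute)

lemma conv_uminus_right: "conv M f (- g) = - conv M f g"
  using conv_add_right[of M f g "- g"] by (simp add: eq_neg_iff_add_eq_0 add.commute)

lemma conv_diff_left: "conv M (f - f') g = conv M f g - conv M f' g"
  using conv_add_left[of M f "- f'" g] by (simp add: conv_uminus_left)

lemma conv_diff_right: "conv M f (g - g') = conv M f g - conv M f g'"
  using conv_add_right[of M f g "- g'"] by (simp add: conv_uminus_right)

lemma conv_sum_left: "conv M (\<Sum>i\<in>A. f i) g = (\<Sum>i\<in>A. conv M (f i) g)"
  by (induction A rule: infinite_finite_induct) (simp_all add: conv_add_left)

lemma keys_conv:
  "Poly_Mapping.keys (conv M f g) \<subseteq> (\<lambda>(a, b). a \<otimes>\<^bsub>M\<^esub> b) ` (Poly_Mapping.keys f \<times> Poly_Mapping.keys g)"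
proof -
  have "Poly_Mapping.keys (conv M f g) \<subseteq> (\<Union>a\<in>Poly_Mapping.keys f. Poly_Mapping.keys
     (\<Sum>b\<in>Poly_Mapping.keys g. Poly_Mapping.single (a \<otimes>\<^bsub>M\<^esub> b)
                   (Poly_Mapping.lookup f a * Poly_Mapping.lookup g b)))"
    by (simp add: monoid_algebra_def keys_sum)
  also have "\<dots> \<subseteq> (\<Union>a\<in>Poly_Mapping.keys f. \<Union>b\<in>Poly_Mapping.keys g. Poly_Mapping.keys
     (Poly_Mapping.single (a \<otimes>\<^bsub>M\<^esub> b)
                   (Poly_Mapping.lookup f a * Poly_Mapping.lookup g b)))"
    by (intro UN_mono keys_sum) auto
  also have "\<dots> \<subseteq> (\<lambda>(a, b). a \<otimes>\<^bsub>M\<^esub> b) ` (Poly_Mapping.keys f \<times> Poly_Mapping.keys g)"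
    by (auto split: if_splits)
  finally show ?thesis .
qed

lemma keys_minus: "Poly_Mapping.keys (f - g) \<subseteq> Poly_Mapping.keys f \<union> Poly_Mapping.keys (g::'a \<Rightarrow>\<^sub>0 'k::ab_group_add)"
  by (auto simp: in_keys_iff lookup_minus)

lemma keys_uminus: "Poly_Mapping.keys (- g) = Poly_Mapping.keys (g::'a \<Rightarrow>\<^sub>0 'k::ab_group_add)"
  by (auto simp: in_keys_iff)

lemma keys_single_subset: "a \<in> A \<Longrightarrow> Poly_Mapping.keys (Poly_Mapping.single a c) \<subseteq> A"
  by simp

context comm_monoid
begin

lemma keys_conv_subset:
  assumes "Poly_Mapping.keys f \<subseteq> A" "Poly_Mapping.keys g \<subseteq> B"
    and "\<And>a b. a \<in> A \<Longrightarrow> b \<in> B \<Longrightarrow> a \<otimes> b \<in> C"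
  shows "Poly_Mapping.keys (conv G f g) \<subseteq> C"
  using keys_conv[of G f g] assms by fastforce

lemma conv_closed:
  assumes "Poly_Mapping.keys f \<subseteq> carrier G" "Poly_Mapping.keys g \<subseteq> carrier G"
  shows "Poly_Mapping.keys (conv G f g) \<subseteq> carrier G"
  using keys_conv_subset[OF assms] by blast

lemma conv_comm:
  assumes "Poly_Mapping.keys f \<subseteq> carrier G" "Poly_Mapping.keys g \<subseteq> carrier G"
  shows "conv G f g = conv G g f"
  using assms(1)
proof (induction rule: poly_mapping_keys_induct)
  case (single a c)
  from assms(2) show ?case
  proof (induction rule: poly_mapping_keys_induct)
    case (single b d)
    then show ?case using \<open>a \<in> carrier G\<close> by (simp add: m_comm mult.commute)
  qed (simp_all add: conv_add_left conv_add_right)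
qed (simp_all add: conv_add_left conv_add_right)

lemma conv_assoc:
  assumes "Poly_Mapping.keys f \<subseteq> carrier G" "Poly_Mapping.keys g \<subseteq> carrier G"
    "Poly_Mapping.keys h \<subseteq> carrier G"
  shows "conv G (conv G f g) h = conv G f (conv G g h)"
  using assms(1)
proof (induction rule: poly_mapping_keys_induct)
  case (single a x)
  from assms(2) show ?case
  proof (induction rule: poly_mapping_keys_induct)
    case (single b y)
    from assms(3) show ?case
    proof (induction rule: poly_mapping_keys_induct)
      case (single c z)
      then show ?case using \<open>a \<in> carrier G\<close> \<open>b \<in> carrier G\<close> by (simp add: m_assoc mult.assoc)
    qed (simp_all add: conv_add_left conv_add_right)
  qed (simp_all add: conv_add_left conv_add_right)
qed (simp_all add: conv_add_left conv_add_right)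

lemma conv_one:
  assumes "Poly_Mapping.keys f \<subseteq> carrier G"
  shows "conv G (Poly_Mapping.single \<one> 1) f = f"
  using assms
  by (induction rule: poly_mapping_keys_induct) (simp_all add: conv_add_right)

lemma monoid_algebra_cring: "cring (monoid_algebra G :: ('a \<Rightarrow>\<^sub>0 'k::field) ring)"
proof (rule cringI)
  show "abelian_group (monoid_algebra G :: ('a \<Rightarrow>\<^sub>0 'k::field) ring)"
  proof (rule abelian_groupI)
    show "\<exists>y\<in>carrier (monoid_algebra G). y \<oplus>\<^bsub>monoid_algebra G\<^esub> x = \<zero>\<^bsub>monoid_algebra G\<^esub>"
      if "x \<in> carrier (monoid_algebra G)" for x :: "'a \<Rightarrow>\<^sub>0 'k"
      using that by (intro bexI[of _ "- x"]) (auto simp: keys_uminus)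
    show "x \<oplus>\<^bsub>monoid_algebra G\<^esub> y \<in> carrier (monoid_algebra G)"
      if "x \<in> carrier (monoid_algebra G)" "y \<in> carrier (monoid_algebra G)" for x y :: "'a \<Rightarrow>\<^sub>0 'k"
      using that keys_add[of x y] by auto
  qed (auto simp: add.assoc add.commute)
  show "comm_monoid (monoid_algebra G :: ('a \<Rightarrow>\<^sub>0 'k::field) ring)"
    by (rule comm_monoidI) (auto simp: conv_closed[THEN subsetD] conv_assoc conv_one intro: conv_comm)
qed (simp add: conv_add_left)

end

lemma (in comm_monoid) monoid_algebra_a_inv:
  assumes "Poly_Mapping.keys (f :: 'a \<Rightarrow>\<^sub>0 'k::field) \<subseteq> carrier G"
  shows "\<ominus>\<^bsub>monoid_algebra G\<^esub> f = - f"
proof -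
  interpret S: cring "monoid_algebra G :: ('a \<Rightarrow>\<^sub>0 'k::field) ring" by (rule monoid_algebra_cring)
  show ?thesis
    by (rule S.minus_equality) (use assms in \<open>auto simp: keys_uminus\<close>)
qed

lemma (in comm_monoid) monoid_algebra_a_minus:
  assumes "Poly_Mapping.keys (g :: 'a \<Rightarrow>\<^sub>0 'k::field) \<subseteq> carrier G"
  shows "f \<ominus>\<^bsub>monoid_algebra G\<^esub> g = f - g"
  using monoid_algebra_a_inv[OF assms] by (simp add: a_minus_def)

text \<open>Monomials span the algebra, so absorption by scalar multiples of monomials extends
  additively to all multipliers; negatives arise from multiplication by the constant -1.\<close>

lemma (in comm_monoid) monoid_algebra_idealI:
  fixes I :: "('a \<Rightarrow>\<^sub>0 'k::field) set"
  assumes sub: "\<And>f. f \<in> I \<Longrightarrow> Poly_Mapping.keys f \<subseteq> carrier G"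
    and zero: "0 \<in> I"
    and add: "\<And>f g. f \<in> I \<Longrightarrow> g \<in> I \<Longrightarrow> f + g \<in> I"
    and mult: "\<And>a c f. a \<in> carrier G \<Longrightarrow> f \<in> I \<Longrightarrow> conv G (Poly_Mapping.single a c) f \<in> I"
  shows "ideal I (monoid_algebra G)"
proof -
  interpret S: cring "monoid_algebra G :: ('a \<Rightarrow>\<^sub>0 'k::field) ring" by (rule monoid_algebra_cring)
  have conv: "conv G g f \<in> I" if "f \<in> I" "Poly_Mapping.keys g \<subseteq> carrier G" for f g
    using that(2)
    by (induction rule: poly_mapping_keys_induct) (use that(1) mult zero add in \<open>auto simp: conv_add_left\<close>)
  have uminus: "- f \<in> I" if "f \<in> I" for f
    using mult[OF _ that, of \<one> "-1"] sub[OF that]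
    by (simp add: single_uminus conv_uminus_left conv_one)
  show ?thesis
  proof (rule idealI)
    show "ring (monoid_algebra G :: ('a \<Rightarrow>\<^sub>0 'k::field) ring)" by (rule S.ring_axioms)
    show "subgroup I (add_monoid (monoid_algebra G))"
    proof (rule S.add.subgroupI)
      show "\<ominus>\<^bsub>monoid_algebra G\<^esub> f \<in> I" if "f \<in> I" for f
        using uminus[OF that] monoid_algebra_a_inv[OF sub[OF that]] by (simp only:)
    qed (use sub zero add in auto)
    show "x \<otimes>\<^bsub>monoid_algebra G\<^esub> a \<in> I" if "a \<in> I" "x \<in> carrier (monoid_algebra G)" for a x
      using conv that by auto
    show "a \<otimes>\<^bsub>monoid_algebra G\<^esub> x \<in> I" if "a \<in> I" "x \<in> carrier (monoid_algebra G)" for a x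
      using conv[OF that(1), of x] that S.m_comm[of a x] sub[OF that(1)] by auto
  qed
qed

context comm_monoid
begin

context
  fixes I :: "('a \<Rightarrow>\<^sub>0 'k::field) set"
  assumes I: "ideal I (monoid_algebra G)"
begin

lemma ideal_keys: "f \<in> I \<Longrightarrow> Poly_Mapping.keys f \<subseteq> carrier G"
  using ideal.Icarr[OF I] by auto

lemma ideal_zero: "0 \<in> I"
  using additive_subgroup.zero_closed[OF ideal.axioms(1)[OF I]] by simp

lemma ideal_add: "f \<in> I \<Longrightarrow> g \<in> I \<Longrightarrow> f + g \<in> I"
  using additive_subgroup.a_closed[OF ideal.axioms(1)[OF I]] by simp

lemma ideal_conv: "f \<in> I \<Longrightarrow> Poly_Mapping.keys g \<subseteq> carrier G \<Longrightarrow> conv G g f \<in> I"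
  using ideal.I_l_closed[OF I] by simp

lemma ideal_uminus: "f \<in> I \<Longrightarrow> - f \<in> I"
  using ideal_conv[of f "Poly_Mapping.single \<one> (-1)"] ideal_keys[of f]
  by (simp add: single_uminus conv_uminus_left conv_one)

lemma ideal_diff: "f \<in> I \<Longrightarrow> g \<in> I \<Longrightarrow> f - g \<in> I"
  using ideal_add[of f "- g"] ideal_uminus by simp

lemma ideal_sum: "(\<And>i. i \<in> A \<Longrightarrow> f i \<in> I) \<Longrightarrow> (\<Sum>i\<in>A. f i) \<in> I"
  by (induction A rule: infinite_finite_induct) (auto simp: ideal_zero ideal_add)

lemma ideal_unit:
  assumes "u \<in> Units G" "Poly_Mapping.keys f \<subseteq> carrier G" "conv G (monomial u) f \<in> I"
  shows "f \<in> I"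
proof -
  have "conv G (monomial (inv u)) (conv G (monomial u) f) \<in> I"
    using assms by (intro ideal_conv[OF assms(3)]) auto
  moreover have "conv G (monomial (inv u)) (conv G (monomial u) f) = conv G (monomial \<one>) f"
    using assms by (subst conv_assoc[symmetric]) auto
  ultimately show ?thesis using assms(2) conv_one[OF assms(2)] by (metis (no_types))
qed

lemma coset_eq_iff:
  assumes "Poly_Mapping.keys f \<subseteq> carrier G" "Poly_Mapping.keys g \<subseteq> carrier G"
  shows "I +>\<^bsub>monoid_algebra G\<^esub> f = I +>\<^bsub>monoid_algebra G\<^esub> g \<longleftrightarrow> f - g \<in> I"
proof -
  interpret S: cring "monoid_algebra G :: ('a \<Rightarrow>\<^sub>0 'k::field) ring" by (rule monoid_algebra_cring)
  show ?thesis
    using S.quotient_eq_iff_same_a_r_cos[OF I, of f g] assms by (simp add: monoid_algebra_a_minus)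
qed

end

end

section \<open>Splitting an algebra element by classes of exponents\<close>

lemma lookup_restrict_support:
  "Poly_Mapping.lookup (restrict_support f d) a = (if a \<in> d then Poly_Mapping.lookup f a else 0)"
proof -
  have "Poly_Mapping.lookup (restrict_support f d) a
     = (\<Sum>b\<in>Poly_Mapping.keys f \<inter> d. if b = a then Poly_Mapping.lookup f b else 0)"
    by (auto simp: restrict_support_def lookup_sum lookup_single when_def intro!: sum.cong)
  also have "\<dots> = (if a \<in> d then Poly_Mapping.lookup f a else 0)"
    by (auto simp: in_keys_iff)
  finally show ?thesis .
qed

lemma keys_restrict_support: "Poly_Mapping.keys (restrict_support f d) = Poly_Mapping.keys f \<inter> d"
  by (auto simp: in_keys_iff lookup_restrict_support split: if_splits)

lemma restrict_support_add: "restrict_support (f + g) d = restrict_support f d + restrict_support g d"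
  by (rule poly_mapping_eqI) (simp add: lookup_restrict_support lookup_add)

text \<open>Every key lies in its own class and in no other class of the image, so exactly one
  summand contributes at each key. The sum runs over the set of classes, hence a class hit by
  several keys counts once.\<close>

lemma restrict_support_partition:
  assumes "\<And>u. u \<in> Poly_Mapping.keys f \<Longrightarrow> u \<in> cl u"
    and "\<And>u v. u \<in> Poly_Mapping.keys f \<Longrightarrow> v \<in> Poly_Mapping.keys f \<Longrightarrow> v \<in> cl u \<Longrightarrow> cl v = cl u"
  shows "f = (\<Sum>d\<in>cl ` Poly_Mapping.keys f. restrict_support f d)"
proof (rule poly_mapping_eqI)
  fix a
  have fin: "finite (cl ` Poly_Mapping.keys f)" by simp
  have "(\<Sum>d\<in>cl ` Poly_Mapping.keys f. if a \<in> d then Poly_Mapping.lookup f a else 0)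
    = (\<Sum>d\<in>cl ` Poly_Mapping.keys f. if d = cl a then Poly_Mapping.lookup f a else 0)"
  proof (rule sum.cong)
    fix d assume "d \<in> cl ` Poly_Mapping.keys f"
    then obtain u where u: "u \<in> Poly_Mapping.keys f" "d = cl u" by blast
    show "(if a \<in> d then Poly_Mapping.lookup f a else 0) = (if d = cl a then Poly_Mapping.lookup f a else 0)"
    proof (cases "a \<in> Poly_Mapping.keys f")
      case True
      then have "a \<in> d \<longleftrightarrow> d = cl a" using assms u by metis
      then show ?thesis by simp
    qed (simp add: in_keys_iff)
  qed simp
  also have "\<dots> = Poly_Mapping.lookup f a"
  proof (cases "a \<in> Poly_Mapping.keys f")
    case True
    then show ?thesis using fin by (simp add: sum.delta)
  qed (simp add: in_keys_iff)
  finally show "Poly_Mapping.lookup f a =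
      Poly_Mapping.lookup (\<Sum>d\<in>cl ` Poly_Mapping.keys f. restrict_support f d) a"
    by (simp add: lookup_sum lookup_restrict_support)
qed

section \<open>Quotients and localizations of commutative monoids\<close>

context comm_monoid
begin

context
  fixes r assumes r: "monoid_congruence G r"
begin

lemma congruence_equiv: "equiv (carrier G) r"
  using r by (simp add: monoid_congruence_def)

lemma congruence_closed: "(a, b) \<in> r \<Longrightarrow> a \<in> carrier G \<and> b \<in> carrier G"
  using congruence_equiv by (auto simp: equiv_def)

lemma congruence_refl: "a \<in> carrier G \<Longrightarrow> (a, a) \<in> r"
  using congruence_equiv by (auto simp: equiv_def refl_on_def)

lemma congruence_sym: "(a, b) \<in> r \<Longrightarrow> (b, a) \<in> r"
  using congruence_equiv by (auto simp: equiv_def dest: symD)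

lemma congruence_trans: "(a, b) \<in> r \<Longrightarrow> (b, c) \<in> r \<Longrightarrow> (a, c) \<in> r"
  using congruence_equiv by (auto simp: equiv_def dest: transD)

lemma congruence_mult_right: "(a, b) \<in> r \<Longrightarrow> c \<in> carrier G \<Longrightarrow> (a \<otimes> c, b \<otimes> c) \<in> r"
  using r by (auto simp: monoid_congruence_def)

lemma congruence_mult_left: "(a, b) \<in> r \<Longrightarrow> c \<in> carrier G \<Longrightarrow> (c \<otimes> a, c \<otimes> b) \<in> r"
  using congruence_mult_right[of a b c] congruence_closed[of a b] m_comm by auto

lemma congruence_mult: "(a, a') \<in> r \<Longrightarrow> (b, b') \<in> r \<Longrightarrow> (a \<otimes> b, a' \<otimes> b') \<in> r"
  using congruence_trans[OF congruence_mult_right[of a a' b] congruence_mult_left[of b b' a']]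
    congruence_closed by blast

lemma class_eq_iff: "a \<in> carrier G \<Longrightarrow> b \<in> carrier G \<Longrightarrow> r `` {a} = r `` {b} \<longleftrightarrow> (a, b) \<in> r"
  using eq_equiv_class_iff[OF congruence_equiv] by blast

lemma quotient_carrier: "carrier (quotient_monoid G r) = (\<lambda>a. r `` {a}) ` carrier G"
  by (auto simp: quotient_monoid_def quotient_def)

lemma quotient_one: "\<one>\<^bsub>quotient_monoid G r\<^esub> = r `` {\<one>}"
  by (simp add: quotient_monoid_def)

lemma quotient_mult:
  assumes "a \<in> carrier G" "b \<in> carrier G"
  shows "r `` {a} \<otimes>\<^bsub>quotient_monoid G r\<^esub> r `` {b} = r `` {a \<otimes> b}"
proof -
  have eq: "r `` {a' \<otimes> b'} = r `` {a \<otimes> b}" if "a' \<in> r `` {a}" "b' \<in> r `` {b}" for a' b'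
    using equiv_class_eq[OF congruence_equiv congruence_mult[of a a' b b']] that by simp
  moreover have "a \<in> r `` {a}" "b \<in> r `` {b}" using assms congruence_refl by auto
  ultimately have "(\<Union>a'\<in>r `` {a}. \<Union>b'\<in>r `` {b}. r `` {a' \<otimes> b'}) = r `` {a \<otimes> b}"
    by blast
  then show ?thesis by (simp add: quotient_monoid_def)
qed

lemma quotient_comm_monoid: "comm_monoid (quotient_monoid G r)"
  by (rule comm_monoidI)
    (auto simp: quotient_carrier quotient_one quotient_mult m_ac)

end

end

section \<open>Localization of a monoid at a prime\<close>

locale prime_localization = comm_monoid Q for Q (structure) +
  fixes P assumes prime: "monoid_prime Q P"
begin

abbreviation "F \<equiv> carrier Q - P"
abbreviation "L \<equiv> localization Q P"
abbreviation "qfrac a s \<equiv> localization_rel Q P `` {(a, s)}"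
abbreviation "QF \<equiv> Q \<times>\<times> (Q\<lparr>carrier := F\<rparr>)"

lemma F_submonoid: "submonoid F Q"
  using prime by (simp add: monoid_prime_def)

lemma P_subset: "P \<subseteq> carrier Q"
  using prime by (auto simp: monoid_prime_def)

lemma P_absorb: "p \<in> P \<Longrightarrow> q \<in> carrier Q \<Longrightarrow> p \<otimes> q \<in> P"
  using prime by (auto simp: monoid_prime_def)

lemma P_absorb': "p \<in> P \<Longrightarrow> q \<in> carrier Q \<Longrightarrow> q \<otimes> p \<in> P"
  using P_absorb[of p q] P_subset m_comm[of p q] by auto

lemma F_one: "\<one> \<in> F"
  using submonoid.one_closed[OF F_submonoid] .

lemma F_mult: "s \<in> F \<Longrightarrow> t \<in> F \<Longrightarrow> s \<otimes> t \<in> F"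
  using submonoid.m_closed[OF F_submonoid] .

lemma F_factor: "a \<otimes> b \<in> F \<Longrightarrow> a \<in> carrier Q \<Longrightarrow> b \<in> carrier Q \<Longrightarrow> a \<in> F \<and> b \<in> F"
  using P_absorb P_absorb' by blast

lemma F_carrier: "s \<in> F \<Longrightarrow> s \<in> carrier Q"
  by simp

lemma QF_carrier: "carrier QF = carrier Q \<times> F"
  by (simp add: DirProd_def)

lemma QF_comm_monoid: "comm_monoid QF"
  by (rule comm_monoidI)
    (auto simp: DirProd_def m_ac P_subset[THEN subsetD] F_mult[simplified] F_one[simplified]
       dest: F_mult)

lemma localization_rel_iff:
  "((a, s), (b, t)) \<in> localization_rel Q P \<longleftrightarrow>
    a \<in> carrier Q \<and> b \<in> carrier Q \<and> s \<in> F \<and> t \<in> F \<and> (\<exists>u\<in>F. u \<otimes> (a \<otimes> t) = u \<otimes> (b \<otimes> s))"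
  by (auto simp: localization_rel_def)

lemma localization_rel_congruence: "monoid_congruence QF (localization_rel Q P)"
  unfolding monoid_congruence_def
proof (intro conjI allI impI ballI)
  show "equiv (carrier QF) (localization_rel Q P)"
  proof (rule equivI)
    show "localization_rel Q P \<subseteq> carrier QF \<times> carrier QF"
      by (auto simp: localization_rel_def DirProd_def)
    show "refl_on (carrier QF) (localization_rel Q P)"
      using F_one by (auto simp: refl_on_def localization_rel_iff DirProd_def)
    show "sym (localization_rel Q P)"
      by (rule symI) (clarsimp simp: localization_rel_def, metis Diff_iff)
    show "trans (localization_rel Q P)"
    proof (rule transI, clarify)
      fix a s b t c v
      assume 1: "((a, s), (b, t)) \<in> localization_rel Q P" and 2: "((b, t), (c, v)) \<in> localization_rel Q P"
      then obtain x y where x: "x \<in> F" "x \<otimes> (a \<otimes> t) = x \<otimes> (b \<otimes> s)"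
        and y: "y \<in> F" "y \<otimes> (b \<otimes> v) = y \<otimes> (c \<otimes> t)"
        by (auto simp: localization_rel_iff simp del: Diff_iff)
      have carr: "a \<in> carrier Q" "b \<in> carrier Q" "c \<in> carrier Q" "s \<in> carrier Q" "t \<in> carrier Q"
        "v \<in> carrier Q" "x \<in> carrier Q" "y \<in> carrier Q" and F: "s \<in> F" "t \<in> F" "v \<in> F"
        using 1 2 x y by (auto simp: localization_rel_iff)
      \<comment> \<open>The multiplier contains the middle denominator \<open>t\<close> besides the
        two given multipliers, because eliminating \<open>b\<close> leaves a factor \<open>t\<close>
        on both sides.\<close>
      have "(t \<otimes> x \<otimes> y) \<otimes> (a \<otimes> v) = (x \<otimes> (a \<otimes> t)) \<otimes> (y \<otimes> v)"
        using carr by (simp add: m_ac)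
      also have "\<dots> = (y \<otimes> (b \<otimes> v)) \<otimes> (x \<otimes> s)"
        using carr by (simp only: x) (simp add: m_ac)
      also have "\<dots> = (t \<otimes> x \<otimes> y) \<otimes> (c \<otimes> s)"
        using carr by (simp only: y) (simp add: m_ac)
      finally show "((a, s), (c, v)) \<in> localization_rel Q P"
        using carr F F_mult[OF F_mult[OF F(2) x(1)] y(1)] localization_rel_iff by blast
    qed
  qed
next
  fix x y z assume xy: "(x, y) \<in> localization_rel Q P" and z: "z \<in> carrier QF"
  obtain a s b t c v where eq: "x = (a, s)" "y = (b, t)" "z = (c, v)" by (metis surj_pair)
  obtain u where u: "u \<in> F" "u \<otimes> (a \<otimes> t) = u \<otimes> (b \<otimes> s)"
    using xy eq by (auto simp: localization_rel_iff simp del: Diff_iff)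
  have carr: "a \<in> carrier Q" "b \<in> carrier Q" "c \<in> carrier Q" "s \<in> carrier Q" "t \<in> carrier Q"
        "v \<in> carrier Q" "u \<in> carrier Q" and F: "s \<in> F" "t \<in> F" "v \<in> F"
    using xy z eq u by (auto simp: localization_rel_iff DirProd_def)
  have "u \<otimes> ((a \<otimes> c) \<otimes> (t \<otimes> v)) = (u \<otimes> (a \<otimes> t)) \<otimes> (c \<otimes> v)"
    using carr by (simp add: m_ac)
  also have "\<dots> = u \<otimes> ((b \<otimes> c) \<otimes> (s \<otimes> v))"
    using carr by (simp only: u) (simp add: m_ac)
  finally show "(x \<otimes>\<^bsub>QF\<^esub> z, y \<otimes>\<^bsub>QF\<^esub> z) \<in> localization_rel Q P"
    using carr F u(1) eq F_mult by (auto simp: localization_rel_iff DirProd_def simp del: Diff_iff)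
qed

lemma L_comm_monoid: "comm_monoid L"
  unfolding localization_def
  by (rule comm_monoid.quotient_comm_monoid[OF QF_comm_monoid localization_rel_congruence])

lemma qfrac_closed: "a \<in> carrier Q \<Longrightarrow> s \<in> F \<Longrightarrow> qfrac a s \<in> carrier L"
  unfolding localization_def comm_monoid.quotient_carrier[OF QF_comm_monoid localization_rel_congruence]
    QF_carrier by blast

lemma L_cases:
  assumes "x \<in> carrier L"
  obtains a s where "a \<in> carrier Q" "s \<in> F" "x = qfrac a s"
  using assms unfolding localization_def
    comm_monoid.quotient_carrier[OF QF_comm_monoid localization_rel_congruence] QF_carrier
  by blast

lemma qfrac_mult:
  assumes "a \<in> carrier Q" "b \<in> carrier Q" "s \<in> F" "t \<in> F"
  shows "qfrac a s \<otimes>\<^bsub>L\<^esub> qfrac b t = qfrac (a \<otimes> b) (s \<otimes> t)"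
  using comm_monoid.quotient_mult[OF QF_comm_monoid localization_rel_congruence, of "(a, s)" "(b, t)"] assms
  by (simp add: localization_def DirProd_def)

lemma qfrac_eq_iff:
  assumes "a \<in> carrier Q" "b \<in> carrier Q" "s \<in> F" "t \<in> F"
  shows "qfrac a s = qfrac b t \<longleftrightarrow> (\<exists>u\<in>F. u \<otimes> (a \<otimes> t) = u \<otimes> (b \<otimes> s))"
  using comm_monoid.class_eq_iff[OF QF_comm_monoid localization_rel_congruence, of "(a, s)" "(b, t)"] assms
  by (auto simp add: DirProd_def localization_rel_iff simp del: Diff_iff)

lemma L_one: "\<one>\<^bsub>L\<^esub> = qfrac \<one> \<one>"
  using comm_monoid.quotient_one[OF QF_comm_monoid localization_rel_congruence]
  by (simp add: localization_def DirProd_def)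

lemma to_loc_qfrac: "to_loc Q P a = qfrac a \<one>"
  by (simp add: to_loc_def)

lemma to_loc_closed [simp]: "a \<in> carrier Q \<Longrightarrow> to_loc Q P a \<in> carrier L"
  using qfrac_closed F_one by (simp add: to_loc_qfrac del: Diff_iff)

lemma to_loc_one [simp]: "to_loc Q P \<one> = \<one>\<^bsub>L\<^esub>"
  by (simp add: to_loc_qfrac L_one)

lemma to_loc_mult:
  "a \<in> carrier Q \<Longrightarrow> b \<in> carrier Q \<Longrightarrow> to_loc Q P (a \<otimes> b) = to_loc Q P a \<otimes>\<^bsub>L\<^esub> to_loc Q P b"
  using qfrac_mult[OF _ _ F_one F_one] by (simp add: to_loc_qfrac)

lemma to_loc_eq_iff:
  assumes "a \<in> carrier Q" "b \<in> carrier Q"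
  shows "to_loc Q P a = to_loc Q P b \<longleftrightarrow> (\<exists>u\<in>F. u \<otimes> a = u \<otimes> b)"
  using qfrac_eq_iff[OF assms F_one F_one] assms by (simp add: to_loc_qfrac)

lemma qfrac_times_denominator:
  assumes "a \<in> carrier Q" "s \<in> F"
  shows "to_loc Q P s \<otimes>\<^bsub>L\<^esub> qfrac a s = to_loc Q P a"
proof -
  have "to_loc Q P s \<otimes>\<^bsub>L\<^esub> qfrac a s = qfrac (s \<otimes> a) (\<one> \<otimes> s)"
    using assms qfrac_mult F_one by (simp add: to_loc_qfrac del: Diff_iff) (use assms in simp)
  also have "\<dots> = qfrac a \<one>"
    using assms F_one by (subst qfrac_eq_iff) (auto simp: m_ac intro!: bexI[of _ \<one>])
  finally show ?thesis by (simp add: to_loc_qfrac)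
qed

lemma to_loc_Units:
  assumes "s \<in> F" shows "to_loc Q P s \<in> Units L"
proof -
  interpret L: comm_monoid L by (rule L_comm_monoid)
  have m: "to_loc Q P s \<otimes>\<^bsub>L\<^esub> qfrac \<one> s = \<one>\<^bsub>L\<^esub>"
    using qfrac_times_denominator[OF one_closed assms] by simp
  have c: "qfrac \<one> s \<in> carrier L" "to_loc Q P s \<in> carrier L"
    using qfrac_closed[OF one_closed assms] assms by auto
  with m have "qfrac \<one> s \<otimes>\<^bsub>L\<^esub> to_loc Q P s = \<one>\<^bsub>L\<^esub>"
    by (simp only: L.m_comm[OF c])
  then show ?thesis using c m unfolding Units_def by blast
qed

text \<open>If \<open>qfrac b t\<close> is inverse to \<open>a\<close>, then
  \<open>u a b = u t\<close> lies in \<open>F\<close> for some \<open>u\<close> in \<open>F\<close>,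
  and factors of elements of \<open>F\<close> lie in \<open>F\<close> because \<open>P\<close>
  absorbs.\<close>

lemma to_loc_Units_iff:
  assumes "a \<in> carrier Q"
  shows "to_loc Q P a \<in> Units L \<longleftrightarrow> a \<in> F"
proof
  assume "to_loc Q P a \<in> Units L"
  then obtain x where "x \<in> carrier L" "to_loc Q P a \<otimes>\<^bsub>L\<^esub> x = \<one>\<^bsub>L\<^esub>"
    by (auto simp: Units_def)
  then obtain b t where bt: "b \<in> carrier Q" "t \<in> F" "qfrac a \<one> \<otimes>\<^bsub>L\<^esub> qfrac b t = qfrac \<one> \<one>"
    by (metis L_cases L_one to_loc_qfrac)
  then have "qfrac (a \<otimes> b) t = qfrac \<one> \<one>"
    using qfrac_mult[OF assms bt(1) F_one bt(2)] by simp
  then obtain u where u: "u \<in> F" "u \<otimes> (a \<otimes> b \<otimes> \<one>) = u \<otimes> (\<one> \<otimes> t)"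
    using qfrac_eq_iff[of "a \<otimes> b" \<one> t \<one>] assms bt F_one by auto
  then have "u \<otimes> (a \<otimes> b) \<in> F" using bt assms F_mult by auto
  then show "a \<in> F" using F_factor assms bt u by (metis F_carrier m_closed)
qed (rule to_loc_Units)

lemma L_repr:
  assumes "x \<in> carrier L"
  obtains s a where "s \<in> F" "a \<in> carrier Q" "to_loc Q P s \<otimes>\<^bsub>L\<^esub> x = to_loc Q P a"
  using assms qfrac_times_denominator by (metis L_cases)

end

section \<open>Finiteness in finitely generated commutative monoids\<close>

text \<open>Divisibility is a well-quasi-order on the carrier, as in Dickson's lemma for exponent
  vectors. This serves as the Noetherian condition: infinite chains of exponents are refuted by a
  later term that is a multiple of an earlier one.\<close>

definition dickson_property :: "('a, 'm) monoid_scheme \<Rightarrow> bool" where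
  "dickson_property M \<longleftrightarrow>
     (\<forall>f::nat \<Rightarrow> 'a. range f \<subseteq> carrier M \<longrightarrow>
        (\<exists>i j. i < j \<and> (\<exists>z\<in>carrier M. f j = f i \<otimes>\<^bsub>M\<^esub> z)))"

text \<open>Adjoining a generator \<open>s\<close> requires control of the old factor and of the
  exponent of \<open>s\<close> at once. A single good pair would not survive this, so the induction
  carries a whole subsequence increasing for divisibility, with cofactors inside
  \<open>H\<close>.\<close>

lemma (in comm_monoid) finite_generated_dickson:
  assumes "finite S" "S \<subseteq> carrier G"
  shows "\<exists>H. submonoid H G \<and> S \<subseteq> H \<and>
    (\<forall>f::nat \<Rightarrow> 'a. range f \<subseteq> H \<longrightarrow>
       (\<exists>r::nat \<Rightarrow> nat. strict_mono r \<and> (\<forall>i j. i \<le> j \<longrightarrow> (\<exists>z\<in>H. f (r j) = f (r i) \<otimes> z))))"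
  using assms
proof (induction rule: finite_induct)
  case empty
  have "submonoid {\<one>} G" by unfold_locales auto
  moreover have "\<exists>r::nat \<Rightarrow> nat. strict_mono r \<and> (\<forall>i j. i \<le> j \<longrightarrow> (\<exists>z\<in>{\<one>}. f (r j) = f (r i) \<otimes> z))"
    if "range f \<subseteq> {\<one>}" for f :: "nat \<Rightarrow> 'a"
    by (rule exI[of _ id]) (use that in \<open>auto simp: strict_mono_def image_subset_iff\<close>)
  ultimately show ?case by blast
next
  case (insert s S)
  then obtain H where H: "submonoid H G" "S \<subseteq> H" and
    seq: "\<And>f::nat \<Rightarrow> 'a. range f \<subseteq> H \<Longrightarrow>
       \<exists>r::nat \<Rightarrow> nat. strict_mono r \<and> (\<forall>i j. i \<le> j \<longrightarrow> (\<exists>z\<in>H. f (r j) = f (r i) \<otimes> z))"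
    by auto
  have s: "s \<in> carrier G" using insert by auto
  note Hc = submonoid.subset[OF H(1), THEN subsetD] submonoid.one_closed[OF H(1)]
    submonoid.m_closed[OF H(1)]
  define H' where "H' = {h \<otimes> s [^] n | h n. h \<in> H \<and> n \<in> (UNIV::nat set)}"
  have "submonoid H' G"
  proof
    show "H' \<subseteq> carrier G" using Hc s by (auto simp: H'_def)
    show "\<one> \<in> H'" unfolding H'_def using Hc(2) by (auto intro!: exI[of _ \<one>] exI[of _ "0::nat"])
    show "x \<otimes> y \<in> H'" if "x \<in> H'" "y \<in> H'" for x y
    proof -
      obtain h n k m where hk: "h \<in> H" "k \<in> H" "x = h \<otimes> s [^] (n::nat)" "y = k \<otimes> s [^] (m::nat)"
        using \<open>x \<in> H'\<close> \<open>y \<in> H'\<close> unfolding H'_def by blast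
      then have "x \<otimes> y = (h \<otimes> k) \<otimes> s [^] (n + m)"
        using Hc(1) s by (simp add: nat_pow_mult[symmetric] m_ac)
      then show ?thesis using hk Hc(3) unfolding H'_def by blast
    qed
  qed
  moreover have "insert s S \<subseteq> H'"
  proof -
    have "s = \<one> \<otimes> s [^] (1::nat)" using s by simp
    moreover have "x = x \<otimes> s [^] (0::nat)" if "x \<in> H" for x using that Hc(1) by simp
    ultimately show ?thesis using H(2) Hc(2) unfolding H'_def by blast
  qed
  moreover have "\<exists>r::nat \<Rightarrow> nat. strict_mono r \<and> (\<forall>i j. i \<le> j \<longrightarrow> (\<exists>z\<in>H'. f (r j) = f (r i) \<otimes> z))"
    if f: "range f \<subseteq> H'" for f :: "nat \<Rightarrow> 'a"
  proof -
    have "\<forall>i. \<exists>h n. h \<in> H \<and> f i = h \<otimes> s [^] (n::nat)"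
      using f unfolding H'_def by blast
    then obtain h n where hn: "\<And>i. h i \<in> H" "\<And>i. f i = h i \<otimes> s [^] (n i :: nat)"
      by metis
    obtain r :: "nat \<Rightarrow> nat" where r: "strict_mono r" "\<And>i j. i \<le> j \<Longrightarrow> \<exists>z\<in>H. h (r j) = h (r i) \<otimes> z"
      using seq[of h] hn(1) by (metis image_subsetI)
    obtain q :: "nat \<Rightarrow> nat" where q: "strict_mono q" "monoseq (\<lambda>i. n (r (q i)))"
      using seq_monosub[of "\<lambda>i. n (r i)"] by blast
    \<comment> \<open>A monotone sequence of naturals that is not increasing is decreasing, hence
      constant from an index of its minimum on; either way a nondecreasing subsequence
      remains.\<close>
    have "\<exists>k::nat \<Rightarrow> nat. strict_mono k \<and> (\<forall>i j. i \<le> j \<longrightarrow> n (r (q (k i))) \<le> n (r (q (k j))))"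
    proof (cases "\<forall>i j. i \<le> j \<longrightarrow> n (r (q i)) \<le> n (r (q j))")
      case True
      then show ?thesis by (intro exI[of _ id]) (auto simp: strict_mono_def)
    next
      case False
      then have dec: "\<And>i j. i \<le> j \<Longrightarrow> n (r (q j)) \<le> n (r (q i))"
        using q(2) by (auto simp: monoseq_def)
      define m where "m = (LEAST m. m \<in> range (\<lambda>i. n (r (q i))))"
      have "m \<in> range (\<lambda>i. n (r (q i)))" unfolding m_def by (rule LeastI[of _ "n (r (q 0))"]) simp
      then obtain i0 where i0: "m = n (r (q i0))" by blast
      have "m \<le> n (r (q i))" for i unfolding m_def by (rule Least_le) simp
      then have "n (r (q (i0 + i))) = m" for i
        using dec[of i0 "i0 + i"] i0 by (simp add: order_antisym)
      then show ?thesis by (intro exI[of _ "\<lambda>i. i0 + i"]) (auto simp: strict_mono_def)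
    qed
    then obtain k :: "nat \<Rightarrow> nat" where k: "strict_mono k" "\<And>i j. i \<le> j \<Longrightarrow> n (r (q (k i))) \<le> n (r (q (k j)))"
      by blast
    define t where "t = (\<lambda>i. r (q (k i)))"
    have qk: "strict_mono (\<lambda>i. q (k i))" using q(1) k(1) by (auto simp: strict_mono_def)
    have "strict_mono t" using r(1) qk by (auto simp: strict_mono_def t_def)
    moreover have "\<exists>z\<in>H'. f (t j) = f (t i) \<otimes> z" if "i \<le> j" for i j
    proof -
      have "q (k i) \<le> q (k j)" using strict_mono_less_eq[OF qk] that by simp
      then obtain z where z: "z \<in> H" "h (t j) = h (t i) \<otimes> z" using r(2) unfolding t_def by blast
      have "n (t j) = n (t i) + (n (t j) - n (t i))" using k(2)[OF that] by (simp add: t_def)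
      then have "s [^] n (t j) = s [^] n (t i) \<otimes> s [^] (n (t j) - n (t i))"
        using s by (metis nat_pow_mult)
      then have "f (t j) = f (t i) \<otimes> (z \<otimes> s [^] (n (t j) - n (t i)))"
        using z hn s Hc(1) by (simp add: m_ac)
      then show ?thesis using z(1) unfolding H'_def by blast
    qed
    ultimately show ?thesis by blast
  qed
  ultimately show ?case by (intro exI[of _ H']) blast
qed

lemma (in comm_monoid) finitely_generated_dickson:
  assumes "finitely_generated_monoid G"
  shows "dickson_property G"
proof -
  obtain S where S: "finite S" "S \<subseteq> carrier G" "\<Inter>{H. submonoid H G \<and> S \<subseteq> H} = carrier G"
    using assms by (auto simp: finitely_generated_monoid_def)
  obtain H where H: "submonoid H G" "S \<subseteq> H"
    "\<And>f::nat \<Rightarrow> 'a. range f \<subseteq> H \<Longrightarrow>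
       \<exists>r::nat \<Rightarrow> nat. strict_mono r \<and> (\<forall>i j. i \<le> j \<longrightarrow> (\<exists>z\<in>H. f (r j) = f (r i) \<otimes> z))"
    using finite_generated_dickson[OF S(1,2)] by blast
  have HG: "H = carrier G" using S(3) H(1,2) submonoid.subset[OF H(1)] by blast
  show ?thesis
    unfolding dickson_property_def
  proof (intro allI impI)
    fix f :: "nat \<Rightarrow> 'a" assume "range f \<subseteq> carrier G"
    then obtain r :: "nat \<Rightarrow> nat" where "strict_mono r" "\<And>i j. i \<le> j \<Longrightarrow> \<exists>z\<in>H. f (r j) = f (r i) \<otimes> z"
      using H(3) HG by blast
    then show "\<exists>i j. i < j \<and> (\<exists>z\<in>carrier G. f j = f i \<otimes> z)"
      using HG by (intro exI[of _ "r 0"] exI[of _ "r 1"]) (auto simp: strict_mono_def)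
  qed
qed

text \<open>The good pair is found among numerators. Denominators are units and move into the
  cofactor.\<close>

lemma (in prime_localization) localization_dickson:
  assumes "dickson_property Q"
  shows "dickson_property L"
  unfolding dickson_property_def
proof (intro allI impI)
  interpret L: comm_monoid L by (rule L_comm_monoid)
  fix f :: "nat \<Rightarrow> ('a \<times> 'a) set" assume f: "range f \<subseteq> carrier L"
  have "\<forall>i. \<exists>s a. s \<in> F \<and> a \<in> carrier Q \<and> to_loc Q P s \<otimes>\<^bsub>L\<^esub> f i = to_loc Q P a"
    using f L_repr by (metis rangeI subsetD)
  then obtain s a where sa: "\<And>i. s i \<in> F" "\<And>i. a i \<in> carrier Q"
    "\<And>i. to_loc Q P (s i) \<otimes>\<^bsub>L\<^esub> f i = to_loc Q P (a i)" by metis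
  obtain i j z where ij: "i < j" "z \<in> carrier Q" "a j = a i \<otimes> z"
    using assms sa(2) unfolding dickson_property_def by (metis image_subsetI)
  let ?u = "to_loc Q P (s j)"
  have u: "?u \<in> Units L" using sa(1) to_loc_Units by blast
  have carr: "f i \<in> carrier L" "f j \<in> carrier L" "to_loc Q P (s i) \<in> carrier L" "?u \<in> carrier L"
    "inv\<^bsub>L\<^esub> ?u \<in> carrier L" "to_loc Q P z \<in> carrier L"
    using f sa(1) ij u by auto
  have "f j = inv\<^bsub>L\<^esub> ?u \<otimes>\<^bsub>L\<^esub> (?u \<otimes>\<^bsub>L\<^esub> f j)"
    using u carr by (simp add: L.m_assoc[symmetric])
  also have "\<dots> = inv\<^bsub>L\<^esub> ?u \<otimes>\<^bsub>L\<^esub> ((to_loc Q P (s i) \<otimes>\<^bsub>L\<^esub> f i) \<otimes>\<^bsub>L\<^esub> to_loc Q P z)"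
    using sa ij by (simp add: to_loc_mult)
  also have "\<dots> = f i \<otimes>\<^bsub>L\<^esub> (inv\<^bsub>L\<^esub> ?u \<otimes>\<^bsub>L\<^esub> to_loc Q P (s i) \<otimes>\<^bsub>L\<^esub> to_loc Q P z)"
    using carr by (simp add: L.m_ac)
  finally show "\<exists>i j. i < j \<and> (\<exists>z\<in>carrier L. f j = f i \<otimes>\<^bsub>L\<^esub> z)"
    using ij(1) carr by (metis L.m_closed)
qed

text \<open>A product in \<open>F\<close> has its factors in \<open>F\<close>, so the generators of
  \<open>Q\<close> outside \<open>P\<close> generate \<open>F\<close>, and units of the localization
  are quotients of elements of \<open>F\<close>.\<close>

lemma (in prime_localization) Units_generated:
  assumes "finitely_generated_monoid Q"
  shows "\<exists>Y. finite Y \<and> Y \<subseteq> Units L \<and> (\<forall>H. subgroup H (units_of L) \<and> Y \<subseteq> H \<longrightarrow> H = Units L)"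
proof -
  interpret L: comm_monoid L by (rule L_comm_monoid)
  obtain S where S: "finite S" "S \<subseteq> carrier Q" "\<Inter>{H. submonoid H Q \<and> S \<subseteq> H} = carrier Q"
    using assms by (auto simp: finitely_generated_monoid_def)
  define Y where "Y = to_loc Q P ` (S - P)"
  have "H = Units L" if H: "subgroup H (units_of L)" "Y \<subseteq> H" for H
  proof
    show "H \<subseteq> Units L" using subgroup.subset[OF H(1)] by (simp add: units_of_def)
    interpret U: comm_group "units_of L" by (rule L.units_comm_group)
    \<comment> \<open>Adding all of \<open>P\<close> turns a condition on elements of
      \<open>F\<close> into a submonoid of \<open>Q\<close>, to which generation of \<open>Q\<close>
      applies.\<close>
    define T where "T = {a \<in> carrier Q. a \<in> P \<or> to_loc Q P a \<in> H}"
    have "submonoid T Q"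
    proof
      show "\<one> \<in> T"
        using subgroup.one_closed[OF H(1)] by (simp add: T_def units_of_def)
      show "a \<otimes> b \<in> T" if "a \<in> T" "b \<in> T" for a b
        using that subgroup.m_closed[OF H(1), of "to_loc Q P a" "to_loc Q P b"] P_absorb P_absorb'
        by (auto simp: T_def units_of_def to_loc_mult)
    qed (auto simp: T_def)
    moreover have "S \<subseteq> T" using H(2) S(2) by (auto simp: T_def Y_def)
    ultimately have T: "carrier Q \<subseteq> T" using S(3) by blast
    have *: "to_loc Q P a \<in> H" if "a \<in> F" for a using T that by (auto simp: T_def)
    show "Units L \<subseteq> H"
    proof
      fix u assume u: "u \<in> Units L"
      obtain s a where sa: "s \<in> F" "a \<in> carrier Q" "to_loc Q P s \<otimes>\<^bsub>L\<^esub> u = to_loc Q P a"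
        using L_repr L.Units_closed[OF u] by blast
      then have "to_loc Q P a \<in> Units L" using u to_loc_Units L.Units_m_closed by metis
      then have "a \<in> F" using to_loc_Units_iff sa(2) by blast
      moreover have "u = inv\<^bsub>L\<^esub> (to_loc Q P s) \<otimes>\<^bsub>L\<^esub> to_loc Q P a"
        using sa u to_loc_Units[OF sa(1)]
        by (metis L.Units_closed L.Units_inv_closed L.Units_l_inv L.l_one L.m_assoc)
      moreover have "inv\<^bsub>L\<^esub> (to_loc Q P s) \<in> H"
        using subgroup.m_inv_closed[OF H(1) *[OF sa(1)]] L.units_of_inv to_loc_Units[OF sa(1)] by simp
      ultimately show "u \<in> H"
        using *[of a] subgroup.m_closed[OF H(1)] by (simp add: units_of_def)
    qed
  qed
  moreover have "finite Y" "Y \<subseteq> Units L" using S(1,2) to_loc_Units by (auto simp: Y_def)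
  ultimately show ?thesis by blast
qed

lemma (in monoid) Units_inv_cancel:
  assumes "u \<in> Units G" "x \<in> carrier G"
  shows "inv u \<otimes> (u \<otimes> x) = x"
  using assms by (metis Units_closed Units_inv_closed Units_l_inv l_one m_assoc)

section \<open>Primary decompositions without embedded components\<close>

context cring
begin

lemma primary_idealD:
  assumes "primary_ideal R C"
  shows "ideal C R" "C \<noteq> carrier R"
    "\<And>a b. a \<in> carrier R \<Longrightarrow> b \<in> carrier R \<Longrightarrow> a \<otimes> b \<in> C \<Longrightarrow> a \<notin> C \<Longrightarrow> \<exists>n::nat. b [^] n \<in> C"
  using assms by (auto simp: primary_ideal_def)

lemma radical_prime:
  assumes C: "primary_ideal R C" and ab: "a \<in> carrier R" "b \<in> carrier R" "a \<otimes> b \<in> ideal_radical R C"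
  shows "a \<in> ideal_radical R C \<or> b \<in> ideal_radical R C"
proof -
  obtain n :: nat where "(a \<otimes> b) [^] n \<in> C" using ab by (auto simp: ideal_radical_def)
  then have n: "a [^] n \<otimes> b [^] n \<in> C" using ab by (simp add: nat_pow_distrib)
  show ?thesis
  proof (cases "a [^] n \<in> C")
    case False
    then obtain m :: nat where "(b [^] n) [^] m \<in> C"
      using primary_idealD(3)[OF C _ _ n] ab by auto
    then have "b [^] (n * m) \<in> C" using ab by (simp add: nat_pow_pow)
    then show ?thesis using ab unfolding ideal_radical_def by blast
  qed (use ab in \<open>auto simp: ideal_radical_def\<close>)
qed

lemma radical_superset: "ideal C R \<Longrightarrow> C \<subseteq> ideal_radical R C"
  unfolding ideal_radical_def
  by (auto dest: ideal.Icarr intro!: exI[of _ "1::nat"])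

lemma radical_one:
  assumes "primary_ideal R C" shows "\<one> \<notin> ideal_radical R C"
  using primary_idealD[OF assms] ideal.one_imp_carrier[of C R] by (auto simp: ideal_radical_def)

lemma radical_subset:
  assumes "D \<subseteq> ideal_radical R C"
  shows "ideal_radical R D \<subseteq> ideal_radical R C"
proof
  fix a assume "a \<in> ideal_radical R D"
  then obtain n :: nat where a: "a \<in> carrier R" "a [^] n \<in> ideal_radical R C"
    using assms by (auto simp: ideal_radical_def[of R D])
  then obtain m :: nat where "(a [^] n) [^] m \<in> C" by (auto simp: ideal_radical_def)
  then have "a [^] (n * m) \<in> C" using a by (simp add: nat_pow_pow)
  then show "a \<in> ideal_radical R C" using a unfolding ideal_radical_def by blast
qed

text \<open>An element outside the radical is taken from each ideal. The product lies in all of them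
  and stays outside, because the radical of a primary ideal is prime.\<close>

lemma prime_avoidance:
  assumes C: "primary_ideal R C"
  shows "finite \<D> \<Longrightarrow> (\<And>D. D \<in> \<D> \<Longrightarrow> ideal D R \<and> \<not> D \<subseteq> ideal_radical R C) \<Longrightarrow>
    \<exists>x\<in>carrier R. x \<notin> ideal_radical R C \<and> (\<forall>D\<in>\<D>. x \<in> D)"
proof (induction rule: finite_induct)
  case empty
  then show ?case using radical_one[OF C] by (intro bexI[of _ \<one>]) auto
next
  case (insert D \<D>)
  obtain x where x: "x \<in> carrier R" "x \<notin> ideal_radical R C" "\<And>D'. D' \<in> \<D> \<Longrightarrow> x \<in> D'"
    using insert.IH insert.prems by auto
  obtain d where d: "d \<in> D" "d \<notin> ideal_radical R C" using insert.prems[of D] by auto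
  have D: "ideal D R" using insert.prems[of D] by auto
  have dc: "d \<in> carrier R" using D d(1) ideal.Icarr by metis
  have "x \<otimes> d \<notin> ideal_radical R C" using radical_prime[OF C x(1) dc] x(2) d(2) by blast
  moreover have "x \<otimes> d \<in> D" using ideal.I_l_closed[OF D d(1) x(1)] .
  moreover have "x \<otimes> d \<in> D'" if "D' \<in> \<D>" for D'
    using ideal.I_r_closed[of D' R x d] insert.prems[of D'] that x(3) dc by auto
  ultimately show ?case using x dc by (intro bexI[of _ "x \<otimes> d"]) auto
qed

lemma prime_contains_member:
  assumes C: "primary_ideal R C" and "finite \<D>" "\<And>D. D \<in> \<D> \<Longrightarrow> ideal D R"
    and sub: "ideal_Inter R \<D> \<subseteq> ideal_radical R C"
  shows "\<exists>D\<in>\<D>. D \<subseteq> ideal_radical R C"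
proof (rule ccontr)
  assume "\<not> ?thesis"
  then obtain x where "x \<in> carrier R" "x \<notin> ideal_radical R C" "\<forall>D\<in>\<D>. x \<in> D"
    using prime_avoidance[OF C assms(2)] assms(3) by auto
  then show False using sub by (auto simp: ideal_Inter_def)
qed

text \<open>The assumption \<open>inc\<close> excludes embedded components. Each \<open>C\<close> is
  then recovered from the intersection as the set of elements that some \<open>s\<close> outside its
  radical multiplies into the intersection, so any minimal decomposition contains the same
  ideals.\<close>

lemma minimal_primary_decomposition_iff:
  assumes fin: "finite \<C>" and prim: "\<And>C. C \<in> \<C> \<Longrightarrow> primary_ideal R C"
    and inc: "\<And>C C'. C \<in> \<C> \<Longrightarrow> C' \<in> \<C> \<Longrightarrow> C' \<subseteq> ideal_radical R C \<Longrightarrow> C' = C"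
  shows "minimal_primary_decomposition R (ideal_Inter R \<C>) \<D> \<longleftrightarrow> \<D> = \<C>"
proof
  let ?A = "ideal_Inter R \<C>"
  have idl: "ideal C R" if "C \<in> \<C>" for C using prim[OF that] primary_idealD by blast
  {
    assume "\<D> = \<C>"
    moreover have "inj_on (ideal_radical R) \<C>"
      using inc radical_superset[OF idl] by (metis inj_onI)
    moreover have "\<not> ideal_Inter R (\<C> - {C}) \<subseteq> C" if C: "C \<in> \<C>" for C
    proof
      assume "ideal_Inter R (\<C> - {C}) \<subseteq> C"
      then have "ideal_Inter R (\<C> - {C}) \<subseteq> ideal_radical R C"
        using radical_superset[OF idl[OF C]] by blast
      then obtain D where "D \<in> \<C> - {C}" "D \<subseteq> ideal_radical R C"
        using prime_contains_member[OF prim[OF C], of "\<C> - {C}"] fin idl by auto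
      then show False using inc C by blast
    qed
    ultimately show "minimal_primary_decomposition R ?A \<D>"
      using fin prim by (auto simp: minimal_primary_decomposition_def)
  }
  assume D: "minimal_primary_decomposition R ?A \<D>"
  then have Dfin: "finite \<D>" and Dprim: "\<And>D. D \<in> \<D> \<Longrightarrow> primary_ideal R D"
    and DA: "ideal_Inter R \<D> = ?A" and Dinj: "inj_on (ideal_radical R) \<D>"
    and Dmin: "\<And>D. D \<in> \<D> \<Longrightarrow> \<not> ideal_Inter R (\<D> - {D}) \<subseteq> D"
    by (auto simp: minimal_primary_decomposition_def)
  have Didl: "ideal D R" if "D \<in> \<D>" for D using Dprim[OF that] primary_idealD by blast
  have "C \<in> \<D>" if C: "C \<in> \<C>" for C
  proof -
    have AC: "?A \<subseteq> C" using C by (auto simp: ideal_Inter_def)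
    \<comment> \<open>Some \<open>C'\<close> of the family lies in the radical of \<open>D\<close>,
      hence in that of \<open>C\<close>, and \<open>inc\<close> gives \<open>C' = C\<close>. So the
      two radicals coincide.\<close>
    have rad: "C \<subseteq> ideal_radical R D \<and> ideal_radical R D = ideal_radical R C"
      if d: "D \<in> \<D>" "D \<subseteq> ideal_radical R C" for D
    proof -
      have DC: "ideal_radical R D \<subseteq> ideal_radical R C" using radical_subset[OF d(2)] .
      have "ideal_Inter R \<C> \<subseteq> ideal_radical R D"
        using DA d(1) radical_superset[OF Didl[OF d(1)]] by (auto simp: ideal_Inter_def)
      then obtain C' where "C' \<in> \<C>" "C' \<subseteq> ideal_radical R D"
        using prime_contains_member[OF Dprim[OF d(1)] fin idl] by blast
      then have "C \<subseteq> ideal_radical R D" using inc C DC by blast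
      then show ?thesis using DC radical_subset by blast
    qed
    have "ideal_Inter R \<D> \<subseteq> ideal_radical R C"
      using DA AC radical_superset[OF idl[OF C]] by blast
    then obtain D where D: "D \<in> \<D>" "D \<subseteq> ideal_radical R C"
      using prime_contains_member[OF prim[OF C] Dfin Didl] by blast
    have "\<not> D' \<subseteq> ideal_radical R C" if "D' \<in> \<D> - {D}" for D'
      using rad[of D'] rad[OF D] that D inj_onD[OF Dinj, of D' D] by auto
    \<comment> \<open>Injectivity of radicals leaves \<open>D\<close> as the only member inside the
      radical of \<open>C\<close>, so \<open>s\<close> can be taken in all other members and outside
      this radical.\<close>
    then obtain s where s: "s \<in> carrier R" "s \<notin> ideal_radical R C" "\<forall>D'\<in>\<D> - {D}. s \<in> D'"
      using prime_avoidance[OF prim[OF C], of "\<D> - {D}"] Dfin Didl by auto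
    have "D \<subseteq> C"
    proof
      fix f assume f: "f \<in> D"
      have fc: "f \<in> carrier R" using ideal.Icarr[OF Didl[OF D(1)] f] .
      have "f \<otimes> s \<in> D'" if "D' \<in> \<D>" for D'
      proof (cases "D' = D")
        case True
        then show ?thesis using ideal.I_r_closed[OF Didl[OF D(1)] f s(1)] by simp
      next
        case False
        then show ?thesis using ideal.I_l_closed[OF Didl[OF that], of s f] s(3) fc that by auto
      qed
      then have "f \<otimes> s \<in> C" using AC DA fc s(1) by (auto simp: ideal_Inter_def)
      then show "f \<in> C"
        using primary_idealD(3)[OF prim[OF C] fc s(1)] s(1,2) by (auto simp: ideal_radical_def)
    qed
    moreover have "C \<subseteq> D"
    proof
      have "\<not> C' \<subseteq> ideal_radical R C" if "C' \<in> \<C> - {C}" for C'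
        using inc[OF C] that by blast
      then obtain t where t: "t \<in> carrier R" "t \<notin> ideal_radical R C" "\<forall>C'\<in>\<C> - {C}. t \<in> C'"
        using prime_avoidance[OF prim[OF C], of "\<C> - {C}"] fin idl by auto
      fix f assume f: "f \<in> C"
      have fc: "f \<in> carrier R" using ideal.Icarr[OF idl[OF C] f] .
      have "f \<otimes> t \<in> C'" if "C' \<in> \<C>" for C'
      proof (cases "C' = C")
        case True
        then show ?thesis using ideal.I_r_closed[OF idl[OF C] f t(1)] by simp
      next
        case False
        then show ?thesis using ideal.I_l_closed[OF idl[OF that], of t f] t(3) fc that by auto
      qed
      then have "f \<otimes> t \<in> D" using DA fc t(1) D(1) by (auto simp: ideal_Inter_def)
      then show "f \<in> D"
        using primary_idealD(3)[OF Dprim[OF D(1)] fc t(1)] t(1,2) rad[OF D] by (auto simp: ideal_radical_def)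
    qed
    ultimately have "D = C" by blast
    then show ?thesis using D(1) by simp
  qed
  then have "\<C> \<subseteq> \<D>" by blast
  \<comment> \<open>An additional member would contain the intersection of the others, since these
    already include all of \<open>\<C>\<close>.\<close>
  moreover have "D \<in> \<C>" if "D \<in> \<D>" for D
  proof (rule ccontr)
    assume "D \<notin> \<C>"
    then have "ideal_Inter R (\<D> - {D}) \<subseteq> ?A"
      using \<open>\<C> \<subseteq> \<D>\<close> by (auto simp: ideal_Inter_def)
    also have "\<dots> \<subseteq> D" using DA that by (auto simp: ideal_Inter_def)
    finally show False using Dmin that by blast
  qed
  ultimately show "\<D> = \<C>" by blast
qed

lemma primary_components_eq:
  assumes "finite \<C>" "\<And>C. C \<in> \<C> \<Longrightarrow> primary_ideal R C"
    and "\<And>C C'. C \<in> \<C> \<Longrightarrow> C' \<in> \<C> \<Longrightarrow> C' \<subseteq> ideal_radical R C \<Longrightarrow> C' = C"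
  shows "primary_components R (ideal_Inter R \<C>) = \<C>"
  unfolding primary_components_def
  using minimal_primary_decomposition_iff[OF assms] by (intro the_equality) auto

end

text \<open>The ring \<open>R\<close> plays a localization of a quotient of \<open>S\<close>, and
  \<open>E\<close> its primitive idempotents. \<open>irr\<close> says that any two nonzero principal
  ideals of the factor \<open>R e\<close> meet nontrivially; \<open>loc\<close> clears denominators,
  which transports the properties of annihilators in \<open>R\<close> to their contractions.\<close>

lemma contraction_components:
  fixes R (structure)
  assumes "cring S" "cring R" and \<theta>: "\<theta> \<in> ring_hom S R"
    and loc: "\<And>r. r \<in> carrier R \<Longrightarrow> \<exists>s\<in>carrier S. \<exists>t\<in>carrier S. \<theta> t \<in> Units R \<and> \<theta> s = \<theta> t \<otimes> r"
    and E: "finite E" "E \<subseteq> carrier R" "\<zero> \<notin> E"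
    and idem: "\<And>e. e \<in> E \<Longrightarrow> e \<otimes> e = e"
    and orth: "\<And>e e'. e \<in> E \<Longrightarrow> e' \<in> E \<Longrightarrow> e \<noteq> e' \<Longrightarrow> e \<otimes> e' = \<zero>"
    and sep: "\<And>r. r \<in> carrier R \<Longrightarrow> (\<And>e. e \<in> E \<Longrightarrow> r \<otimes> e = \<zero>) \<Longrightarrow> r = \<zero>"
    and prim: "\<And>e a b. e \<in> E \<Longrightarrow> a \<in> carrier R \<Longrightarrow> b \<in> carrier R \<Longrightarrow> a \<otimes> b \<otimes> e = \<zero> \<Longrightarrow>
        a \<otimes> e \<noteq> \<zero> \<Longrightarrow> \<exists>n::nat. b [^] n \<otimes> e = \<zero>"
    and irr: "\<And>e a b. e \<in> E \<Longrightarrow> a \<in> carrier R \<Longrightarrow> b \<in> carrier R \<Longrightarrow> a \<otimes> e \<noteq> \<zero> \<Longrightarrow>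
        b \<otimes> e \<noteq> \<zero> \<Longrightarrow> \<exists>x\<in>carrier R. \<exists>y\<in>carrier R. x \<otimes> a \<otimes> e = y \<otimes> b \<otimes> e \<and> x \<otimes> a \<otimes> e \<noteq> \<zero>"
  defines "\<C> \<equiv> (\<lambda>e. {f \<in> carrier S. \<theta> f \<otimes> e = \<zero>}) ` E"
  shows "primary_components S {f \<in> carrier S. \<theta> f = \<zero>} = \<C>"
    and "ideal_Inter S \<C> = {f \<in> carrier S. \<theta> f = \<zero>}"
    and "\<And>C. C \<in> \<C> \<Longrightarrow> irreducible_ideal S C"
proof -
  interpret S: cring S by fact
  interpret R: cring R by fact
  interpret h: ring_hom_cring S R \<theta>
    using assms by (intro ring_hom_cring.intro ring_hom_cring_axioms.intro)
  define C where "C e = {f \<in> carrier S. \<theta> f \<otimes> e = \<zero>}" for e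
  have Ec: "e \<in> carrier R" if "e \<in> E" for e using that E by auto
  have Cid: "ideal (C e) S" if e: "e \<in> E" for e
  proof (rule idealI)
    show "ring S" by unfold_locales
    show "subgroup (C e) (add_monoid S)"
    proof (rule S.add.subgroupI)
      show "C e \<subseteq> carrier S" by (auto simp: C_def)
      show "C e \<noteq> {}" using Ec[OF e] by (auto simp: C_def intro!: exI[of _ "\<zero>\<^bsub>S\<^esub>"])
      show "\<ominus>\<^bsub>S\<^esub> a \<in> C e" if "a \<in> C e" for a
        using that Ec[OF e] R.l_minus[of "\<theta> a" e] by (auto simp: C_def)
      show "a \<oplus>\<^bsub>S\<^esub> b \<in> C e" if "a \<in> C e" "b \<in> C e" for a b
        using that Ec[OF e] by (auto simp: C_def R.l_distr)
    qed
    show "x \<otimes>\<^bsub>S\<^esub> a \<in> C e" if "a \<in> C e" "x \<in> carrier S" for a x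
      using that Ec[OF e] by (auto simp: C_def R.m_assoc)
    show "a \<otimes>\<^bsub>S\<^esub> x \<in> C e" if "a \<in> C e" "x \<in> carrier S" for a x
      using that Ec[OF e] R.m_comm[of "\<theta> a" "\<theta> x"] by (auto simp: C_def R.m_assoc)
  qed
  have pow: "\<theta> (f [^]\<^bsub>S\<^esub> n) = \<theta> f [^] n" if "f \<in> carrier S" for f and n :: nat
    using h.ring.hom_nat_pow that by blast
  have Cprim: "primary_ideal S (C e)" if e: "e \<in> E" for e
    unfolding primary_ideal_def
  proof (intro conjI ballI impI)
    show "ideal (C e) S" by (rule Cid[OF e])
    have "\<one>\<^bsub>S\<^esub> \<notin> C e" using E e by (auto simp: C_def)
    then show "C e \<noteq> carrier S" by auto
    fix a b assume ab: "a \<in> carrier S" "b \<in> carrier S" "a \<otimes>\<^bsub>S\<^esub> b \<in> C e"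
    then show "a \<in> C e \<or> (\<exists>n::nat. b [^]\<^bsub>S\<^esub> n \<in> C e)"
      using prim[OF e, of "\<theta> a" "\<theta> b"] pow[of b] by (auto simp: C_def)
  qed
  \<comment> \<open>Clearing denominators turns \<open>e\<close> into an image \<open>s\<close> from
    \<open>S\<close>. It is killed by \<open>e'\<close> through orthogonality, whereas its powers
    times \<open>e\<close> are units times \<open>e\<close> and never vanish.\<close>
  have Cinc: "e = e'" if e: "e \<in> E" "e' \<in> E" "C e' \<subseteq> ideal_radical S (C e)" for e e'
  proof (rule ccontr)
    assume ne: "e \<noteq> e'"
    obtain s t where st: "s \<in> carrier S" "t \<in> carrier S" "\<theta> t \<in> Units R" "\<theta> s = \<theta> t \<otimes> e"
      using loc[OF Ec[OF e(1)]] by blast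
    have "s \<in> C e'"
      using st Ec e orth[OF e(1,2) ne] by (auto simp: C_def R.m_assoc)
    then obtain n :: nat where n: "\<theta> s [^] n \<otimes> e = \<zero>"
      using e(3) pow[OF st(1)] by (auto simp: ideal_radical_def C_def)
    have "(\<theta> t \<otimes> e) [^] n \<otimes> e = \<theta> t [^] n \<otimes> e" for n :: nat
    proof (induction n)
      case (Suc n)
      have "(\<theta> t \<otimes> e) [^] Suc n \<otimes> e = ((\<theta> t \<otimes> e) [^] n \<otimes> e) \<otimes> (\<theta> t \<otimes> e)"
        using st Ec[OF e(1)] by (simp add: R.m_ac)
      also have "\<dots> = \<theta> t [^] n \<otimes> \<theta> t \<otimes> (e \<otimes> e)"
        using st Ec[OF e(1)] Suc by (simp add: R.m_ac)
      finally show ?case using idem[OF e(1)] by simp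
    qed simp
    then have "\<theta> t [^] n \<otimes> e = \<zero>" using n st by simp
    moreover have "inv (\<theta> t [^] n) \<otimes> (\<theta> t [^] n \<otimes> e) = e"
      using R.Units_inv_cancel[OF R.Units_pow_closed[OF st(3)] Ec[OF e(1)]] .
    ultimately have "e = \<zero>" using R.Units_pow_closed[OF st(3), of n] by simp
    then show False using E e by blast
  qed
  have CE: "\<C> = C ` E" by (simp add: \<C>_def C_def)
  show Int: "ideal_Inter S \<C> = {f \<in> carrier S. \<theta> f = \<zero>}"
    unfolding CE ideal_Inter_def using sep Ec by (auto simp: C_def)
  show "primary_components S {f \<in> carrier S. \<theta> f = \<zero>} = \<C>"
    unfolding Int[symmetric]
  proof (rule S.primary_components_eq)
    show "D' = D" if D: "D \<in> \<C>" "D' \<in> \<C>" "D' \<subseteq> ideal_radical S D" for D D'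
    proof -
      obtain e e' where "e \<in> E" "e' \<in> E" "D = C e" "D' = C e'" using D CE by auto
      then show ?thesis using Cinc[of e e'] D(3) by simp
    qed
  qed (use E Cprim in \<open>auto simp: CE\<close>)
  show "irreducible_ideal S D" if "D \<in> \<C>" for D
  proof -
    obtain e where e: "e \<in> E" "D = C e" using \<open>D \<in> \<C>\<close> CE by auto
    have False if AB: "ideal A S" "ideal B S" "C e \<subset> A" "C e \<subset> B" "C e = A \<inter> B" for A B
    proof -
      obtain a where a: "a \<in> A" "a \<in> carrier S" "\<theta> a \<otimes> e \<noteq> \<zero>"
        using AB ideal.Icarr[OF AB(1)] by (auto simp: C_def)
      obtain b where b: "b \<in> B" "b \<in> carrier S" "\<theta> b \<otimes> e \<noteq> \<zero>"
        using AB ideal.Icarr[OF AB(2)] by (auto simp: C_def)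
      obtain x y where xy: "x \<in> carrier R" "y \<in> carrier R"
        "x \<otimes> \<theta> a \<otimes> e = y \<otimes> \<theta> b \<otimes> e" "x \<otimes> \<theta> a \<otimes> e \<noteq> \<zero>"
        using irr[OF e(1), of "\<theta> a" "\<theta> b"] a b by auto
      obtain s t where st: "s \<in> carrier S" "t \<in> carrier S" "\<theta> t \<in> Units R" "\<theta> s = \<theta> t \<otimes> x"
        using loc[OF xy(1)] by blast
      obtain s' t' where st': "s' \<in> carrier S" "t' \<in> carrier S" "\<theta> t' \<in> Units R" "\<theta> s' = \<theta> t' \<otimes> y"
        using loc[OF xy(2)] by blast
      define z where "z = \<theta> t \<otimes> \<theta> t'"
      have zU: "z \<in> Units R" and zc: "z \<in> carrier R" using st st' by (auto simp: z_def)
      let ?f = "(t' \<otimes>\<^bsub>S\<^esub> s) \<otimes>\<^bsub>S\<^esub> a" and ?g = "(t \<otimes>\<^bsub>S\<^esub> s') \<otimes>\<^bsub>S\<^esub> b"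
      have ec: "e \<in> carrier R" using Ec e by blast
      have f: "\<theta> ?f \<otimes> e = z \<otimes> (x \<otimes> \<theta> a \<otimes> e)"
        using st st' a xy(1) ec by (simp add: z_def R.m_ac)
      have g: "\<theta> ?g \<otimes> e = z \<otimes> (y \<otimes> \<theta> b \<otimes> e)"
        using st st' b xy(2) ec by (simp add: z_def R.m_ac)
      have fA: "?f \<in> A" using ideal.I_l_closed[OF AB(1) a(1)] st st' by blast
      have gB: "?g \<in> B" using ideal.I_l_closed[OF AB(2) b(1)] st st' by blast
      have fg: "?f \<in> carrier S" "?g \<in> carrier S" using st st' a b by auto
      \<comment> \<open>The images of \<open>?f\<close> and \<open>?g\<close> agree on
        \<open>e\<close>, so their difference lies in \<open>C e\<close>, hence in \<open>B\<close>.
        Thus \<open>?f\<close> lies in both ideals and so in \<open>C e\<close>, although its image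
        times \<open>e\<close> is a unit multiple of a nonzero element.\<close>
      have "?f \<ominus>\<^bsub>S\<^esub> ?g \<in> C e"
      proof -
        have "\<theta> (?f \<ominus>\<^bsub>S\<^esub> ?g) \<otimes> e = \<theta> ?f \<otimes> e \<ominus> \<theta> ?g \<otimes> e"
          using fg ec by (simp add: a_minus_def R.l_distr R.l_minus del: h.hom_mult)
        also have "\<dots> = \<zero>"
          using f g xy zc ec b by (simp add: R.minus_eq R.r_neg)
        finally show ?thesis using fg by (simp add: C_def)
      qed
      then have "?f \<ominus>\<^bsub>S\<^esub> ?g \<in> B" using AB by blast
      then have "(?f \<ominus>\<^bsub>S\<^esub> ?g) \<oplus>\<^bsub>S\<^esub> ?g \<in> B"
        using gB additive_subgroup.a_closed[OF ideal.axioms(1)[OF AB(2)]] by blast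
      moreover have "(?f \<ominus>\<^bsub>S\<^esub> ?g) \<oplus>\<^bsub>S\<^esub> ?g = ?f"
        using fg by (simp add: a_minus_def S.a_assoc S.l_neg)
      ultimately have "?f \<in> C e" using fA AB by auto
      then have "z \<otimes> (x \<otimes> \<theta> a \<otimes> e) = \<zero>" using f by (auto simp: C_def)
      moreover have "inv z \<otimes> (z \<otimes> (x \<otimes> \<theta> a \<otimes> e)) = x \<otimes> \<theta> a \<otimes> e"
        using xy(1) a(2) ec by (intro R.Units_inv_cancel[OF zU] R.m_closed h.hom_closed)
      ultimately show False using xy(4) zU by simp
    qed
    then show ?thesis
      unfolding irreducible_ideal_def e(2) using Cid[OF e(1)] by blast
  qed
qed

section \<open>Artinian subrings\<close>

context cring
begin

text \<open>For a subring \<open>A\<close> these are its ideals, negatives being multiples by the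
  negative of 1. The predicate avoids forming a separate ring record for \<open>A\<close>.\<close>

definition subring_module :: "'a set \<Rightarrow> 'a set \<Rightarrow> bool" where
  "subring_module A U \<longleftrightarrow> U \<subseteq> A \<and> \<zero> \<in> U \<and> (\<forall>x\<in>U. \<forall>y\<in>U. x \<oplus> y \<in> U) \<and> (\<forall>a\<in>A. \<forall>x\<in>U. a \<otimes> x \<in> U)"

definition primitive_idempotent :: "'a set \<Rightarrow> 'a \<Rightarrow> bool" where
  "primitive_idempotent A e \<longleftrightarrow> e \<in> A \<and> e \<otimes> e = e \<and> e \<noteq> \<zero> \<and>
     (\<forall>f\<in>A. f \<otimes> f = f \<and> f \<otimes> e = f \<longrightarrow> f = \<zero> \<or> f = e)"

end

text \<open>The function \<open>\<delta>\<close> is a length: its strict monotonicity bounds chains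
  of ideals in both directions. In the application it is a vector space dimension.\<close>

locale artinian_subring = cring R for R (structure) +
  fixes A :: "'a set" and \<delta> :: "'a set \<Rightarrow> nat"
  assumes subr: "subring A R"
    and \<delta>_mono: "\<And>U V. subring_module A U \<Longrightarrow> subring_module A V \<Longrightarrow> U \<subset> V \<Longrightarrow> \<delta> U < \<delta> V"
begin

lemma A_carrier: "a \<in> A \<Longrightarrow> a \<in> carrier R"
  using subringE(1)[OF subr] by blast

lemmas A_closed = subringE(2-7)[OF subr]

lemma A_pow: "a \<in> A \<Longrightarrow> a [^] (n::nat) \<in> A"
  by (induction n) (auto simp: A_closed)

definition gen :: "'a \<Rightarrow> 'a set" where "gen x = (\<lambda>a. a \<otimes> x) ` A"

definition ann :: "'a \<Rightarrow> 'a set" where "ann r = {a \<in> A. a \<otimes> r = \<zero>}"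

lemma gen_module: "x \<in> A \<Longrightarrow> subring_module A (gen x)"
  unfolding subring_module_def gen_def
proof (intro conjI ballI)
  assume x: "x \<in> A"
  show "(\<lambda>a. a \<otimes> x) ` A \<subseteq> A" using x A_closed by auto
  show "\<zero> \<in> (\<lambda>a. a \<otimes> x) ` A" using x A_carrier A_closed(1) by (auto intro!: image_eqI[of _ _ \<zero>])
  show "y \<oplus> z \<in> (\<lambda>a. a \<otimes> x) ` A" if yz: "y \<in> (\<lambda>a. a \<otimes> x) ` A" "z \<in> (\<lambda>a. a \<otimes> x) ` A" for y z
  proof -
    obtain a b where "a \<in> A" "b \<in> A" "y = a \<otimes> x" "z = b \<otimes> x" using yz by auto
    then have "y \<oplus> z = (a \<oplus> b) \<otimes> x" "a \<oplus> b \<in> A" using x A_carrier A_closed(6) by (auto simp: l_distr)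
    then show ?thesis by (rule image_eqI)
  qed
  show "a \<otimes> y \<in> (\<lambda>a. a \<otimes> x) ` A" if ay: "a \<in> A" "y \<in> (\<lambda>a. a \<otimes> x) ` A" for a y
  proof -
    obtain b where "b \<in> A" "y = b \<otimes> x" using ay by auto
    then have "a \<otimes> y = (a \<otimes> b) \<otimes> x" "a \<otimes> b \<in> A"
      using x ay A_carrier A_closed(5) by (auto simp: m_assoc)
    then show ?thesis by (rule image_eqI)
  qed
qed

lemma ann_module: "r \<in> carrier R \<Longrightarrow> subring_module A (ann r)"
  unfolding subring_module_def ann_def
  using A_carrier A_closed by (auto simp: l_distr m_assoc)

lemma A_module: "subring_module A A"
  unfolding subring_module_def using A_closed by auto

lemma \<delta>_le:
  assumes "subring_module A U" shows "\<delta> U \<le> \<delta> A"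
proof (cases "U = A")
  case False
  then have "U \<subset> A" using assms unfolding subring_module_def by blast
  then show ?thesis using \<delta>_mono[OF assms A_module] by simp
qed simp

text \<open>The powers of \<open>x\<close> generate a descending chain of ideals, which stops where
  \<open>\<delta>\<close> is least. There a power is a multiple of its own square, so its product
  with \<open>y\<close> is idempotent.\<close>

lemma fitting:
  assumes x: "x \<in> A"
  shows "\<exists>n y. y \<in> A \<and> x [^] Suc n = x [^] Suc n \<otimes> x [^] Suc n \<otimes> y"
proof -
  obtain n where n: "\<And>m. \<delta> (gen (x [^] Suc n)) \<le> \<delta> (gen (x [^] Suc m))"
    using ex_has_least_nat[of "\<lambda>_. True" 0 "\<lambda>n. \<delta> (gen (x [^] Suc n))"] by blast
  have xc: "x \<in> carrier R" using x A_carrier by blast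
  have sub: "gen (x [^] Suc (Suc n)) \<subseteq> gen (x [^] Suc n)"
  proof
    fix z assume "z \<in> gen (x [^] Suc (Suc n))"
    then obtain a where a: "a \<in> A" "z = a \<otimes> x [^] Suc (Suc n)" by (auto simp: gen_def)
    then have "z = (a \<otimes> x) \<otimes> x [^] Suc n" using xc A_carrier by (simp add: m_ac)
    then show "z \<in> gen (x [^] Suc n)" using a x A_closed unfolding gen_def by blast
  qed
  have "gen (x [^] Suc (Suc n)) = gen (x [^] Suc n)"
  proof (rule ccontr)
    assume "gen (x [^] Suc (Suc n)) \<noteq> gen (x [^] Suc n)"
    then have "gen (x [^] Suc (Suc n)) \<subset> gen (x [^] Suc n)" using sub by blast
    then have "\<delta> (gen (x [^] Suc (Suc n))) < \<delta> (gen (x [^] Suc n))"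
      using \<delta>_mono gen_module A_pow[OF x] by blast
    then show False using n[of "Suc n"] by simp
  qed
  moreover have "x [^] Suc n \<in> gen (x [^] Suc n)"
    using xc A_closed(2) by (auto simp: gen_def intro!: image_eqI[of _ _ \<one>])
  ultimately obtain a where a: "a \<in> A" "x [^] Suc n = a \<otimes> x [^] Suc (Suc n)"
    unfolding gen_def by blast
  have ac: "a \<in> carrier R" using a A_carrier by blast
  \<comment> \<open>Iteration absorbs any number of extra factors of \<open>x\<close>; the value
    \<open>k = Suc n\<close> produces the square.\<close>
  have "x [^] Suc n = x [^] Suc n \<otimes> x [^] k \<otimes> a [^] k" for k :: nat
  proof (induction k)
    case (Suc k)
    have "x [^] Suc n \<otimes> x [^] Suc k \<otimes> a [^] Suc k = (a \<otimes> x [^] Suc (Suc n)) \<otimes> x [^] k \<otimes> a [^] k"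
      using xc ac by (simp add: m_ac)
    also have "\<dots> = x [^] Suc n" using a(2) Suc by simp
    finally show ?case by simp
  qed (use xc in simp)
  from this[of "Suc n"] show ?thesis using A_pow[OF a(1)] by blast
qed

text \<open>By \<open>fitting\<close>, a power \<open>X\<close> of \<open>x\<close> makes
  \<open>X y e\<close> an idempotent below the primitive \<open>e\<close>. It is 0, and then
  \<open>x\<close> is nilpotent on \<open>e\<close>, or it is \<open>e\<close>, and then
  \<open>x\<close> is invertible there. So \<open>e A\<close> is a local ring.\<close>

lemma primitive_local:
  assumes e: "primitive_idempotent A e" and x: "x \<in> A"
  shows "(\<exists>n::nat. x [^] n \<otimes> e = \<zero>) \<or> (\<exists>y\<in>A. x \<otimes> y \<otimes> e = e)"
proof -
  obtain n y where y: "y \<in> A" "x [^] Suc n = x [^] Suc n \<otimes> x [^] Suc n \<otimes> y"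
    using fitting[OF x] by blast
  define X where "X = x [^] Suc n"
  have X: "X \<in> A" "X = X \<otimes> X \<otimes> y" using y A_pow[OF x, of "Suc n"] by (auto simp: X_def)
  have eA: "e \<in> A" "e \<otimes> e = e" using e by (auto simp: primitive_idempotent_def)
  have c: "X \<in> carrier R" "y \<in> carrier R" "e \<in> carrier R" "x \<in> carrier R"
    using X y eA x A_carrier by blast+
  define f where "f = X \<otimes> y \<otimes> e"
  have fA: "f \<in> A" using X y eA A_closed by (auto simp: f_def)
  have "f \<otimes> f = (X \<otimes> X \<otimes> y) \<otimes> y \<otimes> (e \<otimes> e)" using c by (simp add: f_def m_ac)
  also have "\<dots> = f" using X(2) eA(2) by (simp add: f_def)
  finally have "f \<otimes> f = f" .
  moreover have "f \<otimes> e = f" using c eA(2) by (simp add: f_def m_assoc)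
  ultimately have "f = \<zero> \<or> f = e" using e fA by (auto simp: primitive_idempotent_def)
  then show ?thesis
  proof
    assume "f = \<zero>"
    have "X \<otimes> e = (X \<otimes> X \<otimes> y) \<otimes> e" using X(2) by simp
    also have "\<dots> = X \<otimes> f" using c by (simp add: f_def m_ac)
    finally have "x [^] Suc n \<otimes> e = \<zero>" using \<open>f = \<zero>\<close> c unfolding X_def by simp
    then show ?thesis by blast
  next
    assume "f = e"
    then have "x \<otimes> (x [^] n \<otimes> y) \<otimes> e = e" using c by (simp add: f_def X_def m_ac)
    then show ?thesis using x y A_pow A_closed by blast
  qed
qed

text \<open>A nontrivial idempotent \<open>f\<close> below \<open>e\<close> splits it into
  \<open>f\<close> and \<open>e - f\<close>, each generating a strictly smaller ideal; this drives
  the induction. The last clause replaces the equation that the members of \<open>E\<close> add up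
  to \<open>e\<close>.\<close>

lemma primitive_decomposition:
  assumes "e \<in> A" "e \<otimes> e = e"
  shows "\<exists>E. finite E \<and> (\<forall>g\<in>E. primitive_idempotent A g \<and> g \<otimes> e = g) \<and>
    (\<forall>g\<in>E. \<forall>h\<in>E. g \<noteq> h \<longrightarrow> g \<otimes> h = \<zero>) \<and>
    (\<forall>r\<in>carrier R. (\<forall>g\<in>E. r \<otimes> g = \<zero>) \<longrightarrow> r \<otimes> e = \<zero>)"
  using assms
proof (induction "\<delta> (gen e)" arbitrary: e rule: less_induct)
  case less
  have ec: "e \<in> carrier R" using less.prems A_carrier by blast
  consider "e = \<zero>" | "primitive_idempotent A e"
    | f where "f \<in> A" "f \<otimes> f = f" "f \<otimes> e = f" "f \<noteq> \<zero>" "f \<noteq> e"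
    using less.prems unfolding primitive_idempotent_def by blast
  then show ?case
  proof cases
    case 1
    then show ?thesis by (intro exI[of _ "{}"]) auto
  next
    case 2
    then show ?thesis using less.prems by (intro exI[of _ "{e}"]) auto
  next
    case 3
    have fc: "f \<in> carrier R" using 3 A_carrier by blast
    define f' where "f' = e \<ominus> f"
    have f'c: "f' \<in> carrier R" using ec fc by (simp add: f'_def)
    have f'A: "f' \<in> A" using less.prems 3 A_closed by (simp add: f'_def a_minus_def)
    have ff': "f \<otimes> f' = \<zero>" using ec fc 3 by (simp add: f'_def a_minus_def r_distr r_minus r_neg)
    have ef: "e \<otimes> f = f" using 3 ec fc by (simp add: m_comm)
    have f'e: "f' \<otimes> e = f'" using ec fc 3 less.prems
      by (simp add: f'_def a_minus_def l_distr l_minus)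
    have f'f': "f' \<otimes> f' = f'"
    proof -
      have "f' \<otimes> f' = e \<otimes> f' \<ominus> f \<otimes> f'"
        using ec fc f'c by (subst (1) f'_def) (simp add: a_minus_def l_distr l_minus)
      then show ?thesis using ff' f'e ec f'c by (simp add: m_comm a_minus_def)
    qed
    have dec: "\<delta> (gen g) < \<delta> (gen e)" if g: "g \<in> A" "g \<otimes> g = g" "g \<otimes> e = g" "g \<noteq> e" for g
    proof -
      have gc: "g \<in> carrier R" using g A_carrier by blast
      have "gen g \<subseteq> gen e"
      proof
        fix z assume "z \<in> gen g"
        then obtain a where "a \<in> A" "z = a \<otimes> g" by (auto simp: gen_def)
        moreover from this have "z = (a \<otimes> g) \<otimes> e" using g gc ec A_carrier by (simp add: m_assoc)
        ultimately show "z \<in> gen e" using g A_closed unfolding gen_def by blast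
      qed
      moreover have "e \<notin> gen g"
      proof
        assume "e \<in> gen g"
        then obtain a where a: "a \<in> A" "e = a \<otimes> g" by (auto simp: gen_def)
        then have "e \<otimes> g = e" using g gc A_carrier by (simp add: m_assoc)
        then show False using g gc ec m_comm by auto
      qed
      moreover have "e \<in> gen e"
        using ec A_closed(2) by (auto simp: gen_def intro!: image_eqI[of _ _ \<one>])
      ultimately have "gen g \<subset> gen e" by blast
      then show ?thesis using \<delta>_mono gen_module g(1) less.prems(1) by blast
    qed
    have f'ne: "f' \<noteq> e"
    proof
      assume "f' = e"
      then have "f \<otimes> e = \<zero>" using ff' by simp
      then show False using 3 by simp
    qed
    obtain E1 where E1: "finite E1" "\<forall>g\<in>E1. primitive_idempotent A g \<and> g \<otimes> f = g"
      "\<forall>g\<in>E1. \<forall>h\<in>E1. g \<noteq> h \<longrightarrow> g \<otimes> h = \<zero>"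
      "\<forall>r\<in>carrier R. (\<forall>g\<in>E1. r \<otimes> g = \<zero>) \<longrightarrow> r \<otimes> f = \<zero>"
      using less.hyps[OF dec[OF 3(1-3,5)] 3(1,2)] by blast
    obtain E2 where E2: "finite E2" "\<forall>g\<in>E2. primitive_idempotent A g \<and> g \<otimes> f' = g"
      "\<forall>g\<in>E2. \<forall>h\<in>E2. g \<noteq> h \<longrightarrow> g \<otimes> h = \<zero>"
      "\<forall>r\<in>carrier R. (\<forall>g\<in>E2. r \<otimes> g = \<zero>) \<longrightarrow> r \<otimes> f' = \<zero>"
      using less.hyps[OF dec[OF f'A f'f' f'e f'ne] f'A f'f'] by blast
    have c12: "g \<in> carrier R" if "g \<in> E1 \<union> E2" for g
      using that E1(2) E2(2) A_carrier by (auto simp: primitive_idempotent_def)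
    have o12: "g \<otimes> h = \<zero>" if "g \<in> E1" "h \<in> E2" for g h
    proof -
      have "g \<otimes> h = (g \<otimes> f) \<otimes> (h \<otimes> f')" using E1(2) E2(2) that by auto
      also have "\<dots> = (g \<otimes> h) \<otimes> (f \<otimes> f')" using c12 that fc f'c by (simp add: m_ac)
      finally show ?thesis using ff' c12 that by simp
    qed
    have o21: "h \<otimes> g = \<zero>" if "g \<in> E1" "h \<in> E2" for g h
      using o12[OF that] c12 that m_comm by (metis UnCI)
    have sum: "r \<otimes> e = r \<otimes> f \<oplus> r \<otimes> f'" if "r \<in> carrier R" for r
    proof -
      have "f \<oplus> f' = e" using fc ec by (simp add: f'_def a_minus_def a_ac r_neg)
      then show ?thesis using that fc f'c by (metis r_distr)
    qed
    have "g \<otimes> e = g" if "g \<in> E1 \<union> E2" for g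
    proof -
      have "g \<otimes> f = g \<or> g \<otimes> f' = g" using that E1(2) E2(2) by blast
      moreover have "(g \<otimes> f) \<otimes> e = g \<otimes> f" "(g \<otimes> f') \<otimes> e = g \<otimes> f'"
        using c12[OF that] fc f'c ec 3 f'e by (simp_all add: m_assoc)
      ultimately show ?thesis by metis
    qed
    then show ?thesis
      using E1 E2 o12 o21 sum by (intro exI[of _ "E1 \<union> E2"]) auto
  qed
qed

text \<open>A nonzero multiple \<open>y r\<close> with largest annihilator in \<open>A\<close> is
  taken. If \<open>x\<close> did not kill it, no power of \<open>x\<close> would: the annihilator of
  each nonzero \<open>x^k y r\<close> cannot have grown, so it still misses \<open>x\<close>. Such a
  \<open>y r\<close> behaves like a socle element.\<close>

lemma multiple_killed_by_nilpotents:
  assumes r: "r \<in> carrier R" "r \<noteq> \<zero>"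
  shows "\<exists>y\<in>A. y \<otimes> r \<noteq> \<zero> \<and> (\<forall>x\<in>A. \<forall>n::nat. x [^] n \<otimes> (y \<otimes> r) = \<zero> \<longrightarrow> x \<otimes> (y \<otimes> r) = \<zero>)"
proof -
  let ?P = "\<lambda>y. y \<in> A \<and> y \<otimes> r \<noteq> \<zero>"
  have "?P \<one>" using r A_closed by simp
  moreover have "\<forall>y. ?P y \<longrightarrow> \<delta> (ann (y \<otimes> r)) < Suc (\<delta> A)"
    using \<delta>_le ann_module r A_carrier by (simp add: less_Suc_eq_le)
  ultimately have "\<exists>y. ?P y \<and> (\<forall>z. ?P z \<longrightarrow> \<delta> (ann (z \<otimes> r)) \<le> \<delta> (ann (y \<otimes> r)))"
    by (rule ex_has_greatest_nat[where f = "\<lambda>y. \<delta> (ann (y \<otimes> r))"])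
  then obtain y where y: "?P y" and max: "\<And>z. ?P z \<Longrightarrow> \<delta> (ann (z \<otimes> r)) \<le> \<delta> (ann (y \<otimes> r))"
    by auto
  have yc: "y \<in> carrier R" using y A_carrier by blast
  have "x \<otimes> (y \<otimes> r) = \<zero>" if x: "x \<in> A" and n: "x [^] n \<otimes> (y \<otimes> r) = \<zero>" for x and n :: nat
  proof (rule ccontr)
    assume ne: "x \<otimes> (y \<otimes> r) \<noteq> \<zero>"
    have xc: "x \<in> carrier R" using x A_carrier by blast
    have "x [^] k \<otimes> (y \<otimes> r) \<noteq> \<zero>" for k :: nat
    proof (induction k)
      case 0
      then show ?case using y yc r by simp
    next
      case (Suc k)
      let ?z = "x [^] k \<otimes> y"
      have zA: "?z \<in> A" using A_pow[OF x] y A_closed by blast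
      have zr: "?z \<otimes> r = x [^] k \<otimes> (y \<otimes> r)" using xc yc r by (simp add: m_assoc)
      have sub: "ann (y \<otimes> r) \<subseteq> ann (?z \<otimes> r)"
      proof
        fix a assume a: "a \<in> ann (y \<otimes> r)"
        then have ac: "a \<in> carrier R" "a \<in> A" using A_carrier by (auto simp: ann_def)
        have "a \<otimes> (?z \<otimes> r) = x [^] k \<otimes> (a \<otimes> (y \<otimes> r))" using xc yc r ac by (simp add: m_ac)
        then show "a \<in> ann (?z \<otimes> r)" using a ac xc by (simp add: ann_def)
      qed
      have "ann (?z \<otimes> r) = ann (y \<otimes> r)"
      proof (rule ccontr)
        assume "ann (?z \<otimes> r) \<noteq> ann (y \<otimes> r)"
        then have "\<delta> (ann (y \<otimes> r)) < \<delta> (ann (?z \<otimes> r))"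
          using sub \<delta>_mono ann_module zA yc r A_carrier by (metis m_closed psubsetI)
        then show False using max[of ?z] zA zr Suc by simp
      qed
      then have "x \<otimes> (?z \<otimes> r) \<noteq> \<zero>" using ne x by (auto simp: ann_def)
      then show ?case using xc yc r by (simp add: m_ac)
    qed
    then show False using n by blast
  qed
  then show ?thesis using y by blast
qed

end

section \<open>Commutative groups\<close>

context comm_group
begin

lemma subgroup_nat_pow: "subgroup H G \<Longrightarrow> x \<in> H \<Longrightarrow> x [^] (n::nat) \<in> H"
  by (induction n) (auto simp: subgroup.one_closed subgroup.m_closed)

text \<open>The preimage, for a subgroup \<open>K\<close>, of the torsion subgroup of the quotient
  by \<open>K\<close>.\<close>

definition torsion_closure :: "'a set \<Rightarrow> 'a set" where
  "torsion_closure K = {u \<in> carrier G. \<exists>n>0. u [^] (n::nat) \<in> K}"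

lemma torsion_closure_subgroup:
  assumes K: "subgroup K G" shows "subgroup (torsion_closure K) G"
proof (rule subgroupI)
  show "torsion_closure K \<subseteq> carrier G" by (auto simp: torsion_closure_def)
  show "torsion_closure K \<noteq> {}"
    using subgroup.one_closed[OF K] by (auto simp: torsion_closure_def intro!: exI[of _ \<one>] exI[of _ 1])
  show "inv a \<in> torsion_closure K" if "a \<in> torsion_closure K" for a
    using that subgroup.m_inv_closed[OF K] by (auto simp: torsion_closure_def nat_pow_inv)
  show "a \<otimes> b \<in> torsion_closure K" if ab: "a \<in> torsion_closure K" "b \<in> torsion_closure K" for a b
  proof -
    obtain n m :: nat where nm: "n > 0" "m > 0" "a [^] n \<in> K" "b [^] m \<in> K"
      using ab by (auto simp: torsion_closure_def)
    have c: "a \<in> carrier G" "b \<in> carrier G" using ab by (auto simp: torsion_closure_def)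
    have "(a \<otimes> b) [^] (n * m) = (a [^] n) [^] m \<otimes> (b [^] m) [^] n"
      using c by (simp add: nat_pow_distrib nat_pow_pow mult.commute)
    also have "\<dots> \<in> K" using nm subgroup_nat_pow[OF K] subgroup.m_closed[OF K] by blast
    finally show ?thesis using c nm by (auto simp: torsion_closure_def intro!: exI[of _ "n * m"])
  qed
qed

lemma torsion_closure_superset: "subgroup K G \<Longrightarrow> K \<subseteq> torsion_closure K"
  using subgroup.subset[of K G] by (auto simp: torsion_closure_def intro!: exI[of _ 1])

lemma torsion_closure_idem:
  assumes "u \<in> carrier G" "0 < n" "u [^] (n::nat) \<in> torsion_closure K"
  shows "u \<in> torsion_closure K"
proof -
  obtain m :: nat where m: "m > 0" "(u [^] n) [^] m \<in> K" using assms by (auto simp: torsion_closure_def)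
  then have "u [^] (n * m) \<in> K" using assms by (simp add: nat_pow_pow)
  then show ?thesis using assms m by (auto simp: torsion_closure_def intro!: exI[of _ "n * m"])
qed

text \<open>A torsion-free commutative group is orderable; \<open>N\<close> is the cone of nonnegative elements.\<close>

lemma torsion_free_quotient_orderable:
  assumes H: "subgroup H G" and tf: "\<And>u n. u \<in> carrier G \<Longrightarrow> 0 < n \<Longrightarrow> u [^] (n::nat) \<in> H \<Longrightarrow> u \<in> H"
  shows "\<exists>N. N \<subseteq> carrier G \<and> H \<subseteq> N \<and> (\<forall>x\<in>N. \<forall>y\<in>N. x \<otimes> y \<in> N) \<and>
     (\<forall>x\<in>N. inv x \<in> N \<longrightarrow> x \<in> H) \<and> (\<forall>x\<in>carrier G. x \<in> N \<or> inv x \<in> N)"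
proof -
  define cone where "cone N \<longleftrightarrow> N \<subseteq> carrier G \<and> H \<subseteq> N \<and> (\<forall>x\<in>N. \<forall>y\<in>N. x \<otimes> y \<in> N) \<and>
     (\<forall>x\<in>N. inv x \<in> N \<longrightarrow> x \<in> H)" for N
  note Hc = subgroup.subset[OF H] subgroup.one_closed[OF H] subgroup.m_closed[OF H]
    subgroup.m_inv_closed[OF H]
  \<comment> \<open>Zorn's lemma gives a maximal multiplicative set whose mutually inverse elements
    all come from \<open>H\<close>; totality will follow from maximality.\<close>
  have "\<exists>M\<in>Collect cone. \<forall>X\<in>Collect cone. M \<subseteq> X \<longrightarrow> X = M"
  proof (rule subset_Zorn_nonempty)
    have "cone H" unfolding cone_def using Hc by auto
    then show "Collect cone \<noteq> {}" by blast
    fix \<C> assume ne: "\<C> \<noteq> {}" and chain: "subset.chain (Collect cone) \<C>"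
    have c: "\<And>N. N \<in> \<C> \<Longrightarrow> cone N" using chain by (auto simp: subset.chain_def)
    have both: "\<exists>N\<in>\<C>. x \<in> N \<and> y \<in> N" if "x \<in> \<Union>\<C>" "y \<in> \<Union>\<C>" for x y
      using that chain unfolding subset.chain_def by blast
    have "cone (\<Union>\<C>)"
      unfolding cone_def
    proof (intro conjI ballI impI)
      show "\<Union>\<C> \<subseteq> carrier G" using c unfolding cone_def by blast
      show "H \<subseteq> \<Union>\<C>" using c ne unfolding cone_def by blast
      show "x \<otimes> y \<in> \<Union>\<C>" if "x \<in> \<Union>\<C>" "y \<in> \<Union>\<C>" for x y
        using both[OF that] c unfolding cone_def by blast
      show "x \<in> H" if "x \<in> \<Union>\<C>" "inv x \<in> \<Union>\<C>" for x
        using both[OF that] c unfolding cone_def by blast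
    qed
    then show "\<Union>\<C> \<in> Collect cone" by blast
  qed
  then obtain N where N: "cone N" and max: "\<And>X. cone X \<Longrightarrow> N \<subseteq> X \<Longrightarrow> X = N" by auto
  have Nc: "\<And>x. x \<in> N \<Longrightarrow> x \<in> carrier G" "H \<subseteq> N" "\<And>x y. x \<in> N \<Longrightarrow> y \<in> N \<Longrightarrow> x \<otimes> y \<in> N"
    "\<And>x. x \<in> N \<Longrightarrow> inv x \<in> N \<Longrightarrow> x \<in> H" using N by (auto simp: cone_def)
  have N1: "\<one> \<in> N" using Nc(2) Hc(2) by blast
  have Npow: "x [^] (n::nat) \<in> N" if "x \<in> N" for x n
    by (induction n) (use that N1 Nc(3) in auto)
  \<comment> \<open>Adjoining the powers of \<open>x\<close> to the maximal \<open>N\<close> must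
    violate antisymmetry. The violating \<open>z\<close> and its inverse multiply to 1, which
    exhibits a power of the inverse of \<open>x\<close> as an element of \<open>N\<close>.\<close>
  have neg: "\<exists>c>0. inv x [^] (c::nat) \<in> N" if x: "x \<in> carrier G" "x \<notin> N" for x
  proof -
    define N' where "N' = {n \<otimes> x [^] (k::nat) | n k. n \<in> N}"
    have sub: "N \<subseteq> N'"
    proof
      fix n assume "n \<in> N"
      then have "n = n \<otimes> x [^] (0::nat)" using Nc(1) by simp
      then show "n \<in> N'" using \<open>n \<in> N\<close> unfolding N'_def by blast
    qed
    have "x = \<one> \<otimes> x [^] (1::nat)" using x by simp
    then have "x \<in> N'" using N1 unfolding N'_def by blast
    then have "\<not> cone N'" using max[OF _ sub] x by blast
    moreover have "N' \<subseteq> carrier G" using Nc(1) x by (auto simp: N'_def)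
    moreover have "y \<otimes> z \<in> N'" if yz: "y \<in> N'" "z \<in> N'" for y z
    proof -
      obtain n m and k l :: nat where nm: "n \<in> N" "m \<in> N" "y = n \<otimes> x [^] k" "z = m \<otimes> x [^] l"
        using yz unfolding N'_def by blast
      then have "y \<otimes> z = (n \<otimes> m) \<otimes> x [^] (k + l)"
        using x Nc(1) by (simp add: nat_pow_mult[symmetric] m_ac)
      then show ?thesis using nm Nc(3) unfolding N'_def by blast
    qed
    ultimately obtain z where z: "z \<in> N'" "inv z \<in> N'" "z \<notin> H"
      using sub Nc(2) unfolding cone_def by blast
    obtain n m and a b :: nat where nm: "n \<in> N" "m \<in> N" "z = n \<otimes> x [^] a" "inv z = m \<otimes> x [^] b"
      using z unfolding N'_def by blast
    have c: "n \<in> carrier G" "m \<in> carrier G" "z \<in> carrier G" using nm Nc(1) x by auto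
    have "(n \<otimes> m) \<otimes> x [^] (a + b) = z \<otimes> inv z"
      unfolding nm(4) unfolding nm(3) using x c by (simp add: nat_pow_mult[symmetric] m_ac)
    then have "(n \<otimes> m) \<otimes> x [^] (a + b) = \<one>" using c by simp
    then have eq: "inv x [^] (a + b) = n \<otimes> m"
      using c x by (metis inv_equality m_closed nat_pow_closed nat_pow_inv)
    \<comment> \<open>With exponent 0 both \<open>z\<close> and its inverse would already lie in
      \<open>N\<close>, hence \<open>z\<close> in \<open>H\<close>.\<close>
    moreover have "a + b > 0"
    proof (rule ccontr)
      assume "\<not> ?thesis"
      then have "z = n" "inv z = m" using nm(3,4) c by auto
      then show False using z(3) nm Nc(4) by blast
    qed
    ultimately show ?thesis using nm Nc(3) by (metis)
  qed
  have "x \<in> N \<or> inv x \<in> N" if x: "x \<in> carrier G" for x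
  proof (rule ccontr)
    assume not: "\<not> ?thesis"
    obtain c :: nat where c: "c > 0" "inv x [^] c \<in> N" using neg[OF x] not by blast
    obtain d :: nat where d: "d > 0" "x [^] d \<in> N" using neg[of "inv x"] x not by auto
    have "(x [^] d) [^] c \<in> N" "(inv x [^] c) [^] d \<in> N" using Npow c d by blast+
    then have 1: "x [^] (d * c) \<in> N" "inv (x [^] (d * c)) \<in> N"
      using x by (simp_all add: nat_pow_pow nat_pow_inv mult.commute)
    \<comment> \<open>A power of \<open>x\<close> and its inverse both lie in \<open>N\<close>, so
      this power is in \<open>H\<close>; torsion-freeness modulo \<open>H\<close> then puts
      \<open>x\<close> itself into \<open>H\<close>.\<close>
    have "x \<in> H" using tf[OF x, of "d * c"] Nc(4)[OF 1] c d by simp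
    then show False using not Nc(2) by blast
  qed
  then show ?thesis using N unfolding cone_def by blast
qed

text \<open>This does the work of the structure theorem for finitely generated abelian groups. If no
  positive power of \<open>y\<close> lies in \<open>H\<close>, adjoining \<open>y\<close> creates no
  new torsion modulo \<open>K\<close>. Otherwise torsion elements are sorted by the exponent of
  \<open>y\<close> modulo some \<open>m\<close> with \<open>y^m\<close> in \<open>H\<close>, and the
  old representatives are shifted by one element for each residue.\<close>

lemma torsion_closure_finite_index_aux:
  assumes K: "subgroup K G" and "finite Y" "Y \<subseteq> carrier G"
  shows "\<exists>H. subgroup H G \<and> K \<subseteq> H \<and> Y \<subseteq> H \<and>
    (\<exists>X. finite X \<and> X \<subseteq> carrier G \<and> (\<forall>t\<in>H \<inter> torsion_closure K. \<exists>x\<in>X. \<exists>k\<in>K. t = x \<otimes> k))"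
  using assms(2,3)
proof (induction rule: finite_induct)
  case empty
  have "\<exists>x\<in>{\<one>}. \<exists>k\<in>K. t = x \<otimes> k" if "t \<in> K \<inter> torsion_closure K" for t
  proof -
    have "t = \<one> \<otimes> t" using that subgroup.mem_carrier[OF K] by simp
    then show ?thesis using that by blast
  qed
  moreover have "finite {\<one>}" "{\<one>} \<subseteq> carrier G" by auto
  ultimately show ?case using K by (intro exI[of _ K] conjI exI[of _ "{\<one>}"]) auto
next
  case (insert y Y)
  obtain H X where H: "subgroup H G" "K \<subseteq> H" "Y \<subseteq> H" and X: "finite X" "X \<subseteq> carrier G"
    "\<And>t. t \<in> H \<Longrightarrow> t \<in> torsion_closure K \<Longrightarrow> \<exists>x\<in>X. \<exists>k\<in>K. t = x \<otimes> k"
    using insert by auto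
  have y: "y \<in> carrier G" using insert by auto
  have Hc: "\<And>h. h \<in> H \<Longrightarrow> h \<in> carrier G" using subgroup.subset[OF H(1)] by blast
  have Kc: "\<And>h. h \<in> K \<Longrightarrow> h \<in> carrier G" using subgroup.subset[OF K(1)] by blast
  define H' where "H' = {h \<otimes> y [^] (k::int) | h k. h \<in> H}"
  have H': "subgroup H' G"
  proof (rule subgroupI)
    show "H' \<subseteq> carrier G" using Hc y by (auto simp: H'_def)
    show "H' \<noteq> {}" using subgroup.one_closed[OF H(1)] by (auto simp: H'_def)
    show "inv a \<in> H'" if a: "a \<in> H'" for a
    proof -
      obtain h and k :: int where hk: "h \<in> H" "a = h \<otimes> y [^] k" using a unfolding H'_def by blast
      then have "inv a = inv h \<otimes> y [^] (- k)" using Hc y by (simp add: inv_mult int_pow_neg)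
      then show ?thesis using hk subgroup.m_inv_closed[OF H(1)] unfolding H'_def by blast
    qed
    show "a \<otimes> b \<in> H'" if ab: "a \<in> H'" "b \<in> H'" for a b
    proof -
      obtain h h' and k k' :: int where hk: "h \<in> H" "a = h \<otimes> y [^] k" "h' \<in> H" "b = h' \<otimes> y [^] k'"
        using ab unfolding H'_def by blast
      then have "a \<otimes> b = (h \<otimes> h') \<otimes> y [^] (k + k')" using Hc y by (simp add: int_pow_mult m_ac)
      then show ?thesis using hk subgroup.m_closed[OF H(1)] unfolding H'_def by blast
    qed
  qed
  have HH': "H \<subseteq> H'"
  proof
    fix h assume h: "h \<in> H"
    then have "h = h \<otimes> y [^] (0::int)" using Hc by simp
    then show "h \<in> H'" using h unfolding H'_def by blast
  qed
  have "y = \<one> \<otimes> y [^] (1::int)" using y by simp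
  then have yH': "y \<in> H'" using subgroup.one_closed[OF H(1)] unfolding H'_def by blast
  have "\<exists>X'. finite X' \<and> X' \<subseteq> carrier G \<and> (\<forall>t\<in>H' \<inter> torsion_closure K. \<exists>x\<in>X'. \<exists>k\<in>K. t = x \<otimes> k)"
  proof (cases "\<exists>m>0. y [^] (m::nat) \<in> H")
    case False
    have "t \<in> H" if t: "t \<in> H'" "t \<in> torsion_closure K" for t
    proof -
      obtain h and k :: int where hk: "h \<in> H" "t = h \<otimes> y [^] k" using t unfolding H'_def by blast
      obtain n :: nat where n: "n > 0" "t [^] n \<in> H" using t H(2) by (auto simp: torsion_closure_def)
      have "t [^] n = h [^] n \<otimes> (y [^] k) [^] n" using hk Hc y by (simp add: nat_pow_distrib)
      also have "(y [^] k) [^] n = y [^] (k * int n)" using y by (simp add: int_pow_pow flip: int_pow_int)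
      finally have e: "t [^] n = h [^] n \<otimes> y [^] (k * int n)" .
      have hn: "h [^] n \<in> H" using subgroup_nat_pow[OF H(1)] hk by blast
      have "y [^] (k * int n) = inv (h [^] n) \<otimes> t [^] n" using e hk Hc y by (simp add: inv_solve_left)
      then have yH: "y [^] (k * int n) \<in> H"
        using n(2) hn subgroup.m_closed[OF H(1)] subgroup.m_inv_closed[OF H(1)] by simp
      have "k = 0"
      proof (rule ccontr)
        assume "k \<noteq> 0"
        then consider "k * int n > 0" | "k * int n < 0" using n(1) by (metis linorder_neqE mult_eq_0_iff of_nat_0_less_iff less_irrefl)
        then show False
        proof cases
          case 1
          then have "y [^] nat (k * int n) \<in> H" using yH by (simp add: pow_nat)
          then show False using False 1 by (metis zero_less_nat_eq)
        next
          case 2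
          have "inv (y [^] (k * int n)) \<in> H" using yH subgroup.m_inv_closed[OF H(1)] by blast
          then have "y [^] (- (k * int n)) \<in> H" using y by (simp add: int_pow_neg)
          then have "y [^] nat (- (k * int n)) \<in> H" using 2 by (simp add: pow_nat)
          then show False using False 2 by (metis neg_0_less_iff_less zero_less_nat_eq)
        qed
      qed
      then show ?thesis using hk Hc by simp
    qed
    then show ?thesis using X by (intro exI[of _ X]) auto
  next
    case True
    then obtain m :: nat where m: "m > 0" "y [^] m \<in> H" by blast
    define T where "T r = {t \<in> torsion_closure K. \<exists>h\<in>H. t = h \<otimes> y [^] r}" for r :: nat
    \<comment> \<open>One torsion element is chosen for each residue \<open>r\<close>. The value 1
      for an empty residue class is a placeholder that keeps \<open>t0 r\<close> in the
      carrier.\<close>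
    define t0 where "t0 r = (if T r = {} then \<one> else SOME t. t \<in> T r)" for r
    have t0: "t0 r \<in> T r" if "T r \<noteq> {}" for r
      unfolding t0_def using that by (auto intro: someI)
    have t0c: "t0 r \<in> carrier G" for r
      using t0[of r] by (cases "T r = {}") (auto simp: t0_def[of r] T_def torsion_closure_def)
    define X' where "X' = (\<lambda>(x, r). x \<otimes> t0 r) ` (X \<times> {..<m})"
    have "finite X'" using X by (auto simp: X'_def)
    moreover have "X' \<subseteq> carrier G" using X t0c by (auto simp: X'_def)
    moreover have "\<exists>x\<in>X'. \<exists>k\<in>K. t = x \<otimes> k" if t: "t \<in> H'" "t \<in> torsion_closure K" for t
    proof -
      obtain h and k :: int where hk: "h \<in> H" "t = h \<otimes> y [^] k" using t unfolding H'_def by blast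
      define r where "r = nat (k mod int m)"
      define q where "q = k div int m"
      have k: "k = int m * q + int r" and r: "r < m" using m(1)
        by (auto simp: r_def q_def nat_less_iff)
      have "y [^] k = (y [^] m) [^] q \<otimes> y [^] r"
        unfolding k using y by (simp add: int_pow_mult int_pow_pow flip: int_pow_int)
      then have t': "t = (h \<otimes> (y [^] m) [^] q) \<otimes> y [^] r" using hk Hc y by (simp add: m_assoc)
      have "(y [^] m) [^] q \<in> H"
        using subgroup_int_pow_closed[OF H(1) m(2)] .
      then have "h \<otimes> (y [^] m) [^] q \<in> H" using hk(1) subgroup.m_closed[OF H(1)] by blast
      then have "t \<in> T r" using t(2) t' unfolding T_def by blast
      then obtain h1 where h1: "h1 \<in> H" "t = h1 \<otimes> y [^] r" by (auto simp: T_def)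
      have "t0 r \<in> T r" using t0 \<open>t \<in> T r\<close> by blast
      then obtain h2 where h2: "h2 \<in> H" "t0 r = h2 \<otimes> y [^] r" "t0 r \<in> torsion_closure K"
        by (auto simp: T_def)
      have tc: "t \<in> carrier G" using t by (auto simp: torsion_closure_def)
      have "t \<otimes> inv (t0 r) = (h1 \<otimes> inv h2) \<otimes> (y [^] r \<otimes> inv (y [^] r))"
        unfolding h1(2) h2(2) using Hc h1 h2 y by (simp add: inv_mult m_ac del: r_inv)
      then have e: "t \<otimes> inv (t0 r) = h1 \<otimes> inv h2" using Hc h1 h2 y by simp
      then have "t \<otimes> inv (t0 r) \<in> H"
        using h1 h2 subgroup.m_closed[OF H(1)] subgroup.m_inv_closed[OF H(1)] by simp
      moreover have "t \<otimes> inv (t0 r) \<in> torsion_closure K"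
        using t h2 torsion_closure_subgroup[OF K] subgroup.m_closed subgroup.m_inv_closed by metis
      ultimately obtain x k where xk: "x \<in> X" "k \<in> K" "t \<otimes> inv (t0 r) = x \<otimes> k" using X(3) by blast
      have "t = (t \<otimes> inv (t0 r)) \<otimes> t0 r" using tc t0c by (simp add: m_assoc)
      then have "t = (x \<otimes> t0 r) \<otimes> k" using xk X(2) Kc t0c by (simp add: m_ac subset_eq)
      moreover have "x \<otimes> t0 r \<in> X'" using xk r by (auto simp: X'_def)
      ultimately show ?thesis using xk by blast
    qed
    ultimately show ?thesis by blast
  qed
  then show ?case using H' HH' H yH' by (intro exI[of _ H']) auto
qed

text \<open>Finiteness comes from the auxiliary lemma once \<open>H\<close> contains the generators.
  The representatives are made unique because a dual element is later built with one coefficient per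
  coset.\<close>

lemma torsion_closure_finite_index:
  assumes K: "subgroup K G" and Y: "finite Y" "Y \<subseteq> carrier G"
    and gen: "\<And>H. subgroup H G \<Longrightarrow> Y \<subseteq> H \<Longrightarrow> H = carrier G"
  shows "\<exists>X. finite X \<and> X \<subseteq> torsion_closure K \<and>
    (\<forall>t\<in>torsion_closure K. \<exists>!x. x \<in> X \<and> inv x \<otimes> t \<in> K)"
proof -
  obtain X where X: "finite X" "X \<subseteq> carrier G" "\<And>t. t \<in> torsion_closure K \<Longrightarrow> \<exists>x\<in>X. \<exists>k\<in>K. t = x \<otimes> k"
  proof -
    obtain H X where H: "subgroup H G" "Y \<subseteq> H" "finite X" "X \<subseteq> carrier G"
      "\<forall>t\<in>H \<inter> torsion_closure K. \<exists>x\<in>X. \<exists>k\<in>K. t = x \<otimes> k"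
      using torsion_closure_finite_index_aux[OF K Y] by blast
    then have "H = carrier G" using gen by blast
    then show ?thesis using H that[of X] by (auto simp: torsion_closure_def)
  qed
  note Kc = subgroup.subset[OF K, THEN subsetD]
  define cl where "cl t = {s \<in> torsion_closure K. inv t \<otimes> s \<in> K}" for t
  define rep where "rep t = (SOME s. s \<in> cl t)" for t
  have tc: "t \<in> carrier G" if "t \<in> torsion_closure K" for t using that by (auto simp: torsion_closure_def)
  have cl_self: "t \<in> cl t" if "t \<in> torsion_closure K" for t
    using that tc[OF that] subgroup.one_closed[OF K] by (auto simp: cl_def)
  have trans: "inv a \<otimes> c \<in> K" if "inv a \<otimes> b \<in> K" "inv b \<otimes> c \<in> K" "a \<in> carrier G" "b \<in> carrier G" "c \<in> carrier G" for a b c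
  proof -
    have "inv a \<otimes> c = (inv a \<otimes> b) \<otimes> (inv b \<otimes> c)"
      using that(3-5) by (simp add: m_assoc) (simp add: m_assoc[symmetric])
    then show ?thesis using that subgroup.m_closed[OF K] by metis
  qed
  have sym: "inv b \<otimes> a \<in> K" if "inv a \<otimes> b \<in> K" "a \<in> carrier G" "b \<in> carrier G" for a b
  proof -
    have "inv b \<otimes> a = inv (inv a \<otimes> b)" using that by (simp add: inv_mult m_comm)
    then show ?thesis using that subgroup.m_inv_closed[OF K] by metis
  qed
  have cl_eq: "cl s = cl t" if "s \<in> cl t" "t \<in> torsion_closure K" for s t
    using that trans sym tc unfolding cl_def by blast
  have rep: "rep t \<in> cl t" if "t \<in> torsion_closure K" for t
    unfolding rep_def using cl_self[OF that] by (rule someI)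
  define R where "R = rep ` torsion_closure K"
  \<comment> \<open>A representative depends on the coset alone, so it can be computed from an
    element of the finite set \<open>X\<close> in the same coset.\<close>
  have "R \<subseteq> (\<lambda>x. SOME s. s \<in> {s \<in> torsion_closure K. inv x \<otimes> s \<in> K}) ` X"
  proof
    fix r assume "r \<in> R"
    then obtain t where t: "t \<in> torsion_closure K" "r = rep t" by (auto simp: R_def)
    obtain x k where x: "x \<in> X" "k \<in> K" "t = x \<otimes> k" using X(3)[OF t(1)] by blast
    have xc: "x \<in> carrier G" using x X by blast
    have xt: "inv x \<otimes> t \<in> K" using x xc Kc by (simp add: m_assoc[symmetric])
    have "cl t = cl x"
      using trans[OF xt _ xc tc[OF t(1)]] trans[OF sym[OF xt xc tc[OF t(1)]] _ tc[OF t(1)] xc] tc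
      unfolding cl_def by blast
    then show "r \<in> (\<lambda>x. SOME s. s \<in> {s \<in> torsion_closure K. inv x \<otimes> s \<in> K}) ` X"
      using t x unfolding rep_def cl_def by auto
  qed
  then have fin: "finite R" using X(1) finite_subset by blast
  have Rt: "R \<subseteq> torsion_closure K" using rep by (auto simp: R_def cl_def)
  have uniq: "\<exists>!x. x \<in> R \<and> inv x \<otimes> t \<in> K" if t: "t \<in> torsion_closure K" for t
  proof (rule ex1I[of _ "rep t"])
    have "inv t \<otimes> rep t \<in> K" using rep[OF t] by (simp add: cl_def)
    then show "rep t \<in> R \<and> inv (rep t) \<otimes> t \<in> K"
      using t sym[of t "rep t"] tc Rt by (auto simp: R_def)
    fix x assume x: "x \<in> R \<and> inv x \<otimes> t \<in> K"
    then obtain s where s: "s \<in> torsion_closure K" "x = rep s" by (auto simp: R_def)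
    have "inv s \<otimes> x \<in> K" using rep[OF s(1)] s by (simp add: cl_def)
    then have "inv s \<otimes> t \<in> K" using trans[of s x t] x s t tc Rt by blast
    then have "cl t = cl s" using cl_eq[of t s] t s by (simp add: cl_def)
    then show "x = rep t" using s by (simp add: rep_def)
  qed
  show ?thesis using fin Rt uniq by (intro exI[of _ R] conjI ballI)
qed

end

section \<open>Linear algebra\<close>

context vector_space
begin

text \<open>The functional is the coordinate along \<open>x\<close> in a basis of the whole space
  that extends \<open>x\<close> together with a basis of \<open>V\<close>.\<close>

lemma separating_functional:
  assumes V: "subspace V" and x: "x \<notin> V"
  shows "\<exists>\<phi>. (\<forall>u v. \<phi> (u + v) = \<phi> u + \<phi> v) \<and> (\<forall>c v. \<phi> (c *s v) = c * \<phi> v) \<and>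
    (\<forall>v\<in>V. \<phi> v = 0) \<and> \<phi> x = 1"
proof -
  obtain B where B: "B \<subseteq> V" "independent B" "V \<subseteq> span B" using maximal_independent_subset by blast
  have "span B \<subseteq> V" using B(1) V by (rule span_minimal)
  then have xB: "x \<notin> span B" using x by blast
  have ind: "independent (insert x B)" using independent_insertI[OF xB B(2)] .
  define E where "E = extend_basis (insert x B)"
  have E: "independent E" "insert x B \<subseteq> E" "\<And>v. v \<in> span E"
    unfolding E_def using independent_extend_basis[OF ind] extend_basis_superset[OF ind] span_extend_basis[OF ind]
    by auto
  define \<phi> where "\<phi> v = representation E v x" for v
  have add: "\<phi> (u + v) = \<phi> u + \<phi> v" for u v
    unfolding \<phi>_def using representation_add[OF E(1) E(3) E(3)] by simp
  have scale: "\<phi> (c *s v) = c * \<phi> v" for c v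
    unfolding \<phi>_def using representation_scale[OF E(1) E(3)] by simp
  have "\<phi> b = 0" if "b \<in> B" for b
  proof -
    have "b \<noteq> x" using that xB span_base by blast
    then show ?thesis unfolding \<phi>_def using representation_basis[OF E(1), of b] E(2) that by auto
  qed
  moreover have "subspace {v. \<phi> v = 0}"
    unfolding subspace_def using add scale scale[of 0 0] by auto
  ultimately have "span B \<subseteq> {v. \<phi> v = 0}" by (intro span_minimal) auto
  then have "\<forall>v\<in>V. \<phi> v = 0" using B(3) by blast
  moreover have "\<phi> x = 1" unfolding \<phi>_def using representation_basis[OF E(1), of x] E(2) by simp
  ultimately show ?thesis using add scale by blast
qed

lemma dim_strict_mono:
  assumes U: "subspace U" and UW: "U \<subset> W" and W: "W \<subseteq> span C" "finite C"
  shows "dim U < dim W"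
proof -
  obtain B where B: "B \<subseteq> U" "independent B" "U \<subseteq> span B" "card B = dim U"
    using basis_exists by blast
  obtain x where x: "x \<in> W" "x \<notin> U" using UW by blast
  have "span B \<subseteq> U" using B(1) U by (rule span_minimal)
  then have xB: "x \<notin> span B" using x by blast
  have ind: "independent (insert x B)" using independent_insertI[OF xB B(2)] .
  obtain B' where B': "insert x B \<subseteq> B'" "B' \<subseteq> W" "independent B'" "W \<subseteq> span B'"
    using maximal_independent_subset_extend[OF _ ind, of W] B(1) x UW by blast
  have fin: "finite B'" using independent_span_bound[OF W(2) B'(3)] B'(2) W(1) by blast
  have "finite B" using finite_subset[OF _ fin, of B] B'(1) by simp
  moreover have "x \<notin> B" using xB span_base by blast
  ultimately have "card B < card (insert x B)" by simp
  also have "\<dots> \<le> card B'" using card_mono[OF fin B'(1)] .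
  also have "card B' = dim W" using basis_card_eq_dim[OF B'(2,4,3)] .
  finally show ?thesis using B(4) by simp
qed

end

definition psmult :: "'k::field \<Rightarrow> ('a \<Rightarrow>\<^sub>0 'k) \<Rightarrow> ('a \<Rightarrow>\<^sub>0 'k)" where
  "psmult c f = Poly_Mapping.map ((*) c) f"

lemma lookup_psmult [simp]: "Poly_Mapping.lookup (psmult c f) a = c * Poly_Mapping.lookup f a"
  by (simp add: psmult_def Poly_Mapping.map.rep_eq when_def)

lemma keys_psmult: "Poly_Mapping.keys (psmult c f) \<subseteq> Poly_Mapping.keys f"
  by (auto simp: in_keys_iff)

lemma psmult_single [simp]: "psmult c (Poly_Mapping.single a x) = Poly_Mapping.single a (c * x)"
  by (rule poly_mapping_eqI) (simp add: lookup_single when_def)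

lemma psmult_add: "psmult c (f + g) = psmult c f + psmult c g"
  by (rule poly_mapping_eqI) (simp add: lookup_add distrib_left)

lemma psmult_vector_space: "vector_space (psmult :: 'k::field \<Rightarrow> ('a \<Rightarrow>\<^sub>0 'k) \<Rightarrow> _)"
  by unfold_locales
    (auto intro!: poly_mapping_eqI simp: lookup_add distrib_left distrib_right mult.assoc)

interpretation pvs: vector_space "psmult :: 'k::field \<Rightarrow> ('a \<Rightarrow>\<^sub>0 'k) \<Rightarrow> _"
  by (rule psmult_vector_space)

lemma poly_mapping_in_span:
  assumes "Poly_Mapping.keys (f :: 'a \<Rightarrow>\<^sub>0 'k::field) \<subseteq> X"
  shows "f \<in> pvs.span (monomial ` X)"
  using assms
proof (induction rule: poly_mapping_keys_induct)
  case zero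
  show ?case by (rule pvs.span_zero)
next
  case (single a c)
  then have "psmult c (monomial a) \<in> pvs.span (monomial ` X)"
    by (intro pvs.span_scale pvs.span_base) blast
  then show ?case by simp
next
  case (add f g)
  then show ?case by (intro pvs.span_add)
qed

section \<open>Residue classes of monoid algebras\<close>

context comm_monoid
begin

lemma conv_scalar:
  assumes "Poly_Mapping.keys f \<subseteq> carrier G"
  shows "conv G (Poly_Mapping.single \<one> c) f = psmult c f"
  using assms
  by (induction rule: poly_mapping_keys_induct) (simp_all add: conv_add_right psmult_add)

lemma ideal_psmult:
  assumes "ideal I (monoid_algebra G)" "f \<in> I"
  shows "psmult c f \<in> I"
  using ideal_conv[OF assms keys_single_subset[OF one_closed], of c] conv_scalar[OF ideal_keys[OF assms], of c]
  by (simp only:)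

context
  fixes I :: "('a \<Rightarrow>\<^sub>0 'k::field) set"
  assumes I: "ideal I (monoid_algebra G)"
begin

abbreviation "resR \<equiv> monoid_algebra G Quot I"
abbreviation "res f \<equiv> I +>\<^bsub>monoid_algebra G\<^esub> f"

lemma res_ring: "cring resR"
  by (rule ideal.quotient_is_cring[OF I monoid_algebra_cring])

lemma res_hom: "(\<lambda>f. res f) \<in> ring_hom (monoid_algebra G) resR"
  by (rule ideal.rcos_ring_hom[OF I])

lemma res_closed: "Poly_Mapping.keys f \<subseteq> carrier G \<Longrightarrow> res f \<in> carrier resR"
  using ring_hom_closed[OF res_hom, of f] by simp

lemma res_cases:
  assumes "x \<in> carrier resR"
  obtains f where "Poly_Mapping.keys f \<subseteq> carrier G" "x = res f"
  using assms by (auto simp: FactRing_def A_RCOSETS_def')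

lemma res_mult:
  "Poly_Mapping.keys f \<subseteq> carrier G \<Longrightarrow> Poly_Mapping.keys g \<subseteq> carrier G \<Longrightarrow>
    res f \<otimes>\<^bsub>resR\<^esub> res g = res (conv G f g)"
  using ring_hom_mult[OF res_hom, of f g] by simp

lemma res_add:
  "Poly_Mapping.keys f \<subseteq> carrier G \<Longrightarrow> Poly_Mapping.keys g \<subseteq> carrier G \<Longrightarrow>
    res f \<oplus>\<^bsub>resR\<^esub> res g = res (f + g)"
  using ring_hom_add[OF res_hom, of f g] by simp

lemma res_one: "\<one>\<^bsub>resR\<^esub> = res (monomial \<one>)"
  using ring_hom_one[OF res_hom] by simp

lemma res_zero: "\<zero>\<^bsub>resR\<^esub> = res 0"
proof -
  interpret S: cring "monoid_algebra G :: ('a \<Rightarrow>\<^sub>0 'k::field) ring" by (rule monoid_algebra_cring)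
  interpret R: cring resR by (rule res_ring)
  show ?thesis using ring_hom_zero[OF res_hom S.ring_axioms R.ring_axioms] by simp
qed

lemma res_eq_zero_iff: "Poly_Mapping.keys f \<subseteq> carrier G \<Longrightarrow> res f = \<zero>\<^bsub>resR\<^esub> \<longleftrightarrow> f \<in> I"
  using coset_eq_iff[OF I, of f 0] by (simp add: res_zero)

lemma res_uminus:
  assumes "Poly_Mapping.keys f \<subseteq> carrier G"
  shows "\<ominus>\<^bsub>resR\<^esub> res f = res (- f)"
proof -
  interpret R: cring resR by (rule res_ring)
  show ?thesis
    using assms by (intro R.minus_equality) (simp_all add: res_add res_zero res_closed keys_uminus)
qed

end

end

section \<open>The functional of a witness\<close>

context comm_monoid
begin

text \<open>Multiplying \<open>f\<close> by \<open>t^a\<close> only replaces the test exponent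
  \<open>x\<close> by \<open>x \<otimes> a\<close>. Since the condition ranges over the whole
  carrier, the kernel absorbs monomials.\<close>

lemma functional_kernel_ideal:
  fixes \<psi> :: "'a \<Rightarrow> 'k::field"
  shows "ideal {f. Poly_Mapping.keys f \<subseteq> carrier G \<and>
    (\<forall>x\<in>carrier G. keysum (\<lambda>u c. c * \<psi> (x \<otimes> u)) f = 0)} (monoid_algebra G)"
proof (rule monoid_algebra_idealI)
  have add: "keysum (\<lambda>u c. c * \<psi> (x \<otimes> u)) (f + g) = keysum (\<lambda>u c. c * \<psi> (x \<otimes> u)) f + keysum (\<lambda>u c. c * \<psi> (x \<otimes> u)) g"
    for x and f g :: "'a \<Rightarrow>\<^sub>0 'k"
    by (rule keysum_add) (simp_all add: distrib_right)
  have conv: "keysum (\<lambda>u c. c * \<psi> (x \<otimes> u)) (conv G (Poly_Mapping.single a c) f)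
      = c * keysum (\<lambda>u c. c * \<psi> (x \<otimes> a \<otimes> u)) f"
    if "x \<in> carrier G" "a \<in> carrier G" "Poly_Mapping.keys f \<subseteq> carrier G" for x a c and f :: "'a \<Rightarrow>\<^sub>0 'k"
    using that(3)
    by (induction rule: poly_mapping_keys_induct)
      (use that(1,2) in \<open>simp_all add: conv_add_right add keysum_single m_assoc distrib_left\<close>)
  let ?Y = "{f. Poly_Mapping.keys f \<subseteq> carrier G \<and>
    (\<forall>x\<in>carrier G. keysum (\<lambda>u c. c * \<psi> (x \<otimes> u)) f = 0)}"
  show "conv G (Poly_Mapping.single a c) f \<in> ?Y" if "a \<in> carrier G" "f \<in> ?Y" for a c f
    using that conv conv_closed[of "Poly_Mapping.single a c" f] by auto
  show "f + g \<in> ?Y" if "f \<in> ?Y" "g \<in> ?Y" for f g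
    using that order_trans[OF keys_add[of f g]] by (auto simp: add)
qed auto

end

text \<open>
  For a binomial ideal \<open>I\<close> and a monomial \<open>w\<close> outside \<open>I\<close>, \<open>\<psi> u\<close> is the scalar \<open>c\<close> such that
  \<open>t\<^sup>u - c t\<^sup>w\<close> lies in \<open>I\<close>, provided a nonzero such \<open>c\<close> exists, and \<open>0\<close> otherwise. The kernel
  \<open>core\<close> of the pairing \<open>(x, f) \<mapsto> \<psi>(t\<^sup>x f)\<close> turns out to be the irreducible closure.
\<close>

locale witness_form = comm_monoid G for G (structure) +
  fixes I :: "('a \<Rightarrow>\<^sub>0 'k::field) set" and w :: 'a and \<psi> :: "'a \<Rightarrow> 'k"
  assumes I_ideal: "ideal I (monoid_algebra G)"
    and w_closed [simp]: "w \<in> carrier G"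
    and \<psi>_w [simp]: "\<psi> w = 1"
    and \<psi>_I: "f \<in> I \<Longrightarrow> keysum (\<lambda>u c. c * \<psi> u) f = 0"
    and \<psi>_binomial: "u \<in> carrier G \<Longrightarrow> \<psi> u \<noteq> 0 \<Longrightarrow> monomial u - Poly_Mapping.single w (\<psi> u) \<in> I"
begin

abbreviation "\<kappa> f \<equiv> keysum (\<lambda>u c. c * \<psi> u) f"
abbreviation "pr x f \<equiv> keysum (\<lambda>u c. c * \<psi> (x \<otimes> u)) f"

definition core :: "('a \<Rightarrow>\<^sub>0 'k) set" where
  "core = {f. Poly_Mapping.keys f \<subseteq> carrier G \<and> (\<forall>x\<in>carrier G. pr x f = 0)}"

lemma pr_add: "pr x (f + g) = pr x f + pr x g"
  by (rule keysum_add) (simp_all add: distrib_right)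

lemma pr_diff: "pr x (f - g) = pr x f - pr x g"
  using pr_add[of x "f - g" g] by simp

lemma pr_single [simp]: "pr x (Poly_Mapping.single u c) = c * \<psi> (x \<otimes> u)"
  by (rule keysum_single) simp

lemma \<kappa>_add: "\<kappa> (f + g) = \<kappa> f + \<kappa> g"
  by (rule keysum_add) (simp_all add: distrib_right)

lemma \<kappa>_diff: "\<kappa> (f - g) = \<kappa> f - \<kappa> g"
  using \<kappa>_add[of "f - g" g] by simp

lemma \<kappa>_single [simp]: "\<kappa> (Poly_Mapping.single u c) = c * \<psi> u"
  by (rule keysum_single) simp

lemma pr_sum: "pr x (\<Sum>i\<in>A. f i) = (\<Sum>i\<in>A. pr x (f i))"
  by (induction A rule: infinite_finite_induct) (simp_all add: pr_add)

lemma pr_conv: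
  assumes "x \<in> carrier G" "a \<in> carrier G" "Poly_Mapping.keys f \<subseteq> carrier G"
  shows "pr x (conv G (Poly_Mapping.single a c) f) = c * pr (x \<otimes> a) f"
  using assms(3)
  by (induction rule: poly_mapping_keys_induct)
    (use assms(1,2) in \<open>simp_all add: conv_add_right pr_add m_assoc distrib_left\<close>)

text \<open>Bilinearity reduces this to monomials. It justifies reading \<open>pr a f\<close> as the
  coefficient of \<open>t^w\<close> in \<open>t^a f\<close>.\<close>

lemma \<kappa>_conv:
  assumes "a \<in> carrier G" "Poly_Mapping.keys f \<subseteq> carrier G"
  shows "\<kappa> (conv G (Poly_Mapping.single a c) f) = c * pr a f"
  using assms(2)
  by (induction rule: poly_mapping_keys_induct)
    (use assms(1) in \<open>simp_all add: conv_add_right pr_add \<kappa>_add distrib_left\<close>)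

lemma pr_I: "f \<in> I \<Longrightarrow> x \<in> carrier G \<Longrightarrow> pr x f = 0"
  using \<psi>_I[OF ideal_conv[OF I_ideal, of f "monomial x"]] \<kappa>_conv[of x f 1] ideal_keys[OF I_ideal, of f]
  by simp

text \<open>Modulo \<open>I\<close> the monomial \<open>t^u\<close> is a scalar multiple of
  \<open>t^w\<close>, and this survives multiplication by \<open>t^x\<close>. Later evaluations of
  \<open>\<psi>\<close> reduce in this way to values on multiples of \<open>w\<close>.\<close>

lemma \<psi>_shift:
  assumes "x \<in> carrier G" "u \<in> carrier G" "\<psi> u \<noteq> 0"
  shows "\<psi> (x \<otimes> u) = \<psi> u * \<psi> (x \<otimes> w)"
  using pr_I[OF \<psi>_binomial[OF assms(2,3)] assms(1)] by (simp add: pr_diff)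

lemma core_ideal: "ideal core (monoid_algebra G)"
  unfolding core_def by (rule functional_kernel_ideal)

lemma w_notin_I: "monomial w \<notin> I"
  using \<psi>_I[of "monomial w"] by auto

text \<open>If \<open>\<psi> (v \<otimes> u)\<close> is nonzero for a unit \<open>v\<close>, then
  \<open>t^u\<close> is proportional modulo \<open>I\<close> to \<open>t^w\<close> divided by
  \<open>t^v\<close>; if there is no such \<open>v\<close>, no unit test sees \<open>u\<close>. So
  the part of \<open>f\<close> visible to units is a combination of unit multiples of
  \<open>t^w\<close>.\<close>

lemma unit_part:
  assumes "Poly_Mapping.keys f \<subseteq> carrier G"
  shows "\<exists>b. Poly_Mapping.keys b \<subseteq> Units G \<and> (\<forall>v\<in>Units G. pr v f = pr v (conv G b (monomial w)))"
  using assms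
proof (induction rule: poly_mapping_keys_induct)
  case (single u c)
  show ?case
  proof (cases "\<exists>v\<in>Units G. \<psi> (v \<otimes> u) \<noteq> 0")
    case True
    then obtain v where v: "v \<in> Units G" "\<psi> (v \<otimes> u) \<noteq> 0" by blast
    have "pr v' (Poly_Mapping.single u c) = pr v' (conv G (Poly_Mapping.single (inv v) (c * \<psi> (v \<otimes> u))) (monomial w))"
      if v': "v' \<in> Units G" for v'
    proof -
      have c: "v \<in> carrier G" "v' \<in> carrier G" "inv v \<in> carrier G" "u \<in> carrier G"
        using v v' single by auto
      then have "v' \<otimes> u = (v' \<otimes> inv v) \<otimes> (v \<otimes> u)"
        using Units_inv_cancel[OF v(1) c(4)] by (simp add: m_assoc)
      then have "\<psi> (v' \<otimes> u) = \<psi> (v \<otimes> u) * \<psi> (v' \<otimes> inv v \<otimes> w)"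
        using \<psi>_shift[of "v' \<otimes> inv v" "v \<otimes> u"] v c by simp
      then show ?thesis using c by (simp add: m_assoc)
    qed
    then show ?thesis using v
      by (intro exI[of _ "Poly_Mapping.single (inv v) (c * \<psi> (v \<otimes> u))"]) auto
  next
    case False
    then show ?thesis by (intro exI[of _ 0]) auto
  qed
next
  case (add f g)
  then obtain b b' where b: "Poly_Mapping.keys b \<subseteq> Units G" "\<forall>v\<in>Units G. pr v f = pr v (conv G b (monomial w))"
    "Poly_Mapping.keys b' \<subseteq> Units G" "\<forall>v\<in>Units G. pr v g = pr v (conv G b' (monomial w))"
    by blast
  then show ?case
    using order_trans[OF keys_add[of b b']]
    by (intro exI[of _ "b + b'"]) (auto simp: pr_add conv_add_left)
qed (auto intro: exI[of _ 0])

end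

lemma (in comm_monoid) Units_factor:
  assumes "a \<otimes> b \<in> Units G" "a \<in> carrier G" "b \<in> carrier G"
  shows "a \<in> Units G"
proof -
  let ?c = "b \<otimes> inv (a \<otimes> b)"
  have c: "?c \<in> carrier G" using assms by simp
  have 1: "a \<otimes> ?c = \<one>" using assms by (simp add: m_assoc[symmetric])
  then have "?c \<otimes> a = \<one>" using m_comm[OF assms(2) c] by simp
  then show ?thesis using 1 assms(2) c unfolding Units_def by blast
qed

lemma keys_diff_single_subset:
  "a \<in> C \<Longrightarrow> b \<in> C \<Longrightarrow>
    Poly_Mapping.keys (Poly_Mapping.single a c - Poly_Mapping.single b (d::'k::ab_group_add)) \<subseteq> C"
  by (rule order_trans[OF keys_minus]) auto

lemma restrict_support_sum_eq:
  assumes "Poly_Mapping.keys f \<subseteq> C" "Poly_Mapping.keys g \<inter> C = {}"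
  shows "restrict_support (f + g) C = f"
proof (rule poly_mapping_eqI)
  fix a
  show "Poly_Mapping.lookup (restrict_support (f + g) C) a = Poly_Mapping.lookup f a"
    using assms by (auto simp: lookup_restrict_support lookup_add in_keys_iff)
qed

section \<open>The torsion part of the unit group\<close>

text \<open>Besides \<open>t^w\<close> lying outside \<open>I\<close>, the assumption
  \<open>nonunit\<close> is all that is retained of an essential witness: no nonunit multiple of
  \<open>w\<close> is congruent to \<open>w\<close>. The other two assumptions come from finite
  generation of the monoid before localization.\<close>

locale socle_form = witness_form G I w \<psi>
  for G (structure) and I :: "('a \<Rightarrow>\<^sub>0 'k::field) set" and w :: 'a and \<psi> :: "'a \<Rightarrow> 'k" +
  assumes nonunit: "x \<in> carrier G \<Longrightarrow> x \<notin> Units G \<Longrightarrow> \<psi> (x \<otimes> w) = 0"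
    and dickson: "dickson_property G"
    and units_fg: "\<exists>Y. finite Y \<and> Y \<subseteq> Units G \<and> (\<forall>H. subgroup H (units_of G) \<and> Y \<subseteq> H \<longrightarrow> H = Units G)"
begin

abbreviation "R \<equiv> monoid_algebra G Quot core"
abbreviation "\<pi> f \<equiv> core +>\<^bsub>monoid_algebra G\<^esub> f"

text \<open>The stabilizer of the class of \<open>w\<close> in the unit group, since
  \<open>\<psi>\<close> is nonzero exactly on that class.\<close>

definition "K = {u \<in> Units G. \<psi> (u \<otimes> w) \<noteq> 0}"
definition "KT = comm_group.torsion_closure (units_of G) K"
text \<open>These cosets are the degrees of a grading of the group algebra of the units by a
  torsion-free group; \<open>A\<close> is the image in \<open>R\<close> of the part of degree
  zero.\<close>

definition "tcoset g = {u \<in> Units G. inv g \<otimes> u \<in> KT}"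
definition "A = \<pi> ` {f. Poly_Mapping.keys f \<subseteq> KT}"

lemma R_cring: "cring R"
  by (rule res_ring[OF core_ideal])

lemmas pi_closed = res_closed[OF core_ideal]
lemmas pi_cases = res_cases[OF core_ideal]
lemmas pi_mult = res_mult[OF core_ideal]
lemmas pi_add = res_add[OF core_ideal]
lemmas pi_one = res_one[OF core_ideal]
lemmas pi_eq_zero = res_eq_zero_iff[OF core_ideal]
lemmas pi_eq = coset_eq_iff[OF core_ideal]
lemmas pi_uminus = res_uminus[OF core_ideal]

lemma U_comm_group: "comm_group (units_of G)"
  by (rule units_comm_group)

lemma Units_subset: "Units G \<subseteq> carrier G"
  by (auto simp: Units_def)

lemma K_mult:
  assumes "u \<in> carrier G" "k \<in> K"
  shows "\<psi> (u \<otimes> (k \<otimes> w)) = \<psi> (k \<otimes> w) * \<psi> (u \<otimes> w)"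
  using \<psi>_shift[of u "k \<otimes> w"] assms by (auto simp: K_def)

lemma K_subgroup: "subgroup K (units_of G)"
proof -
  interpret U: comm_group "units_of G" by (rule U_comm_group)
  show ?thesis
  proof (rule U.subgroupI)
    show "K \<subseteq> carrier (units_of G)" by (auto simp: K_def units_of_carrier)
    have "\<one> \<in> K" by (simp add: K_def)
    then show "K \<noteq> {}" by blast
    fix k assume k: "k \<in> K"
    then have kU: "k \<in> Units G" "k \<in> carrier G" by (auto simp: K_def)
    have "inv k \<otimes> (k \<otimes> w) = w" using Units_inv_cancel kU by simp
    then have "\<psi> (k \<otimes> w) * \<psi> (inv k \<otimes> w) = 1" using K_mult[of "inv k" k] k kU by simp
    then show "inv\<^bsub>units_of G\<^esub> k \<in> K" using kU by (auto simp: K_def units_of_inv)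
    fix l assume l: "l \<in> K"
    then have lU: "l \<in> Units G" "l \<in> carrier G" by (auto simp: K_def)
    have "\<psi> (k \<otimes> (l \<otimes> w)) \<noteq> 0" using K_mult[of k l] k l kU by (auto simp: K_def)
    then show "k \<otimes>\<^bsub>units_of G\<^esub> l \<in> K" using kU lU by (simp add: K_def units_of_mult m_assoc)
  qed
qed

lemma KT_subgroup: "subgroup KT (units_of G)"
  unfolding KT_def by (rule comm_group.torsion_closure_subgroup[OF U_comm_group K_subgroup])

lemma KT_Units: "u \<in> KT \<Longrightarrow> u \<in> Units G"
  using subgroup.mem_carrier[OF KT_subgroup] by (simp add: units_of_carrier)

lemma KT_carrier: "u \<in> KT \<Longrightarrow> u \<in> carrier G"
  using KT_Units Units_subset by blast

lemma K_KT: "K \<subseteq> KT"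
  unfolding KT_def by (rule comm_group.torsion_closure_superset[OF U_comm_group K_subgroup])

lemma KT_one: "\<one> \<in> KT"
  using subgroup.one_closed[OF KT_subgroup] by (simp add: units_of_one)

lemma KT_mult: "u \<in> KT \<Longrightarrow> v \<in> KT \<Longrightarrow> u \<otimes> v \<in> KT"
  using subgroup.m_closed[OF KT_subgroup] by (simp add: units_of_mult)

lemma KT_inv: "u \<in> KT \<Longrightarrow> inv u \<in> KT"
  using subgroup.m_inv_closed[OF KT_subgroup] units_of_inv[OF KT_Units] by metis

lemma KT_cancel:
  assumes "u \<in> carrier G" "v \<in> KT" "u \<otimes> v \<in> KT"
  shows "u \<in> KT"
proof -
  have "u = (u \<otimes> v) \<otimes> inv v" using assms KT_Units[OF assms(2)] KT_carrier by (simp add: m_assoc)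
  then show ?thesis using KT_mult[OF assms(3) KT_inv[OF assms(2)]] by simp
qed

lemma Units_ratio:
  assumes "a \<in> Units G" "b \<in> Units G" "c \<in> Units G"
  shows "(inv a \<otimes> b) \<otimes> (inv b \<otimes> c) = inv a \<otimes> c" "inv (inv a \<otimes> b) = inv b \<otimes> a"
proof -
  have c: "a \<in> carrier G" "b \<in> carrier G" "c \<in> carrier G" "inv a \<in> carrier G" "inv b \<in> carrier G"
    using assms by auto
  have "b \<otimes> (inv b \<otimes> c) = c" using assms c by (simp add: m_assoc[symmetric])
  then show "(inv a \<otimes> b) \<otimes> (inv b \<otimes> c) = inv a \<otimes> c" using c by (simp add: m_assoc)
  have "(inv b \<otimes> a) \<otimes> (inv a \<otimes> b) = \<one>"
    using assms c by (simp add: m_assoc) (simp add: m_assoc[symmetric])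
  then show "inv (inv a \<otimes> b) = inv b \<otimes> a"
    using assms c by (metis inv_unique' m_closed m_comm)
qed

lemma tcoset_self: "g \<in> Units G \<Longrightarrow> g \<in> tcoset g"
  using KT_one by (simp add: tcoset_def)

lemma tcoset_eq:
  assumes "g \<in> Units G" "u \<in> tcoset g"
  shows "tcoset u = tcoset g"
proof -
  have u: "u \<in> Units G" "inv g \<otimes> u \<in> KT" using assms by (auto simp: tcoset_def)
  have u': "inv u \<otimes> g \<in> KT" using KT_inv[OF u(2)] Units_ratio(2)[OF assms(1) u(1) u(1)] by simp
  have "inv u \<otimes> x \<in> KT \<longleftrightarrow> inv g \<otimes> x \<in> KT" if x: "x \<in> Units G" for x
    using KT_mult[OF u(2), of "inv u \<otimes> x"] KT_mult[OF u', of "inv g \<otimes> x"]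
      Units_ratio(1)[OF assms(1) u(1) x] Units_ratio(1)[OF u(1) assms(1) x] by auto
  then show ?thesis unfolding tcoset_def by blast
qed

lemma tcoset_subset: "tcoset g \<subseteq> Units G"
  by (auto simp: tcoset_def)

lemma \<psi>_unit_shift:
  assumes "v \<in> Units G" "u \<in> Units G" "\<psi> (v \<otimes> w \<otimes> u) \<noteq> 0"
  shows "v \<otimes> u \<in> K"
proof -
  have "v \<otimes> w \<otimes> u = (v \<otimes> u) \<otimes> w" using assms Units_closed by (simp add: m_ac)
  then show ?thesis using assms by (simp add: K_def)
qed

lemma keys_Units: "Poly_Mapping.keys (f :: 'a \<Rightarrow>\<^sub>0 'k) \<subseteq> Units G \<Longrightarrow> Poly_Mapping.keys f \<subseteq> carrier G"
  using Units_subset by blast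

lemma keys_KT: "Poly_Mapping.keys (f :: 'a \<Rightarrow>\<^sub>0 'k) \<subseteq> KT \<Longrightarrow> Poly_Mapping.keys f \<subseteq> Units G"
  using KT_Units by blast

lemma keys_KT': "Poly_Mapping.keys (f :: 'a \<Rightarrow>\<^sub>0 'k) \<subseteq> KT \<Longrightarrow> Poly_Mapping.keys f \<subseteq> carrier G"
  using KT_carrier by blast

lemma conv_Units:
  "Poly_Mapping.keys (f :: 'a \<Rightarrow>\<^sub>0 'k) \<subseteq> Units G \<Longrightarrow> Poly_Mapping.keys g \<subseteq> Units G \<Longrightarrow> Poly_Mapping.keys (conv G f g) \<subseteq> Units G"
  by (rule keys_conv_subset) auto

lemma conv_KT:
  "Poly_Mapping.keys (f :: 'a \<Rightarrow>\<^sub>0 'k) \<subseteq> KT \<Longrightarrow> Poly_Mapping.keys g \<subseteq> KT \<Longrightarrow> Poly_Mapping.keys (conv G f g) \<subseteq> KT"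
  by (rule keys_conv_subset) (auto intro: KT_mult)

lemma pr_conv_w:
  assumes "v \<in> carrier G" "Poly_Mapping.keys f \<subseteq> carrier G"
  shows "pr v (conv G f (monomial w)) = pr (v \<otimes> w) f"
  using pr_conv[of v w f 1] conv_comm[OF assms(2), of "monomial w"] assms by simp

text \<open>If a test \<open>x\<close> sees some key \<open>u0\<close>, then by
  \<open>\<psi>_shift\<close> it acts on \<open>f\<close> as a multiple of the test by
  \<open>w\<close> divided by \<open>u0\<close>; if it sees no key, it is zero on \<open>f\<close>.
  So tests by unit multiples of \<open>w\<close> decide.\<close>

lemma core_unit_iff:
  assumes f: "Poly_Mapping.keys f \<subseteq> Units G"
  shows "f \<in> core \<longleftrightarrow> (\<forall>v\<in>Units G. pr (v \<otimes> w) f = 0)"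
proof
  assume "f \<in> core"
  then show "\<forall>v\<in>Units G. pr (v \<otimes> w) f = 0" by (auto simp: core_def)
next
  assume z: "\<forall>v\<in>Units G. pr (v \<otimes> w) f = 0"
  have "pr x f = 0" if x: "x \<in> carrier G" for x
  proof (cases "\<exists>u\<in>Poly_Mapping.keys f. \<psi> (x \<otimes> u) \<noteq> 0")
    case False
    then show ?thesis by (simp add: keysum_def)
  next
    case True
    then obtain u0 where u0: "u0 \<in> Poly_Mapping.keys f" "\<psi> (x \<otimes> u0) \<noteq> 0" by blast
    have u0U: "u0 \<in> Units G" "u0 \<in> carrier G" "inv u0 \<in> carrier G" using u0 f by auto
    have "\<psi> (x \<otimes> u) = \<psi> (x \<otimes> u0) * \<psi> (inv u0 \<otimes> w \<otimes> u)" if "u \<in> Poly_Mapping.keys f" for u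
    proof -
      have u: "u \<in> carrier G" using that f by auto
      have "(inv u0 \<otimes> u) \<otimes> (x \<otimes> u0) = (x \<otimes> u) \<otimes> (u0 \<otimes> inv u0)"
        using u u0U x by (simp add: m_ac del: Units_r_inv)
      then have "(inv u0 \<otimes> u) \<otimes> (x \<otimes> u0) = x \<otimes> u" using u x u0U by simp
      then have "\<psi> (x \<otimes> u) = \<psi> (x \<otimes> u0) * \<psi> (inv u0 \<otimes> u \<otimes> w)"
        using \<psi>_shift[of "inv u0 \<otimes> u" "x \<otimes> u0"] u u0U x u0 by simp
      moreover have "inv u0 \<otimes> u \<otimes> w = inv u0 \<otimes> w \<otimes> u" using u u0U by (simp add: m_ac)
      ultimately show ?thesis by simp
    qed
    then have "pr x f = \<psi> (x \<otimes> u0) * pr (inv u0 \<otimes> w) f"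
      unfolding keysum_def sum_distrib_left by (intro sum.cong) (simp_all add: mult_ac)
    then show ?thesis using z u0U by simp
  qed
  then show "f \<in> core" using f keys_Units by (simp add: core_def)
qed

text \<open>The unit tests of \<open>f t^w\<close> are the tests of \<open>f\<close> by unit
  multiples of \<open>w\<close>, and for \<open>f\<close> supported on units these decide membership
  in \<open>core\<close>.\<close>

lemma core_cancel_w:
  assumes "Poly_Mapping.keys f \<subseteq> Units G" "conv G f (monomial w) \<in> core"
  shows "f \<in> core"
  unfolding core_unit_iff[OF assms(1)]
  using assms(2) pr_conv_w[OF _ keys_Units[OF assms(1)]] by (auto simp: core_def)

text \<open>Shifting a test by \<open>k\<close> in \<open>K\<close> multiplies it by the constant
  \<open>\<psi> (k \<otimes> w)\<close>. Hence one monomial for each coset of \<open>K\<close>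
  suffices, which will bound the dimension of \<open>A\<close>.\<close>

lemma K_reduce:
  assumes "x \<in> Units G" "k \<in> K"
  shows "Poly_Mapping.single (x \<otimes> k) c - Poly_Mapping.single x (c * \<psi> (k \<otimes> w)) \<in> core"
proof -
  have kU: "k \<in> Units G" "k \<in> carrier G" "x \<in> carrier G" using assms by (auto simp: K_def)
  have "Poly_Mapping.keys (Poly_Mapping.single (x \<otimes> k) c - Poly_Mapping.single x (c * \<psi> (k \<otimes> w))) \<subseteq> Units G"
    using assms(1) kU(1) by (intro keys_diff_single_subset) auto
  moreover have "\<psi> (v \<otimes> w \<otimes> (x \<otimes> k)) = \<psi> (k \<otimes> w) * \<psi> (v \<otimes> w \<otimes> x)" if "v \<in> Units G" for v
  proof -
    have v: "v \<in> carrier G" using that by auto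
    have "v \<otimes> w \<otimes> (x \<otimes> k) = (v \<otimes> x) \<otimes> (k \<otimes> w)" "v \<otimes> w \<otimes> x = (v \<otimes> x) \<otimes> w"
      using v kU by (simp_all add: m_ac)
    then show ?thesis using K_mult[of "v \<otimes> x" k] v kU assms by simp
  qed
  ultimately show ?thesis by (simp add: core_unit_iff pr_diff)
qed

lemma pr_restrict:
  "pr x (restrict_support f C) = (\<Sum>u\<in>Poly_Mapping.keys f \<inter> C. Poly_Mapping.lookup f u * \<psi> (x \<otimes> u))"
  unfolding keysum_def keys_restrict_support
  by (intro sum.cong) (auto simp: lookup_restrict_support)

text \<open>A test by \<open>v \<otimes> w\<close> sees only units \<open>u\<close> with
  \<open>v \<otimes> u\<close> in \<open>K\<close>, and these lie in one coset of \<open>KT\<close>.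
  So each test either agrees on \<open>f\<close> and on its piece, or vanishes on the piece:
  \<open>core\<close> is homogeneous on the group algebra of the units.\<close>

lemma core_restrict:
  assumes f: "f \<in> core" "Poly_Mapping.keys f \<subseteq> Units G" and g: "g \<in> Units G"
  shows "restrict_support f (tcoset g) \<in> core"
proof -
  have "pr (v \<otimes> w) (restrict_support f (tcoset g)) = 0" if v: "v \<in> Units G" for v
  proof (cases "v \<otimes> g \<in> KT")
    case True
    have "\<psi> (v \<otimes> w \<otimes> u) = 0" if u: "u \<in> Poly_Mapping.keys f - tcoset g" for u
    proof (rule ccontr)
      assume ne: "\<psi> (v \<otimes> w \<otimes> u) \<noteq> 0"
      have uU: "u \<in> Units G" using u f by auto
      have c: "u \<in> carrier G" "v \<in> carrier G" "g \<in> carrier G" "inv g \<in> carrier G" using uU v g by auto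
      have "v \<otimes> u \<in> KT" using \<psi>_unit_shift[OF v uU ne] K_KT by blast
      moreover have "(inv g \<otimes> u) \<otimes> (v \<otimes> g) = v \<otimes> u"
      proof -
        have "(inv g \<otimes> u) \<otimes> (v \<otimes> g) = (v \<otimes> u) \<otimes> (g \<otimes> inv g)" using c by (simp add: m_ac)
        then show ?thesis using c g by simp
      qed
      ultimately have "inv g \<otimes> u \<in> KT" using KT_cancel[of "inv g \<otimes> u" "v \<otimes> g"] True c by simp
      then show False using u uU by (simp add: tcoset_def)
    qed
    then have "pr (v \<otimes> w) (restrict_support f (tcoset g)) = pr (v \<otimes> w) f"
      unfolding pr_restrict unfolding keysum_def
      by (intro sum.mono_neutral_left) auto
    also have "\<dots> = 0" using f core_unit_iff v by blast
    finally show ?thesis .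
  next
    case False
    have "\<psi> (v \<otimes> w \<otimes> u) = 0" if u: "u \<in> tcoset g" for u
    proof (rule ccontr)
      assume ne: "\<psi> (v \<otimes> w \<otimes> u) \<noteq> 0"
      have uU: "u \<in> Units G" "inv g \<otimes> u \<in> KT" using u by (auto simp: tcoset_def)
      have c: "u \<in> carrier G" "v \<in> carrier G" "g \<in> carrier G" "inv g \<in> carrier G" using uU v g by auto
      have "v \<otimes> u \<in> KT" using \<psi>_unit_shift[OF v uU(1) ne] K_KT by blast
      moreover have "(v \<otimes> g) \<otimes> (inv g \<otimes> u) = v \<otimes> u"
      proof -
        have "(v \<otimes> g) \<otimes> (inv g \<otimes> u) = (v \<otimes> u) \<otimes> (g \<otimes> inv g)" using c by (simp add: m_ac)
        then show ?thesis using c g by simp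
      qed
      ultimately show False using KT_cancel[of "v \<otimes> g" "inv g \<otimes> u"] False c uU by simp
    qed
    then show ?thesis by (simp add: pr_restrict)
  qed
  then show ?thesis
    using f by (subst core_unit_iff) (auto simp: keys_restrict_support)
qed

lemma A_subring: "subring A R"
proof -
  interpret R: cring R by (rule R_cring)
  show ?thesis
  proof (rule R.subringI)
    show "A \<subseteq> carrier R" using pi_closed keys_KT' by (auto simp: A_def)
    show "\<one>\<^bsub>R\<^esub> \<in> A" unfolding A_def pi_one using KT_one by (intro imageI) simp
    show "\<ominus>\<^bsub>R\<^esub> a \<in> A" if "a \<in> A" for a
    proof -
      obtain f where f: "Poly_Mapping.keys f \<subseteq> KT" "a = \<pi> f" using \<open>a \<in> A\<close> by (auto simp: A_def)
      then have "\<ominus>\<^bsub>R\<^esub> a = \<pi> (- f)" using pi_uminus[OF keys_KT'[OF f(1)]] by (simp only:)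
      then show ?thesis using f by (auto simp: A_def keys_uminus)
    qed
    show "a \<otimes>\<^bsub>R\<^esub> b \<in> A" if "a \<in> A" "b \<in> A" for a b
    proof -
      obtain f g where f: "Poly_Mapping.keys f \<subseteq> KT" "a = \<pi> f" "Poly_Mapping.keys g \<subseteq> KT" "b = \<pi> g"
        using \<open>a \<in> A\<close> \<open>b \<in> A\<close> by (auto simp: A_def)
      then have "a \<otimes>\<^bsub>R\<^esub> b = \<pi> (conv G f g)" using pi_mult keys_KT' by simp
      then show ?thesis using conv_KT[OF f(1,3)] by (auto simp: A_def)
    qed
    show "a \<oplus>\<^bsub>R\<^esub> b \<in> A" if "a \<in> A" "b \<in> A" for a b
    proof -
      obtain f g where f: "Poly_Mapping.keys f \<subseteq> KT" "a = \<pi> f" "Poly_Mapping.keys g \<subseteq> KT" "b = \<pi> g"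
        using \<open>a \<in> A\<close> \<open>b \<in> A\<close> by (auto simp: A_def)
      then have "a \<oplus>\<^bsub>R\<^esub> b = \<pi> (f + g)" using pi_add keys_KT' by simp
      then show ?thesis using order_trans[OF keys_add Un_least[OF f(1,3)]] by (auto simp: A_def)
    qed
  qed
qed

section \<open>Finite dimension of the torsion part\<close>

lemma KT_reps:
  "\<exists>X. finite X \<and> X \<subseteq> KT \<and> (\<forall>t\<in>KT. \<exists>!x. x \<in> X \<and> inv x \<otimes> t \<in> K)"
proof -
  interpret U: comm_group "units_of G" by (rule U_comm_group)
  obtain Y where Y: "finite Y" "Y \<subseteq> Units G" "\<And>H. subgroup H (units_of G) \<and> Y \<subseteq> H \<longrightarrow> H = Units G"
    using units_fg by blast
  have "\<exists>X. finite X \<and> X \<subseteq> KT \<and>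
      (\<forall>t\<in>KT. \<exists>!x. x \<in> X \<and> inv\<^bsub>units_of G\<^esub> x \<otimes>\<^bsub>units_of G\<^esub> t \<in> K)"
    unfolding KT_def
    by (rule U.torsion_closure_finite_index[OF K_subgroup Y(1)]) (use Y in \<open>auto simp: units_of_carrier\<close>)
  then obtain X where X: "finite X \<and> X \<subseteq> KT \<and>
      (\<forall>t\<in>KT. \<exists>!x. x \<in> X \<and> inv\<^bsub>units_of G\<^esub> x \<otimes>\<^bsub>units_of G\<^esub> t \<in> K)"
    by (rule exE)
  have e: "x \<in> X \<and> inv\<^bsub>units_of G\<^esub> x \<otimes>\<^bsub>units_of G\<^esub> t \<in> K \<longleftrightarrow> x \<in> X \<and> inv x \<otimes> t \<in> K" for x t
    using X KT_Units by (metis subsetD units_of_inv units_of_mult)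
  show ?thesis using X unfolding e by (rule exI)
qed

definition "reps = (SOME X. finite X \<and> X \<subseteq> KT \<and> (\<forall>t\<in>KT. \<exists>!x. x \<in> X \<and> inv x \<otimes> t \<in> K))"

lemma reps: "finite reps" "reps \<subseteq> KT" "\<And>t. t \<in> KT \<Longrightarrow> \<exists>!x. x \<in> reps \<and> inv x \<otimes> t \<in> K"
proof -
  have "finite reps \<and> reps \<subseteq> KT \<and> (\<forall>t\<in>KT. \<exists>!x. x \<in> reps \<and> inv x \<otimes> t \<in> K)"
    unfolding reps_def by (rule someI_ex[OF KT_reps])
  then show "finite reps" "reps \<subseteq> KT" "\<And>t. t \<in> KT \<Longrightarrow> \<exists>!x. x \<in> reps \<and> inv x \<otimes> t \<in> K"
    by simp_all
qed

lemma reps_cases: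
  assumes "t \<in> KT"
  obtains x where "x \<in> reps" "x \<in> Units G" "inv x \<otimes> t \<in> K" "t = x \<otimes> (inv x \<otimes> t)"
proof -
  obtain x where x: "x \<in> reps" "inv x \<otimes> t \<in> K" using reps(3)[OF assms] by blast
  have xU: "x \<in> Units G" using x reps(2) KT_Units by blast
  then have "t = x \<otimes> (inv x \<otimes> t)"
    using KT_carrier[OF assms] Units_closed[OF xU] by (simp add: m_assoc[symmetric])
  then show ?thesis using x xU by (intro that[of x])
qed

lemma A_reps:
  assumes "Poly_Mapping.keys f \<subseteq> KT"
  shows "\<exists>f'. Poly_Mapping.keys f' \<subseteq> reps \<and> f - f' \<in> core"
  using assms
proof (induction rule: poly_mapping_keys_induct)
  case zero
  then show ?case using ideal_zero[OF core_ideal] by (intro exI[of _ 0]) simp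
next
  case (single t c)
  obtain x where x: "x \<in> reps" "x \<in> Units G" "inv x \<otimes> t \<in> K" "t = x \<otimes> (inv x \<otimes> t)"
    using reps_cases[OF single] .
  have "Poly_Mapping.single t c - Poly_Mapping.single x (c * \<psi> (inv x \<otimes> t \<otimes> w)) \<in> core"
    using K_reduce[OF x(2,3), of c] x(4) by simp
  then show ?case using x(1) by (intro exI[of _ "Poly_Mapping.single x (c * \<psi> (inv x \<otimes> t \<otimes> w))"]) simp
next
  case (add f g)
  then obtain f' g' where "Poly_Mapping.keys f' \<subseteq> reps" "f - f' \<in> core"
    "Poly_Mapping.keys g' \<subseteq> reps" "g - g' \<in> core" by blast
  then show ?case
    using ideal_add[OF core_ideal, of "f - f'" "g - g'"] order_trans[OF keys_add[of f' g']]
    by (intro exI[of _ "f' + g'"]) (auto simp: algebra_simps)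
qed

interpretation pvs: vector_space "psmult :: 'k \<Rightarrow> ('a \<Rightarrow>\<^sub>0 'k) \<Rightarrow> _"
  by (rule psmult_vector_space)

text \<open>The residue ring record carries no scalar multiplication, so dimensions are taken of
  preimages among polynomial mappings with support in \<open>X\<close>.\<close>

definition "hat X U = {f. Poly_Mapping.keys f \<subseteq> X \<and> \<pi> f \<in> U}"

lemma hat_subspace:
  assumes X: "X \<subseteq> KT" and U: "cring.subring_module R A U"
  shows "pvs.subspace (hat X U)"
proof -
  interpret R: cring R by (rule R_cring)
  have U': "\<pi> 0 \<in> U" "\<And>x y. x \<in> U \<Longrightarrow> y \<in> U \<Longrightarrow> x \<oplus>\<^bsub>R\<^esub> y \<in> U" "\<And>a x. a \<in> A \<Longrightarrow> x \<in> U \<Longrightarrow> a \<otimes>\<^bsub>R\<^esub> x \<in> U"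
    using U by (auto simp: R.subring_module_def res_zero[OF core_ideal])
  have Xc: "X \<subseteq> carrier G" using X KT_carrier by blast
  show ?thesis
  proof (rule pvs.subspaceI)
    show "0 \<in> hat X U" using U'(1) by (simp add: hat_def)
    show "f + g \<in> hat X U" if "f \<in> hat X U" "g \<in> hat X U" for f g
      using that U'(2)[of "\<pi> f" "\<pi> g"] pi_add[of f g] Xc order_trans[OF keys_add[of f g]]
      by (auto simp: hat_def)
    show "psmult c f \<in> hat X U" if f: "f \<in> hat X U" for c f
    proof -
      have "\<pi> (Poly_Mapping.single \<one> c) \<in> A" using KT_one by (auto simp: A_def)
      then have "\<pi> (Poly_Mapping.single \<one> c) \<otimes>\<^bsub>R\<^esub> \<pi> f \<in> U" using U'(3) f by (auto simp: hat_def)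
      moreover have "Poly_Mapping.keys f \<subseteq> carrier G" using f Xc by (auto simp: hat_def)
      ultimately have "\<pi> (psmult c f) \<in> U" using pi_mult[of "Poly_Mapping.single \<one> c" f] conv_scalar[of f c] by simp
      then show ?thesis using f keys_psmult[of c f] by (auto simp: hat_def)
    qed
  qed
qed

definition "\<delta> U = pvs.dim (hat reps U)"

text \<open>Every element of \<open>A\<close> has a preimage supported on the finite set
  \<open>reps\<close>, so a strict inclusion of ideals gives a strict inclusion of preimages inside
  a finite-dimensional space.\<close>

lemma A_artinian: "artinian_subring R A \<delta>"
proof -
  interpret R: cring R by (rule R_cring)
  show ?thesis
  proof (intro artinian_subring.intro artinian_subring_axioms.intro)
    show "cring R" by (rule R_cring)
    show "subring A R" by (rule A_subring)
    fix U V assume U: "R.subring_module A U" and V: "R.subring_module A V" and UV: "U \<subset> V"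
    obtain r where r: "r \<in> V" "r \<notin> U" using UV by blast
    have "r \<in> A" using r V by (auto simp: R.subring_module_def)
    then obtain f0 where "Poly_Mapping.keys f0 \<subseteq> KT" "r = \<pi> f0" by (auto simp: A_def)
    then obtain f where f: "Poly_Mapping.keys f \<subseteq> reps" "r = \<pi> f"
      using A_reps[of f0] pi_eq keys_KT' reps(2) by (metis order_trans)
    then have "f \<in> hat reps V" "f \<notin> hat reps U" using r by (auto simp: hat_def)
    moreover have "hat reps U \<subseteq> hat reps V" using UV by (auto simp: hat_def)
    ultimately have "hat reps U \<subset> hat reps V" by blast
    moreover have "hat reps V \<subseteq> pvs.span (monomial ` reps)"
      using poly_mapping_in_span by (auto simp: hat_def)
    ultimately show "\<delta> U < \<delta> V"
      unfolding \<delta>_def using pvs.dim_strict_mono[OF hat_subspace[OF reps(2) U]] reps(1) by blast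
  qed
qed

text \<open>
  The functional \<open>\<psi>\<close> makes \<open>A\<close> a Frobenius algebra: every functional \<open>\<phi>\<close> on \<open>A\<close> is of the form
  \<open>f \<mapsto> \<psi>(t\<^sup>w z f)\<close>. A functional separating \<open>t\<close> from the ideal generated by \<open>s\<close> thus gives
  \<open>z\<close> with \<open>z s = 0\<close> and \<open>z t \<noteq> 0\<close>.
\<close>

lemma double_annihilator:
  assumes s: "s \<in> A" and t: "t \<in> A"
    and ann: "\<And>x. x \<in> A \<Longrightarrow> x \<otimes>\<^bsub>R\<^esub> s = \<zero>\<^bsub>R\<^esub> \<Longrightarrow> x \<otimes>\<^bsub>R\<^esub> t = \<zero>\<^bsub>R\<^esub>"
  shows "\<exists>a\<in>A. t = a \<otimes>\<^bsub>R\<^esub> s"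
proof (rule ccontr)
  assume not: "\<not> ?thesis"
  interpret R: cring R by (rule R_cring)
  interpret Art: artinian_subring R A \<delta> by (rule A_artinian)
  obtain fs where fs: "Poly_Mapping.keys fs \<subseteq> KT" "s = \<pi> fs" using s by (auto simp: A_def)
  obtain ft where ft: "Poly_Mapping.keys ft \<subseteq> KT" "t = \<pi> ft" using t by (auto simp: A_def)
  define V where "V = hat KT (Art.gen s)"
  have V: "pvs.subspace V"
    unfolding V_def by (rule hat_subspace[OF subset_refl Art.gen_module[OF s]])
  have "ft \<notin> V" using not ft by (auto simp: V_def hat_def Art.gen_def)
  then obtain \<phi> where \<phi>: "\<And>u v. \<phi> (u + v) = \<phi> u + \<phi> v" "\<And>c v. \<phi> (psmult c v) = c * \<phi> v"
    "\<And>v. v \<in> V \<Longrightarrow> \<phi> v = 0" "\<phi> ft = 1"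
    using pvs.separating_functional[OF V] by blast
  have \<phi>_single: "\<phi> (Poly_Mapping.single x c) = c * \<phi> (monomial x)" for x c
    using \<phi>(2)[of c "monomial x"] by simp
  have \<phi>_diff: "\<phi> (u - v) = \<phi> u - \<phi> v" for u v
    using \<phi>(1)[of "u - v" v] by simp
  \<comment> \<open>The dual element: its coefficient at the inverse of \<open>x\<close> is the
    value of \<open>\<phi>\<close> at \<open>t^x\<close>, so that testing \<open>z f\<close> with
    \<open>w\<close> returns \<open>\<phi> f\<close>.\<close>
  define z where "z = (\<Sum>x\<in>reps. Poly_Mapping.single (inv x) (\<phi> (monomial x)))"
  have rU: "x \<in> Units G" if "x \<in> reps" for x using reps(2) that KT_Units by blast
  have z: "Poly_Mapping.keys z \<subseteq> KT"
  proof -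
    have "Poly_Mapping.keys z \<subseteq> (\<Union>x\<in>reps. Poly_Mapping.keys (Poly_Mapping.single (inv x) (\<phi> (monomial x))))"
      unfolding z_def by (rule keys_sum)
    then show ?thesis using reps(2) KT_inv by (auto split: if_splits)
  qed
  \<comment> \<open>Elements of \<open>core\<close> represent 0 and hence lie in \<open>V\<close>,
    where \<open>\<phi>\<close> vanishes. This lets \<open>\<phi>\<close> be computed on coset
    representatives.\<close>
  have core_V: "f \<in> V" if "f \<in> core" "Poly_Mapping.keys f \<subseteq> KT" for f
  proof -
    have "\<pi> f = \<zero>\<^bsub>R\<^esub>" using that pi_eq_zero keys_KT' by blast
    moreover have "\<zero>\<^bsub>R\<^esub> \<in> Art.gen s" using Art.gen_module[OF s] by (simp add: R.subring_module_def)
    ultimately show ?thesis using that by (simp add: V_def hat_def)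
  qed
  have rep: "pr w (conv G z f) = \<phi> f" if "Poly_Mapping.keys f \<subseteq> KT" for f
    using that
  proof (induction rule: poly_mapping_keys_induct)
    case zero
    then show ?case using \<phi>(2)[of 0 0] by simp
  next
    case (single t c)
    obtain x0 where x0: "x0 \<in> reps" "x0 \<in> Units G" "inv x0 \<otimes> t \<in> K" "t = x0 \<otimes> (inv x0 \<otimes> t)"
      using reps_cases[OF single] .
    have tU: "t \<in> Units G" "t \<in> carrier G" using single KT_Units KT_carrier by auto
    have "pr w (conv G z (Poly_Mapping.single t c)) = (\<Sum>x\<in>reps. \<phi> (monomial x) * c * \<psi> (w \<otimes> (inv x \<otimes> t)))"
      by (simp add: z_def conv_sum_left pr_sum)
    \<comment> \<open>The factor \<open>\<psi>\<close> vanishes unless \<open>x\<close> represents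
      the coset of \<open>t\<close>, and only one representative does.\<close>
    also have "\<dots> = (\<Sum>x\<in>{x0}. \<phi> (monomial x) * c * \<psi> (w \<otimes> (inv x \<otimes> t)))"
    proof (rule sum.mono_neutral_right[OF reps(1)])
      show "{x0} \<subseteq> reps" using x0 by simp
      show "\<forall>x\<in>reps - {x0}. \<phi> (monomial x) * c * \<psi> (w \<otimes> (inv x \<otimes> t)) = 0"
      proof
        fix x assume x: "x \<in> reps - {x0}"
        then have "inv x \<otimes> t \<notin> K" using reps(3)[OF single] x0 by blast
        then have "\<psi> (inv x \<otimes> t \<otimes> w) = 0" using x rU tU by (auto simp: K_def)
        then show "\<phi> (monomial x) * c * \<psi> (w \<otimes> (inv x \<otimes> t)) = 0"
          using m_comm[of w "inv x \<otimes> t"] x rU tU by auto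
      qed
    qed
    also have "\<dots> = \<phi> (monomial x0) * c * \<psi> (inv x0 \<otimes> t \<otimes> w)"
      using m_comm[of w "inv x0 \<otimes> t"] x0 tU by simp
    also have "\<dots> = \<phi> (Poly_Mapping.single t c)"
    proof -
      let ?d = "Poly_Mapping.single t c - Poly_Mapping.single x0 (c * \<psi> (inv x0 \<otimes> t \<otimes> w))"
      have "?d \<in> core" using K_reduce[OF x0(2,3), of c] x0(4) by simp
      moreover have "Poly_Mapping.keys ?d \<subseteq> KT"
        using single x0(1) reps(2) by (intro keys_diff_single_subset) auto
      ultimately have "\<phi> ?d = 0" using core_V \<phi>(3) by blast
      then show ?thesis
        using \<phi>_single[of x0 "c * \<psi> (inv x0 \<otimes> t \<otimes> w)"] by (simp add: \<phi>_diff mult_ac)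
    qed
    finally show ?case .
  qed (simp add: conv_add_right pr_add \<phi>)
  \<comment> \<open>Tests by \<open>v\<close> in \<open>KT\<close> return \<open>\<phi>\<close> of
    \<open>t^v\<close> times \<open>fs\<close>, whose residue lies in the ideal generated by
    \<open>s\<close>. Tests by other units see nothing supported on \<open>KT\<close>.\<close>
  have "conv G z fs \<in> core"
    unfolding core_unit_iff[OF keys_KT[OF conv_KT[OF z fs(1)]]]
  proof
    fix v assume v: "v \<in> Units G"
    show "pr (v \<otimes> w) (conv G z fs) = 0"
    proof (cases "v \<in> KT")
      case True
      have vc: "v \<in> carrier G" using v by auto
      let ?v = "monomial v :: 'a \<Rightarrow>\<^sub>0 'k"
      have vf: "Poly_Mapping.keys ?v \<subseteq> KT" using True by simp
      have "conv G ?v (conv G z fs) = conv G z (conv G ?v fs)"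
        using conv_assoc[of ?v z fs] conv_assoc[of z ?v fs] conv_comm[of ?v z] keys_KT' vf z fs(1) by metis
      then have "pr (w \<otimes> v) (conv G z fs) = pr w (conv G z (conv G ?v fs))"
        using pr_conv[of w v "conv G z fs" 1] keys_KT'[OF conv_KT[OF z fs(1)]] vc by simp
      also have "\<dots> = \<phi> (conv G ?v fs)" using rep[OF conv_KT[OF vf fs(1)]] .
      also have "\<dots> = 0"
      proof (rule \<phi>(3))
        have "\<pi> (conv G ?v fs) = \<pi> ?v \<otimes>\<^bsub>R\<^esub> s" using pi_mult[of ?v fs] keys_KT' vf fs vc by simp
        moreover have "\<pi> ?v \<in> A" using vf unfolding A_def by blast
        ultimately show "conv G ?v fs \<in> V"
          using conv_KT[OF vf fs(1)] by (auto simp: V_def hat_def Art.gen_def)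
      qed
      finally show ?thesis using m_comm[OF vc w_closed] by simp
    next
      case False
      have "\<psi> (v \<otimes> w \<otimes> u) = 0" if "u \<in> KT" for u
        using \<psi>_unit_shift[OF v KT_Units[OF that]] KT_cancel[of v u] K_KT v that False by blast
      then show ?thesis
        using conv_KT[OF z fs(1)] unfolding keysum_def by (intro sum.neutral) auto
    qed
  qed
  then have "\<pi> z \<otimes>\<^bsub>R\<^esub> s = \<zero>\<^bsub>R\<^esub>"
    using pi_mult[of z fs] pi_eq_zero[of "conv G z fs"] keys_KT' z fs conv_KT[OF z fs(1)] by simp
  then have "\<pi> z \<otimes>\<^bsub>R\<^esub> t = \<zero>\<^bsub>R\<^esub>" using ann[of "\<pi> z"] z unfolding A_def by blast
  then have "conv G z ft \<in> core"
    using pi_mult[of z ft] pi_eq_zero[of "conv G z ft"] keys_KT' z ft conv_KT[OF z ft(1)] by simp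
  then have "pr w (conv G z ft) = 0" by (simp add: core_def)
  then show False using rep[OF ft(1)] \<phi>(4) by simp
qed

end

text \<open>Nilpotency is measured on an element \<open>c\<close>. One factor of the power is
  multiplied out at a time, which replaces \<open>c\<close> by \<open>a c\<close> or
  \<open>b c\<close> and lowers \<open>n\<close> or \<open>m\<close>.\<close>

lemma (in cring) nilpotent_add:
  assumes "a \<in> carrier R" "b \<in> carrier R" "c \<in> carrier R"
    and "a [^] (n::nat) \<otimes> c = \<zero>" "b [^] (m::nat) \<otimes> c = \<zero>"
  shows "(a \<oplus> b) [^] (n + m) \<otimes> c = \<zero>"
  using assms(3-5)
proof (induction "n + m" arbitrary: n m c)
  case 0
  then show ?case by simp
next
  case (Suc N)
  show ?case
  proof (cases "n = 0 \<or> m = 0")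
    case True
    then have "c = \<zero>" using Suc by auto
    then show ?thesis using assms(1,2) by simp
  next
    case False
    then obtain n' m' where nm: "n = Suc n'" "m = Suc m'" by (metis not0_implies_Suc)
    have "b [^] m \<otimes> (a \<otimes> c) = a \<otimes> (b [^] m \<otimes> c)" using assms(1,2) Suc.prems(1) by (simp add: m_ac)
    then have "(a \<oplus> b) [^] (n' + m) \<otimes> (a \<otimes> c) = \<zero>"
      using Suc.hyps nm Suc.prems assms(1,2) by (intro Suc.hyps(1)) (auto simp: m_assoc)
    moreover have "a [^] n \<otimes> (b \<otimes> c) = b \<otimes> (a [^] n \<otimes> c)" using assms(1,2) Suc.prems(1) by (simp add: m_ac)
    then have "(a \<oplus> b) [^] (n + m') \<otimes> (b \<otimes> c) = \<zero>"
      using Suc.hyps nm Suc.prems assms(1,2) by (intro Suc.hyps(1)) (auto simp: m_assoc)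
    moreover have "(a \<oplus> b) [^] (n + m) \<otimes> c = (a \<oplus> b) [^] N \<otimes> (a \<otimes> c) \<oplus> (a \<oplus> b) [^] N \<otimes> (b \<otimes> c)"
    proof -
      have "(a \<oplus> b) [^] (n + m) \<otimes> c = (a \<oplus> b) [^] N \<otimes> ((a \<oplus> b) \<otimes> c)"
        using assms(1,2) Suc.prems(1) Suc.hyps(2)[symmetric] by (simp add: m_assoc)
      then show ?thesis using assms(1,2) Suc.prems(1) by (simp add: l_distr r_distr)
    qed
    moreover have "n' + m = N" "n + m' = N" using Suc.hyps(2) nm by auto
    ultimately show ?thesis by simp
  qed
qed

lemma (in comm_monoid) inv_mult_Units:
  assumes "x \<in> Units G" "y \<in> Units G"
  shows "inv (x \<otimes> y) = inv x \<otimes> inv y"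
proof -
  have c: "x \<in> carrier G" "y \<in> carrier G" "inv x \<in> carrier G" "inv y \<in> carrier G" using assms by auto
  have "(x \<otimes> y) \<otimes> (inv x \<otimes> inv y) = (x \<otimes> inv x) \<otimes> (y \<otimes> inv y)"
    using c by (simp add: m_ac del: Units_r_inv)
  then have 1: "(x \<otimes> y) \<otimes> (inv x \<otimes> inv y) = \<one>" using assms by simp
  then have "(inv x \<otimes> inv y) \<otimes> (x \<otimes> y) = \<one>"
    using m_comm[of "x \<otimes> y" "inv x \<otimes> inv y"] c by simp
  then show ?thesis using inv_unique'[of "x \<otimes> y" "inv x \<otimes> inv y"] 1 c by simp
qed

section \<open>Leading terms with respect to an order on the torsion-free part\<close>

context socle_form
begin

interpretation R: cring R by (rule R_cring)
interpretation Art: artinian_subring R A \<delta> by (rule A_artinian)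

lemma cone_exists:
  "\<exists>N. N \<subseteq> Units G \<and> KT \<subseteq> N \<and> (\<forall>x\<in>N. \<forall>y\<in>N. x \<otimes> y \<in> N) \<and>
     (\<forall>x\<in>N. inv x \<in> N \<longrightarrow> x \<in> KT) \<and> (\<forall>x\<in>Units G. x \<in> N \<or> inv x \<in> N)"
proof -
  interpret U: comm_group "units_of G" by (rule U_comm_group)
  have tf: "u \<in> KT" if "u \<in> carrier (units_of G)" "0 < n" "u [^]\<^bsub>units_of G\<^esub> (n::nat) \<in> KT" for u n
    using U.torsion_closure_idem that unfolding KT_def by blast
  from U.torsion_free_quotient_orderable[OF KT_subgroup tf]
  obtain N where N: "N \<subseteq> carrier (units_of G) \<and> KT \<subseteq> N \<and>
      (\<forall>x\<in>N. \<forall>y\<in>N. x \<otimes>\<^bsub>units_of G\<^esub> y \<in> N) \<and>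
      (\<forall>x\<in>N. inv\<^bsub>units_of G\<^esub> x \<in> N \<longrightarrow> x \<in> KT) \<and>
      (\<forall>x\<in>carrier (units_of G). x \<in> N \<or> inv\<^bsub>units_of G\<^esub> x \<in> N)"
    by (rule exE)
  have NU: "N \<subseteq> Units G" using N by (simp add: units_of_carrier)
  show ?thesis
  proof (intro exI[of _ N] conjI ballI impI)
    show "N \<subseteq> Units G" by (rule NU)
    show "KT \<subseteq> N" using N by (elim conjE)
    show "x \<otimes> y \<in> N" if "x \<in> N" "y \<in> N" for x y
      using N that by (simp add: units_of_mult)
    show "x \<in> KT" if "x \<in> N" "inv x \<in> N" for x
      using N that NU units_of_inv[of x] by auto
    show "x \<in> N \<or> inv x \<in> N" if "x \<in> Units G" for x
      using N units_of_inv[OF that] that unfolding units_of_carrier by metis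
  qed
qed

text \<open>Membership of \<open>inv u \<otimes> g\<close> is read as \<open>u\<close> being at most
  \<open>g\<close>. This is a total preorder compatible with multiplication whose equivalence
  classes are the cosets of \<open>KT\<close>, so a leading term is a whole coset piece.\<close>

definition "cone = (SOME N. N \<subseteq> Units G \<and> KT \<subseteq> N \<and> (\<forall>x\<in>N. \<forall>y\<in>N. x \<otimes> y \<in> N) \<and>
     (\<forall>x\<in>N. inv x \<in> N \<longrightarrow> x \<in> KT) \<and> (\<forall>x\<in>Units G. x \<in> N \<or> inv x \<in> N))"

lemma cone: "cone \<subseteq> Units G" "KT \<subseteq> cone" "x \<in> cone \<Longrightarrow> y \<in> cone \<Longrightarrow> x \<otimes> y \<in> cone"
     "x \<in> cone \<Longrightarrow> inv x \<in> cone \<Longrightarrow> x \<in> KT" "x \<in> Units G \<Longrightarrow> x \<in> cone \<or> inv x \<in> cone"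
proof -
  have "cone \<subseteq> Units G \<and> KT \<subseteq> cone \<and> (\<forall>x\<in>cone. \<forall>y\<in>cone. x \<otimes> y \<in> cone) \<and>
     (\<forall>x\<in>cone. inv x \<in> cone \<longrightarrow> x \<in> KT) \<and> (\<forall>x\<in>Units G. x \<in> cone \<or> inv x \<in> cone)"
    unfolding cone_def by (rule someI_ex[OF cone_exists])
  then show "cone \<subseteq> Units G" "KT \<subseteq> cone" "x \<in> cone \<Longrightarrow> y \<in> cone \<Longrightarrow> x \<otimes> y \<in> cone"
     "x \<in> cone \<Longrightarrow> inv x \<in> cone \<Longrightarrow> x \<in> KT" "x \<in> Units G \<Longrightarrow> x \<in> cone \<or> inv x \<in> cone"
    by auto
qed

lemma cone_maximum:
  assumes "finite Z" "Z \<noteq> {}" "Z \<subseteq> Units G"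
  shows "\<exists>g\<in>Z. \<forall>u\<in>Z. inv u \<otimes> g \<in> cone"
  using assms
proof (induction rule: finite_ne_induct)
  case (singleton x)
  then show ?case using cone(2) KT_one by auto
next
  case (insert z Z)
  then obtain g where g: "g \<in> Z" "\<And>u. u \<in> Z \<Longrightarrow> inv u \<otimes> g \<in> cone" by auto
  have U: "z \<in> Units G" "g \<in> Units G" using insert g by auto
  show ?case
  proof (cases "inv z \<otimes> g \<in> cone")
    case True
    then show ?thesis using g by blast
  next
    case False
    then have zg: "inv g \<otimes> z \<in> cone"
      using cone(5)[of "inv z \<otimes> g"] Units_ratio(2)[of z g g] U by auto
    have "inv u \<otimes> z \<in> cone" if u: "u \<in> Z" for u
      using cone(3)[OF g(2)[OF u] zg] Units_ratio(1)[of u g z] U u insert.prems by auto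
    moreover have "inv z \<otimes> z \<in> cone" using U cone(2) KT_one by auto
    ultimately show ?thesis by blast
  qed
qed

lemma tcoset_mult:
  assumes "g \<in> Units G" "g' \<in> Units G" "u \<in> tcoset g" "v \<in> tcoset g'"
  shows "u \<otimes> v \<in> tcoset (g \<otimes> g')"
proof -
  have uv: "u \<in> Units G" "v \<in> Units G" "inv g \<otimes> u \<in> KT" "inv g' \<otimes> v \<in> KT"
    using assms by (auto simp: tcoset_def)
  have c: "u \<in> carrier G" "v \<in> carrier G" "inv g \<in> carrier G" "inv g' \<in> carrier G"
    using uv assms by auto
  have "inv (g \<otimes> g') \<otimes> (u \<otimes> v) = (inv g \<otimes> u) \<otimes> (inv g' \<otimes> v)"
    using inv_mult_Units[OF assms(1,2)] c by (simp add: m_ac)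
  then show ?thesis using KT_mult[OF uv(3,4)] uv by (simp add: tcoset_def)
qed

lemma tcoset_KT:
  assumes "g \<in> Units G" "k \<in> KT" "u \<in> Units G"
  shows "u \<otimes> k \<in> tcoset g \<longleftrightarrow> u \<in> tcoset g"
proof -
  have c: "u \<in> carrier G" "k \<in> carrier G" "inv g \<in> carrier G" "k \<in> Units G"
    using assms KT_carrier KT_Units by auto
  have "inv g \<otimes> (u \<otimes> k) = (inv g \<otimes> u) \<otimes> k" using c by (simp add: m_assoc)
  then show ?thesis
    using KT_mult[of "inv g \<otimes> u" k] KT_cancel[of "inv g \<otimes> u" k] assms c by (auto simp: tcoset_def)
qed

text \<open>Both ratios lie in \<open>cone\<close>, and the inverse of their product lies in
  \<open>KT\<close>. Multiplying that inverse by one ratio gives the inverse of the other, so both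
  inverses are in \<open>cone\<close> as well and the ratios belong to \<open>KT\<close>.\<close>

lemma tcoset_maximal:
  assumes U: "g \<in> Units G" "g' \<in> Units G" "u \<in> Units G" "v \<in> Units G"
    and le: "inv u \<otimes> g \<in> cone" "inv v \<otimes> g' \<in> cone" and uv: "u \<otimes> v \<in> tcoset (g \<otimes> g')"
  shows "u \<in> tcoset g \<and> v \<in> tcoset g'"
proof -
  let ?x = "inv u \<otimes> g" and ?y = "inv v \<otimes> g'"
  have c: "u \<in> carrier G" "v \<in> carrier G" "inv g \<in> carrier G" "inv g' \<in> carrier G"
    "inv u \<in> carrier G" "inv v \<in> carrier G" "g \<in> carrier G" "g' \<in> carrier G"
    using U by auto
  have ix: "inv ?x = inv g \<otimes> u" "inv ?y = inv g' \<otimes> v" using Units_ratio(2) U by auto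
  have xU: "?x \<in> Units G" "?y \<in> Units G" using U by auto
  have t: "inv (g \<otimes> g') \<otimes> (u \<otimes> v) \<in> KT" using uv by (simp add: tcoset_def)
  have e: "inv (g \<otimes> g') \<otimes> (u \<otimes> v) = inv ?x \<otimes> inv ?y"
    unfolding ix using inv_mult_Units[OF U(1,2)] c by (simp add: m_ac)
  have k: "inv ?x \<otimes> inv ?y \<in> cone" using t e cone(2) by auto
  have cx: "?x \<in> carrier G" "?y \<in> carrier G" "inv ?x \<in> carrier G" "inv ?y \<in> carrier G" using xU by auto
  have "inv ?x = ?y \<otimes> (inv ?x \<otimes> inv ?y)"
  proof -
    have "?y \<otimes> (inv ?x \<otimes> inv ?y) = inv ?x \<otimes> (?y \<otimes> inv ?y)" by (rule m_lcomm) (rule cx)+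
    then show ?thesis using cx xU(2) by (simp only: Units_r_inv r_one)
  qed
  then have "inv ?x \<in> cone" using cone(3)[OF le(2) k] by (simp only:)
  then have xK: "?x \<in> KT" using cone(4) le(1) by blast
  have "inv ?y = ?x \<otimes> (inv ?x \<otimes> inv ?y)"
  proof -
    have "?x \<otimes> (inv ?x \<otimes> inv ?y) = (?x \<otimes> inv ?x) \<otimes> inv ?y" by (rule m_assoc[symmetric]) (rule cx)+
    then show ?thesis using cx xU(1) by (simp only: Units_r_inv l_one)
  qed
  then have "inv ?y \<in> cone" using cone(3)[OF le(1) k] by (simp only:)
  then have yK: "?y \<in> KT" using cone(4) le(2) by blast
  show ?thesis using KT_inv[OF xK] KT_inv[OF yK] ix U by (simp add: tcoset_def)
qed

lemma coset_sum:
  assumes f: "Poly_Mapping.keys f \<subseteq> Units G"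
    and h: "\<And>u. u \<in> Poly_Mapping.keys f \<Longrightarrow> conv G (restrict_support f (tcoset u)) h \<in> core"
  shows "conv G f h \<in> core"
proof -
  have eq: "f = (\<Sum>d\<in>tcoset ` Poly_Mapping.keys f. restrict_support f d)"
    by (rule restrict_support_partition) (use f tcoset_self tcoset_eq in blast)+
  have "conv G f h = (\<Sum>d\<in>tcoset ` Poly_Mapping.keys f. conv G (restrict_support f d) h)"
    by (subst (1) eq) (rule conv_sum_left)
  also have "\<dots> \<in> core" using h by (intro ideal_sum[OF core_ideal]) auto
  finally show ?thesis .
qed

text \<open>Multiplication by a unit of \<open>KT\<close> preserves every coset, so the part of
  \<open>f\<close> outside the coset contributes only outside it.\<close>

lemma restrict_conv_KT:
  assumes "Poly_Mapping.keys f \<subseteq> Units G" "Poly_Mapping.keys h \<subseteq> KT" "g \<in> Units G"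
  shows "restrict_support (conv G f h) (tcoset g) = conv G (restrict_support f (tcoset g)) h"
proof -
  let ?f1 = "restrict_support f (tcoset g)" and ?f2 = "restrict_support f (- tcoset g)"
  have "f = ?f1 + ?f2"
    by (rule poly_mapping_eqI) (simp add: lookup_add lookup_restrict_support)
  then have "conv G f h = conv G ?f1 h + conv G ?f2 h" by (metis conv_add_left)
  moreover have "Poly_Mapping.keys (conv G ?f1 h) \<subseteq> tcoset g"
    by (rule keys_conv_subset[where A = "tcoset g" and B = KT])
      (use assms tcoset_KT tcoset_subset[THEN subsetD] in \<open>auto simp: keys_restrict_support\<close>)
  moreover have "Poly_Mapping.keys (conv G ?f2 h) \<subseteq> - tcoset g"
    by (rule keys_conv_subset[where A = "Units G - tcoset g" and B = KT])
      (use assms tcoset_KT in \<open>auto simp: keys_restrict_support\<close>)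
  ultimately show ?thesis using restrict_support_sum_eq by (metis disjoint_eq_subset_Compl)
qed

text \<open>The set \<open>Z\<close> collects the keys whose coset piece fails to annihilate
  \<open>h\<close> modulo \<open>core\<close>. It is a union of full pieces of the support, so
  discarding the remaining pieces leaves those in \<open>Z\<close> intact and does not change the
  product with \<open>h\<close> modulo \<open>core\<close>.\<close>

lemma bad_part:
  fixes f h :: "'a \<Rightarrow>\<^sub>0 'k"
  assumes f: "Poly_Mapping.keys f \<subseteq> Units G"
  defines "Z \<equiv> {u \<in> Poly_Mapping.keys f. conv G (restrict_support f (tcoset u)) h \<notin> core}"
  shows "conv G (f - restrict_support f Z) h \<in> core"
    and "u \<in> Z \<Longrightarrow> restrict_support (restrict_support f Z) (tcoset u) = restrict_support f (tcoset u)"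
proof -
  have same: "v \<in> Z \<longleftrightarrow> u \<in> Z" if "u \<in> Poly_Mapping.keys f" "v \<in> Poly_Mapping.keys f" "v \<in> tcoset u" for u v
    using tcoset_eq[of u v] that f unfolding Z_def by auto
  show "conv G (f - restrict_support f Z) h \<in> core"
  proof (rule coset_sum)
    show "Poly_Mapping.keys (f - restrict_support f Z) \<subseteq> Units G"
      using f by (intro order_trans[OF keys_minus]) (auto simp: keys_restrict_support)
    fix u assume u: "u \<in> Poly_Mapping.keys (f - restrict_support f Z)"
    then have u': "u \<in> Poly_Mapping.keys f" "u \<notin> Z"
      by (auto simp: in_keys_iff lookup_minus lookup_restrict_support split: if_splits)
    have "restrict_support (f - restrict_support f Z) (tcoset u) = restrict_support f (tcoset u)"
    proof (rule poly_mapping_eqI)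
      fix a
      show "Poly_Mapping.lookup (restrict_support (f - restrict_support f Z) (tcoset u)) a
        = Poly_Mapping.lookup (restrict_support f (tcoset u)) a"
        using same[OF u'(1), of a] u'(2)
        by (cases "a \<in> Poly_Mapping.keys f") (auto simp: lookup_minus lookup_restrict_support in_keys_iff)
    qed
    then show "conv G (restrict_support (f - restrict_support f Z) (tcoset u)) h \<in> core"
      using u' unfolding Z_def by auto
  qed
  assume u: "u \<in> Z"
  then have uf: "u \<in> Poly_Mapping.keys f" by (auto simp: Z_def)
  show "restrict_support (restrict_support f Z) (tcoset u) = restrict_support f (tcoset u)"
  proof (rule poly_mapping_eqI)
    fix a
    show "Poly_Mapping.lookup (restrict_support (restrict_support f Z) (tcoset u)) a
      = Poly_Mapping.lookup (restrict_support f (tcoset u)) a"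
      using same[OF uf, of a] u
      by (cases "a \<in> Poly_Mapping.keys f") (auto simp: lookup_restrict_support in_keys_iff)
  qed
qed

text \<open>Dividing the piece by its degree \<open>g\<close> moves its support into
  \<open>KT\<close>.\<close>

lemma homogeneous_piece:
  fixes f :: "'a \<Rightarrow>\<^sub>0 'k"
  assumes f: "Poly_Mapping.keys f \<subseteq> Units G" and g: "g \<in> Units G"
  shows "\<exists>a\<in>A. \<pi> (restrict_support f (tcoset g)) = \<pi> (monomial g) \<otimes>\<^bsub>R\<^esub> a"
proof -
  let ?p = "restrict_support f (tcoset g)"
  let ?a = "conv G (monomial (inv g)) ?p"
  have pk: "Poly_Mapping.keys ?p \<subseteq> tcoset g" by (simp add: keys_restrict_support)
  have pc: "Poly_Mapping.keys ?p \<subseteq> carrier G" using pk tcoset_subset Units_subset by blast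
  have gc: "g \<in> carrier G" "inv g \<in> carrier G" using g by auto
  have a: "Poly_Mapping.keys ?a \<subseteq> KT"
    by (rule keys_conv_subset[where A = "{inv g}" and B = "tcoset g"]) (use pk in \<open>auto simp: tcoset_def\<close>)
  have "conv G (monomial g) ?a = conv G (conv G (monomial g) (monomial (inv g))) ?p"
    using gc pc by (intro conv_assoc[symmetric]) auto
  also have "\<dots> = ?p" using g conv_one[OF pc] by simp
  finally have "\<pi> ?p = \<pi> (monomial g) \<otimes>\<^bsub>R\<^esub> \<pi> ?a"
    using pi_mult[of "monomial g" ?a] gc keys_KT'[OF a] by simp
  then show ?thesis using a unfolding A_def by blast
qed

lemma pi_monomial_inv:
  assumes "g \<in> Units G"
  shows "\<pi> (monomial g) \<otimes>\<^bsub>R\<^esub> \<pi> (monomial (inv g)) = \<one>\<^bsub>R\<^esub>"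
    "\<pi> (monomial g) \<in> carrier R" "\<pi> (monomial (inv g)) \<in> carrier R"
  using assms pi_mult[of "monomial g" "monomial (inv g)"] by (auto simp: pi_one pi_closed)

text \<open>Up to the invertible monomial \<open>t^g\<close> the piece is an element of
  \<open>A\<close>, and the factor of \<open>A\<close> at \<open>e\<close> is local.\<close>

lemma piece_dichotomy:
  fixes f :: "'a \<Rightarrow>\<^sub>0 'k"
  assumes e: "R.primitive_idempotent A e"
    and f: "Poly_Mapping.keys f \<subseteq> Units G" and g: "g \<in> Units G"
  shows "(\<exists>a\<in>A. \<exists>n::nat. \<pi> (restrict_support f (tcoset g)) = \<pi> (monomial g) \<otimes>\<^bsub>R\<^esub> a \<and>
      a [^]\<^bsub>R\<^esub> n \<otimes>\<^bsub>R\<^esub> e = \<zero>\<^bsub>R\<^esub>) \<or>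
    (\<exists>y\<in>carrier R. \<pi> (restrict_support f (tcoset g)) \<otimes>\<^bsub>R\<^esub> y \<otimes>\<^bsub>R\<^esub> e = e)"
proof -
  obtain a where a: "a \<in> A" "\<pi> (restrict_support f (tcoset g)) = \<pi> (monomial g) \<otimes>\<^bsub>R\<^esub> a"
    using homogeneous_piece[OF f g] by blast
  have ec: "e \<in> carrier R" using e Art.A_carrier by (auto simp: R.primitive_idempotent_def)
  from Art.primitive_local[OF e a(1)] show ?thesis
  proof
    assume "\<exists>y\<in>A. a \<otimes>\<^bsub>R\<^esub> y \<otimes>\<^bsub>R\<^esub> e = e"
    then obtain y where y: "y \<in> A" "a \<otimes>\<^bsub>R\<^esub> y \<otimes>\<^bsub>R\<^esub> e = e" by blast
    note c = pi_monomial_inv(2,3)[OF g] Art.A_carrier[OF a(1)] Art.A_carrier[OF y(1)] ec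
    have "(\<pi> (monomial g) \<otimes>\<^bsub>R\<^esub> a) \<otimes>\<^bsub>R\<^esub> (\<pi> (monomial (inv g)) \<otimes>\<^bsub>R\<^esub> y) \<otimes>\<^bsub>R\<^esub> e
      = (\<pi> (monomial g) \<otimes>\<^bsub>R\<^esub> \<pi> (monomial (inv g))) \<otimes>\<^bsub>R\<^esub> (a \<otimes>\<^bsub>R\<^esub> y \<otimes>\<^bsub>R\<^esub> e)"
      using c by (simp add: R.m_ac)
    also have "\<dots> = e" using y(2) pi_monomial_inv(1)[OF g] ec by simp
    finally show ?thesis using a(2) c R.m_closed by metis
  qed (use a in blast)
qed

text \<open>Products of leading pieces cannot cancel. After discarding pieces that contribute
  nothing, let \<open>f1\<close> and \<open>h1\<close> be the largest remaining ones; homogeneity of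
  \<open>core\<close> makes their product vanish on \<open>e\<close>. By \<open>killed\<close> a
  nilpotent \<open>f1\<close> would annihilate \<open>h e\<close>, so \<open>f1\<close> is
  invertible on \<open>e\<close> and \<open>h1\<close> vanishes there, against its choice.\<close>

lemma leading_term:
  fixes f h :: "'a \<Rightarrow>\<^sub>0 'k"
  assumes e: "R.primitive_idempotent A e"
    and f: "Poly_Mapping.keys f \<subseteq> Units G" and h: "Poly_Mapping.keys h \<subseteq> Units G"
    and killed: "\<And>x n. x \<in> A \<Longrightarrow> x [^]\<^bsub>R\<^esub> (n::nat) \<otimes>\<^bsub>R\<^esub> e = \<zero>\<^bsub>R\<^esub> \<Longrightarrow> x \<otimes>\<^bsub>R\<^esub> (\<pi> h \<otimes>\<^bsub>R\<^esub> e) = \<zero>\<^bsub>R\<^esub>"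
    and ne: "\<pi> h \<otimes>\<^bsub>R\<^esub> e \<noteq> \<zero>\<^bsub>R\<^esub>"
    and zero: "\<pi> f \<otimes>\<^bsub>R\<^esub> (\<pi> h \<otimes>\<^bsub>R\<^esub> e) = \<zero>\<^bsub>R\<^esub>"
    and g: "g \<in> Units G"
  shows "\<exists>a\<in>A. \<exists>n::nat. \<pi> (restrict_support f (tcoset g)) = \<pi> (monomial g) \<otimes>\<^bsub>R\<^esub> a \<and>
      a [^]\<^bsub>R\<^esub> n \<otimes>\<^bsub>R\<^esub> e = \<zero>\<^bsub>R\<^esub>"
proof -
  have eA: "e \<in> A" "e \<otimes>\<^bsub>R\<^esub> e = e" using e by (auto simp: R.primitive_idempotent_def)
  obtain fe where fe: "Poly_Mapping.keys fe \<subseteq> KT" "e = \<pi> fe" using eA by (auto simp: A_def)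
  note feU = keys_KT[OF fe(1)]
  have ec: "e \<in> carrier R" using eA Art.A_carrier by blast
  define H where "H = conv G h fe"
  have HU: "Poly_Mapping.keys H \<subseteq> Units G" unfolding H_def by (rule conv_Units[OF h feU])
  have piH: "\<pi> H = \<pi> h \<otimes>\<^bsub>R\<^esub> e"
    unfolding H_def fe(2) by (rule pi_mult[symmetric, OF keys_Units[OF h] keys_Units[OF feU]])
  have hc: "\<pi> h \<in> carrier R" by (rule pi_closed[OF keys_Units[OF h]])
  have resU: "Poly_Mapping.keys (restrict_support q D) \<subseteq> Units G" if "Poly_Mapping.keys q \<subseteq> Units G"
    for q :: "'a \<Rightarrow>\<^sub>0 'k" and D using that by (auto simp: keys_restrict_support)
  have in_core: "conv G p q \<in> core \<longleftrightarrow> \<pi> p \<otimes>\<^bsub>R\<^esub> \<pi> q = \<zero>\<^bsub>R\<^esub>"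
    if "Poly_Mapping.keys p \<subseteq> Units G" "Poly_Mapping.keys q \<subseteq> Units G" for p q :: "'a \<Rightarrow>\<^sub>0 'k"
    using pi_mult[OF keys_Units[OF that(1)] keys_Units[OF that(2)]]
      pi_eq_zero[OF keys_Units[OF conv_Units[OF that]]] by simp
  \<comment> \<open>The two sets use different tests: a piece of \<open>f\<close> has to survive
    multiplication by \<open>h e\<close>, a piece of \<open>h\<close> only multiplication by
    \<open>e\<close>.\<close>
  define Z where "Z = {u \<in> Poly_Mapping.keys f. conv G (restrict_support f (tcoset u)) H \<notin> core}"
  define Zh where "Zh = {u \<in> Poly_Mapping.keys h. conv G (restrict_support h (tcoset u)) fe \<notin> core}"
  define f' where "f' = restrict_support f Z"
  define h' where "h' = restrict_support h Zh"
  have Zf: "Z \<subseteq> Units G" "finite Z" "Zh \<subseteq> Units G" "finite Zh" using f h by (auto simp: Z_def Zh_def)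
  have f'U: "Poly_Mapping.keys f' \<subseteq> Units G" and h'U: "Poly_Mapping.keys h' \<subseteq> Units G"
    using f h by (auto simp: f'_def h'_def keys_restrict_support)
  have f'Z: "Poly_Mapping.keys f' \<subseteq> Z" "Poly_Mapping.keys h' \<subseteq> Zh"
    by (auto simp: f'_def h'_def keys_restrict_support)
  have "conv G (f - f') H \<in> core" unfolding f'_def Z_def by (rule bad_part(1)[OF f])
  moreover have "conv G f H \<in> core" using in_core[OF f HU] zero piH by simp
  ultimately have f'H: "conv G f' H \<in> core"
    using ideal_diff[OF core_ideal, of "conv G f H" "conv G (f - f') H"] by (simp add: conv_diff_left)
  have hh': "conv G (h - h') fe \<in> core" unfolding h'_def Zh_def by (rule bad_part(1)[OF h])
  \<comment> \<open>Emptiness means that each coset piece of \<open>f\<close> annihilates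
    \<open>h e\<close> separately.\<close>
  have "Z = {}"
  proof (rule ccontr)
    assume "Z \<noteq> {}"
    then obtain g where gZ: "g \<in> Z" and gmax: "\<And>u. u \<in> Z \<Longrightarrow> inv u \<otimes> g \<in> cone"
      using cone_maximum[OF Zf(2) _ Zf(1)] by blast
    have "Zh \<noteq> {}"
    proof
      assume "Zh = {}"
      then have "h' = 0" by (simp add: h'_def restrict_support_def)
      then have "conv G h fe \<in> core" using hh' by simp
      then show False using in_core[OF h feU] ne fe by simp
    qed
    then obtain g' where g'Z: "g' \<in> Zh" and g'max: "\<And>u. u \<in> Zh \<Longrightarrow> inv u \<otimes> g' \<in> cone"
      using cone_maximum[OF Zf(4) _ Zf(3)] by blast
    have gU: "g \<in> Units G" "g' \<in> Units G" "g \<otimes> g' \<in> Units G" using gZ g'Z Zf by auto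
    define f1 where "f1 = restrict_support f (tcoset g)"
    define h1 where "h1 = restrict_support h (tcoset g')"
    have f1: "restrict_support f' (tcoset g) = f1"
      using bad_part(2)[OF f, of g H] gZ unfolding f1_def f'_def Z_def by blast
    have h1: "restrict_support h' (tcoset g') = h1"
      using bad_part(2)[OF h, of g' fe] g'Z unfolding h1_def h'_def Zh_def by blast
    define f2 where "f2 = f' - f1"
    define h2 where "h2 = h' - h1"
    have f2k: "Poly_Mapping.keys f2 \<subseteq> Z - tcoset g"
      using f'Z(1) unfolding f2_def f1[symmetric]
      by (auto simp: in_keys_iff lookup_minus lookup_restrict_support split: if_splits)
    have h2k: "Poly_Mapping.keys h2 \<subseteq> Zh - tcoset g'"
      using f'Z(2) unfolding h2_def h1[symmetric]
      by (auto simp: in_keys_iff lookup_minus lookup_restrict_support split: if_splits)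
    have f1k: "Poly_Mapping.keys f1 \<subseteq> tcoset g" "Poly_Mapping.keys f1 \<subseteq> Z"
      using f'Z(1) by (auto simp: f1[symmetric] keys_restrict_support)
    have h1k: "Poly_Mapping.keys h1 \<subseteq> tcoset g'" "Poly_Mapping.keys h1 \<subseteq> Zh"
      using f'Z(2) by (auto simp: h1[symmetric] keys_restrict_support)
    have f1U: "Poly_Mapping.keys f1 \<subseteq> Units G" and h1U: "Poly_Mapping.keys h1 \<subseteq> Units G"
      using f1k h1k Zf by blast+
    let ?C = "tcoset (g \<otimes> g')"
    define F1 where "F1 = conv G (conv G f1 h1) fe"
    define F2 where "F2 = conv G (conv G f1 h2 + conv G f2 h') fe"
    have F: "conv G (conv G f' h') fe = F1 + F2"
    proof -
      have "conv G f' h' = conv G f1 h' + conv G f2 h'"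
        using conv_add_left[of G f1 f2 h'] by (simp add: f2_def)
      moreover have "conv G f1 h' = conv G f1 h1 + conv G f1 h2"
        using conv_add_right[of G f1 h1 h2] by (simp add: h2_def)
      ultimately have "conv G f' h' = conv G f1 h1 + (conv G f1 h2 + conv G f2 h')"
        by (simp only: add.assoc)
      then show ?thesis unfolding F1_def F2_def by (simp only: conv_add_left)
    qed
    have "Poly_Mapping.keys (conv G f1 h1) \<subseteq> ?C"
      by (rule keys_conv_subset[OF f1k(1) h1k(1)]) (rule tcoset_mult[OF gU(1,2)])
    then have F1k: "Poly_Mapping.keys F1 \<subseteq> ?C"
      unfolding F1_def using tcoset_KT[OF gU(3)] tcoset_subset[THEN subsetD]
      by (intro keys_conv_subset[OF _ fe(1), where A = ?C]) auto
    \<comment> \<open>Mixed products miss the top coset, by maximality of \<open>g\<close> and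
      \<open>g'\<close>; the same holds for the remaining part below.\<close>
    have 1: "Poly_Mapping.keys (conv G f1 h2) \<subseteq> Units G - ?C"
    proof (rule keys_conv_subset[OF f1k(2) h2k])
      fix a b assume ab: "a \<in> Z" "b \<in> Zh - tcoset g'"
      then show "a \<otimes> b \<in> Units G - ?C"
        using tcoset_maximal[OF gU(1,2), of a b] gmax[of a] g'max[of b] Zf by auto
    qed
    have 2: "Poly_Mapping.keys (conv G f2 h') \<subseteq> Units G - ?C"
    proof (rule keys_conv_subset[OF f2k f'Z(2)])
      fix a b assume ab: "a \<in> Z - tcoset g" "b \<in> Zh"
      then show "a \<otimes> b \<in> Units G - ?C"
        using tcoset_maximal[OF gU(1,2), of a b] gmax[of a] g'max[of b] Zf by auto
    qed
    have "Poly_Mapping.keys F2 \<subseteq> - ?C"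
      unfolding F2_def
    proof (rule keys_conv_subset[OF order_trans[OF keys_add Un_least[OF 1 2]] fe(1)])
      fix a b assume "a \<in> Units G - ?C" "b \<in> KT"
      then show "a \<otimes> b \<in> - ?C" using tcoset_KT[OF gU(3), of b a] by auto
    qed
    then have "restrict_support (F1 + F2) ?C = F1"
      by (intro restrict_support_sum_eq[OF F1k]) blast
    moreover have "F1 + F2 \<in> core"
    proof -
      have "conv G f' (conv G (h - h') fe) \<in> core"
        by (rule ideal_conv[OF core_ideal hh' keys_Units[OF f'U]])
      moreover have "conv G f' H = conv G f' (conv G (h - h') fe) + conv G f' (conv G h' fe)"
        unfolding H_def by (simp add: conv_add_right[symmetric] conv_add_left[symmetric])
      ultimately have "conv G f' (conv G h' fe) \<in> core"
        using ideal_diff[OF core_ideal f'H, of "conv G f' (conv G (h - h') fe)"] by simp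
      then show ?thesis
        unfolding F[symmetric] conv_assoc[OF keys_Units[OF f'U] keys_Units[OF h'U] keys_Units[OF feU]] .
    qed
    moreover have "Poly_Mapping.keys (F1 + F2) \<subseteq> Units G"
      unfolding F[symmetric] by (intro conv_Units f'U h'U feU)
    ultimately have "F1 \<in> core" using core_restrict[OF _ _ gU(3), of "F1 + F2"] by simp
    then have "\<pi> (conv G f1 h1) \<otimes>\<^bsub>R\<^esub> e = \<zero>\<^bsub>R\<^esub>"
      unfolding F1_def in_core[OF conv_Units[OF f1U h1U] feU] fe(2) .
    then have z: "\<pi> f1 \<otimes>\<^bsub>R\<^esub> \<pi> h1 \<otimes>\<^bsub>R\<^esub> e = \<zero>\<^bsub>R\<^esub>"
      using pi_mult[OF keys_Units[OF f1U] keys_Units[OF h1U]] by simp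
    have c: "\<pi> f1 \<in> carrier R" "\<pi> h1 \<in> carrier R" using pi_closed keys_Units f1U h1U by blast+
    have "\<pi> f1 \<otimes>\<^bsub>R\<^esub> (\<pi> h \<otimes>\<^bsub>R\<^esub> e) \<noteq> \<zero>\<^bsub>R\<^esub>"
      using gZ in_core[OF f1U HU] piH by (simp add: Z_def f1_def)
    moreover have "\<pi> f1 \<otimes>\<^bsub>R\<^esub> (\<pi> h \<otimes>\<^bsub>R\<^esub> e) = \<zero>\<^bsub>R\<^esub>"
      if an: "a \<in> A" "\<pi> f1 = \<pi> (monomial g) \<otimes>\<^bsub>R\<^esub> a" "a [^]\<^bsub>R\<^esub> (n::nat) \<otimes>\<^bsub>R\<^esub> e = \<zero>\<^bsub>R\<^esub>" for a n
      using killed[OF an(1,3)] an(2) pi_monomial_inv(2)[OF gU(1)] Art.A_carrier[OF an(1)] hc ec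
      by (simp add: R.m_assoc)
    ultimately obtain y where y: "y \<in> carrier R" "\<pi> f1 \<otimes>\<^bsub>R\<^esub> y \<otimes>\<^bsub>R\<^esub> e = e"
      using piece_dichotomy[OF e f gU(1)] unfolding f1_def[symmetric] by blast
    have "\<pi> h1 \<otimes>\<^bsub>R\<^esub> e = \<pi> h1 \<otimes>\<^bsub>R\<^esub> (\<pi> f1 \<otimes>\<^bsub>R\<^esub> y \<otimes>\<^bsub>R\<^esub> e)" using y by simp
    also have "\<dots> = y \<otimes>\<^bsub>R\<^esub> (\<pi> f1 \<otimes>\<^bsub>R\<^esub> \<pi> h1 \<otimes>\<^bsub>R\<^esub> e)" using c y(1) ec by (simp add: R.m_ac)
    also have "\<dots> = \<zero>\<^bsub>R\<^esub>" using z y by simp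
    finally show False using g'Z in_core[OF h1U feU] fe(2) by (simp add: Zh_def h1_def)
  qed
  then have kill: "\<pi> (restrict_support f (tcoset g)) \<otimes>\<^bsub>R\<^esub> (\<pi> h \<otimes>\<^bsub>R\<^esub> e) = \<zero>\<^bsub>R\<^esub>"
  proof (cases "\<exists>u\<in>Poly_Mapping.keys f. u \<in> tcoset g")
    case True
    then obtain u where u: "u \<in> Poly_Mapping.keys f" "u \<in> tcoset g" by blast
    then have "conv G (restrict_support f (tcoset g)) H \<in> core"
      using \<open>Z = {}\<close> tcoset_eq[OF g u(2)] by (auto simp: Z_def)
    then show ?thesis using in_core[OF resU[OF f] HU] piH by simp
  next
    case False
    then have "restrict_support f (tcoset g) = 0" by (auto simp: restrict_support_def intro!: sum.neutral)
    then show ?thesis using hc ec by (simp add: res_zero[OF core_ideal, symmetric])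
  qed
  \<comment> \<open>A piece invertible on \<open>e\<close> and annihilating \<open>h e\<close> would
    force \<open>h e\<close> to be 0, so only the nilpotent alternative remains.\<close>
  have False if y: "y \<in> carrier R" "\<pi> (restrict_support f (tcoset g)) \<otimes>\<^bsub>R\<^esub> y \<otimes>\<^bsub>R\<^esub> e = e" for y
  proof -
    let ?p = "\<pi> (restrict_support f (tcoset g))"
    have pc: "?p \<in> carrier R" by (rule pi_closed[OF keys_Units[OF resU[OF f]]])
    have "\<pi> h \<otimes>\<^bsub>R\<^esub> e = \<pi> h \<otimes>\<^bsub>R\<^esub> (?p \<otimes>\<^bsub>R\<^esub> y \<otimes>\<^bsub>R\<^esub> e)" using y by simp
    also have "\<dots> = y \<otimes>\<^bsub>R\<^esub> (?p \<otimes>\<^bsub>R\<^esub> (\<pi> h \<otimes>\<^bsub>R\<^esub> e))" using pc y(1) hc ec by (simp add: R.m_ac)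
    also have "\<dots> = \<zero>\<^bsub>R\<^esub>" using kill y by simp
    finally show False using ne by blast
  qed
  then show ?thesis using piece_dichotomy[OF e f g] by blast
qed

end

section \<open>Primary and irreducible annihilators\<close>

context socle_form
begin

interpretation R: cring R by (rule R_cring)
interpretation Art: artinian_subring R A \<delta> by (rule A_artinian)

lemma primitive_carrier: "R.primitive_idempotent A e \<Longrightarrow> e \<in> carrier R"
  using Art.A_carrier by (auto simp: R.primitive_idempotent_def)

lemma primitive_idem: "R.primitive_idempotent A e \<Longrightarrow> e \<otimes>\<^bsub>R\<^esub> e = e"
  by (auto simp: R.primitive_idempotent_def)

lemma A_cases:
  assumes "a \<in> A"
  obtains f :: "'a \<Rightarrow>\<^sub>0 'k" where "Poly_Mapping.keys f \<subseteq> KT" "a = \<pi> f"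
  using assms by (auto simp: A_def)

text \<open>The image of the group algebra of all units; \<open>A\<close> is its torsion
  part.\<close>

definition "B = \<pi> ` {f. Poly_Mapping.keys f \<subseteq> Units G}"

lemma B_cases:
  assumes "b \<in> B"
  obtains f :: "'a \<Rightarrow>\<^sub>0 'k" where "Poly_Mapping.keys f \<subseteq> Units G" "b = \<pi> f"
  using assms by (auto simp: B_def)

lemma B_I: "Poly_Mapping.keys f \<subseteq> Units G \<Longrightarrow> \<pi> f \<in> B"
  by (auto simp: B_def)

lemma B_carrier: "b \<in> B \<Longrightarrow> b \<in> carrier R"
  using pi_closed keys_Units by (auto simp: B_def)

lemma A_B: "a \<in> A \<Longrightarrow> a \<in> B"
  using keys_KT by (auto simp: A_def B_def)

lemma B_mult: "a \<in> B \<Longrightarrow> b \<in> B \<Longrightarrow> a \<otimes>\<^bsub>R\<^esub> b \<in> B"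
  by (elim B_cases) (simp add: pi_mult keys_Units conv_Units B_I)

lemma B_add: "a \<in> B \<Longrightarrow> b \<in> B \<Longrightarrow> a \<oplus>\<^bsub>R\<^esub> b \<in> B"
proof (elim B_cases)
  fix f g :: "'a \<Rightarrow>\<^sub>0 'k"
  assume fg: "Poly_Mapping.keys f \<subseteq> Units G" "a = \<pi> f" "Poly_Mapping.keys g \<subseteq> Units G" "b = \<pi> g"
  then have "a \<oplus>\<^bsub>R\<^esub> b = \<pi> (f + g)" by (simp add: pi_add keys_Units)
  then show ?thesis using order_trans[OF keys_add Un_least[OF fg(1,3)]] B_I by simp
qed

lemma pieces_induct:
  assumes f: "Poly_Mapping.keys f \<subseteq> Units G"
    and zero: "P \<zero>\<^bsub>R\<^esub>"
    and add: "\<And>a b. a \<in> B \<Longrightarrow> b \<in> B \<Longrightarrow> P a \<Longrightarrow> P b \<Longrightarrow> P (a \<oplus>\<^bsub>R\<^esub> b)"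
    and piece: "\<And>u. u \<in> Units G \<Longrightarrow> P (\<pi> (restrict_support f (tcoset u)))"
  shows "P (\<pi> f)"
proof -
  have eq: "f = (\<Sum>d\<in>tcoset ` Poly_Mapping.keys f. restrict_support f d)"
    by (rule restrict_support_partition) (use f tcoset_self tcoset_eq in blast)+
  have "Poly_Mapping.keys (\<Sum>d\<in>D. restrict_support f d) \<subseteq> Units G \<and> P (\<pi> (\<Sum>d\<in>D. restrict_support f d))"
    if "finite D" "D \<subseteq> tcoset ` Units G" for D
    using that
  proof (induction rule: finite_induct)
    case empty
    then show ?case using zero by (simp add: res_zero[OF core_ideal])
  next
    case (insert d D)
    let ?a = "restrict_support f d" and ?b = "\<Sum>d\<in>D. restrict_support f d"
    have a: "Poly_Mapping.keys ?a \<subseteq> Units G" using f by (auto simp: keys_restrict_support)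
    have b: "Poly_Mapping.keys ?b \<subseteq> Units G" "P (\<pi> ?b)" using insert by auto
    have "P (\<pi> ?a)" using piece insert.prems by auto
    then have "P (\<pi> ?a \<oplus>\<^bsub>R\<^esub> \<pi> ?b)" using add[OF B_I[OF a] B_I[OF b(1)]] b(2) by blast
    then have "P (\<pi> (?a + ?b))" using pi_add[OF keys_Units[OF a] keys_Units[OF b(1)]] by simp
    then show ?case using insert.hyps order_trans[OF keys_add Un_least[OF a b(1)]] by simp
  qed
  from this[of "tcoset ` Poly_Mapping.keys f"] f show ?thesis
    unfolding eq[symmetric] by (simp add: image_mono)
qed

lemma monomial_unit: "u \<in> Units G \<Longrightarrow> \<pi> (monomial u) \<in> B"
  by (rule B_I) simp

lemma nilpotent_pieces:
  assumes e: "e \<in> carrier R"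
    and f: "Poly_Mapping.keys f \<subseteq> Units G"
    and nil: "\<And>u. u \<in> Units G \<Longrightarrow> \<exists>a\<in>A. \<exists>n::nat. \<pi> (restrict_support f (tcoset u)) = \<pi> (monomial u) \<otimes>\<^bsub>R\<^esub> a \<and>
      a [^]\<^bsub>R\<^esub> n \<otimes>\<^bsub>R\<^esub> e = \<zero>\<^bsub>R\<^esub>"
  shows "\<exists>n::nat. \<pi> f [^]\<^bsub>R\<^esub> n \<otimes>\<^bsub>R\<^esub> e = \<zero>\<^bsub>R\<^esub>"
  using f
proof (rule pieces_induct)
  show "\<exists>n::nat. \<zero>\<^bsub>R\<^esub> [^]\<^bsub>R\<^esub> n \<otimes>\<^bsub>R\<^esub> e = \<zero>\<^bsub>R\<^esub>" using e by (intro exI[of _ 1]) simp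
  show "\<exists>n::nat. (a \<oplus>\<^bsub>R\<^esub> b) [^]\<^bsub>R\<^esub> n \<otimes>\<^bsub>R\<^esub> e = \<zero>\<^bsub>R\<^esub>"
    if "a \<in> B" "b \<in> B" "\<exists>n::nat. a [^]\<^bsub>R\<^esub> n \<otimes>\<^bsub>R\<^esub> e = \<zero>\<^bsub>R\<^esub>" "\<exists>n::nat. b [^]\<^bsub>R\<^esub> n \<otimes>\<^bsub>R\<^esub> e = \<zero>\<^bsub>R\<^esub>" for a b
    using that R.nilpotent_add[of a b e] e B_carrier by blast
  fix u assume u: "u \<in> Units G"
  obtain a and n :: nat where a: "a \<in> A" "\<pi> (restrict_support f (tcoset u)) = \<pi> (monomial u) \<otimes>\<^bsub>R\<^esub> a"
    "a [^]\<^bsub>R\<^esub> n \<otimes>\<^bsub>R\<^esub> e = \<zero>\<^bsub>R\<^esub>" using nil[OF u] by blast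
  have c: "a \<in> carrier R" "\<pi> (monomial u) \<in> carrier R"
    using Art.A_carrier a(1) pi_monomial_inv(2)[OF u] by blast+
  have "(\<pi> (monomial u) \<otimes>\<^bsub>R\<^esub> a) [^]\<^bsub>R\<^esub> n \<otimes>\<^bsub>R\<^esub> e = \<pi> (monomial u) [^]\<^bsub>R\<^esub> n \<otimes>\<^bsub>R\<^esub> (a [^]\<^bsub>R\<^esub> n \<otimes>\<^bsub>R\<^esub> e)"
    using c e by (simp add: R.nat_pow_distrib R.m_assoc)
  then show "\<exists>n::nat. \<pi> (restrict_support f (tcoset u)) [^]\<^bsub>R\<^esub> n \<otimes>\<^bsub>R\<^esub> e = \<zero>\<^bsub>R\<^esub>"
    using a c by (intro exI[of _ n]) simp
qed

text \<open>Applied to \<open>c e\<close>, the Artinian argument yields a multiple killed by every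
  element of \<open>A\<close> that is nilpotent on it, and whatever is nilpotent on \<open>e\<close>
  is nilpotent on this multiple.\<close>

lemma killed_multiple:
  assumes e: "R.primitive_idempotent A e" and c: "c \<in> B" "c \<otimes>\<^bsub>R\<^esub> e \<noteq> \<zero>\<^bsub>R\<^esub>"
  shows "\<exists>y\<in>A. y \<otimes>\<^bsub>R\<^esub> c \<otimes>\<^bsub>R\<^esub> e \<noteq> \<zero>\<^bsub>R\<^esub> \<and> (\<forall>x\<in>A. \<forall>n::nat. x [^]\<^bsub>R\<^esub> n \<otimes>\<^bsub>R\<^esub> e = \<zero>\<^bsub>R\<^esub> \<longrightarrow>
    x \<otimes>\<^bsub>R\<^esub> (y \<otimes>\<^bsub>R\<^esub> c \<otimes>\<^bsub>R\<^esub> e) = \<zero>\<^bsub>R\<^esub>)"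
proof -
  have ec: "e \<in> carrier R" and cc: "c \<in> carrier R" using primitive_carrier e B_carrier c by blast+
  obtain y where y: "y \<in> A" "y \<otimes>\<^bsub>R\<^esub> (c \<otimes>\<^bsub>R\<^esub> e) \<noteq> \<zero>\<^bsub>R\<^esub>"
    "\<And>x n. x \<in> A \<Longrightarrow> x [^]\<^bsub>R\<^esub> (n::nat) \<otimes>\<^bsub>R\<^esub> (y \<otimes>\<^bsub>R\<^esub> (c \<otimes>\<^bsub>R\<^esub> e)) = \<zero>\<^bsub>R\<^esub> \<Longrightarrow> x \<otimes>\<^bsub>R\<^esub> (y \<otimes>\<^bsub>R\<^esub> (c \<otimes>\<^bsub>R\<^esub> e)) = \<zero>\<^bsub>R\<^esub>"
    using Art.multiple_killed_by_nilpotents[of "c \<otimes>\<^bsub>R\<^esub> e"] c cc ec by auto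
  have yc: "y \<in> carrier R" using y Art.A_carrier by blast
  have "x \<otimes>\<^bsub>R\<^esub> (y \<otimes>\<^bsub>R\<^esub> c \<otimes>\<^bsub>R\<^esub> e) = \<zero>\<^bsub>R\<^esub>" if x: "x \<in> A" "x [^]\<^bsub>R\<^esub> (n::nat) \<otimes>\<^bsub>R\<^esub> e = \<zero>\<^bsub>R\<^esub>" for x n
  proof -
    have xc: "x \<in> carrier R" using x Art.A_carrier by blast
    have "x [^]\<^bsub>R\<^esub> n \<otimes>\<^bsub>R\<^esub> (y \<otimes>\<^bsub>R\<^esub> (c \<otimes>\<^bsub>R\<^esub> e)) = (y \<otimes>\<^bsub>R\<^esub> c) \<otimes>\<^bsub>R\<^esub> (x [^]\<^bsub>R\<^esub> n \<otimes>\<^bsub>R\<^esub> e)"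
      using xc yc cc ec by (simp add: R.m_ac)
    then show ?thesis using y(3)[OF x(1), of n] x(2) xc yc cc ec by (simp add: R.m_assoc)
  qed
  then show ?thesis using y(1,2) yc cc ec by (intro bexI[of _ y]) (auto simp: R.m_assoc)
qed

text \<open>A multiple \<open>y c\<close> killed by nilpotents replaces \<open>c\<close>, so that
  \<open>leading_term\<close> applies. All coset pieces of \<open>b\<close> are then nilpotent on
  \<open>e\<close>, and sums of nilpotents are nilpotent.\<close>

lemma primary_B:
  assumes e: "R.primitive_idempotent A e" and bc: "b \<in> B" "c \<in> B"
    and z: "b \<otimes>\<^bsub>R\<^esub> c \<otimes>\<^bsub>R\<^esub> e = \<zero>\<^bsub>R\<^esub>" and ne: "c \<otimes>\<^bsub>R\<^esub> e \<noteq> \<zero>\<^bsub>R\<^esub>"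
  shows "\<exists>n::nat. b [^]\<^bsub>R\<^esub> n \<otimes>\<^bsub>R\<^esub> e = \<zero>\<^bsub>R\<^esub>"
proof -
  have ec: "e \<in> carrier R" by (rule primitive_carrier[OF e])
  have carr: "b \<in> carrier R" "c \<in> carrier R" using B_carrier bc by auto
  obtain y where y: "y \<in> A" "y \<otimes>\<^bsub>R\<^esub> c \<otimes>\<^bsub>R\<^esub> e \<noteq> \<zero>\<^bsub>R\<^esub>" "\<And>x n. x \<in> A \<Longrightarrow> x [^]\<^bsub>R\<^esub> (n::nat) \<otimes>\<^bsub>R\<^esub> e = \<zero>\<^bsub>R\<^esub> \<Longrightarrow>
    x \<otimes>\<^bsub>R\<^esub> (y \<otimes>\<^bsub>R\<^esub> c \<otimes>\<^bsub>R\<^esub> e) = \<zero>\<^bsub>R\<^esub>" using killed_multiple[OF e bc(2) ne] by blast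
  have yc: "y \<in> carrier R" using y Art.A_carrier by blast
  obtain f :: "'a \<Rightarrow>\<^sub>0 'k" where f: "Poly_Mapping.keys f \<subseteq> Units G" "b = \<pi> f" using B_cases[OF bc(1)] .
  obtain h :: "'a \<Rightarrow>\<^sub>0 'k" where h: "Poly_Mapping.keys h \<subseteq> Units G" "y \<otimes>\<^bsub>R\<^esub> c = \<pi> h"
    using B_cases[OF B_mult[OF A_B[OF y(1)] bc(2)]] .
  have "b \<otimes>\<^bsub>R\<^esub> (y \<otimes>\<^bsub>R\<^esub> c \<otimes>\<^bsub>R\<^esub> e) = y \<otimes>\<^bsub>R\<^esub> (b \<otimes>\<^bsub>R\<^esub> c \<otimes>\<^bsub>R\<^esub> e)" using carr yc ec by (simp add: R.m_ac)
  then have "b \<otimes>\<^bsub>R\<^esub> (y \<otimes>\<^bsub>R\<^esub> c \<otimes>\<^bsub>R\<^esub> e) = \<zero>\<^bsub>R\<^esub>" using z yc by simp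
  then show ?thesis
    using leading_term[OF e f(1) h(1)] y(2,3) nilpotent_pieces[OF ec f(1)] unfolding h(2) f(2) by blast
qed

text \<open>The element \<open>s\<close> is a nonzero socle element of the local ring
  \<open>e A\<close>. By the double annihilator property it generates every element of degree zero
  killed by nilpotents; the general case goes piece by piece.\<close>

lemma socle_multiple:
  assumes e: "R.primitive_idempotent A e"
    and s: "s \<in> A" "s \<otimes>\<^bsub>R\<^esub> e = s" "s \<noteq> \<zero>\<^bsub>R\<^esub>"
      "\<And>x n. x \<in> A \<Longrightarrow> x [^]\<^bsub>R\<^esub> (n::nat) \<otimes>\<^bsub>R\<^esub> e = \<zero>\<^bsub>R\<^esub> \<Longrightarrow> x \<otimes>\<^bsub>R\<^esub> s = \<zero>\<^bsub>R\<^esub>"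
    and b: "b \<in> B" "\<And>x n. x \<in> A \<Longrightarrow> x [^]\<^bsub>R\<^esub> (n::nat) \<otimes>\<^bsub>R\<^esub> e = \<zero>\<^bsub>R\<^esub> \<Longrightarrow> x \<otimes>\<^bsub>R\<^esub> (b \<otimes>\<^bsub>R\<^esub> e) = \<zero>\<^bsub>R\<^esub>"
  shows "\<exists>b'\<in>B. b \<otimes>\<^bsub>R\<^esub> e = s \<otimes>\<^bsub>R\<^esub> b'"
proof -
  have ec: "e \<in> carrier R" and eA: "e \<in> A" using primitive_carrier[OF e] e by (auto simp: R.primitive_idempotent_def)
  have sc: "s \<in> carrier R" using s Art.A_carrier by blast
  obtain f :: "'a \<Rightarrow>\<^sub>0 'k" where f: "Poly_Mapping.keys f \<subseteq> Units G" "b = \<pi> f" using B_cases[OF b(1)] .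
  obtain fe :: "'a \<Rightarrow>\<^sub>0 'k" where fe: "Poly_Mapping.keys fe \<subseteq> KT" "e = \<pi> fe" using A_cases[OF eA] .
  \<comment> \<open>The multiplier \<open>x e\<close> has a representative supported on
    \<open>KT\<close>, so it respects the grading and annihilation passes from \<open>b\<close> to
    its pieces.\<close>
  have killed: "x \<otimes>\<^bsub>R\<^esub> (\<pi> (restrict_support f (tcoset u)) \<otimes>\<^bsub>R\<^esub> e) = \<zero>\<^bsub>R\<^esub>"
    if x: "x \<in> A" "x [^]\<^bsub>R\<^esub> (n::nat) \<otimes>\<^bsub>R\<^esub> e = \<zero>\<^bsub>R\<^esub>" and u: "u \<in> Units G" for x n u
  proof -
    obtain fx :: "'a \<Rightarrow>\<^sub>0 'k" where fx: "Poly_Mapping.keys fx \<subseteq> KT" "x = \<pi> fx" using A_cases[OF x(1)] .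
    let ?h = "conv G fx fe" and ?p = "restrict_support f (tcoset u)"
    have h: "Poly_Mapping.keys ?h \<subseteq> KT" by (rule conv_KT[OF fx(1) fe(1)])
    have pU: "Poly_Mapping.keys ?p \<subseteq> Units G" using f by (auto simp: keys_restrict_support)
    have eq: "\<pi> (conv G q ?h) = x \<otimes>\<^bsub>R\<^esub> (\<pi> q \<otimes>\<^bsub>R\<^esub> e)" if q: "Poly_Mapping.keys q \<subseteq> Units G" for q :: "'a \<Rightarrow>\<^sub>0 'k"
    proof -
      have "\<pi> (conv G q ?h) = \<pi> q \<otimes>\<^bsub>R\<^esub> (x \<otimes>\<^bsub>R\<^esub> e)"
        unfolding fx(2) fe(2) using q h fx fe
        by (simp add: pi_mult keys_Units keys_KT')
      then show ?thesis
        using pi_closed[OF keys_Units[OF q]] Art.A_carrier[OF x(1)] ec by (simp add: R.m_ac)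
    qed
    have cU: "Poly_Mapping.keys (conv G q ?h) \<subseteq> Units G" if "Poly_Mapping.keys q \<subseteq> Units G" for q :: "'a \<Rightarrow>\<^sub>0 'k"
      by (rule conv_Units[OF that keys_KT[OF h]])
    have "conv G f ?h \<in> core"
      using eq[OF f(1)] b(2)[OF x] pi_eq_zero[OF keys_Units[OF cU[OF f(1)]]] f(2) by simp
    then have "conv G ?p ?h \<in> core"
      using core_restrict[OF _ cU[OF f(1)] u] restrict_conv_KT[OF f(1) h u] by simp
    then show ?thesis
      using eq[OF pU] pi_eq_zero[OF keys_Units[OF cU[OF pU]]] by simp
  qed
  have "\<exists>b'\<in>B. \<pi> f \<otimes>\<^bsub>R\<^esub> e = s \<otimes>\<^bsub>R\<^esub> b'"
    using f(1)
  proof (rule pieces_induct)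
    have "\<zero>\<^bsub>R\<^esub> \<in> B" using A_B Art.A_closed(1) by blast
    then show "\<exists>b'\<in>B. \<zero>\<^bsub>R\<^esub> \<otimes>\<^bsub>R\<^esub> e = s \<otimes>\<^bsub>R\<^esub> b'" using ec sc by (intro bexI[of _ "\<zero>\<^bsub>R\<^esub>"]) auto
    show "\<exists>b'\<in>B. (p \<oplus>\<^bsub>R\<^esub> q) \<otimes>\<^bsub>R\<^esub> e = s \<otimes>\<^bsub>R\<^esub> b'"
      if pq0: "p \<in> B" "q \<in> B" "\<exists>b'\<in>B. p \<otimes>\<^bsub>R\<^esub> e = s \<otimes>\<^bsub>R\<^esub> b'" "\<exists>b'\<in>B. q \<otimes>\<^bsub>R\<^esub> e = s \<otimes>\<^bsub>R\<^esub> b'" for p q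
    proof -
      obtain p' q' where pq: "p' \<in> B" "q' \<in> B" "p \<otimes>\<^bsub>R\<^esub> e = s \<otimes>\<^bsub>R\<^esub> p'" "q \<otimes>\<^bsub>R\<^esub> e = s \<otimes>\<^bsub>R\<^esub> q'"
        using pq0(3,4) by blast
      then have "(p \<oplus>\<^bsub>R\<^esub> q) \<otimes>\<^bsub>R\<^esub> e = s \<otimes>\<^bsub>R\<^esub> (p' \<oplus>\<^bsub>R\<^esub> q')"
        using B_carrier \<open>p \<in> B\<close> \<open>q \<in> B\<close> ec sc by (simp add: R.l_distr R.r_distr)
      then show ?thesis using B_add[OF pq(1,2)] by blast
    qed
    fix u assume u: "u \<in> Units G"
    let ?m = "\<pi> (monomial u)" and ?m' = "\<pi> (monomial (inv u))"
    note m = pi_monomial_inv[OF u]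
    obtain a where a: "a \<in> A" "\<pi> (restrict_support f (tcoset u)) = ?m \<otimes>\<^bsub>R\<^esub> a"
      using homogeneous_piece[OF f(1) u] by blast
    have ac: "a \<in> carrier R" using a Art.A_carrier by blast
    \<comment> \<open>An \<open>x\<close> killing the nonzero \<open>s\<close> cannot be invertible
      on \<open>e\<close>; it is therefore nilpotent there and kills the piece.\<close>
    have "x \<otimes>\<^bsub>R\<^esub> (a \<otimes>\<^bsub>R\<^esub> e) = \<zero>\<^bsub>R\<^esub>" if x: "x \<in> A" "x \<otimes>\<^bsub>R\<^esub> s = \<zero>\<^bsub>R\<^esub>" for x
    proof -
      have xc: "x \<in> carrier R" using x Art.A_carrier by blast
      from Art.primitive_local[OF e x(1)] show ?thesis
      proof
        assume "\<exists>n::nat. x [^]\<^bsub>R\<^esub> n \<otimes>\<^bsub>R\<^esub> e = \<zero>\<^bsub>R\<^esub>"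
        then have "x \<otimes>\<^bsub>R\<^esub> ((?m \<otimes>\<^bsub>R\<^esub> a) \<otimes>\<^bsub>R\<^esub> e) = \<zero>\<^bsub>R\<^esub>" using killed[OF x(1) _ u] a(2) by auto
        then have "?m' \<otimes>\<^bsub>R\<^esub> (x \<otimes>\<^bsub>R\<^esub> ((?m \<otimes>\<^bsub>R\<^esub> a) \<otimes>\<^bsub>R\<^esub> e)) = \<zero>\<^bsub>R\<^esub>" using m by simp
        moreover have "?m' \<otimes>\<^bsub>R\<^esub> (x \<otimes>\<^bsub>R\<^esub> ((?m \<otimes>\<^bsub>R\<^esub> a) \<otimes>\<^bsub>R\<^esub> e)) = (?m \<otimes>\<^bsub>R\<^esub> ?m') \<otimes>\<^bsub>R\<^esub> (x \<otimes>\<^bsub>R\<^esub> (a \<otimes>\<^bsub>R\<^esub> e))"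
          using m(2,3) xc ac ec by (simp add: R.m_ac)
        ultimately show ?thesis using m(1) xc ac ec by simp
      next
        assume "\<exists>y\<in>A. x \<otimes>\<^bsub>R\<^esub> y \<otimes>\<^bsub>R\<^esub> e = e"
        then obtain y where y: "y \<in> A" "x \<otimes>\<^bsub>R\<^esub> y \<otimes>\<^bsub>R\<^esub> e = e" by blast
        have yc: "y \<in> carrier R" using y Art.A_carrier by blast
        have "s = s \<otimes>\<^bsub>R\<^esub> (x \<otimes>\<^bsub>R\<^esub> y \<otimes>\<^bsub>R\<^esub> e)" using y(2) s(2) by simp
        also have "\<dots> = y \<otimes>\<^bsub>R\<^esub> e \<otimes>\<^bsub>R\<^esub> (x \<otimes>\<^bsub>R\<^esub> s)" using sc xc yc ec by (simp add: R.m_ac)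
        also have "\<dots> = \<zero>\<^bsub>R\<^esub>" using x(2) yc ec by simp
        finally show ?thesis using s(3) by blast
      qed
    qed
    then obtain a' where a': "a' \<in> A" "a \<otimes>\<^bsub>R\<^esub> e = a' \<otimes>\<^bsub>R\<^esub> s"
      using double_annihilator[OF s(1) Art.A_closed(5)[OF a(1) eA]] by blast
    have "(?m \<otimes>\<^bsub>R\<^esub> a) \<otimes>\<^bsub>R\<^esub> e = s \<otimes>\<^bsub>R\<^esub> (?m \<otimes>\<^bsub>R\<^esub> a')"
    proof -
      have a'c: "a' \<in> carrier R" using a' Art.A_carrier by blast
      have "(?m \<otimes>\<^bsub>R\<^esub> a) \<otimes>\<^bsub>R\<^esub> e = ?m \<otimes>\<^bsub>R\<^esub> (a' \<otimes>\<^bsub>R\<^esub> s)" using m(2) ac ec a'(2) by (simp add: R.m_assoc)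
      also have "\<dots> = s \<otimes>\<^bsub>R\<^esub> (?m \<otimes>\<^bsub>R\<^esub> a')" using m(2) a'c sc by (simp add: R.m_ac)
      finally show ?thesis .
    qed
    then show "\<exists>b'\<in>B. \<pi> (restrict_support f (tcoset u)) \<otimes>\<^bsub>R\<^esub> e = s \<otimes>\<^bsub>R\<^esub> b'"
      using a(2) B_mult[OF monomial_unit[OF u] A_B[OF a'(1)]] by auto
  qed
  then show ?thesis using f(2) by simp
qed

lemma kill_by_nilpotent_pieces:
  assumes s: "s \<in> carrier R"
    and f: "Poly_Mapping.keys f \<subseteq> Units G"
    and nil: "\<And>u. u \<in> Units G \<Longrightarrow> \<exists>a\<in>A. \<pi> (restrict_support f (tcoset u)) = \<pi> (monomial u) \<otimes>\<^bsub>R\<^esub> a \<and>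
      a \<otimes>\<^bsub>R\<^esub> s = \<zero>\<^bsub>R\<^esub>"
  shows "\<pi> f \<otimes>\<^bsub>R\<^esub> s = \<zero>\<^bsub>R\<^esub>"
  using f
proof (rule pieces_induct)
  show "(a \<oplus>\<^bsub>R\<^esub> b) \<otimes>\<^bsub>R\<^esub> s = \<zero>\<^bsub>R\<^esub>"
    if "a \<in> B" "b \<in> B" "a \<otimes>\<^bsub>R\<^esub> s = \<zero>\<^bsub>R\<^esub>" "b \<otimes>\<^bsub>R\<^esub> s = \<zero>\<^bsub>R\<^esub>" for a b
    using that s B_carrier by (simp add: R.l_distr)
  fix u assume u: "u \<in> Units G"
  show "\<pi> (restrict_support f (tcoset u)) \<otimes>\<^bsub>R\<^esub> s = \<zero>\<^bsub>R\<^esub>"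
    using nil[OF u] pi_monomial_inv(2)[OF u] s Art.A_carrier by (auto simp: R.m_assoc)
qed (use s in simp)

text \<open>Nonzero multiples of \<open>b e\<close> and \<open>c e\<close> have the forms
  \<open>s b'\<close> and \<open>s c'\<close>, and cross multiplication yields a common multiple. If
  it vanished, \<open>leading_term\<close> would make all pieces of \<open>c'\<close> nilpotent on
  \<open>e\<close>; they would kill \<open>s\<close>, and \<open>s c'\<close> would be 0.\<close>

lemma irreducible_B:
  assumes e: "R.primitive_idempotent A e" and bc: "b \<in> B" "c \<in> B"
    and ne: "b \<otimes>\<^bsub>R\<^esub> e \<noteq> \<zero>\<^bsub>R\<^esub>" "c \<otimes>\<^bsub>R\<^esub> e \<noteq> \<zero>\<^bsub>R\<^esub>"
  shows "\<exists>x\<in>B. \<exists>y\<in>B. x \<otimes>\<^bsub>R\<^esub> b \<otimes>\<^bsub>R\<^esub> e = y \<otimes>\<^bsub>R\<^esub> c \<otimes>\<^bsub>R\<^esub> e \<and> x \<otimes>\<^bsub>R\<^esub> b \<otimes>\<^bsub>R\<^esub> e \<noteq> \<zero>\<^bsub>R\<^esub>"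
proof -
  have ec: "e \<in> carrier R" and eA: "e \<in> A" "e \<noteq> \<zero>\<^bsub>R\<^esub>"
    using primitive_carrier[OF e] e by (auto simp: R.primitive_idempotent_def)
  have carr: "b \<in> carrier R" "c \<in> carrier R" using B_carrier bc by auto
  have one: "\<one>\<^bsub>R\<^esub> \<in> B" using A_B Art.A_closed(2) by blast
  \<comment> \<open>The socle element \<open>s\<close> of \<open>e A\<close> arises from the same
    construction applied to 1.\<close>
  obtain y0 where y0: "y0 \<in> A" "y0 \<otimes>\<^bsub>R\<^esub> \<one>\<^bsub>R\<^esub> \<otimes>\<^bsub>R\<^esub> e \<noteq> \<zero>\<^bsub>R\<^esub>" "\<And>x n. x \<in> A \<Longrightarrow> x [^]\<^bsub>R\<^esub> (n::nat) \<otimes>\<^bsub>R\<^esub> e = \<zero>\<^bsub>R\<^esub> \<Longrightarrow>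
    x \<otimes>\<^bsub>R\<^esub> (y0 \<otimes>\<^bsub>R\<^esub> \<one>\<^bsub>R\<^esub> \<otimes>\<^bsub>R\<^esub> e) = \<zero>\<^bsub>R\<^esub>" using killed_multiple[OF e one] eA ec by auto
  obtain y1 where y1: "y1 \<in> A" "y1 \<otimes>\<^bsub>R\<^esub> b \<otimes>\<^bsub>R\<^esub> e \<noteq> \<zero>\<^bsub>R\<^esub>" "\<And>x n. x \<in> A \<Longrightarrow> x [^]\<^bsub>R\<^esub> (n::nat) \<otimes>\<^bsub>R\<^esub> e = \<zero>\<^bsub>R\<^esub> \<Longrightarrow>
    x \<otimes>\<^bsub>R\<^esub> (y1 \<otimes>\<^bsub>R\<^esub> b \<otimes>\<^bsub>R\<^esub> e) = \<zero>\<^bsub>R\<^esub>" using killed_multiple[OF e bc(1) ne(1)] by blast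
  obtain y2 where y2: "y2 \<in> A" "y2 \<otimes>\<^bsub>R\<^esub> c \<otimes>\<^bsub>R\<^esub> e \<noteq> \<zero>\<^bsub>R\<^esub>" "\<And>x n. x \<in> A \<Longrightarrow> x [^]\<^bsub>R\<^esub> (n::nat) \<otimes>\<^bsub>R\<^esub> e = \<zero>\<^bsub>R\<^esub> \<Longrightarrow>
    x \<otimes>\<^bsub>R\<^esub> (y2 \<otimes>\<^bsub>R\<^esub> c \<otimes>\<^bsub>R\<^esub> e) = \<zero>\<^bsub>R\<^esub>" using killed_multiple[OF e bc(2) ne(2)] by blast
  have yc: "y0 \<in> carrier R" "y1 \<in> carrier R" "y2 \<in> carrier R" using y0(1) y1(1) y2(1) Art.A_carrier by auto
  define s where "s = y0 \<otimes>\<^bsub>R\<^esub> e"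
  have s: "s \<in> A" "s \<otimes>\<^bsub>R\<^esub> e = s" "s \<noteq> \<zero>\<^bsub>R\<^esub>"
    "\<And>x n. x \<in> A \<Longrightarrow> x [^]\<^bsub>R\<^esub> (n::nat) \<otimes>\<^bsub>R\<^esub> e = \<zero>\<^bsub>R\<^esub> \<Longrightarrow> x \<otimes>\<^bsub>R\<^esub> s = \<zero>\<^bsub>R\<^esub>"
    using y0 yc ec eA(1) Art.A_closed(5)[of y0 e] primitive_idem[OF e] by (simp_all add: s_def R.m_assoc)
  have sc: "s \<in> carrier R" using s Art.A_carrier by blast
  have "\<exists>b'\<in>B. y1 \<otimes>\<^bsub>R\<^esub> b \<otimes>\<^bsub>R\<^esub> e = s \<otimes>\<^bsub>R\<^esub> b'"
  proof (rule socle_multiple[OF e s(1-3)])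
    show "x \<otimes>\<^bsub>R\<^esub> s = \<zero>\<^bsub>R\<^esub>" if "x \<in> A" "x [^]\<^bsub>R\<^esub> (n::nat) \<otimes>\<^bsub>R\<^esub> e = \<zero>\<^bsub>R\<^esub>" for x n
      by (rule s(4)[OF that])
    show "y1 \<otimes>\<^bsub>R\<^esub> b \<in> B" by (rule B_mult[OF A_B[OF y1(1)] bc(1)])
    show "x \<otimes>\<^bsub>R\<^esub> (y1 \<otimes>\<^bsub>R\<^esub> b \<otimes>\<^bsub>R\<^esub> e) = \<zero>\<^bsub>R\<^esub>"
      if "x \<in> A" "x [^]\<^bsub>R\<^esub> (n::nat) \<otimes>\<^bsub>R\<^esub> e = \<zero>\<^bsub>R\<^esub>" for x n
      by (rule y1(3)[OF that])
  qed
  then obtain b' where b': "b' \<in> B" "y1 \<otimes>\<^bsub>R\<^esub> b \<otimes>\<^bsub>R\<^esub> e = s \<otimes>\<^bsub>R\<^esub> b'" by blast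
  have "\<exists>c'\<in>B. y2 \<otimes>\<^bsub>R\<^esub> c \<otimes>\<^bsub>R\<^esub> e = s \<otimes>\<^bsub>R\<^esub> c'"
  proof (rule socle_multiple[OF e s(1-3)])
    show "x \<otimes>\<^bsub>R\<^esub> s = \<zero>\<^bsub>R\<^esub>" if "x \<in> A" "x [^]\<^bsub>R\<^esub> (n::nat) \<otimes>\<^bsub>R\<^esub> e = \<zero>\<^bsub>R\<^esub>" for x n
      by (rule s(4)[OF that])
    show "y2 \<otimes>\<^bsub>R\<^esub> c \<in> B" by (rule B_mult[OF A_B[OF y2(1)] bc(2)])
    show "x \<otimes>\<^bsub>R\<^esub> (y2 \<otimes>\<^bsub>R\<^esub> c \<otimes>\<^bsub>R\<^esub> e) = \<zero>\<^bsub>R\<^esub>"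
      if "x \<in> A" "x [^]\<^bsub>R\<^esub> (n::nat) \<otimes>\<^bsub>R\<^esub> e = \<zero>\<^bsub>R\<^esub>" for x n
      by (rule y2(3)[OF that])
  qed
  then obtain c' where c': "c' \<in> B" "y2 \<otimes>\<^bsub>R\<^esub> c \<otimes>\<^bsub>R\<^esub> e = s \<otimes>\<^bsub>R\<^esub> c'" by blast
  have c'c: "c' \<in> carrier R" "b' \<in> carrier R" using c' b' B_carrier by blast+
  have eq1: "(c' \<otimes>\<^bsub>R\<^esub> y1) \<otimes>\<^bsub>R\<^esub> b \<otimes>\<^bsub>R\<^esub> e = c' \<otimes>\<^bsub>R\<^esub> (y1 \<otimes>\<^bsub>R\<^esub> b \<otimes>\<^bsub>R\<^esub> e)"
    using c'c yc carr ec by (simp add: R.m_assoc)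
  have eq2: "(b' \<otimes>\<^bsub>R\<^esub> y2) \<otimes>\<^bsub>R\<^esub> c \<otimes>\<^bsub>R\<^esub> e = b' \<otimes>\<^bsub>R\<^esub> (y2 \<otimes>\<^bsub>R\<^esub> c \<otimes>\<^bsub>R\<^esub> e)"
    using c'c yc carr ec by (simp add: R.m_assoc)
  have "c' \<otimes>\<^bsub>R\<^esub> (s \<otimes>\<^bsub>R\<^esub> b') = b' \<otimes>\<^bsub>R\<^esub> (s \<otimes>\<^bsub>R\<^esub> c')" using c'c sc by (simp add: R.m_ac)
  then have eq: "(c' \<otimes>\<^bsub>R\<^esub> y1) \<otimes>\<^bsub>R\<^esub> b \<otimes>\<^bsub>R\<^esub> e = (b' \<otimes>\<^bsub>R\<^esub> y2) \<otimes>\<^bsub>R\<^esub> c \<otimes>\<^bsub>R\<^esub> e"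
    unfolding eq1 eq2 b'(2) c'(2) .
  have "(c' \<otimes>\<^bsub>R\<^esub> y1) \<otimes>\<^bsub>R\<^esub> b \<otimes>\<^bsub>R\<^esub> e \<noteq> \<zero>\<^bsub>R\<^esub>"
  proof
    assume "(c' \<otimes>\<^bsub>R\<^esub> y1) \<otimes>\<^bsub>R\<^esub> b \<otimes>\<^bsub>R\<^esub> e = \<zero>\<^bsub>R\<^esub>"
    then have z: "c' \<otimes>\<^bsub>R\<^esub> (y1 \<otimes>\<^bsub>R\<^esub> b \<otimes>\<^bsub>R\<^esub> e) = \<zero>\<^bsub>R\<^esub>" using eq1 by simp
    obtain f :: "'a \<Rightarrow>\<^sub>0 'k" where f: "Poly_Mapping.keys f \<subseteq> Units G" "c' = \<pi> f" using B_cases[OF c'(1)] .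
    obtain h :: "'a \<Rightarrow>\<^sub>0 'k" where h: "Poly_Mapping.keys h \<subseteq> Units G" "y1 \<otimes>\<^bsub>R\<^esub> b = \<pi> h"
      using B_cases[OF B_mult[OF A_B[OF y1(1)] bc(1)]] .
    have "\<exists>a\<in>A. \<pi> (restrict_support f (tcoset u)) = \<pi> (monomial u) \<otimes>\<^bsub>R\<^esub> a \<and> a \<otimes>\<^bsub>R\<^esub> s = \<zero>\<^bsub>R\<^esub>"
      if u: "u \<in> Units G" for u
      using leading_term[OF e f(1) h(1) _ _ _ u] y1(2,3) z s(4) unfolding h(2) f(2) by blast
    then have "c' \<otimes>\<^bsub>R\<^esub> s = \<zero>\<^bsub>R\<^esub>" using kill_by_nilpotent_pieces[OF sc f(1)] f(2) by blast
    then show False using c'(2) y2(2) R.m_comm[OF sc c'c(1)] by simp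
  qed
  then show ?thesis
    using eq B_mult[OF c'(1) A_B[OF y1(1)]] B_mult[OF b'(1) A_B[OF y2(1)]] by blast
qed

section \<open>The socle\<close>

lemma nonunit_mult: "p \<in> carrier G \<Longrightarrow> p \<notin> Units G \<Longrightarrow> z \<in> carrier G \<Longrightarrow> p \<otimes> z \<notin> Units G"
  using Units_factor by blast

text \<open>If every \<open>h n\<close> were outside \<open>core\<close>, each would be seen by a
  cofactor \<open>x n\<close>, and divisibility among the cofactors would give
  \<open>x j = x i \<otimes> z\<close> with \<open>i < j\<close>. Passing from
  \<open>h i \<otimes> x i\<close> to \<open>h j \<otimes> x j\<close> multiplies by a nonunit,
  which \<open>\<psi>\<close> kills. This takes the role of nilpotency of the maximal ideal.\<close>

lemma nonunit_products_vanish: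
  fixes h p :: "nat \<Rightarrow> 'a"
  assumes h0: "h 0 \<in> carrier G" and p: "\<And>n. p n \<in> carrier G \<and> p n \<notin> Units G"
    and step: "\<And>n. h (Suc n) = p n \<otimes> h n"
  shows "\<exists>n. (monomial (h n) :: 'a \<Rightarrow>\<^sub>0 'k) \<in> core"
proof (rule ccontr)
  assume not: "\<not> ?thesis"
  have hc: "h n \<in> carrier G" for n by (induction n) (use h0 p step in auto)
  have "\<exists>x\<in>carrier G. \<psi> (h n \<otimes> x) \<noteq> 0" for n
  proof (rule ccontr)
    assume "\<not> ?thesis"
    then have "\<psi> (x \<otimes> h n) = 0" if "x \<in> carrier G" for x using that m_comm[OF hc that] by metis
    then have "(monomial (h n) :: 'a \<Rightarrow>\<^sub>0 'k) \<in> core" using hc by (simp add: core_def)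
    then show False using not by blast
  qed
  then obtain x where x: "\<And>n. x n \<in> carrier G" "\<And>n. \<psi> (h n \<otimes> x n) \<noteq> 0" by metis
  obtain i j z where ij: "i < j" "z \<in> carrier G" "x j = x i \<otimes> z"
    using dickson x(1) unfolding dickson_property_def by (metis image_subsetI)
  have "\<exists>q\<in>carrier G - Units G. h (i + Suc k) = q \<otimes> h i" for k
  proof (induction k)
    case 0
    then show ?case using p[of i] step[of i] by auto
  next
    case (Suc k)
    then obtain q where q: "q \<in> carrier G - Units G" "h (i + Suc k) = q \<otimes> h i" by blast
    then have "h (i + Suc (Suc k)) = (p (i + Suc k) \<otimes> q) \<otimes> h i"
      using step[of "i + Suc k"] p[of "i + Suc k"] hc by (simp add: m_assoc)
    moreover have "p (i + Suc k) \<otimes> q \<in> carrier G - Units G"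
      using nonunit_mult p[of "i + Suc k"] q by auto
    ultimately show ?case by blast
  qed
  from this[of "j - Suc i"] ij(1) obtain q where q: "q \<in> carrier G" "q \<notin> Units G" "h j = q \<otimes> h i" by auto
  have "h j \<otimes> x j = (q \<otimes> z) \<otimes> (h i \<otimes> x i)"
    using q ij hc[of i] x(1)[of i] by (simp add: m_ac)
  then have "\<psi> (h j \<otimes> x j) = \<psi> (h i \<otimes> x i) * \<psi> ((q \<otimes> z) \<otimes> w)"
    using \<psi>_shift[of "q \<otimes> z" "h i \<otimes> x i"] q ij hc[of i] x by simp
  then show False using nonunit[of "q \<otimes> z"] nonunit_mult[of q z] q ij x(2)[of j] by simp
qed

lemma core_nonunit_w:
  assumes "p \<in> carrier G" "p \<notin> Units G"
  shows "conv G (Poly_Mapping.single p c) (monomial w) \<in> core"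
proof -
  have "\<psi> (x \<otimes> (p \<otimes> w)) = 0" if "x \<in> carrier G" for x
    using nonunit[of "p \<otimes> x"] nonunit_mult[OF assms that] assms that by (simp add: m_ac)
  then show ?thesis using assms by (simp add: core_def)
qed

abbreviation "\<omega> \<equiv> \<pi> (monomial w)"

text \<open>A monomial multiple is chosen that is nonzero while all its nonunit monomial multiples
  vanish; it exists since products of nonunits reach \<open>core\<close>. Only unit tests can detect
  it, and to these it looks like some \<open>b t^w\<close>.\<close>

lemma socle_nonzero_multiple:
  assumes r: "r \<in> carrier R" "r \<noteq> \<zero>\<^bsub>R\<^esub>"
  shows "\<exists>x\<in>carrier R. \<exists>b\<in>B. x \<otimes>\<^bsub>R\<^esub> r = b \<otimes>\<^bsub>R\<^esub> \<omega> \<and> x \<otimes>\<^bsub>R\<^esub> r \<noteq> \<zero>\<^bsub>R\<^esub>"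
proof -
  obtain f where f: "Poly_Mapping.keys f \<subseteq> carrier G" "r = \<pi> f" using pi_cases[OF r(1)] .
  have f0: "f \<notin> core" using r(2) f pi_eq_zero by blast
  let ?good = "\<lambda>x. x \<in> carrier G \<and> conv G (monomial x) f \<notin> core"
  have "\<exists>x. ?good x \<and> (\<forall>p\<in>carrier G - Units G. conv G (monomial (p \<otimes> x)) f \<in> core)"
  proof (rule ccontr)
    assume not: "\<not> ?thesis"
    have step: "\<exists>y. ?good y \<and> (\<exists>p. p \<in> carrier G \<and> p \<notin> Units G \<and> y = p \<otimes> x)" if x: "?good x" for x
    proof -
      have "\<not> (\<forall>p\<in>carrier G - Units G. conv G (monomial (p \<otimes> x)) f \<in> core)" using not x by blast
      then obtain p where "p \<in> carrier G - Units G" "conv G (monomial (p \<otimes> x)) f \<notin> core" by blast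
      then show ?thesis using x by (intro exI[of _ "p \<otimes> x"]) auto
    qed
    have "\<exists>h. \<forall>n::nat. ?good (h n) \<and> (\<exists>p. p \<in> carrier G \<and> p \<notin> Units G \<and> h (Suc n) = p \<otimes> h n)"
    proof (rule dependent_nat_choice)
      show "\<exists>x. ?good x" using f0 f(1) by (intro exI[of _ \<one>]) (simp add: conv_one)
    qed (use step in blast)
    then obtain h where h: "\<And>n::nat. ?good (h n)"
      "\<And>n. \<exists>p. p \<in> carrier G \<and> p \<notin> Units G \<and> h (Suc n) = p \<otimes> h n" by blast
    from h(2) obtain p where p: "\<And>n. p n \<in> carrier G \<and> p n \<notin> Units G" "\<And>n. h (Suc n) = p n \<otimes> h n" by metis
    obtain n where "(monomial (h n) :: 'a \<Rightarrow>\<^sub>0 'k) \<in> core"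
      using nonunit_products_vanish[of h p] h(1) p by blast
    then have "conv G f (monomial (h n)) \<in> core" using ideal_conv[OF core_ideal _ f(1)] by blast
    then show False using h(1)[of n] conv_comm[of f "monomial (h n)"] f(1) by simp
  qed
  then obtain x where x: "x \<in> carrier G" "conv G (monomial x) f \<notin> core"
    "\<And>p. p \<in> carrier G \<Longrightarrow> p \<notin> Units G \<Longrightarrow> conv G (monomial (p \<otimes> x)) f \<in> core" by blast
  define f' where "f' = conv G (monomial x) f"
  have f': "Poly_Mapping.keys f' \<subseteq> carrier G" unfolding f'_def using x(1) f(1) by (intro conv_closed) auto
  obtain b where b: "Poly_Mapping.keys b \<subseteq> Units G" "\<And>v. v \<in> Units G \<Longrightarrow> pr v f' = pr v (conv G b (monomial w))"
    using unit_part[OF f'] by blast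
  have bc: "Poly_Mapping.keys (conv G b (monomial w)) \<subseteq> carrier G"
    using keys_Units[OF b(1)] by (intro conv_closed) auto
  \<comment> \<open>Unit tests agree by the choice of \<open>b\<close>. Nonunit tests vanish on
    \<open>f'\<close> by the choice of \<open>x\<close>, and on \<open>b t^w\<close> because
    \<open>\<psi>\<close> is 0 on nonunit multiples of \<open>w\<close>.\<close>
  have "f' - conv G b (monomial w) \<in> core"
    unfolding core_def mem_Collect_eq
  proof (intro conjI ballI)
    show "Poly_Mapping.keys (f' - conv G b (monomial w)) \<subseteq> carrier G"
      using order_trans[OF keys_minus Un_least[OF f' bc]] .
    fix p assume p: "p \<in> carrier G"
    show "pr p (f' - conv G b (monomial w)) = 0"
    proof (cases "p \<in> Units G")
      case True
      then show ?thesis using b(2) by (simp add: pr_diff)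
    next
      case False
      have "conv G (monomial p) f' = conv G (monomial (p \<otimes> x)) f"
        unfolding f'_def using p x(1) f(1) conv_assoc[of "monomial p" "monomial x" f] by simp
      then have "conv G (monomial p) f' \<in> core" using x(3)[OF p False] by simp
      then have "pr \<one> (conv G (monomial p) f') = 0" by (simp add: core_def)
      then have "pr p f' = 0" using pr_conv[of \<one> p f' 1] p f' by simp
      moreover have "pr p (conv G b (monomial w)) = 0"
      proof -
        have "\<psi> (p \<otimes> w \<otimes> u) = 0" if "u \<in> Poly_Mapping.keys b" for u
        proof -
          have u: "u \<in> carrier G" using that b(1) Units_subset by blast
          have "p \<otimes> w \<otimes> u = (p \<otimes> u) \<otimes> w" using p u by (simp add: m_ac)
          then show ?thesis using nonunit[of "p \<otimes> u"] nonunit_mult[OF p False u] p u by simp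
        qed
        then have "pr (p \<otimes> w) b = 0" unfolding keysum_def by (intro sum.neutral) auto
        then show ?thesis using pr_conv_w[OF p keys_Units[OF b(1)]] by simp
      qed
      ultimately show ?thesis by (simp add: pr_diff)
    qed
  qed
  then have 1: "\<pi> f' = \<pi> (conv G b (monomial w))" using pi_eq[OF f' bc] by simp
  have 2: "\<pi> f' = \<pi> (monomial x) \<otimes>\<^bsub>R\<^esub> r"
    unfolding f'_def f(2) using x(1) f(1) by (simp add: pi_mult)
  have 3: "\<pi> (conv G b (monomial w)) = \<pi> b \<otimes>\<^bsub>R\<^esub> \<omega>"
    using pi_mult[OF keys_Units[OF b(1)], of "monomial w"] by simp
  have 4: "\<pi> f' \<noteq> \<zero>\<^bsub>R\<^esub>" using pi_eq_zero[OF f'] x(2) by (simp add: f'_def)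
  have 5: "\<pi> (monomial x) \<in> carrier R" using x(1) by (intro pi_closed) simp
  have "\<pi> (monomial x) \<otimes>\<^bsub>R\<^esub> r = \<pi> b \<otimes>\<^bsub>R\<^esub> \<omega> \<and> \<pi> (monomial x) \<otimes>\<^bsub>R\<^esub> r \<noteq> \<zero>\<^bsub>R\<^esub>"
    using 1 3 4 unfolding 2 by simp
  then have "\<exists>b\<in>B. \<pi> (monomial x) \<otimes>\<^bsub>R\<^esub> r = b \<otimes>\<^bsub>R\<^esub> \<omega> \<and> \<pi> (monomial x) \<otimes>\<^bsub>R\<^esub> r \<noteq> \<zero>\<^bsub>R\<^esub>"
    using B_I[OF b(1)] by (rule bexI)
  then show ?thesis using 5 by (rule bexI)
qed

lemma \<omega>_cancel:
  assumes "b \<in> B" "b \<otimes>\<^bsub>R\<^esub> \<omega> = \<zero>\<^bsub>R\<^esub>"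
  shows "b = \<zero>\<^bsub>R\<^esub>"
proof -
  obtain f :: "'a \<Rightarrow>\<^sub>0 'k" where f: "Poly_Mapping.keys f \<subseteq> Units G" "b = \<pi> f" using B_cases[OF assms(1)] .
  have "Poly_Mapping.keys (conv G f (monomial w)) \<subseteq> carrier G"
    using keys_Units[OF f(1)] by (intro conv_closed) auto
  then have "conv G f (monomial w) \<in> core"
    using assms(2) f pi_mult[OF keys_Units[OF f(1)], of "monomial w"] pi_eq_zero by simp
  then show ?thesis using core_cancel_w[OF f(1)] pi_eq_zero[OF keys_Units[OF f(1)]] f(2) by simp
qed

lemma \<omega>_closed: "\<omega> \<in> carrier R"
  by (intro pi_closed) simp

text \<open>Unit monomials contribute to \<open>B\<close>. A nonunit monomial annihilates
  \<open>\<omega>\<close>, and it is nilpotent because its powers are products of nonunits and reach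
  \<open>core\<close>; sums of such elements stay nilpotent.\<close>

lemma unit_decomposition:
  assumes r: "r \<in> carrier R"
  shows "\<exists>b\<in>B. \<exists>n\<in>carrier R. r = b \<oplus>\<^bsub>R\<^esub> n \<and> n \<otimes>\<^bsub>R\<^esub> \<omega> = \<zero>\<^bsub>R\<^esub> \<and> (\<exists>k::nat. n [^]\<^bsub>R\<^esub> k = \<zero>\<^bsub>R\<^esub>)"
proof -
  let ?P = "\<lambda>r. \<exists>b\<in>B. \<exists>n\<in>carrier R. r = b \<oplus>\<^bsub>R\<^esub> n \<and> n \<otimes>\<^bsub>R\<^esub> \<omega> = \<zero>\<^bsub>R\<^esub> \<and> (\<exists>k::nat. n [^]\<^bsub>R\<^esub> k = \<zero>\<^bsub>R\<^esub>)"
  have zB: "\<zero>\<^bsub>R\<^esub> \<in> B" using A_B Art.A_closed(1) by blast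
  have z1: "\<zero>\<^bsub>R\<^esub> [^]\<^bsub>R\<^esub> (1::nat) = \<zero>\<^bsub>R\<^esub>" by simp
  obtain f where f: "Poly_Mapping.keys f \<subseteq> carrier G" "r = \<pi> f" using pi_cases[OF r] .
  have "?P (\<pi> f)"
    using f(1)
  proof (induction rule: poly_mapping_keys_induct)
    case zero
    have "\<pi> 0 = \<zero>\<^bsub>R\<^esub> \<oplus>\<^bsub>R\<^esub> \<zero>\<^bsub>R\<^esub>" by (simp add: res_zero[OF core_ideal, symmetric])
    then show ?case using zB z1 \<omega>_closed R.l_null R.zero_closed by blast
  next
    case (single p c)
    have pc: "\<pi> (Poly_Mapping.single p c) \<in> carrier R" using single by (intro pi_closed) simp
    show ?case
    proof (cases "p \<in> Units G")
      case True
      then have "\<pi> (Poly_Mapping.single p c) \<in> B" by (intro B_I) simp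
      moreover have "\<pi> (Poly_Mapping.single p c) = \<pi> (Poly_Mapping.single p c) \<oplus>\<^bsub>R\<^esub> \<zero>\<^bsub>R\<^esub>" using pc by simp
      ultimately show ?thesis using z1 \<omega>_closed R.l_null R.zero_closed by blast
    next
      case False
      let ?s = "Poly_Mapping.single p c"
      have "\<pi> ?s \<otimes>\<^bsub>R\<^esub> \<omega> = \<pi> (conv G ?s (monomial w))" using single by (simp add: pi_mult)
      moreover have "conv G ?s (monomial w) \<in> core" by (rule core_nonunit_w[OF single False])
      ultimately have "\<pi> ?s \<otimes>\<^bsub>R\<^esub> \<omega> = \<zero>\<^bsub>R\<^esub>"
        using pi_eq_zero ideal_keys[OF core_ideal] by metis
      moreover have "\<exists>k::nat. \<pi> ?s [^]\<^bsub>R\<^esub> k = \<zero>\<^bsub>R\<^esub>"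
      proof -
        have pow: "\<pi> ?s [^]\<^bsub>R\<^esub> (k::nat) = \<pi> (Poly_Mapping.single (p [^] k) (c ^ k))" for k
        proof (induction k)
          case (Suc k)
          have "\<pi> ?s [^]\<^bsub>R\<^esub> Suc k = \<pi> (conv G (Poly_Mapping.single (p [^] k) (c ^ k)) ?s)"
            using Suc single pi_mult[of "Poly_Mapping.single (p [^] k) (c ^ k)" ?s] by simp
          then show ?case by (simp add: mult.commute)
        qed (simp add: pi_one)
        obtain k :: nat where "(monomial (p [^] k) :: 'a \<Rightarrow>\<^sub>0 'k) \<in> core"
          using nonunit_products_vanish[of "\<lambda>k. p [^] k" "\<lambda>_. p"] single False m_comm by auto
        then have "conv G (Poly_Mapping.single \<one> (c ^ k)) (monomial (p [^] k)) \<in> core"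
          by (intro ideal_conv[OF core_ideal]) auto
        then have "Poly_Mapping.single (p [^] k) (c ^ k) \<in> core" using single by simp
        then have "\<pi> ?s [^]\<^bsub>R\<^esub> k = \<zero>\<^bsub>R\<^esub>" unfolding pow using pi_eq_zero ideal_keys[OF core_ideal] by metis
        then show ?thesis by blast
      qed
      moreover have "\<pi> ?s = \<zero>\<^bsub>R\<^esub> \<oplus>\<^bsub>R\<^esub> \<pi> ?s" using pc by simp
      ultimately show ?thesis using zB pc by blast
    qed
  next
    case (add f g)
    obtain b n and k :: nat where bn: "b \<in> B" "n \<in> carrier R" "\<pi> f = b \<oplus>\<^bsub>R\<^esub> n" "n \<otimes>\<^bsub>R\<^esub> \<omega> = \<zero>\<^bsub>R\<^esub>" "n [^]\<^bsub>R\<^esub> k = \<zero>\<^bsub>R\<^esub>"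
      using add by blast
    obtain b' n' and k' :: nat where bn': "b' \<in> B" "n' \<in> carrier R" "\<pi> g = b' \<oplus>\<^bsub>R\<^esub> n'" "n' \<otimes>\<^bsub>R\<^esub> \<omega> = \<zero>\<^bsub>R\<^esub>" "n' [^]\<^bsub>R\<^esub> k' = \<zero>\<^bsub>R\<^esub>"
      using add by blast
    have c: "b \<in> carrier R" "b' \<in> carrier R" using bn bn' B_carrier by auto
    have "\<pi> (f + g) = (b \<oplus>\<^bsub>R\<^esub> b') \<oplus>\<^bsub>R\<^esub> (n \<oplus>\<^bsub>R\<^esub> n')"
      using pi_add[OF add(1,2)] bn bn' c by (simp add: R.a_ac)
    moreover have "(n \<oplus>\<^bsub>R\<^esub> n') \<otimes>\<^bsub>R\<^esub> \<omega> = \<zero>\<^bsub>R\<^esub>" using bn bn' \<omega>_closed by (simp add: R.l_distr)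
    moreover have "(n \<oplus>\<^bsub>R\<^esub> n') [^]\<^bsub>R\<^esub> (k + k') = \<zero>\<^bsub>R\<^esub>"
      using R.nilpotent_add[of n n' "\<one>\<^bsub>R\<^esub>" k k'] bn bn' by simp
    ultimately show ?case using B_add[OF bn(1) bn'(1)] bn(2) bn'(2) R.a_closed by blast
  qed
  then show ?thesis using f(2) by simp
qed

text \<open>A multiple of \<open>a e\<close> has the form \<open>c \<omega>\<close> with
  \<open>c\<close> in \<open>B\<close>, and the nilpotent part of \<open>b\<close> acts on
  \<open>\<omega>\<close> as zero. Cancelling \<open>\<omega>\<close> leaves a relation in
  \<open>B\<close>, where \<open>primary_B\<close> applies; the nilpotent part is added back at the
  end.\<close>

lemma annihilator_primary:
  assumes e: "R.primitive_idempotent A e" and ab: "a \<in> carrier R" "b \<in> carrier R"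
    and z: "a \<otimes>\<^bsub>R\<^esub> b \<otimes>\<^bsub>R\<^esub> e = \<zero>\<^bsub>R\<^esub>" and ne: "a \<otimes>\<^bsub>R\<^esub> e \<noteq> \<zero>\<^bsub>R\<^esub>"
  shows "\<exists>n::nat. b [^]\<^bsub>R\<^esub> n \<otimes>\<^bsub>R\<^esub> e = \<zero>\<^bsub>R\<^esub>"
proof -
  have ec: "e \<in> carrier R" "e \<in> A" "e \<otimes>\<^bsub>R\<^esub> e = e" using primitive_carrier e by (auto simp: R.primitive_idempotent_def)
  obtain x c where x: "x \<in> carrier R" "c \<in> B" "x \<otimes>\<^bsub>R\<^esub> (a \<otimes>\<^bsub>R\<^esub> e) = c \<otimes>\<^bsub>R\<^esub> \<omega>" "x \<otimes>\<^bsub>R\<^esub> (a \<otimes>\<^bsub>R\<^esub> e) \<noteq> \<zero>\<^bsub>R\<^esub>"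
    using socle_nonzero_multiple[OF R.m_closed[OF ab(1) ec(1)] ne] by blast
  have cc: "c \<in> carrier R" using x B_carrier by blast
  have cwe: "c \<otimes>\<^bsub>R\<^esub> \<omega> \<otimes>\<^bsub>R\<^esub> e = c \<otimes>\<^bsub>R\<^esub> \<omega>"
  proof -
    have "c \<otimes>\<^bsub>R\<^esub> \<omega> \<otimes>\<^bsub>R\<^esub> e = x \<otimes>\<^bsub>R\<^esub> (a \<otimes>\<^bsub>R\<^esub> (e \<otimes>\<^bsub>R\<^esub> e))"
      unfolding x(3)[symmetric] using x(1) ab ec(1) by (simp add: R.m_assoc)
    then show ?thesis using x(3) ec(3) by simp
  qed
  have cne: "c \<otimes>\<^bsub>R\<^esub> e \<noteq> \<zero>\<^bsub>R\<^esub>"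
  proof
    assume "c \<otimes>\<^bsub>R\<^esub> e = \<zero>\<^bsub>R\<^esub>"
    then have "c \<otimes>\<^bsub>R\<^esub> \<omega> \<otimes>\<^bsub>R\<^esub> e = \<zero>\<^bsub>R\<^esub>"
      using cc ec \<omega>_closed by (metis R.m_assoc R.m_comm R.r_null)
    then show False using cwe x by simp
  qed
  obtain b0 n and k :: nat where b0: "b0 \<in> B" "n \<in> carrier R" "b = b0 \<oplus>\<^bsub>R\<^esub> n" "n \<otimes>\<^bsub>R\<^esub> \<omega> = \<zero>\<^bsub>R\<^esub>" "n [^]\<^bsub>R\<^esub> k = \<zero>\<^bsub>R\<^esub>"
    using unit_decomposition[OF ab(2)] by blast
  have b0c: "b0 \<in> carrier R" using b0 B_carrier by blast
  have "b \<otimes>\<^bsub>R\<^esub> (c \<otimes>\<^bsub>R\<^esub> \<omega>) = x \<otimes>\<^bsub>R\<^esub> (a \<otimes>\<^bsub>R\<^esub> b \<otimes>\<^bsub>R\<^esub> e)"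
    unfolding x(3)[symmetric] using x(1) ab ec(1) by (simp add: R.m_ac)
  then have "b \<otimes>\<^bsub>R\<^esub> (c \<otimes>\<^bsub>R\<^esub> \<omega>) = \<zero>\<^bsub>R\<^esub>" using z x(1) by simp
  moreover have "b \<otimes>\<^bsub>R\<^esub> (c \<otimes>\<^bsub>R\<^esub> \<omega>) = (b0 \<otimes>\<^bsub>R\<^esub> c) \<otimes>\<^bsub>R\<^esub> \<omega> \<oplus>\<^bsub>R\<^esub> c \<otimes>\<^bsub>R\<^esub> (n \<otimes>\<^bsub>R\<^esub> \<omega>)"
    unfolding b0(3) R.l_distr[OF b0c b0(2) R.m_closed[OF cc \<omega>_closed]]
    using b0c b0(2) cc \<omega>_closed by (simp add: R.m_ac)
  ultimately have "(b0 \<otimes>\<^bsub>R\<^esub> c) \<otimes>\<^bsub>R\<^esub> \<omega> = \<zero>\<^bsub>R\<^esub>" using b0(4) cc b0c \<omega>_closed by simp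
  then have "b0 \<otimes>\<^bsub>R\<^esub> c = \<zero>\<^bsub>R\<^esub>" by (rule \<omega>_cancel[OF B_mult[OF b0(1) x(2)]])
  then have "b0 \<otimes>\<^bsub>R\<^esub> c \<otimes>\<^bsub>R\<^esub> e = \<zero>\<^bsub>R\<^esub>" using ec by simp
  then obtain m :: nat where "b0 [^]\<^bsub>R\<^esub> m \<otimes>\<^bsub>R\<^esub> e = \<zero>\<^bsub>R\<^esub>" using primary_B[OF e b0(1) x(2) _ cne] by blast
  moreover have "n [^]\<^bsub>R\<^esub> k \<otimes>\<^bsub>R\<^esub> e = \<zero>\<^bsub>R\<^esub>" using b0(5) ec by simp
  ultimately show ?thesis using R.nilpotent_add[OF b0c b0(2) ec(1)] b0(3) by blast
qed

text \<open>Both elements are first moved into \<open>B e \<omega>\<close>. A common nonzero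
  multiple of the coefficients stays nonzero after multiplication by \<open>\<omega>\<close>, which
  is injective on \<open>B\<close>.\<close>

lemma annihilator_irreducible:
  assumes e: "R.primitive_idempotent A e" and ab: "a \<in> carrier R" "b \<in> carrier R"
    and ne: "a \<otimes>\<^bsub>R\<^esub> e \<noteq> \<zero>\<^bsub>R\<^esub>" "b \<otimes>\<^bsub>R\<^esub> e \<noteq> \<zero>\<^bsub>R\<^esub>"
  shows "\<exists>x\<in>carrier R. \<exists>y\<in>carrier R. x \<otimes>\<^bsub>R\<^esub> a \<otimes>\<^bsub>R\<^esub> e = y \<otimes>\<^bsub>R\<^esub> b \<otimes>\<^bsub>R\<^esub> e \<and> x \<otimes>\<^bsub>R\<^esub> a \<otimes>\<^bsub>R\<^esub> e \<noteq> \<zero>\<^bsub>R\<^esub>"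
proof -
  have ec: "e \<in> carrier R" "e \<in> A" "e \<otimes>\<^bsub>R\<^esub> e = e" using primitive_carrier e by (auto simp: R.primitive_idempotent_def)
  have red: "\<exists>x\<in>carrier R. \<exists>c\<in>B. x \<otimes>\<^bsub>R\<^esub> (a \<otimes>\<^bsub>R\<^esub> e) = c \<otimes>\<^bsub>R\<^esub> e \<otimes>\<^bsub>R\<^esub> \<omega> \<and> c \<otimes>\<^bsub>R\<^esub> e \<noteq> \<zero>\<^bsub>R\<^esub>"
    if a: "a \<in> carrier R" "a \<otimes>\<^bsub>R\<^esub> e \<noteq> \<zero>\<^bsub>R\<^esub>" for a
  proof -
    obtain x c where x: "x \<in> carrier R" "c \<in> B" "x \<otimes>\<^bsub>R\<^esub> (a \<otimes>\<^bsub>R\<^esub> e) = c \<otimes>\<^bsub>R\<^esub> \<omega>" "x \<otimes>\<^bsub>R\<^esub> (a \<otimes>\<^bsub>R\<^esub> e) \<noteq> \<zero>\<^bsub>R\<^esub>"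
      using socle_nonzero_multiple[OF R.m_closed[OF a(1) ec(1)] a(2)] by blast
    have cc: "c \<in> carrier R" using x B_carrier by blast
    have "c \<otimes>\<^bsub>R\<^esub> e \<otimes>\<^bsub>R\<^esub> \<omega> = (c \<otimes>\<^bsub>R\<^esub> \<omega>) \<otimes>\<^bsub>R\<^esub> e" using cc ec(1) \<omega>_closed by (simp add: R.m_ac)
    also have "\<dots> = x \<otimes>\<^bsub>R\<^esub> (a \<otimes>\<^bsub>R\<^esub> (e \<otimes>\<^bsub>R\<^esub> e))"
      unfolding x(3)[symmetric] using x(1) a ec(1) by (simp add: R.m_assoc)
    finally have eq: "x \<otimes>\<^bsub>R\<^esub> (a \<otimes>\<^bsub>R\<^esub> e) = c \<otimes>\<^bsub>R\<^esub> e \<otimes>\<^bsub>R\<^esub> \<omega>" using ec(3) by simp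
    then have "c \<otimes>\<^bsub>R\<^esub> e \<noteq> \<zero>\<^bsub>R\<^esub>" using x(4) \<omega>_closed by auto
    then show ?thesis using x eq by blast
  qed
  obtain x c where x: "x \<in> carrier R" "c \<in> B" "x \<otimes>\<^bsub>R\<^esub> (a \<otimes>\<^bsub>R\<^esub> e) = c \<otimes>\<^bsub>R\<^esub> e \<otimes>\<^bsub>R\<^esub> \<omega>" "c \<otimes>\<^bsub>R\<^esub> e \<noteq> \<zero>\<^bsub>R\<^esub>"
    using red[OF ab(1) ne(1)] by blast
  obtain y d where y: "y \<in> carrier R" "d \<in> B" "y \<otimes>\<^bsub>R\<^esub> (b \<otimes>\<^bsub>R\<^esub> e) = d \<otimes>\<^bsub>R\<^esub> e \<otimes>\<^bsub>R\<^esub> \<omega>" "d \<otimes>\<^bsub>R\<^esub> e \<noteq> \<zero>\<^bsub>R\<^esub>"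
    using red[OF ab(2) ne(2)] by blast
  obtain p q where p: "p \<in> B" "q \<in> B" "p \<otimes>\<^bsub>R\<^esub> c \<otimes>\<^bsub>R\<^esub> e = q \<otimes>\<^bsub>R\<^esub> d \<otimes>\<^bsub>R\<^esub> e" "p \<otimes>\<^bsub>R\<^esub> c \<otimes>\<^bsub>R\<^esub> e \<noteq> \<zero>\<^bsub>R\<^esub>"
    using irreducible_B[OF e x(2) y(2) x(4) y(4)] by blast
  have c: "c \<in> carrier R" "d \<in> carrier R" "p \<in> carrier R" "q \<in> carrier R" using x y p B_carrier by blast+
  have 1: "(p \<otimes>\<^bsub>R\<^esub> x) \<otimes>\<^bsub>R\<^esub> a \<otimes>\<^bsub>R\<^esub> e = (p \<otimes>\<^bsub>R\<^esub> c \<otimes>\<^bsub>R\<^esub> e) \<otimes>\<^bsub>R\<^esub> \<omega>"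
  proof -
    have "(p \<otimes>\<^bsub>R\<^esub> x) \<otimes>\<^bsub>R\<^esub> a \<otimes>\<^bsub>R\<^esub> e = p \<otimes>\<^bsub>R\<^esub> (x \<otimes>\<^bsub>R\<^esub> (a \<otimes>\<^bsub>R\<^esub> e))" using c x(1) ab ec(1) by (simp add: R.m_assoc)
    then show ?thesis unfolding x(3) using c ec(1) \<omega>_closed by (simp add: R.m_assoc)
  qed
  have 2: "(q \<otimes>\<^bsub>R\<^esub> y) \<otimes>\<^bsub>R\<^esub> b \<otimes>\<^bsub>R\<^esub> e = (q \<otimes>\<^bsub>R\<^esub> d \<otimes>\<^bsub>R\<^esub> e) \<otimes>\<^bsub>R\<^esub> \<omega>"
  proof -
    have "(q \<otimes>\<^bsub>R\<^esub> y) \<otimes>\<^bsub>R\<^esub> b \<otimes>\<^bsub>R\<^esub> e = q \<otimes>\<^bsub>R\<^esub> (y \<otimes>\<^bsub>R\<^esub> (b \<otimes>\<^bsub>R\<^esub> e))" using c y(1) ab ec(1) by (simp add: R.m_assoc)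
    then show ?thesis unfolding y(3) using c ec(1) \<omega>_closed by (simp add: R.m_assoc)
  qed
  have "(p \<otimes>\<^bsub>R\<^esub> c \<otimes>\<^bsub>R\<^esub> e) \<otimes>\<^bsub>R\<^esub> \<omega> \<noteq> \<zero>\<^bsub>R\<^esub>"
    using \<omega>_cancel[OF B_mult[OF B_mult[OF p(1) x(2)] A_B[OF ec(2)]]] p(4) by blast
  then show ?thesis using 1 2 p(3) c x(1) y(1) by (intro bexI[of _ "p \<otimes>\<^bsub>R\<^esub> x"] bexI[of _ "q \<otimes>\<^bsub>R\<^esub> y"]) auto
qed

text \<open>The idempotents come from decomposing 1 in \<open>A\<close>, hence an element of
  \<open>R\<close> killed by all of them is 0. The condition \<open>loc\<close> describes a
  localization map: each element becomes an image from \<open>S\<close> after multiplication by a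
  unit monomial.\<close>

theorem core_contraction_components:
  assumes S: "cring S" and h: "h \<in> ring_hom S (monoid_algebra G)"
    and loc: "\<And>f. Poly_Mapping.keys f \<subseteq> carrier G \<Longrightarrow> \<exists>s\<in>carrier S. \<exists>t\<in>carrier S. \<exists>u\<in>Units G.
      h t = monomial u \<and> h s = conv G (monomial u) f"
  shows "ideal_Inter S (primary_components S {f \<in> carrier S. h f \<in> core}) = {f \<in> carrier S. h f \<in> core}"
    and "C \<in> primary_components S {f \<in> carrier S. h f \<in> core} \<Longrightarrow> irreducible_ideal S C"
proof -
  have "\<exists>E. finite E \<and> (\<forall>g\<in>E. R.primitive_idempotent A g \<and> g \<otimes>\<^bsub>R\<^esub> \<one>\<^bsub>R\<^esub> = g) \<and>
    (\<forall>g\<in>E. \<forall>h\<in>E. g \<noteq> h \<longrightarrow> g \<otimes>\<^bsub>R\<^esub> h = \<zero>\<^bsub>R\<^esub>) \<and>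
    (\<forall>r\<in>carrier R. (\<forall>g\<in>E. r \<otimes>\<^bsub>R\<^esub> g = \<zero>\<^bsub>R\<^esub>) \<longrightarrow> r \<otimes>\<^bsub>R\<^esub> \<one>\<^bsub>R\<^esub> = \<zero>\<^bsub>R\<^esub>)"
    by (rule Art.primitive_decomposition[OF Art.A_closed(2)]) simp
  then obtain E where E0: "finite E \<and> (\<forall>g\<in>E. R.primitive_idempotent A g \<and> g \<otimes>\<^bsub>R\<^esub> \<one>\<^bsub>R\<^esub> = g) \<and>
    (\<forall>g\<in>E. \<forall>h\<in>E. g \<noteq> h \<longrightarrow> g \<otimes>\<^bsub>R\<^esub> h = \<zero>\<^bsub>R\<^esub>) \<and>
    (\<forall>r\<in>carrier R. (\<forall>g\<in>E. r \<otimes>\<^bsub>R\<^esub> g = \<zero>\<^bsub>R\<^esub>) \<longrightarrow> r \<otimes>\<^bsub>R\<^esub> \<one>\<^bsub>R\<^esub> = \<zero>\<^bsub>R\<^esub>)"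
    by (rule exE)
  have E: "finite E" "\<And>g. g \<in> E \<Longrightarrow> R.primitive_idempotent A g"
    "\<And>g h. g \<in> E \<Longrightarrow> h \<in> E \<Longrightarrow> g \<noteq> h \<Longrightarrow> g \<otimes>\<^bsub>R\<^esub> h = \<zero>\<^bsub>R\<^esub>"
    "\<And>r. r \<in> carrier R \<Longrightarrow> (\<And>g. g \<in> E \<Longrightarrow> r \<otimes>\<^bsub>R\<^esub> g = \<zero>\<^bsub>R\<^esub>) \<Longrightarrow> r \<otimes>\<^bsub>R\<^esub> \<one>\<^bsub>R\<^esub> = \<zero>\<^bsub>R\<^esub>"
  proof -
    show "finite E" using E0 by (elim conjE)
    show "R.primitive_idempotent A g" if "g \<in> E" for g using E0 that by (elim conjE) simp
    show "g \<otimes>\<^bsub>R\<^esub> h = \<zero>\<^bsub>R\<^esub>" if "g \<in> E" "h \<in> E" "g \<noteq> h" for g h using E0 that by (elim conjE) simp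
    show "r \<otimes>\<^bsub>R\<^esub> \<one>\<^bsub>R\<^esub> = \<zero>\<^bsub>R\<^esub>" if r: "r \<in> carrier R" and g: "\<And>g. g \<in> E \<Longrightarrow> r \<otimes>\<^bsub>R\<^esub> g = \<zero>\<^bsub>R\<^esub>" for r
    proof -
      have "\<forall>r\<in>carrier R. (\<forall>g\<in>E. r \<otimes>\<^bsub>R\<^esub> g = \<zero>\<^bsub>R\<^esub>) \<longrightarrow> r \<otimes>\<^bsub>R\<^esub> \<one>\<^bsub>R\<^esub> = \<zero>\<^bsub>R\<^esub>"
        using E0 by (elim conjE)
      from bspec[OF this r] show ?thesis by (rule mp) (rule ballI, rule g)
    qed
  qed
  let ?\<theta> = "\<lambda>f. \<pi> (h f)"
  have hk: "Poly_Mapping.keys (h f) \<subseteq> carrier G" if "f \<in> carrier S" for f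
    using ring_hom_closed[OF h that] by simp
  have \<theta>: "?\<theta> \<in> ring_hom S R"
    using ring_hom_trans[OF h res_hom[OF core_ideal]] by (simp add: comp_def)
  have eq: "{f \<in> carrier S. h f \<in> core} = {f \<in> carrier S. ?\<theta> f = \<zero>\<^bsub>R\<^esub>}"
    using pi_eq_zero hk by blast
  have locR: "\<exists>s\<in>carrier S. \<exists>t\<in>carrier S. ?\<theta> t \<in> Units R \<and> ?\<theta> s = ?\<theta> t \<otimes>\<^bsub>R\<^esub> r" if r: "r \<in> carrier R" for r
  proof -
    obtain f where f: "Poly_Mapping.keys f \<subseteq> carrier G" "r = \<pi> f" using pi_cases[OF r] .
    obtain s t u where st: "s \<in> carrier S" "t \<in> carrier S" "u \<in> Units G" "h t = monomial u" "h s = conv G (monomial u) f"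
      using loc[OF f(1)] by blast
    have "?\<theta> s = ?\<theta> t \<otimes>\<^bsub>R\<^esub> r" unfolding st(4,5) f(2)
      using pi_mult[OF keys_single_subset[OF Units_closed[OF st(3)]] f(1), symmetric] .
    moreover have "?\<theta> t \<in> Units R"
    proof -
      note m = pi_monomial_inv[OF st(3)]
      have "\<pi> (monomial (inv u)) \<otimes>\<^bsub>R\<^esub> \<pi> (monomial u) = \<one>\<^bsub>R\<^esub>"
        using m(1) R.m_comm[OF m(2,3)] by simp
      then show ?thesis using m unfolding st(4) Units_def by blast
    qed
    ultimately show ?thesis using st by blast
  qed
  have conds: "E \<subseteq> carrier R" "\<zero>\<^bsub>R\<^esub> \<notin> E" "\<And>e. e \<in> E \<Longrightarrow> e \<otimes>\<^bsub>R\<^esub> e = e"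
  proof -
    show "E \<subseteq> carrier R" by (rule subsetI) (rule primitive_carrier[OF E(2)])
    have "e \<noteq> \<zero>\<^bsub>R\<^esub>" if "e \<in> E" for e
      using E(2)[OF that] unfolding R.primitive_idempotent_def by (elim conjE)
    then show "\<zero>\<^bsub>R\<^esub> \<notin> E" by blast
    show "e \<otimes>\<^bsub>R\<^esub> e = e" if "e \<in> E" for e by (rule primitive_idem[OF E(2)[OF that]])
  qed
  have sep: "r = \<zero>\<^bsub>R\<^esub>" if "r \<in> carrier R" "\<And>e. e \<in> E \<Longrightarrow> r \<otimes>\<^bsub>R\<^esub> e = \<zero>\<^bsub>R\<^esub>" for r
    using E(4)[OF that(1)] that by simp
  have prim: "\<exists>n::nat. b [^]\<^bsub>R\<^esub> n \<otimes>\<^bsub>R\<^esub> e = \<zero>\<^bsub>R\<^esub>"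
    if "e \<in> E" "a \<in> carrier R" "b \<in> carrier R" "a \<otimes>\<^bsub>R\<^esub> b \<otimes>\<^bsub>R\<^esub> e = \<zero>\<^bsub>R\<^esub>" "a \<otimes>\<^bsub>R\<^esub> e \<noteq> \<zero>\<^bsub>R\<^esub>" for e a b
    by (rule annihilator_primary[OF E(2)[OF that(1)] that(2-5)])
  have irr: "\<exists>x\<in>carrier R. \<exists>y\<in>carrier R. x \<otimes>\<^bsub>R\<^esub> a \<otimes>\<^bsub>R\<^esub> e = y \<otimes>\<^bsub>R\<^esub> b \<otimes>\<^bsub>R\<^esub> e \<and> x \<otimes>\<^bsub>R\<^esub> a \<otimes>\<^bsub>R\<^esub> e \<noteq> \<zero>\<^bsub>R\<^esub>"
    if "e \<in> E" "a \<in> carrier R" "b \<in> carrier R" "a \<otimes>\<^bsub>R\<^esub> e \<noteq> \<zero>\<^bsub>R\<^esub>" "b \<otimes>\<^bsub>R\<^esub> e \<noteq> \<zero>\<^bsub>R\<^esub>" for e a b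
    by (rule annihilator_irreducible[OF E(2)[OF that(1)] that(2-5)])
  define \<C> where "\<C> = (\<lambda>e. {f \<in> carrier S. ?\<theta> f \<otimes>\<^bsub>R\<^esub> e = \<zero>\<^bsub>R\<^esub>}) ` E"
  note facts = S R_cring \<theta> locR E(1) conds E(3) sep prim irr
  have c1: "primary_components S {f \<in> carrier S. ?\<theta> f = \<zero>\<^bsub>R\<^esub>} = \<C>"
    unfolding \<C>_def using facts by (rule contraction_components(1))
  have c2: "ideal_Inter S \<C> = {f \<in> carrier S. ?\<theta> f = \<zero>\<^bsub>R\<^esub>}"
    unfolding \<C>_def using facts by (rule contraction_components(2))
  have c3: "irreducible_ideal S D" if "D \<in> \<C>" for D
    using facts that[unfolded \<C>_def] by (rule contraction_components(3))
  show "ideal_Inter S (primary_components S {f \<in> carrier S. h f \<in> core}) = {f \<in> carrier S. h f \<in> core}"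
    unfolding eq c1 c2 ..
  show "irreducible_ideal S C" if "C \<in> primary_components S {f \<in> carrier S. h f \<in> core}"
    using that unfolding eq c1 by (rule c3)
qed

end

section \<open>Binomial ideals\<close>

context comm_monoid
begin

lemma binomials_carrier: "(binomials G :: ('a \<Rightarrow>\<^sub>0 'k::field) set) \<subseteq> carrier (monoid_algebra G)"
proof
  fix f :: "'a \<Rightarrow>\<^sub>0 'k" assume "f \<in> binomials G"
  then obtain a b c where "a \<in> carrier G" "b \<in> carrier G" "f = monomial a - Poly_Mapping.single b c"
    by (auto simp: binomials_def)
  then show "f \<in> carrier (monoid_algebra G)" using keys_diff_single_subset[of a "carrier G" b 1 c] by simp
qed

lemma binomial_ideal_ideal:
  fixes I :: "('a \<Rightarrow>\<^sub>0 'k::field) set"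
  assumes "binomial_ideal G I" shows "ideal I (monoid_algebra G)"
proof -
  interpret S: cring "monoid_algebra G :: ('a \<Rightarrow>\<^sub>0 'k::field) ring" by (rule monoid_algebra_cring)
  obtain B :: "('a \<Rightarrow>\<^sub>0 'k) set" where "B \<subseteq> binomials G" "I = Idl\<^bsub>monoid_algebra G\<^esub> B"
    using assms unfolding binomial_ideal_def by blast
  then show ?thesis using S.genideal_ideal[of B] binomials_carrier by blast
qed

lemma ideal_sum_superset:
  fixes I J :: "('a \<Rightarrow>\<^sub>0 'k::field) set"
  assumes "ideal I (monoid_algebra G)" "ideal J (monoid_algebra G)"
  shows "I \<subseteq> I <+>\<^bsub>monoid_algebra G\<^esub> J" "J \<subseteq> I <+>\<^bsub>monoid_algebra G\<^esub> J"
proof -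
  have "f = f \<oplus>\<^bsub>monoid_algebra G\<^esub> 0" "f = 0 \<oplus>\<^bsub>monoid_algebra G\<^esub> f" for f :: "'a \<Rightarrow>\<^sub>0 'k" by simp_all
  then show "I \<subseteq> I <+>\<^bsub>monoid_algebra G\<^esub> J" "J \<subseteq> I <+>\<^bsub>monoid_algebra G\<^esub> J"
    unfolding set_add_def' using ideal_zero[OF assms(1)] ideal_zero[OF assms(2)] by blast+
qed

lemma binomial_ideal_sum:
  fixes I J :: "('a \<Rightarrow>\<^sub>0 'k::field) set"
  assumes "binomial_ideal G I" "binomial_ideal G J"
  shows "binomial_ideal G (I <+>\<^bsub>monoid_algebra G\<^esub> J)"
proof -
  interpret S: cring "monoid_algebra G :: ('a \<Rightarrow>\<^sub>0 'k::field) ring" by (rule monoid_algebra_cring)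
  obtain B C :: "('a \<Rightarrow>\<^sub>0 'k) set" where B: "B \<subseteq> binomials G" "I = Idl\<^bsub>monoid_algebra G\<^esub> B"
    and C: "C \<subseteq> binomials G" "J = Idl\<^bsub>monoid_algebra G\<^esub> C"
    using assms unfolding binomial_ideal_def by blast
  have BC: "B \<subseteq> carrier (monoid_algebra G)" "C \<subseteq> carrier (monoid_algebra G)"
    using B C binomials_carrier by blast+
  have I: "ideal I (monoid_algebra G)" and J: "ideal J (monoid_algebra G)"
    using assms binomial_ideal_ideal by blast+
  have IJ: "ideal (I <+>\<^bsub>monoid_algebra G\<^esub> J) (monoid_algebra G)" by (rule S.add_ideals[OF I J])
  let ?K = "Idl\<^bsub>monoid_algebra G\<^esub> (B \<union> C)"
  have K: "ideal ?K (monoid_algebra G)" using BC by (intro S.genideal_ideal) blast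
  have sub: "B \<subseteq> ?K" "C \<subseteq> ?K" using S.genideal_self[of "B \<union> C"] BC by auto
  have IK: "I \<subseteq> ?K" "J \<subseteq> ?K" unfolding B(2) C(2) using S.genideal_minimal[OF K] sub by blast+
  have "I <+>\<^bsub>monoid_algebra G\<^esub> J \<subseteq> ?K"
    unfolding set_add_def' using IK additive_subgroup.a_closed[OF ideal.axioms(1)[OF K]] by blast
  moreover have "?K \<subseteq> I <+>\<^bsub>monoid_algebra G\<^esub> J"
  proof (rule S.genideal_minimal[OF IJ])
    have "B \<subseteq> I" "C \<subseteq> J" unfolding B(2) C(2) by (rule S.genideal_self, rule BC)+
    then show "B \<union> C \<subseteq> I <+>\<^bsub>monoid_algebra G\<^esub> J" using ideal_sum_superset[OF I J] by blast
  qed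
  ultimately have "I <+>\<^bsub>monoid_algebra G\<^esub> J = ?K" by blast
  moreover have "B \<union> C \<subseteq> binomials G" using B(1) C(1) by (rule Un_least)
  ultimately show ?thesis unfolding binomial_ideal_def by (intro exI[of _ "B \<union> C"] conjI)
qed

context
  fixes I :: "('a \<Rightarrow>\<^sub>0 'k::field) set"
  assumes I: "ideal I (monoid_algebra G)"
begin

lemma binomial_shift:
  assumes "monomial a - Poly_Mapping.single b c \<in> I" "x \<in> carrier G"
  shows "monomial (x \<otimes> a) - Poly_Mapping.single (x \<otimes> b) c \<in> I"
  using ideal_conv[OF I assms(1), of "monomial x"] assms(2) by (simp add: conv_diff_right)

lemma binomial_trans:
  assumes "monomial a - Poly_Mapping.single b c \<in> I" "monomial b - Poly_Mapping.single d c' \<in> I" "d \<in> carrier G"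
  shows "monomial a - Poly_Mapping.single d (c * c') \<in> I"
proof -
  have "psmult c (monomial b - Poly_Mapping.single d c') \<in> I" by (rule ideal_psmult[OF I assms(2)])
  moreover have "psmult c (monomial b - Poly_Mapping.single d c') = Poly_Mapping.single b c - Poly_Mapping.single d (c * c')"
    by (rule poly_mapping_eqI) (simp add: lookup_minus lookup_single right_diff_distrib when_def)
  ultimately show ?thesis using ideal_add[OF I assms(1)] by fastforce
qed

lemma binomial_sym:
  assumes "monomial a - Poly_Mapping.single b c \<in> I" "c \<noteq> 0"
  shows "monomial b - Poly_Mapping.single a (inverse c) \<in> I"
proof -
  have "psmult (- inverse c) (monomial a - Poly_Mapping.single b c) \<in> I" by (rule ideal_psmult[OF I assms(1)])
  moreover have "psmult (- inverse c) (monomial a - Poly_Mapping.single b c) = monomial b - Poly_Mapping.single a (inverse c)"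
    using assms(2) by (intro poly_mapping_eqI) (simp add: lookup_minus lookup_single right_diff_distrib when_def)
  ultimately show ?thesis by simp
qed

lemma ideal_congruence_monoid_congruence: "monoid_congruence G (ideal_congruence G I)"
  unfolding monoid_congruence_def
proof (intro conjI allI impI ballI)
  show "equiv (carrier G) (ideal_congruence G I)"
  proof (rule equivI)
    show "ideal_congruence G I \<subseteq> carrier G \<times> carrier G" by (auto simp: ideal_congruence_def)
    show "refl_on (carrier G) (ideal_congruence G I)"
      using ideal_zero[OF I] by (auto simp: refl_on_def ideal_congruence_def intro!: exI[of _ 1])
    show "sym (ideal_congruence G I)"
    proof (rule symI)
      fix a b assume "(a, b) \<in> ideal_congruence G I"
      then obtain c where c: "c \<noteq> 0" "monomial a - Poly_Mapping.single b c \<in> I" "a \<in> carrier G" "b \<in> carrier G"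
        by (auto simp: ideal_congruence_def)
      moreover have "inverse c \<noteq> 0" using c(1) by simp
      ultimately show "(b, a) \<in> ideal_congruence G I"
        unfolding ideal_congruence_def using binomial_sym[OF c(2,1)] by blast
    qed
    show "trans (ideal_congruence G I)"
    proof (rule transI)
      fix a b d assume "(a, b) \<in> ideal_congruence G I" "(b, d) \<in> ideal_congruence G I"
      then obtain c c' where "c \<noteq> 0" "c' \<noteq> 0" "monomial a - Poly_Mapping.single b c \<in> I"
        "monomial b - Poly_Mapping.single d c' \<in> I" "a \<in> carrier G" "d \<in> carrier G"
        by (auto simp: ideal_congruence_def)
      then show "(a, d) \<in> ideal_congruence G I"
        using binomial_trans[of a b c d c'] by (auto simp: ideal_congruence_def intro!: exI[of _ "c * c'"])
    qed
  qed
  fix a b c assume "(a, b) \<in> ideal_congruence G I" "c \<in> carrier G"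
  then show "(a \<otimes> c, b \<otimes> c) \<in> ideal_congruence G I"
    using binomial_shift[of a b _ c] by (auto simp: ideal_congruence_def m_comm)
qed

lemma ideal_single:
  assumes "Poly_Mapping.single a c \<in> I" "c \<noteq> 0"
  shows "monomial a \<in> I"
  using ideal_psmult[OF I assms(1), of "inverse c"] assms(2) by simp

lemma binomial_in_ideal:
  assumes "monomial a - Poly_Mapping.single b c \<in> I" "c \<noteq> 0"
  shows "monomial a \<in> I \<longleftrightarrow> monomial b \<in> I"
proof
  assume "monomial a \<in> I"
  then have "monomial a - (monomial a - Poly_Mapping.single b c) \<in> I" using ideal_diff[OF I] assms by blast
  then show "monomial b \<in> I" using ideal_single assms(2) by simp
next
  assume "monomial b \<in> I"
  then have "psmult c (monomial b) \<in> I" by (rule ideal_psmult[OF I])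
  then show "monomial a \<in> I" using ideal_add[OF I assms(1)] by fastforce
qed

lemma ideal_congruence_in_ideal:
  "(a, b) \<in> ideal_congruence G I \<Longrightarrow> monomial a \<in> I \<longleftrightarrow> monomial b \<in> I"
  using binomial_in_ideal by (auto simp: ideal_congruence_def)

end

text \<open>The description is meaningful when \<open>t^w\<close> lies outside \<open>I\<close>,
  which makes the scalar unique. Monomials in \<open>I\<close> are incongruent to such a
  \<open>w\<close> and receive the value 0.\<close>

definition witness_coeff :: "('a \<Rightarrow>\<^sub>0 'k::field) set \<Rightarrow> 'a \<Rightarrow> 'a \<Rightarrow> 'k" where
  "witness_coeff I w u = (if (u, w) \<in> ideal_congruence G I
     then THE c. monomial u - Poly_Mapping.single w c \<in> I else 0)"

lemma binomial_unique:
  fixes I :: "('a \<Rightarrow>\<^sub>0 'k::field) set"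
  assumes I: "ideal I (monoid_algebra G)" and w: "monomial w \<notin> I"
    and "monomial u - Poly_Mapping.single w c \<in> I" "monomial u - Poly_Mapping.single w c' \<in> I"
  shows "c = c'"
proof (rule ccontr)
  assume "c \<noteq> c'"
  have "(monomial u - Poly_Mapping.single w c) - (monomial u - Poly_Mapping.single w c') \<in> I"
    using ideal_diff[OF I] assms by blast
  then have "Poly_Mapping.single w (c' - c) \<in> I" by (simp add: single_diff)
  then show False using ideal_single[OF I] w \<open>c \<noteq> c'\<close> by simp
qed

lemma witness_coeff_eq:
  fixes I :: "('a \<Rightarrow>\<^sub>0 'k::field) set"
  assumes I: "ideal I (monoid_algebra G)" and w: "monomial w \<notin> I" "w \<in> carrier G" "u \<in> carrier G"
    and b: "monomial u - Poly_Mapping.single w c \<in> I" "c \<noteq> 0"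
  shows "witness_coeff I w u = c"
proof -
  have "(u, w) \<in> ideal_congruence G I" using assms by (auto simp: ideal_congruence_def)
  then show ?thesis
    unfolding witness_coeff_def using b(1) binomial_unique[OF I w(1)] by (auto intro!: the_equality)
qed

lemma witness_coeff_cases:
  fixes I :: "('a \<Rightarrow>\<^sub>0 'k::field) set"
  assumes I: "ideal I (monoid_algebra G)" and w: "monomial w \<notin> I" "w \<in> carrier G" "u \<in> carrier G"
  obtains "witness_coeff I w u = 0" "(u, w) \<notin> ideal_congruence G I"
  | "witness_coeff I w u \<noteq> 0" "monomial u - Poly_Mapping.single w (witness_coeff I w u) \<in> I"
    "(u, w) \<in> ideal_congruence G I"
proof (cases "(u, w) \<in> ideal_congruence G I")
  case True
  then obtain c where "c \<noteq> 0" "monomial u - Poly_Mapping.single w c \<in> I" by (auto simp: ideal_congruence_def)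
  then show ?thesis using witness_coeff_eq[OF I w] that(2) True by metis
qed (use that in \<open>simp add: witness_coeff_def\<close>)

text \<open>The point is that the functional vanishes on \<open>I\<close>. All its shifts vanish on
  the binomial generators, so these lie in the kernel of the pairing, which is an ideal and
  therefore contains \<open>I\<close>.\<close>

lemma binomial_witness_form:
  fixes I :: "('a \<Rightarrow>\<^sub>0 'k::field) set"
  assumes bin: "binomial_ideal G I" and w: "monomial w \<notin> I" "w \<in> carrier G"
  shows "witness_form G I w (witness_coeff I w)"
proof -
  have I: "ideal I (monoid_algebra G)" by (rule binomial_ideal_ideal[OF bin])
  interpret S: cring "monoid_algebra G :: ('a \<Rightarrow>\<^sub>0 'k::field) ring" by (rule monoid_algebra_cring)
  let ?\<psi> = "witness_coeff I w"
  let ?Y = "{f. Poly_Mapping.keys f \<subseteq> carrier G \<and>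
    (\<forall>x\<in>carrier G. keysum (\<lambda>u c. c * ?\<psi> (x \<otimes> u)) f = 0)}"
  obtain B :: "('a \<Rightarrow>\<^sub>0 'k) set" where B: "B \<subseteq> binomials G" "I = Idl\<^bsub>monoid_algebra G\<^esub> B"
    using bin unfolding binomial_ideal_def by blast
  have zero: "?\<psi> u = 0" if "monomial u \<in> I" "u \<in> carrier G" for u
    using witness_coeff_cases[OF I w that(2)] ideal_congruence_in_ideal[OF I, of u w] that(1) w(1) by metis
  have "B \<subseteq> ?Y"
  proof
    fix f assume "f \<in> B"
    then obtain a b c where f: "a \<in> carrier G" "b \<in> carrier G" "f = monomial a - Poly_Mapping.single b c"
      using B(1) by (auto simp: binomials_def)
    have fI: "f \<in> I" using \<open>f \<in> B\<close> S.genideal_self[of B] B binomials_carrier by blast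
    have "?\<psi> (x \<otimes> a) = c * ?\<psi> (x \<otimes> b)" if x: "x \<in> carrier G" for x
    proof -
      have s: "monomial (x \<otimes> a) - Poly_Mapping.single (x \<otimes> b) c \<in> I"
        using binomial_shift[OF I _ x] fI f(3) by blast
      have c: "x \<otimes> a \<in> carrier G" "x \<otimes> b \<in> carrier G" using x f by auto
      show ?thesis
      \<comment> \<open>For \<open>c = 0\<close> the generator is a monomial, whose multiples lie in
        \<open>I\<close> and have coefficient 0. Otherwise the two exponents are congruent and their
        coefficients differ by the factor \<open>c\<close>.\<close>
      proof (cases "c = 0")
        case True
        then show ?thesis using s zero[OF _ c(1)] by simp
      next
        case False
        have eq: "(x \<otimes> a, x \<otimes> b) \<in> ideal_congruence G I" using s False c by (auto simp: ideal_congruence_def)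
        show ?thesis
        proof (rule witness_coeff_cases[OF I w c(2)])
          assume "?\<psi> (x \<otimes> b) = 0" "(x \<otimes> b, w) \<notin> ideal_congruence G I"
          moreover from this eq have "(x \<otimes> a, w) \<notin> ideal_congruence G I"
            using congruence_trans[OF ideal_congruence_monoid_congruence[OF I]]
              congruence_sym[OF ideal_congruence_monoid_congruence[OF I]] by blast
          ultimately show ?thesis by (simp add: witness_coeff_def)
        next
          assume nz: "?\<psi> (x \<otimes> b) \<noteq> 0" "monomial (x \<otimes> b) - Poly_Mapping.single w (?\<psi> (x \<otimes> b)) \<in> I"
          then have "monomial (x \<otimes> a) - Poly_Mapping.single w (c * ?\<psi> (x \<otimes> b)) \<in> I"
            using binomial_trans[OF I s _ w(2)] by blast
          then show ?thesis using witness_coeff_eq[OF I w c(1)] nz(1) False by simp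
        qed
      qed
    qed
    moreover have "keysum (\<lambda>u c. c * ?\<psi> (x \<otimes> u)) f + c * ?\<psi> (x \<otimes> b) = ?\<psi> (x \<otimes> a)" for x
    proof -
      have "keysum (\<lambda>u c. c * ?\<psi> (x \<otimes> u)) (f + Poly_Mapping.single b c)
        = keysum (\<lambda>u c. c * ?\<psi> (x \<otimes> u)) f + keysum (\<lambda>u c. c * ?\<psi> (x \<otimes> u)) (Poly_Mapping.single b c)"
        by (rule keysum_add) (simp_all add: distrib_right)
      then show ?thesis using f(3) by (simp add: keysum_single)
    qed
    ultimately have "\<forall>x\<in>carrier G. keysum (\<lambda>u c. c * ?\<psi> (x \<otimes> u)) f = 0"
      by (metis add_cancel_left_left)
    then show "f \<in> ?Y" using ideal_keys[OF I fI] by simp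
  qed
  then have IY: "I \<subseteq> ?Y" unfolding B(2) by (rule S.genideal_minimal[OF functional_kernel_ideal])
  show ?thesis
  proof (intro witness_form.intro witness_form_axioms.intro)
    show "comm_monoid G" by (rule comm_monoid_axioms)
    show "ideal I (monoid_algebra G)" by (rule I)
    show "w \<in> carrier G" by (rule w)
    show "?\<psi> w = 1" using witness_coeff_eq[OF I w w(2), of 1] ideal_zero[OF I] by simp
    show "keysum (\<lambda>u c. c * ?\<psi> u) f = 0" if f: "f \<in> I" for f
    proof -
      have "keysum (\<lambda>u c. c * ?\<psi> (\<one> \<otimes> u)) f = 0" using f IY by blast
      moreover have "keysum (\<lambda>u c. c * ?\<psi> (\<one> \<otimes> u)) f = keysum (\<lambda>u c. c * ?\<psi> u) f"
        using ideal_keys[OF I f] by (intro keysum_cong) auto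
      ultimately show ?thesis by simp
    qed
    show "monomial u - Poly_Mapping.single w (?\<psi> u) \<in> I" if "u \<in> carrier G" "?\<psi> u \<noteq> 0" for u
      using witness_coeff_cases[OF I w that(1)] that(2) by metis
  qed
qed

end

context witness_form
begin

lemma \<psi>_congruence_iff:
  assumes "u \<in> carrier G"
  shows "(u, w) \<in> ideal_congruence G I \<longleftrightarrow> \<psi> u \<noteq> 0"
proof
  assume "(u, w) \<in> ideal_congruence G I"
  then obtain c where c: "c \<noteq> 0" "monomial u - Poly_Mapping.single w c \<in> I"
    by (auto simp: ideal_congruence_def)
  then have "\<psi> u - c = 0" using \<psi>_I[OF c(2)] by (simp add: \<kappa>_diff)
  then show "\<psi> u \<noteq> 0" using c by simp
qed (use assms \<psi>_binomial in \<open>auto simp: ideal_congruence_def\<close>)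

lemma congruence: "monoid_congruence G (ideal_congruence G I)"
  by (rule ideal_congruence_monoid_congruence[OF I_ideal])

lemma class_w_iff: "u \<in> carrier G \<Longrightarrow> u \<in> ideal_congruence G I `` {w} \<longleftrightarrow> \<psi> u \<noteq> 0"
  using \<psi>_congruence_iff[of u] congruence_sym[OF congruence] by auto

text \<open>Each key congruent to \<open>w\<close> contributes its coefficient times its
  \<open>\<psi>\<close> value, and no other key survives the restriction. This shows that
  \<open>\<kappa>\<close> reads the component in the degree of \<open>w\<close>.\<close>

lemma restrict_class_w:
  assumes "Poly_Mapping.keys f \<subseteq> carrier G"
  shows "restrict_support f (ideal_congruence G I `` {w}) - Poly_Mapping.single w (\<kappa> f) \<in> I"
  using assms
proof (induction rule: poly_mapping_keys_induct)
  case zero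
  show ?case using ideal_zero[OF I_ideal] by (simp add: restrict_support_def)
next
  case (single u c)
  show ?case
  proof (cases "\<psi> u = 0")
    case True
    then have "restrict_support (Poly_Mapping.single u c) (ideal_congruence G I `` {w}) = 0"
      using class_w_iff[OF single] by (intro poly_mapping_eqI) (auto simp: lookup_restrict_support lookup_single when_def)
    then show ?thesis using True ideal_zero[OF I_ideal] by simp
  next
    case False
    have "restrict_support (Poly_Mapping.single u c) (ideal_congruence G I `` {w}) = Poly_Mapping.single u c"
      using False class_w_iff[OF single] by (intro poly_mapping_eqI) (auto simp: lookup_restrict_support lookup_single when_def)
    moreover have "psmult c (monomial u - Poly_Mapping.single w (\<psi> u)) \<in> I"
      by (rule ideal_psmult[OF I_ideal \<psi>_binomial[OF single False]])
    moreover have "psmult c (monomial u - Poly_Mapping.single w (\<psi> u)) = Poly_Mapping.single u c - Poly_Mapping.single w (c * \<psi> u)"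
      by (rule poly_mapping_eqI) (simp add: lookup_minus lookup_single right_diff_distrib when_def)
    ultimately show ?thesis by simp
  qed
next
  case (add f g)
  then show ?case
    using ideal_add[OF I_ideal add(3,4)]
    by (simp add: restrict_support_add \<kappa>_add single_add algebra_simps)
qed

lemma restrict_class_w_iff:
  assumes "Poly_Mapping.keys f \<subseteq> carrier G"
  shows "restrict_support f (ideal_congruence G I `` {w}) \<in> I \<longleftrightarrow> \<kappa> f = 0"
proof
  assume "restrict_support f (ideal_congruence G I `` {w}) \<in> I"
  then have "restrict_support f (ideal_congruence G I `` {w}) -
      (restrict_support f (ideal_congruence G I `` {w}) - Poly_Mapping.single w (\<kappa> f)) \<in> I"
    using ideal_diff[OF I_ideal] restrict_class_w[OF assms] by blast
  then have "Poly_Mapping.single w (\<kappa> f) \<in> I" by simp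
  then show "\<kappa> f = 0" using ideal_single[OF I_ideal] w_notin_I by blast
next
  assume "\<kappa> f = 0"
  then show "restrict_support f (ideal_congruence G I `` {w}) \<in> I" using restrict_class_w[OF assms] by simp
qed

end

context comm_monoid
begin

text \<open>This is the grading of a binomial ideal by its congruence. In a degree whose monomials
  lie in \<open>I\<close> the claim is immediate; in any other degree the component is, modulo
  \<open>I\<close>, the monomial \<open>t^w\<close> with coefficient
  \<open>\<kappa> f = 0\<close>.\<close>

lemma binomial_ideal_restrict:
  fixes I :: "('a \<Rightarrow>\<^sub>0 'k::field) set"
  assumes bin: "binomial_ideal G I" and f: "f \<in> I" and d: "w \<in> carrier G" "d = ideal_congruence G I `` {w}"
  shows "restrict_support f d \<in> I"
proof (cases "monomial w \<in> I")
  case True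
  have I: "ideal I (monoid_algebra G)" by (rule binomial_ideal_ideal[OF bin])
  have "Poly_Mapping.single a c \<in> I" if "a \<in> d" for a c
  proof -
    have "monomial a \<in> I" using that True ideal_congruence_in_ideal[OF I, of w a] d(2) by simp
    then show ?thesis using ideal_psmult[OF I, of "monomial a" c] by simp
  qed
  then show ?thesis unfolding restrict_support_def by (intro ideal_sum[OF I]) auto
next
  case False
  interpret witness_form G I w "witness_coeff I w" by (rule binomial_witness_form[OF bin False d(1)])
  show ?thesis
    unfolding d(2) using restrict_class_w_iff[OF ideal_keys[OF I_ideal f]] \<psi>_I[OF f] by blast
qed

lemma class_partition:
  fixes I f :: "_"
  assumes I: "ideal I (monoid_algebra G :: ('a \<Rightarrow>\<^sub>0 'k::field) ring)" and f: "Poly_Mapping.keys (f :: 'a \<Rightarrow>\<^sub>0 'k) \<subseteq> carrier G"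
  shows "f = (\<Sum>d\<in>(\<lambda>u. ideal_congruence G I `` {u}) ` Poly_Mapping.keys f. restrict_support f d)"
proof (rule restrict_support_partition)
  note c = ideal_congruence_monoid_congruence[OF I]
  show "u \<in> ideal_congruence G I `` {u}" if "u \<in> Poly_Mapping.keys f" for u
    using congruence_refl[OF c] that f by auto
  show "ideal_congruence G I `` {v} = ideal_congruence G I `` {u}"
    if "v \<in> ideal_congruence G I `` {u}" for u v
    using equiv_class_eq[OF congruence_equiv[OF c], of u v] that by simp
qed

lemma exists_class_not_in_ideal:
  fixes I :: "('a \<Rightarrow>\<^sub>0 'k::field) set"
  assumes I: "ideal I (monoid_algebra G)" and f: "Poly_Mapping.keys f \<subseteq> carrier G" "f \<notin> I"
  shows "\<exists>u\<in>Poly_Mapping.keys f. restrict_support f (ideal_congruence G I `` {u}) \<notin> I"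
proof (rule ccontr)
  assume "\<not> ?thesis"
  then have "(\<Sum>d\<in>(\<lambda>u. ideal_congruence G I `` {u}) ` Poly_Mapping.keys f. restrict_support f d) \<in> I"
    by (intro ideal_sum[OF I]) auto
  then show False using class_partition[OF I f(1)] f(2) by simp
qed

end

section \<open>Localization of ideals\<close>

context prime_localization
begin

lemma loc_map_keysum: "loc_map Q P f = keysum (\<lambda>a x. Poly_Mapping.single (to_loc Q P a) x) f"
  by (simp add: loc_map_def keysum_def)

lemma loc_map_single [simp]: "loc_map Q P (Poly_Mapping.single a c) = Poly_Mapping.single (to_loc Q P a) c"
  by (simp add: loc_map_keysum keysum_single)

lemma loc_map_zero [simp]: "loc_map Q P 0 = 0"
  by (simp add: loc_map_keysum)

lemma loc_map_add: "loc_map Q P (f + g) = loc_map Q P f + loc_map Q P g"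
  unfolding loc_map_keysum by (rule keysum_add) (simp_all add: single_add)

lemma loc_map_diff: "loc_map Q P (f - g) = loc_map Q P f - loc_map Q P g"
  using loc_map_add[of "f - g" g] by simp

lemma loc_map_keys:
  assumes "Poly_Mapping.keys f \<subseteq> carrier Q"
  shows "Poly_Mapping.keys (loc_map Q P f) \<subseteq> to_loc Q P ` carrier Q"
proof -
  have "Poly_Mapping.keys (loc_map Q P f) \<subseteq> (\<Union>a\<in>Poly_Mapping.keys f.
      Poly_Mapping.keys (Poly_Mapping.single (to_loc Q P a) (Poly_Mapping.lookup f a)))"
    unfolding loc_map_def by (rule keys_sum)
  then show ?thesis using assms by (auto split: if_splits)
qed

lemma loc_map_closed:
  "Poly_Mapping.keys f \<subseteq> carrier Q \<Longrightarrow> Poly_Mapping.keys (loc_map Q P f) \<subseteq> carrier L"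
  using loc_map_keys[of f] to_loc_closed by blast

lemma loc_map_conv:
  assumes "Poly_Mapping.keys f \<subseteq> carrier Q" "Poly_Mapping.keys g \<subseteq> carrier Q"
  shows "loc_map Q P (conv Q f g) = conv L (loc_map Q P f) (loc_map Q P g)"
  using assms(1)
proof (induction rule: poly_mapping_keys_induct)
  case (single a x)
  from assms(2) show ?case
    by (induction rule: poly_mapping_keys_induct)
      (use single in \<open>simp_all add: conv_add_right loc_map_add to_loc_mult\<close>)
qed (simp_all add: conv_add_left loc_map_add)

lemma loc_map_hom:
  "loc_map Q P \<in> ring_hom (monoid_algebra Q :: ('a \<Rightarrow>\<^sub>0 'k::field) ring) (loc_algebra Q P)"
  by (rule ring_hom_memI) (use loc_map_closed loc_map_conv in \<open>auto simp: loc_map_add\<close>)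

text \<open>A common denominator is built up additively, as the product of the denominators of the
  summands.\<close>

lemma loc_map_surj:
  fixes f :: "('a \<times> 'a) set \<Rightarrow>\<^sub>0 'k::field"
  assumes "Poly_Mapping.keys f \<subseteq> carrier L"
  shows "\<exists>s\<in>F. \<exists>g. Poly_Mapping.keys g \<subseteq> carrier Q \<and> conv L (monomial (to_loc Q P s)) f = loc_map Q P g"
  using assms
proof (induction rule: poly_mapping_keys_induct)
  case zero
  show ?case using F_one by (intro bexI[of _ \<one>] exI[of _ 0]) auto
next
  case (single x c)
  obtain s a where "s \<in> F" "a \<in> carrier Q" "to_loc Q P s \<otimes>\<^bsub>L\<^esub> x = to_loc Q P a"
    using L_repr[OF single] .
  then show ?case by (intro bexI[of _ s] exI[of _ "Poly_Mapping.single a c"]) auto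
next
  case (add f g)
  obtain s f' where s: "s \<in> F" "Poly_Mapping.keys f' \<subseteq> carrier Q" "conv L (monomial (to_loc Q P s)) f = loc_map Q P f'"
    using add by blast
  obtain t g' where t: "t \<in> F" "Poly_Mapping.keys g' \<subseteq> carrier Q" "conv L (monomial (to_loc Q P t)) g = loc_map Q P g'"
    using add by blast
  have c: "s \<in> carrier Q" "t \<in> carrier Q" using s t by auto
  have sc: "Poly_Mapping.keys (monomial s :: 'a \<Rightarrow>\<^sub>0 'k) \<subseteq> carrier Q" "Poly_Mapping.keys (monomial t :: 'a \<Rightarrow>\<^sub>0 'k) \<subseteq> carrier Q"
    using c by auto
  have mm: "conv L (monomial (to_loc Q P (s \<otimes> t))) h = conv L (monomial (to_loc Q P t)) (conv L (monomial (to_loc Q P s)) h)"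
    "conv L (monomial (to_loc Q P (s \<otimes> t))) h = conv L (monomial (to_loc Q P s)) (conv L (monomial (to_loc Q P t)) h)"
    if "Poly_Mapping.keys h \<subseteq> carrier L" for h :: "('a \<times> 'a) set \<Rightarrow>\<^sub>0 'k"
    using comm_monoid.conv_assoc[OF L_comm_monoid, of "monomial (to_loc Q P t)" "monomial (to_loc Q P s)" h]
      comm_monoid.conv_assoc[OF L_comm_monoid, of "monomial (to_loc Q P s)" "monomial (to_loc Q P t)" h]
      that c to_loc_mult[of s t] to_loc_mult[of t s] m_comm[of s t] by simp_all
  have "conv L (monomial (to_loc Q P (s \<otimes> t))) (f + g)
    = conv L (monomial (to_loc Q P t)) (loc_map Q P f') + conv L (monomial (to_loc Q P s)) (loc_map Q P g')"
    unfolding conv_add_right using mm(1)[OF add(1)] mm(2)[OF add(2)] s(3) t(3) by simp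
  also have "\<dots> = loc_map Q P (conv Q (monomial t) f' + conv Q (monomial s) g')"
    using loc_map_conv[OF sc(2) s(2)] loc_map_conv[OF sc(1) t(2)] by (simp add: loc_map_add)
  finally show ?case
    using F_mult[OF s(1) t(1)] order_trans[OF keys_add Un_least[OF conv_closed[OF sc(2) s(2)] conv_closed[OF sc(1) t(2)]]]
    by blast
qed

text \<open>The finitely many coincidences of keys in the localization are realized by a single
  multiplier \<open>s\<close>. Multiplication by \<open>t^s\<close> then merges the same keys as
  localization does, so the coefficients agree.\<close>

lemma loc_map_kernel:
  fixes f :: "'a \<Rightarrow>\<^sub>0 'k::field"
  assumes f: "Poly_Mapping.keys f \<subseteq> carrier Q" and z: "loc_map Q P f = 0"
  shows "\<exists>s\<in>F. conv Q (monomial s) f = 0"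
proof -
  have ex: "\<exists>s\<in>F. \<forall>(a, b)\<in>D. to_loc Q P a = to_loc Q P b \<longrightarrow> s \<otimes> a = s \<otimes> b"
    if "finite D" "D \<subseteq> carrier Q \<times> carrier Q" for D
    using that
  proof (induction rule: finite_induct)
    case empty
    then show ?case using F_one by blast
  next
    case (insert p D)
    obtain a b where p: "p = (a, b)" "a \<in> carrier Q" "b \<in> carrier Q" using insert.prems by auto
    obtain s where s: "s \<in> F" "\<forall>(a, b)\<in>D. to_loc Q P a = to_loc Q P b \<longrightarrow> s \<otimes> a = s \<otimes> b"
      using insert by auto
    obtain u where u: "u \<in> F" "to_loc Q P a = to_loc Q P b \<longrightarrow> u \<otimes> a = u \<otimes> b"
      using to_loc_eq_iff[OF p(2,3)] F_one by blast
    have c: "s \<in> carrier Q" "u \<in> carrier Q" using s u by auto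
    have "(s \<otimes> u) \<otimes> x = (s \<otimes> u) \<otimes> y"
      if "(x, y) \<in> insert p D" "to_loc Q P x = to_loc Q P y" for x y
    proof -
      have xy: "x \<in> carrier Q" "y \<in> carrier Q" using that insert.prems by auto
      have "s \<otimes> x = s \<otimes> y \<or> u \<otimes> x = u \<otimes> y" using that s(2) u(2) p by auto
      moreover have "(s \<otimes> u) \<otimes> x = u \<otimes> (s \<otimes> x)" "(s \<otimes> u) \<otimes> y = u \<otimes> (s \<otimes> y)"
        "(s \<otimes> u) \<otimes> x = s \<otimes> (u \<otimes> x)" "(s \<otimes> u) \<otimes> y = s \<otimes> (u \<otimes> y)" using c xy by (simp_all add: m_ac)
      ultimately show ?thesis by metis
    qed
    then show ?case using F_mult[OF s(1) u(1)] by blast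
  qed
  have "\<exists>s\<in>F. \<forall>(a, b)\<in>Poly_Mapping.keys f \<times> Poly_Mapping.keys f. to_loc Q P a = to_loc Q P b \<longrightarrow> s \<otimes> a = s \<otimes> b"
    by (rule ex) (use f in auto)
  then obtain s where s0: "s \<in> F"
    "\<forall>(a, b)\<in>Poly_Mapping.keys f \<times> Poly_Mapping.keys f. to_loc Q P a = to_loc Q P b \<longrightarrow> s \<otimes> a = s \<otimes> b"
    by (rule bexE)
  have s: "s \<in> F" "\<And>a b. a \<in> Poly_Mapping.keys f \<Longrightarrow> b \<in> Poly_Mapping.keys f \<Longrightarrow>
      to_loc Q P a = to_loc Q P b \<Longrightarrow> s \<otimes> a = s \<otimes> b" using s0 by blast+
  have iff: "s \<otimes> a = s \<otimes> b \<longleftrightarrow> to_loc Q P a = to_loc Q P b"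
    if "a \<in> Poly_Mapping.keys f" "b \<in> Poly_Mapping.keys f" for a b
    using s(2)[OF that] to_loc_eq_iff[of a b] s(1) that f by blast
  have lookup_c: "Poly_Mapping.lookup (conv Q (monomial s) f) y
      = (\<Sum>a\<in>Poly_Mapping.keys f. if s \<otimes> a = y then Poly_Mapping.lookup f a else 0)" for y
    by (simp add: conv_keysum keysum_single keysum_def lookup_sum lookup_single when_def)
  have lookup_l: "Poly_Mapping.lookup (loc_map Q P f) y
      = (\<Sum>a\<in>Poly_Mapping.keys f. if to_loc Q P a = y then Poly_Mapping.lookup f a else 0)" for y
    by (simp add: loc_map_def lookup_sum lookup_single when_def)
  have "conv Q (monomial s) f = 0"
  proof (rule poly_mapping_eqI)
    fix y
    show "Poly_Mapping.lookup (conv Q (monomial s) f) y = Poly_Mapping.lookup 0 y"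
    proof (cases "\<exists>a\<in>Poly_Mapping.keys f. s \<otimes> a = y")
      case True
      then obtain a where a: "a \<in> Poly_Mapping.keys f" "y = s \<otimes> a" by blast
      have "Poly_Mapping.lookup (conv Q (monomial s) f) y = Poly_Mapping.lookup (loc_map Q P f) (to_loc Q P a)"
        unfolding lookup_c lookup_l a(2) using iff a(1) by (intro sum.cong) auto
      then show ?thesis using z by simp
    next
      case False
      then show ?thesis unfolding lookup_c by (auto intro!: sum.neutral)
    qed
  qed
  then show ?thesis using s(1) by blast
qed

end

section \<open>Localized ideals and their congruences\<close>

context prime_localization
begin

context
  fixes I :: "('a \<Rightarrow>\<^sub>0 'k::field) set"
  assumes I: "ideal I (monoid_algebra Q)"
begin

interpretation L: comm_monoid L by (rule L_comm_monoid)
interpretation S: cring "monoid_algebra Q :: ('a \<Rightarrow>\<^sub>0 'k) ring" by (rule monoid_algebra_cring)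
interpretation LA: cring "loc_algebra Q P :: (('a \<times> 'a) set \<Rightarrow>\<^sub>0 'k) ring" by (rule L.monoid_algebra_cring)

lemma loc_ideal_ideal: "ideal (loc_ideal Q P I) (loc_algebra Q P)"
  unfolding loc_ideal_def
  using loc_map_closed ideal_keys[OF I] by (intro LA.genideal_ideal) auto

lemma loc_map_in_loc_idealI: "f \<in> I \<Longrightarrow> loc_map Q P f \<in> loc_ideal Q P I"
  unfolding loc_ideal_def
  using LA.genideal_self[of "loc_map Q P ` I"] loc_map_closed ideal_keys[OF I] by auto

text \<open>Fractions with numerator in \<open>I\<close> form an ideal, since denominators can be
  multiplied together, and this ideal contains the image of \<open>I\<close>. For the converse the
  unit monomial \<open>t^s\<close> is divided out.\<close>

lemma loc_ideal_iff:
  "x \<in> loc_ideal Q P I \<longleftrightarrow> Poly_Mapping.keys x \<subseteq> carrier L \<and>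
     (\<exists>s\<in>F. \<exists>f\<in>I. conv L (monomial (to_loc Q P s)) x = loc_map Q P f)"
proof
  let ?Y = "{x. Poly_Mapping.keys x \<subseteq> carrier L \<and>
     (\<exists>s\<in>F. \<exists>f\<in>I. conv L (monomial (to_loc Q P s)) x = loc_map Q P f)}"
  have "ideal ?Y (loc_algebra Q P)"
  proof (rule L.monoid_algebra_idealI)
    show "0 \<in> ?Y" using F_one ideal_zero[OF I] by (auto intro!: bexI[of _ \<one>] bexI[of _ 0])
    show "x + y \<in> ?Y" if xy: "x \<in> ?Y" "y \<in> ?Y" for x y
    proof -
      obtain s f where s: "s \<in> F" "f \<in> I" "conv L (monomial (to_loc Q P s)) x = loc_map Q P f" using xy by auto
      obtain t g where t: "t \<in> F" "g \<in> I" "conv L (monomial (to_loc Q P t)) y = loc_map Q P g" using xy by auto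
      have k: "Poly_Mapping.keys x \<subseteq> carrier L" "Poly_Mapping.keys y \<subseteq> carrier L" using xy by auto
      have c: "s \<in> carrier Q" "t \<in> carrier Q" using s t by auto
      have m: "monomial (to_loc Q P (s \<otimes> t)) = conv L (monomial (to_loc Q P t)) (monomial (to_loc Q P s) :: _ \<Rightarrow>\<^sub>0 'k)"
        "monomial (to_loc Q P (s \<otimes> t)) = conv L (monomial (to_loc Q P s)) (monomial (to_loc Q P t) :: _ \<Rightarrow>\<^sub>0 'k)"
        using c by (simp_all add: to_loc_mult L.m_comm)
      have "conv L (monomial (to_loc Q P (s \<otimes> t))) x = loc_map Q P (conv Q (monomial t) f)"
        unfolding m(1) using c k s(3) L.conv_assoc[of "monomial (to_loc Q P t)" "monomial (to_loc Q P s)" x]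
          loc_map_conv[of "monomial t" f] ideal_keys[OF I s(2)] by simp
      moreover have "conv L (monomial (to_loc Q P (s \<otimes> t))) y = loc_map Q P (conv Q (monomial s) g)"
        unfolding m(2) using c k t(3) L.conv_assoc[of "monomial (to_loc Q P s)" "monomial (to_loc Q P t)" y]
          loc_map_conv[of "monomial s" g] ideal_keys[OF I t(2)] by simp
      ultimately have "conv L (monomial (to_loc Q P (s \<otimes> t))) (x + y)
          = loc_map Q P (conv Q (monomial t) f + conv Q (monomial s) g)"
        by (simp add: conv_add_right loc_map_add)
      moreover have "conv Q (monomial t) f + conv Q (monomial s) g \<in> I"
        using c by (intro ideal_add[OF I] ideal_conv[OF I] s t) auto
      ultimately show ?thesis using F_mult[OF s(1) t(1)] order_trans[OF keys_add Un_least[OF k]] by blast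
    qed
    show "conv L (Poly_Mapping.single y c) x \<in> ?Y" if yx: "y \<in> carrier L" "x \<in> ?Y" for y c x
    proof -
      obtain s f where s: "s \<in> F" "f \<in> I" "conv L (monomial (to_loc Q P s)) x = loc_map Q P f" using yx by auto
      obtain t a where t: "t \<in> F" "a \<in> carrier Q" "to_loc Q P t \<otimes>\<^bsub>L\<^esub> y = to_loc Q P a" using L_repr[OF yx(1)] .
      have k: "Poly_Mapping.keys x \<subseteq> carrier L" using yx by auto
      have cc: "s \<in> carrier Q" "t \<in> carrier Q" using s t by auto
      have "conv L (monomial (to_loc Q P (s \<otimes> t))) (conv L (Poly_Mapping.single y c) x)
        = conv L (Poly_Mapping.single (to_loc Q P (s \<otimes> t) \<otimes>\<^bsub>L\<^esub> y) c) x"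
        using L.conv_assoc[of "monomial (to_loc Q P (s \<otimes> t))" "Poly_Mapping.single y c" x] cc yx k by simp
      also have "to_loc Q P (s \<otimes> t) \<otimes>\<^bsub>L\<^esub> y = to_loc Q P a \<otimes>\<^bsub>L\<^esub> to_loc Q P s"
        using cc t yx by (simp add: to_loc_mult L.m_ac flip: t(3))
      also have "conv L (Poly_Mapping.single (to_loc Q P a \<otimes>\<^bsub>L\<^esub> to_loc Q P s) c) x
        = conv L (Poly_Mapping.single (to_loc Q P a) c) (loc_map Q P f)"
        unfolding s(3)[symmetric]
        using L.conv_assoc[of "Poly_Mapping.single (to_loc Q P a) c" "monomial (to_loc Q P s)" x] cc t k by simp
      also have "\<dots> = loc_map Q P (conv Q (Poly_Mapping.single a c) f)"
        using loc_map_conv[of "Poly_Mapping.single a c" f] t ideal_keys[OF I s(2)] by simp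
      finally have eq: "conv L (monomial (to_loc Q P (s \<otimes> t))) (conv L (Poly_Mapping.single y c) x)
        = loc_map Q P (conv Q (Poly_Mapping.single a c) f)" .
      have "conv Q (Poly_Mapping.single a c) f \<in> I" using t by (intro ideal_conv[OF I s(2)]) auto
      moreover have "Poly_Mapping.keys (conv L (Poly_Mapping.single y c) x) \<subseteq> carrier L"
        using yx(1) k by (intro L.conv_closed) auto
      ultimately show ?thesis using eq F_mult[OF s(1) t(1)] by blast
    qed
  qed auto
  moreover have "loc_map Q P ` I \<subseteq> ?Y"
  proof
    fix x assume "x \<in> loc_map Q P ` I"
    then obtain f where f: "f \<in> I" "x = loc_map Q P f" by auto
    have k: "Poly_Mapping.keys x \<subseteq> carrier L" using f loc_map_closed ideal_keys[OF I] by auto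
    have "conv L (monomial (to_loc Q P \<one>)) x = loc_map Q P f" using L.conv_one[OF k] f by simp
    then show "x \<in> ?Y" using k f(1) F_one by blast
  qed
  ultimately have "loc_ideal Q P I \<subseteq> ?Y" unfolding loc_ideal_def by (rule LA.genideal_minimal)
  then show "x \<in> loc_ideal Q P I \<Longrightarrow> Poly_Mapping.keys x \<subseteq> carrier L \<and>
     (\<exists>s\<in>F. \<exists>f\<in>I. conv L (monomial (to_loc Q P s)) x = loc_map Q P f)" by blast
next
  assume "Poly_Mapping.keys x \<subseteq> carrier L \<and>
     (\<exists>s\<in>F. \<exists>f\<in>I. conv L (monomial (to_loc Q P s)) x = loc_map Q P f)"
  then show "x \<in> loc_ideal Q P I"
    using L.ideal_unit[OF loc_ideal_ideal to_loc_Units] loc_map_in_loc_idealI by metis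
qed

lemma loc_map_in_loc_ideal_iff:
  assumes f: "Poly_Mapping.keys f \<subseteq> carrier Q"
  shows "loc_map Q P f \<in> loc_ideal Q P I \<longleftrightarrow> (\<exists>s\<in>F. conv Q (monomial s) f \<in> I)"
proof
  assume "loc_map Q P f \<in> loc_ideal Q P I"
  then obtain s g where s: "s \<in> F" "g \<in> I" "conv L (monomial (to_loc Q P s)) (loc_map Q P f) = loc_map Q P g"
    unfolding loc_ideal_iff by blast
  have c: "s \<in> carrier Q" using s by auto
  have k: "Poly_Mapping.keys (conv Q (monomial s) f) \<subseteq> carrier Q" using c f by (intro conv_closed) auto
  have "loc_map Q P (conv Q (monomial s) f - g) = 0"
    using s(3) loc_map_conv[of "monomial s" f] c f by (simp add: loc_map_diff)
  then obtain u where u: "u \<in> F" "conv Q (monomial u) (conv Q (monomial s) f - g) = 0"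
    using loc_map_kernel[OF order_trans[OF keys_minus Un_least[OF k ideal_keys[OF I s(2)]]]] by blast
  have uc: "u \<in> carrier Q" using u by auto
  have "conv Q (monomial (u \<otimes> s)) f = conv Q (monomial u) g"
    using u(2) conv_assoc[of "monomial u" "monomial s" f] c uc f by (simp add: conv_diff_right)
  moreover have "conv Q (monomial u) g \<in> I" using uc by (intro ideal_conv[OF I s(2)]) auto
  ultimately show "\<exists>s\<in>F. conv Q (monomial s) f \<in> I" using F_mult[OF u(1) s(1)] by metis
next
  assume "\<exists>s\<in>F. conv Q (monomial s) f \<in> I"
  then obtain s where s: "s \<in> F" "conv Q (monomial s) f \<in> I" by blast
  then have "conv L (monomial (to_loc Q P s)) (loc_map Q P f) \<in> loc_ideal Q P I"
    using loc_map_in_loc_idealI[OF s(2)] loc_map_conv[of "monomial s" f] f by simp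
  then show "loc_map Q P f \<in> loc_ideal Q P I"
    using L.ideal_unit[OF loc_ideal_ideal to_loc_Units[OF s(1)] loc_map_closed[OF f]] by blast
qed

text \<open>One inclusion holds since the right-hand side is a congruence containing the generators.
  Conversely, a localized binomial returns to \<open>I\<close> after clearing denominators and
  applying one more multiplier \<open>v\<close>; all of these are units of the localization and can
  be divided out.\<close>

lemma loc_congruence_eq:
  "loc_congruence Q (ideal_congruence Q I) P = ideal_congruence L (loc_ideal Q P I)"
proof
  let ?r = "map_prod (to_loc Q P) (to_loc Q P) ` ideal_congruence Q I"
  have "?r \<subseteq> ideal_congruence L (loc_ideal Q P I)"
  proof
    fix p assume "p \<in> ?r"
    then obtain a b c where a: "a \<in> carrier Q" "b \<in> carrier Q" "c \<noteq> 0" "monomial a - Poly_Mapping.single b c \<in> I"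
      "p = (to_loc Q P a, to_loc Q P b)" by (auto simp: ideal_congruence_def)
    then show "p \<in> ideal_congruence L (loc_ideal Q P I)"
      using loc_map_in_loc_idealI[OF a(4)] by (auto simp: ideal_congruence_def loc_map_diff)
  qed
  then show "loc_congruence Q (ideal_congruence Q I) P \<subseteq> ideal_congruence L (loc_ideal Q P I)"
    unfolding loc_congruence_def generated_congruence_def
    using L.ideal_congruence_monoid_congruence[OF loc_ideal_ideal] by blast
  show "ideal_congruence L (loc_ideal Q P I) \<subseteq> loc_congruence Q (ideal_congruence Q I) P"
    unfolding loc_congruence_def generated_congruence_def
  proof (rule subsetI, rule InterI, clarify)
    fix x y r assume xy: "(x, y) \<in> ideal_congruence L (loc_ideal Q P I)"
      and r: "monoid_congruence L r" "?r \<subseteq> r"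
    then obtain c where c: "c \<noteq> 0" "monomial x - Poly_Mapping.single y c \<in> loc_ideal Q P I"
      and xyc: "x \<in> carrier L" "y \<in> carrier L" by (auto simp: ideal_congruence_def)
    obtain s a where s: "s \<in> F" "a \<in> carrier Q" "to_loc Q P s \<otimes>\<^bsub>L\<^esub> x = to_loc Q P a" using L_repr[OF xyc(1)] .
    obtain t b where t: "t \<in> F" "b \<in> carrier Q" "to_loc Q P t \<otimes>\<^bsub>L\<^esub> y = to_loc Q P b" using L_repr[OF xyc(2)] .
    have st: "s \<in> carrier Q" "t \<in> carrier Q" using s t by auto
    define u where "u = to_loc Q P (s \<otimes> t)"
    have uU: "u \<in> Units L" unfolding u_def by (rule to_loc_Units[OF F_mult[OF s(1) t(1)]])
    have uc: "u \<in> carrier L" using uU by auto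
    have ux: "u \<otimes>\<^bsub>L\<^esub> x = to_loc Q P (t \<otimes> a)" unfolding u_def
      using st xyc s by (simp add: to_loc_mult L.m_ac flip: s(3))
    have uy: "u \<otimes>\<^bsub>L\<^esub> y = to_loc Q P (s \<otimes> b)" unfolding u_def
      using st xyc t by (simp add: to_loc_mult L.m_ac flip: t(3))
    have "loc_map Q P (monomial (t \<otimes> a) - Poly_Mapping.single (s \<otimes> b) c) \<in> loc_ideal Q P I"
      using L.binomial_shift[OF loc_ideal_ideal c(2) uc] by (simp add: loc_map_diff ux uy)
    then obtain v where v: "v \<in> F" "conv Q (monomial v) (monomial (t \<otimes> a) - Poly_Mapping.single (s \<otimes> b) c) \<in> I"
      using loc_map_in_loc_ideal_iff[OF keys_diff_single_subset] st s t by (metis m_closed)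
    have vc: "v \<in> carrier Q" using v by auto
    have "(v \<otimes> (t \<otimes> a), v \<otimes> (s \<otimes> b)) \<in> ideal_congruence Q I"
      using v c(1) vc st s t by (auto simp: ideal_congruence_def conv_diff_right)
    then have "(to_loc Q P (v \<otimes> (t \<otimes> a)), to_loc Q P (v \<otimes> (s \<otimes> b))) \<in> r" using r(2) by force
    then have vr: "(to_loc Q P v \<otimes>\<^bsub>L\<^esub> (u \<otimes>\<^bsub>L\<^esub> x), to_loc Q P v \<otimes>\<^bsub>L\<^esub> (u \<otimes>\<^bsub>L\<^esub> y)) \<in> r"
      unfolding ux uy using vc st s t by (simp add: to_loc_mult)
    let ?z = "inv\<^bsub>L\<^esub> (to_loc Q P v \<otimes>\<^bsub>L\<^esub> u)"
    have zU: "to_loc Q P v \<otimes>\<^bsub>L\<^esub> u \<in> Units L" using to_loc_Units[OF v(1)] uU by simp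
    have z: "?z \<otimes>\<^bsub>L\<^esub> (to_loc Q P v \<otimes>\<^bsub>L\<^esub> (u \<otimes>\<^bsub>L\<^esub> h)) = h" if "h \<in> carrier L" for h
      using L.Units_inv_cancel[OF zU that] that uc vc by (simp add: L.m_assoc)
    show "(x, y) \<in> r"
      using L.congruence_mult_left[OF r(1) vr, of ?z] zU z xyc by simp
  qed
qed

lemma loc_quotient_eq:
  "loc_quotient Q (ideal_congruence Q I) P = quotient_monoid L (ideal_congruence L (loc_ideal Q P I))"
  by (simp add: loc_quotient_def loc_congruence_eq)

lemma loc_class_eq:
  "loc_class Q (ideal_congruence Q I) P a = ideal_congruence L (loc_ideal Q P I) `` {to_loc Q P a}"
  by (simp add: loc_class_def loc_congruence_eq)

lemma loc_congruence_congruence: "monoid_congruence L (ideal_congruence L (loc_ideal Q P I))"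
  by (rule L.ideal_congruence_monoid_congruence[OF loc_ideal_ideal])

end

lemma loc_ideal_binomial:
  fixes I :: "('a \<Rightarrow>\<^sub>0 'k::field) set"
  assumes "binomial_ideal Q I"
  shows "binomial_ideal L (loc_ideal Q P I)"
proof -
  interpret L: comm_monoid L by (rule L_comm_monoid)
  interpret S: cring "monoid_algebra Q :: ('a \<Rightarrow>\<^sub>0 'k) ring" by (rule monoid_algebra_cring)
  interpret LA: cring "loc_algebra Q P :: (('a \<times> 'a) set \<Rightarrow>\<^sub>0 'k) ring" by (rule L.monoid_algebra_cring)
  interpret h: ring_hom_ring "monoid_algebra Q :: ('a \<Rightarrow>\<^sub>0 'k) ring" "loc_algebra Q P" "loc_map Q P"
    by (rule ring_hom_ringI2[OF S.ring_axioms LA.ring_axioms loc_map_hom])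
  obtain B :: "('a \<Rightarrow>\<^sub>0 'k) set" where B: "B \<subseteq> binomials Q" "I = Idl\<^bsub>monoid_algebra Q\<^esub> B"
    using assms unfolding binomial_ideal_def by blast
  have Bc: "B \<subseteq> carrier (monoid_algebra Q)" using B binomials_carrier by blast
  have I: "ideal I (monoid_algebra Q)" by (rule binomial_ideal_ideal[OF assms])
  have LB: "loc_map Q P ` B \<subseteq> binomials L"
  proof
    fix x assume "x \<in> loc_map Q P ` B"
    then obtain a b c where ab: "a \<in> carrier Q" "b \<in> carrier Q" "x = loc_map Q P (monomial a - Poly_Mapping.single b c)"
      using B(1) by (auto simp: binomials_def)
    then have "x = monomial (to_loc Q P a) - Poly_Mapping.single (to_loc Q P b) c" by (simp add: loc_map_diff)
    then show "x \<in> binomials L" unfolding binomials_def using to_loc_closed ab(1,2) by blast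
  qed
  then have LBc: "loc_map Q P ` B \<subseteq> carrier (loc_algebra Q P)" using L.binomials_carrier by blast
  let ?K = "Idl\<^bsub>loc_algebra Q P\<^esub> (loc_map Q P ` B)"
  have K: "ideal ?K (loc_algebra Q P)" by (rule LA.genideal_ideal[OF LBc])
  have "I \<subseteq> {f \<in> carrier (monoid_algebra Q). loc_map Q P f \<in> ?K}"
    unfolding B(2)
    by (rule S.genideal_minimal[OF h.ideal_vimage[OF K]]) (use Bc LA.genideal_self[OF LBc] in auto)
  then have "loc_ideal Q P I \<subseteq> ?K"
    unfolding loc_ideal_def by (intro LA.genideal_minimal[OF K]) auto
  moreover have "?K \<subseteq> loc_ideal Q P I"
    using loc_map_in_loc_idealI[OF I] S.genideal_self[OF Bc] unfolding B(2)[symmetric]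
    by (intro LA.genideal_minimal[OF loc_ideal_ideal[OF I]]) auto
  ultimately have "loc_ideal Q P I = ?K" by blast
  then show ?thesis unfolding binomial_ideal_def using LB by blast
qed

text \<open>Two representatives differ by an element of the localized ideal, whose component in
  degree \<open>d\<close> again lies in that ideal. So the union over representatives collapses to
  one coset.\<close>

lemma homogeneous_component_eq:
  fixes J :: "('a \<Rightarrow>\<^sub>0 'k::field) set"
  assumes J: "ideal J (monoid_algebra Q)" and bin: "binomial_ideal L (loc_ideal Q P J)"
    and f: "Poly_Mapping.keys f \<subseteq> carrier L"
    and x: "x \<in> carrier L" "d = ideal_congruence L (loc_ideal Q P J) `` {x}"
  shows "homogeneous_component Q P J d (loc_residue Q P J f) = loc_residue Q P J (restrict_support f d)"
proof -
  interpret L: comm_monoid L by (rule L_comm_monoid)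
  note JJ = loc_ideal_ideal[OF J]
  have eq: "loc_residue Q P J (restrict_support g d) = loc_residue Q P J (restrict_support f d)"
    if gf: "g \<in> loc_residue Q P J f" for g
  proof -
    obtain j where j: "j \<in> loc_ideal Q P J" "g = j + f"
      using gf unfolding loc_residue_def a_r_coset_def' by auto
    have jk: "Poly_Mapping.keys j \<subseteq> carrier L" by (rule L.ideal_keys[OF JJ j(1)])
    have gk: "Poly_Mapping.keys g \<subseteq> carrier L" unfolding j(2) by (rule order_trans[OF keys_add Un_least[OF jk f]])
    have "restrict_support g d - restrict_support f d = restrict_support j d"
      unfolding j(2) restrict_support_add by simp
    then have "restrict_support g d - restrict_support f d \<in> loc_ideal Q P J"
      using L.binomial_ideal_restrict[OF bin j(1) x] by simp
    then show ?thesis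
      using L.coset_eq_iff[OF JJ, of "restrict_support g d" "restrict_support f d"] gk f
      by (auto simp: keys_restrict_support loc_residue_def)
  qed
  have "f \<in> loc_residue Q P J f"
    unfolding loc_residue_def a_r_coset_def' using L.ideal_zero[OF JJ] by force
  then show ?thesis unfolding homogeneous_component_def using eq by blast
qed

section \<open>The irreducible closure as the kernel of the pairing\<close>

context
  fixes J :: "('a \<Rightarrow>\<^sub>0 'k::field) set" and w :: 'a and \<psi> :: "('a \<times> 'a) set \<Rightarrow> 'k"
  assumes J: "ideal J (monoid_algebra Q)" and w: "w \<in> carrier Q"
    and bin: "binomial_ideal L (loc_ideal Q P J)"
    and wf: "witness_form L (loc_ideal Q P J) (to_loc Q P w) \<psi>"
begin

interpretation L: comm_monoid L by (rule L_comm_monoid)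
interpretation W: witness_form L "loc_ideal Q P J" "to_loc Q P w" \<psi> by (rule wf)

abbreviation "JJ \<equiv> loc_ideal Q P J"
abbreviation "RR \<equiv> loc_residue_ring Q P J"
abbreviation "rs f \<equiv> loc_residue Q P J f"
abbreviation "cong \<equiv> ideal_congruence L (loc_ideal Q P J)"
abbreviation "W0 \<equiv> to_loc Q P w"

lemma RR_eq: "RR = loc_algebra Q P Quot JJ" by (simp add: loc_residue_ring_def)
lemma rs_eq: "rs f = JJ +>\<^bsub>loc_algebra Q P\<^esub> f" by (simp add: loc_residue_def)

lemmas rs_cring = L.res_ring[OF W.I_ideal, folded RR_eq]
lemmas rs_closed = L.res_closed[OF W.I_ideal, folded rs_eq RR_eq]
lemmas rs_mult = L.res_mult[OF W.I_ideal, folded rs_eq RR_eq]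
lemmas rs_add = L.res_add[OF W.I_ideal, folded rs_eq RR_eq]
lemmas rs_zero = L.res_zero[OF W.I_ideal, folded rs_eq RR_eq]
lemmas rs_uminus = L.res_uminus[OF W.I_ideal, folded rs_eq RR_eq]
lemmas rs_eq_zero = L.res_eq_zero_iff[OF W.I_ideal, folded rs_eq RR_eq]
lemmas rs_eq_iff = L.coset_eq_iff[OF W.I_ideal, folded rs_eq]

lemma rs_cases:
  assumes "x \<in> carrier RR"
  obtains f where "Poly_Mapping.keys f \<subseteq> carrier L" "x = rs f"
  using L.res_cases[OF W.I_ideal, of x] assms unfolding RR_eq rs_eq by blast

text \<open>The test by a unit \<open>u\<close> reads the component in the degree of
  \<open>w\<close> divided by \<open>u\<close>. The candidate for the complement thus consists of
  the elements without component in the degrees of unit multiples of \<open>w\<close>.\<close>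

definition perp :: "(('a \<times> 'a) set \<Rightarrow>\<^sub>0 'k) set set" where
  "perp = {rs f | f. Poly_Mapping.keys f \<subseteq> carrier L \<and> (\<forall>u\<in>Units L. W.pr u f = 0)}"

lemma perp_iff:
  assumes "Poly_Mapping.keys f \<subseteq> carrier L"
  shows "rs f \<in> perp \<longleftrightarrow> (\<forall>u\<in>Units L. W.pr u f = 0)"
proof
  assume "rs f \<in> perp"
  then obtain g where g: "Poly_Mapping.keys g \<subseteq> carrier L" "rs f = rs g" "\<forall>u\<in>Units L. W.pr u g = 0"
    unfolding perp_def by blast
  have "f - g \<in> JJ" using rs_eq_iff[OF assms g(1)] g(2) by simp
  then have "W.pr u (f - g) = 0" if "u \<in> Units L" for u using W.pr_I that by auto
  then show "\<forall>u\<in>Units L. W.pr u f = 0" using g(3) by (simp add: W.pr_diff)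
qed (use assms in \<open>auto simp: perp_def\<close>)

lemma perp_cases:
  assumes "x \<in> perp"
  obtains f where "Poly_Mapping.keys f \<subseteq> carrier L" "x = rs f" "\<forall>u\<in>Units L. W.pr u f = 0"
  using assms unfolding perp_def by blast

lemma class_shift_iff:
  assumes u: "u \<in> Units L" and x: "x \<in> carrier L"
  shows "x \<in> cong `` {inv\<^bsub>L\<^esub> u \<otimes>\<^bsub>L\<^esub> W0} \<longleftrightarrow> \<psi> (u \<otimes>\<^bsub>L\<^esub> x) \<noteq> 0"
proof -
  have c: "u \<in> carrier L" "inv\<^bsub>L\<^esub> u \<in> carrier L" using u by auto
  have e: "u \<otimes>\<^bsub>L\<^esub> (inv\<^bsub>L\<^esub> u \<otimes>\<^bsub>L\<^esub> W0) = W0" using u c by (simp add: L.m_assoc[symmetric])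
  have "x \<in> cong `` {inv\<^bsub>L\<^esub> u \<otimes>\<^bsub>L\<^esub> W0} \<longleftrightarrow> (inv\<^bsub>L\<^esub> u \<otimes>\<^bsub>L\<^esub> W0, x) \<in> cong" by simp
  also have "\<dots> \<longleftrightarrow> (W0, u \<otimes>\<^bsub>L\<^esub> x) \<in> cong"
    using L.congruence_mult_left[OF W.congruence, of "inv\<^bsub>L\<^esub> u \<otimes>\<^bsub>L\<^esub> W0" x u]
      L.congruence_mult_left[OF W.congruence, of W0 "u \<otimes>\<^bsub>L\<^esub> x" "inv\<^bsub>L\<^esub> u"] L.Units_inv_cancel[OF u x] e c by auto
  also have "\<dots> \<longleftrightarrow> \<psi> (u \<otimes>\<^bsub>L\<^esub> x) \<noteq> 0" using W.class_w_iff[of "u \<otimes>\<^bsub>L\<^esub> x"] c x by simp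
  finally show ?thesis .
qed

lemma restrict_class_shift:
  assumes f: "Poly_Mapping.keys f \<subseteq> carrier L" and u: "u \<in> Units L"
  shows "restrict_support f (cong `` {inv\<^bsub>L\<^esub> u \<otimes>\<^bsub>L\<^esub> W0}) - Poly_Mapping.single (inv\<^bsub>L\<^esub> u \<otimes>\<^bsub>L\<^esub> W0) (W.pr u f) \<in> JJ"
  using f
proof (induction rule: poly_mapping_keys_induct)
  case zero
  show ?case using L.ideal_zero[OF W.I_ideal] by (simp add: restrict_support_def)
next
  case (single x c)
  have uc: "u \<in> carrier L" "inv\<^bsub>L\<^esub> u \<in> carrier L" using u by auto
  show ?case
  proof (cases "\<psi> (u \<otimes>\<^bsub>L\<^esub> x) = 0")
    case True
    then have "restrict_support (Poly_Mapping.single x c) (cong `` {inv\<^bsub>L\<^esub> u \<otimes>\<^bsub>L\<^esub> W0}) = 0"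
      using class_shift_iff[OF u single]
      by (intro poly_mapping_eqI) (auto simp: lookup_restrict_support lookup_single when_def)
    then show ?thesis using True L.ideal_zero[OF W.I_ideal] by simp
  next
    case False
    have "restrict_support (Poly_Mapping.single x c) (cong `` {inv\<^bsub>L\<^esub> u \<otimes>\<^bsub>L\<^esub> W0}) = Poly_Mapping.single x c"
      using False class_shift_iff[OF u single]
      by (intro poly_mapping_eqI) (auto simp: lookup_restrict_support lookup_single when_def)
    moreover have "monomial x - Poly_Mapping.single (inv\<^bsub>L\<^esub> u \<otimes>\<^bsub>L\<^esub> W0) (\<psi> (u \<otimes>\<^bsub>L\<^esub> x)) \<in> JJ"
      using L.binomial_shift[OF W.I_ideal W.\<psi>_binomial[OF _ False] uc(2)] L.Units_inv_cancel[OF u single] uc single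
      by simp
    then have "psmult c (monomial x - Poly_Mapping.single (inv\<^bsub>L\<^esub> u \<otimes>\<^bsub>L\<^esub> W0) (\<psi> (u \<otimes>\<^bsub>L\<^esub> x))) \<in> JJ"
      by (rule L.ideal_psmult[OF W.I_ideal])
    moreover have "psmult c (monomial x - Poly_Mapping.single (inv\<^bsub>L\<^esub> u \<otimes>\<^bsub>L\<^esub> W0) (\<psi> (u \<otimes>\<^bsub>L\<^esub> x)))
        = Poly_Mapping.single x c - Poly_Mapping.single (inv\<^bsub>L\<^esub> u \<otimes>\<^bsub>L\<^esub> W0) (c * \<psi> (u \<otimes>\<^bsub>L\<^esub> x))"
      by (rule poly_mapping_eqI) (simp add: lookup_minus lookup_single right_diff_distrib when_def)
    ultimately show ?thesis by simp
  qed
next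
  case (add f g)
  then show ?case
    using L.ideal_add[OF W.I_ideal add(3,4)]
    by (simp add: restrict_support_add W.pr_add single_add algebra_simps)
qed

lemma submodule_eq:
  "witness_submodule Q J P w = {rs (conv L g (monomial W0)) | g. Poly_Mapping.keys g \<subseteq> Units L}"
  by (simp add: witness_submodule_def units_of_carrier)

lemma monomial_W0_unit_notin: "u \<in> Units L \<Longrightarrow> monomial (u \<otimes>\<^bsub>L\<^esub> W0) \<notin> JJ"
  using L.ideal_unit[OF W.I_ideal, of u "monomial W0"] W.w_notin_I w by auto

lemma degrees_carrier:
  assumes "d \<in> carrier (loc_quotient Q (ideal_congruence Q J) P)"
  obtains x where "x \<in> carrier L" "d = cong `` {x}"
  using assms unfolding loc_quotient_eq[OF J] L.quotient_carrier[OF W.congruence] by blast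

lemma degree_in_carrier: "x \<in> carrier L \<Longrightarrow> cong `` {x} \<in> carrier (loc_quotient Q (ideal_congruence Q J) P)"
  unfolding loc_quotient_eq[OF J] L.quotient_carrier[OF W.congruence] by blast

text \<open>A unit test either sees nothing of a homogeneous component, or the component has exactly
  the degree read by this test and then lies in the ideal.\<close>

lemma perp_graded: "graded_subspace Q P J perp"
  unfolding graded_subspace_def
proof (intro conjI ballI)
  interpret RR: cring RR by (rule rs_cring)
  show "subalgebra (range (\<lambda>c. rs (Poly_Mapping.single \<one>\<^bsub>L\<^esub> c))) perp RR"
  proof (intro subalgebra.intro subalgebra_axioms.intro)
    show "subgroup perp (add_monoid RR)"
    proof (rule RR.add.subgroupI)
      show "perp \<subseteq> carrier RR" using rs_closed by (auto simp: perp_def)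
      have "rs 0 \<in> perp" by (simp add: perp_iff)
      then show "perp \<noteq> {}" by blast
      show "\<ominus>\<^bsub>RR\<^esub> x \<in> perp" if "x \<in> perp" for x
      proof -
        obtain f where f: "Poly_Mapping.keys f \<subseteq> carrier L" "x = rs f" "\<forall>u\<in>Units L. W.pr u f = 0"
          using perp_cases[OF \<open>x \<in> perp\<close>] .
        have "Poly_Mapping.keys (- f) \<subseteq> carrier L" using f(1) by (simp add: keys_uminus)
        moreover have "W.pr u (- f) = 0" if "u \<in> Units L" for u
          using W.pr_diff[of u 0 f] f(3) that by simp
        ultimately have "rs (- f) \<in> perp" by (simp add: perp_iff)
        then show ?thesis using rs_uminus[OF f(1)] f(2) by simp
      qed
      show "x \<oplus>\<^bsub>RR\<^esub> y \<in> perp" if "x \<in> perp" "y \<in> perp" for x y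
      proof -
        obtain f where f: "Poly_Mapping.keys f \<subseteq> carrier L" "x = rs f" "\<forall>u\<in>Units L. W.pr u f = 0"
          using perp_cases[OF \<open>x \<in> perp\<close>] .
        obtain g where g: "Poly_Mapping.keys g \<subseteq> carrier L" "y = rs g" "\<forall>u\<in>Units L. W.pr u g = 0"
          using perp_cases[OF \<open>y \<in> perp\<close>] .
        have "rs (f + g) \<in> perp"
          using f g perp_iff[OF order_trans[OF keys_add Un_least[OF f(1) g(1)]]] by (simp add: W.pr_add)
        then show ?thesis using rs_add[OF f(1) g(1)] f(2) g(2) by simp
      qed
    qed
    show "k \<otimes>\<^bsub>RR\<^esub> v \<in> perp" if kv: "k \<in> range (\<lambda>c. rs (Poly_Mapping.single \<one>\<^bsub>L\<^esub> c))" "v \<in> perp" for k v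
    proof -
      obtain c where k: "k = rs (Poly_Mapping.single \<one>\<^bsub>L\<^esub> c)" using kv(1) by blast
      obtain f where f: "Poly_Mapping.keys f \<subseteq> carrier L" "v = rs f" "\<forall>u\<in>Units L. W.pr u f = 0"
        using perp_cases[OF kv(2)] .
      let ?g = "conv L (Poly_Mapping.single \<one>\<^bsub>L\<^esub> c) f"
      have "Poly_Mapping.keys ?g \<subseteq> carrier L" using f(1) by (intro L.conv_closed) auto
      moreover have "W.pr u ?g = 0" if "u \<in> Units L" for u
        using W.pr_conv[of u "\<one>\<^bsub>L\<^esub>" f c] f that by auto
      ultimately have "rs ?g \<in> perp" by (simp add: perp_iff)
      then show ?thesis using rs_mult[of "Poly_Mapping.single \<one>\<^bsub>L\<^esub> c" f] f k by simp
    qed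
  qed
  fix x d assume x: "x \<in> perp" and d: "d \<in> carrier (loc_quotient Q (ideal_congruence Q J) P)"
  obtain f where f: "Poly_Mapping.keys f \<subseteq> carrier L" "x = rs f" "\<forall>u\<in>Units L. W.pr u f = 0"
    using perp_cases[OF x] .
  obtain y where y: "y \<in> carrier L" "d = cong `` {y}" using degrees_carrier[OF d] .
  have rk: "Poly_Mapping.keys (restrict_support f d) \<subseteq> carrier L" using f(1) by (auto simp: keys_restrict_support)
  have "W.pr u (restrict_support f d) = 0" if u: "u \<in> Units L" for u
  proof (cases "\<exists>v\<in>d \<inter> carrier L. \<psi> (u \<otimes>\<^bsub>L\<^esub> v) \<noteq> 0")
    case True
    then obtain v where v: "v \<in> d" "v \<in> carrier L" "v \<in> cong `` {inv\<^bsub>L\<^esub> u \<otimes>\<^bsub>L\<^esub> W0}" using class_shift_iff[OF u] by blast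
    have "d = cong `` {v}"
      using equiv_class_eq[OF L.congruence_equiv[OF W.congruence], of y v] v y by simp
    also have "\<dots> = cong `` {inv\<^bsub>L\<^esub> u \<otimes>\<^bsub>L\<^esub> W0}"
      using equiv_class_eq[OF L.congruence_equiv[OF W.congruence], of "inv\<^bsub>L\<^esub> u \<otimes>\<^bsub>L\<^esub> W0" v] v by simp
    finally have "restrict_support f d \<in> JJ" using restrict_class_shift[OF f(1) u] f(3) u by simp
    then show ?thesis using W.pr_I u by auto
  next
    case False
    then show ?thesis
      unfolding keysum_def using f(1) by (intro sum.neutral) (auto simp: keys_restrict_support)
  qed
  then show "homogeneous_component Q P J d x \<in> perp"
    unfolding f(2) homogeneous_component_eq[OF J bin f(1) y] by (simp add: perp_iff[OF rk])
qed

lemma W0_closed: "W0 \<in> carrier L" using w by simp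

lemma submodule_conv_keys: "Poly_Mapping.keys (g :: _ \<Rightarrow>\<^sub>0 'k) \<subseteq> Units L \<Longrightarrow> Poly_Mapping.keys (conv L g (monomial W0)) \<subseteq> carrier L"
  using W0_closed by (intro L.conv_closed) auto

text \<open>Elements of the submodule live in the degrees of unit multiples of \<open>w\<close>, and
  there the vanishing of all unit tests means that each component vanishes.\<close>

lemma submodule_perp_Int: "witness_submodule Q J P w \<inter> perp = {\<zero>\<^bsub>RR\<^esub>}"
proof
  show "witness_submodule Q J P w \<inter> perp \<subseteq> {\<zero>\<^bsub>RR\<^esub>}"
  proof
    fix x assume x: "x \<in> witness_submodule Q J P w \<inter> perp"
    then obtain g where g: "Poly_Mapping.keys g \<subseteq> Units L" "x = rs (conv L g (monomial W0))"
      unfolding submodule_eq by blast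
    let ?f = "conv L g (monomial W0)"
    have fk: "Poly_Mapping.keys ?f \<subseteq> carrier L" by (rule submodule_conv_keys[OF g(1)])
    have pr: "\<forall>u\<in>Units L. W.pr u ?f = 0" using x perp_iff[OF fk] g(2) by simp
    have "?f \<in> JJ"
    proof (rule ccontr)
      assume "?f \<notin> JJ"
      then obtain y where y: "y \<in> Poly_Mapping.keys ?f" "restrict_support ?f (cong `` {y}) \<notin> JJ"
        using L.exists_class_not_in_ideal[OF W.I_ideal fk] by blast
      have "Poly_Mapping.keys ?f \<subseteq> (\<lambda>u. u \<otimes>\<^bsub>L\<^esub> W0) ` Units L"
        by (rule L.keys_conv_subset[OF g(1), of _ "{W0}"]) auto
      then obtain u where u: "u \<in> Units L" "y = u \<otimes>\<^bsub>L\<^esub> W0" using y(1) by blast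
      have "restrict_support ?f (cong `` {u \<otimes>\<^bsub>L\<^esub> W0}) \<in> JJ"
        using restrict_class_shift[OF fk, of "inv\<^bsub>L\<^esub> u"] u pr by simp
      then show False using y(2) u(2) by simp
    qed
    then show "x \<in> {\<zero>\<^bsub>RR\<^esub>}" using rs_eq_zero[OF fk] g(2) by simp
  qed
  have "rs 0 \<in> perp" by (simp add: perp_iff)
  moreover have "rs 0 \<in> witness_submodule Q J P w" unfolding submodule_eq by (auto intro!: exI[of _ 0])
  ultimately show "{\<zero>\<^bsub>RR\<^esub>} \<subseteq> witness_submodule Q J P w \<inter> perp" by (simp add: rs_zero)
qed

lemma submodule_perp_sum: "witness_submodule Q J P w <+>\<^bsub>RR\<^esub> perp = carrier RR"
proof
  interpret RR: cring RR by (rule rs_cring)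
  show "witness_submodule Q J P w <+>\<^bsub>RR\<^esub> perp \<subseteq> carrier RR"
    unfolding set_add_def' submodule_eq perp_def using rs_closed submodule_conv_keys by auto
  show "carrier RR \<subseteq> witness_submodule Q J P w <+>\<^bsub>RR\<^esub> perp"
  proof
    fix x assume "x \<in> carrier RR"
    then obtain f where f: "Poly_Mapping.keys f \<subseteq> carrier L" "x = rs f" by (rule rs_cases)
    obtain b where b: "Poly_Mapping.keys b \<subseteq> Units L" "\<forall>v\<in>Units L. W.pr v f = W.pr v (conv L b (monomial W0))"
      using W.unit_part[OF f(1)] by blast
    let ?b = "conv L b (monomial W0)"
    have bk: "Poly_Mapping.keys ?b \<subseteq> carrier L" by (rule submodule_conv_keys[OF b(1)])
    have dk: "Poly_Mapping.keys (f - ?b) \<subseteq> carrier L" by (rule order_trans[OF keys_minus Un_least[OF f(1) bk]])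
    have "rs (f - ?b) \<in> perp" using perp_iff[OF dk] b(2) by (simp add: W.pr_diff)
    moreover have "rs ?b \<in> witness_submodule Q J P w" unfolding submodule_eq using b(1) by blast
    moreover have "x = rs ?b \<oplus>\<^bsub>RR\<^esub> rs (f - ?b)" using rs_add[OF bk dk] f(2) by simp
    ultimately show "x \<in> witness_submodule Q J P w <+>\<^bsub>RR\<^esub> perp" unfolding set_add_def' by blast
  qed
qed

text \<open>A graded complement \<open>V\<close> avoids the degrees of unit multiples of
  \<open>w\<close>, since a component there would lie in both \<open>V\<close> and the submodule.
  Hence \<open>V\<close> is contained in \<open>perp\<close>, and nested complements of the same
  submodule coincide.\<close>

lemma witness_perp_eq: "witness_perp Q J P w = perp"
  unfolding witness_perp_def
proof (rule the_equality)
  interpret RR: cring RR by (rule rs_cring)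
  show "graded_subspace Q P J perp \<and> witness_submodule Q J P w <+>\<^bsub>RR\<^esub> perp = carrier RR \<and>
      witness_submodule Q J P w \<inter> perp = {\<zero>\<^bsub>RR\<^esub>}"
    using perp_graded submodule_perp_sum submodule_perp_Int by blast
  fix V assume V: "graded_subspace Q P J V \<and> witness_submodule Q J P w <+>\<^bsub>RR\<^esub> V = carrier RR \<and>
      witness_submodule Q J P w \<inter> V = {\<zero>\<^bsub>RR\<^esub>}"
  have Vs: "subgroup V (add_monoid RR)" using V by (auto simp: graded_subspace_def subalgebra_def)
  have Vc: "V \<subseteq> carrier RR" using subgroup.subset[OF Vs] by simp
  have VP: "V \<subseteq> perp"
  proof
    fix x assume x: "x \<in> V"
    then obtain f where f: "Poly_Mapping.keys f \<subseteq> carrier L" "x = rs f" using Vc rs_cases by blast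
    have "W.pr u f = 0" if u: "u \<in> Units L" for u
    proof (rule ccontr)
      assume ne: "W.pr u f \<noteq> 0"
      let ?y = "inv\<^bsub>L\<^esub> u \<otimes>\<^bsub>L\<^esub> W0"
      let ?d = "cong `` {?y}"
      let ?g = "Poly_Mapping.single (inv\<^bsub>L\<^esub> u) (W.pr u f)"
      have yc: "?y \<in> carrier L" "inv\<^bsub>L\<^esub> u \<in> Units L" using u W0_closed by auto
      have rk: "Poly_Mapping.keys (restrict_support f ?d) \<subseteq> carrier L" using f(1) by (auto simp: keys_restrict_support)
      have "rs (restrict_support f ?d) \<in> V"
        using V x degree_in_carrier[OF yc(1)] homogeneous_component_eq[OF J bin f(1) yc(1) refl] f(2)
        unfolding graded_subspace_def by metis
      moreover have "rs (restrict_support f ?d) = rs (Poly_Mapping.single ?y (W.pr u f))"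
        using rs_eq_iff[OF rk, of "Poly_Mapping.single ?y (W.pr u f)"] restrict_class_shift[OF f(1) u] yc by simp
      moreover have "rs (Poly_Mapping.single ?y (W.pr u f)) \<in> witness_submodule Q J P w"
        unfolding submodule_eq using yc(2) by (auto intro!: exI[of _ ?g] split: if_splits)
      ultimately have "rs (Poly_Mapping.single ?y (W.pr u f)) = \<zero>\<^bsub>RR\<^esub>" using V by (metis IntI singletonD)
      then have "Poly_Mapping.single ?y (W.pr u f) \<in> JJ" using rs_eq_zero yc(1) by simp
      then show False using L.ideal_single[OF W.I_ideal] ne monomial_W0_unit_notin[OF yc(2)] by blast
    qed
    then show "x \<in> perp" using f perp_iff by simp
  qed
  moreover have "perp \<subseteq> V"
  proof
    fix x assume x: "x \<in> perp"
    have Ps: "subgroup perp (add_monoid RR)" using perp_graded by (auto simp: graded_subspace_def subalgebra_def)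
    have xc: "x \<in> carrier RR" using subgroup.subset[OF Ps] x by auto
    then have "x \<in> witness_submodule Q J P w <+>\<^bsub>RR\<^esub> V" using V by simp
    then obtain s v where sv: "s \<in> witness_submodule Q J P w" "v \<in> V" "x = s \<oplus>\<^bsub>RR\<^esub> v"
      unfolding set_add_def' by blast
    have sc: "s \<in> carrier RR" using sv(1) rs_closed submodule_conv_keys unfolding submodule_eq by auto
    have vc: "v \<in> carrier RR" using sv Vc by blast
    have "x \<oplus>\<^bsub>RR\<^esub> \<ominus>\<^bsub>RR\<^esub> v \<in> perp"
      using subgroup.m_closed[OF Ps x, of "\<ominus>\<^bsub>RR\<^esub> v"] subgroup.m_inv_closed[OF Ps, of v] sv(2) VP
      by (simp add: a_inv_def subset_iff)
    moreover have "x \<oplus>\<^bsub>RR\<^esub> \<ominus>\<^bsub>RR\<^esub> v = s" using sv(3) sc vc by (simp add: RR.a_assoc RR.r_neg)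
    ultimately have "s \<in> {\<zero>\<^bsub>RR\<^esub>}" using sv(1) submodule_perp_Int by blast
    then have "x = v" using sv(3) vc by simp
    then show "x \<in> V" using sv(2) by simp
  qed
  ultimately show "V = perp" by blast
qed

definition coreR :: "(('a \<times> 'a) set \<Rightarrow>\<^sub>0 'k) set set" where
  "coreR = rs ` W.core"

lemma core_keys: "f \<in> W.core \<Longrightarrow> Poly_Mapping.keys f \<subseteq> carrier L"
  by (simp add: W.core_def)

lemma JJ_core: "JJ \<subseteq> W.core"
  using W.pr_I L.ideal_keys[OF W.I_ideal] by (auto simp: W.core_def)

lemma coreR_iff:
  assumes "Poly_Mapping.keys f \<subseteq> carrier L"
  shows "rs f \<in> coreR \<longleftrightarrow> f \<in> W.core"
proof
  assume "rs f \<in> coreR"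
  then obtain g where g: "g \<in> W.core" "rs f = rs g" by (auto simp: coreR_def)
  have "f - g \<in> W.core" using rs_eq_iff[OF assms core_keys[OF g(1)]] g(2) JJ_core by auto
  then have "(f - g) + g \<in> W.core" using L.ideal_add[OF W.core_ideal] g(1) by blast
  then show "f \<in> W.core" by simp
qed (simp add: coreR_def)

lemma coreR_ideal: "ideal coreR RR"
proof (rule idealI)
  interpret RR: cring RR by (rule rs_cring)
  show "ring RR" by (rule RR.ring_axioms)
  show "subgroup coreR (add_monoid RR)"
  proof (rule RR.add.subgroupI)
    show "coreR \<subseteq> carrier RR" using rs_closed core_keys by (auto simp: coreR_def)
    show "coreR \<noteq> {}" using L.ideal_zero[OF W.core_ideal] by (auto simp: coreR_def)
    show "\<ominus>\<^bsub>RR\<^esub> x \<in> coreR" if "x \<in> coreR" for x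
      using that rs_uminus[OF core_keys] L.ideal_uminus[OF W.core_ideal] by (auto simp: coreR_def)
    show "x \<oplus>\<^bsub>RR\<^esub> y \<in> coreR" if "x \<in> coreR" "y \<in> coreR" for x y
      using that rs_add[OF core_keys core_keys] L.ideal_add[OF W.core_ideal] by (auto simp: coreR_def)
  qed
  show l: "x \<otimes>\<^bsub>RR\<^esub> a \<in> coreR" if "a \<in> coreR" "x \<in> carrier RR" for a x
  proof -
    obtain f where f: "f \<in> W.core" "a = rs f" using \<open>a \<in> coreR\<close> by (auto simp: coreR_def)
    obtain g where g: "Poly_Mapping.keys g \<subseteq> carrier L" "x = rs g" using rs_cases[OF \<open>x \<in> carrier RR\<close>] .
    show ?thesis using rs_mult[OF g(1) core_keys[OF f(1)]] L.ideal_conv[OF W.core_ideal f(1) g(1)] f(2) g(2)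
      by (simp add: coreR_def)
  qed
  show "a \<otimes>\<^bsub>RR\<^esub> x \<in> coreR" if "a \<in> coreR" "x \<in> carrier RR" for a x
  proof -
    have "a \<in> carrier RR" using that(1) rs_closed core_keys by (auto simp: coreR_def)
    then show ?thesis using l[OF that] RR.m_comm[of a x] that(2) by simp
  qed
qed

text \<open>If \<open>f\<close> represents an element of an ideal inside \<open>perp\<close>, then
  \<open>t^y f\<close> has vanishing test by 1, and this test is the pairing of \<open>y\<close>
  with \<open>f\<close>. So such an ideal stays inside the kernel of the pairing, which itself lies
  in \<open>perp\<close>.\<close>

lemma witness_perp_core_eq: "witness_perp_core Q J P w = coreR"
  unfolding witness_perp_core_def witness_perp_eq
proof (rule Greatest_equality)
  have "coreR \<subseteq> perp"
  proof
    fix x assume "x \<in> coreR"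
    then obtain f where f: "f \<in> W.core" "x = rs f" by (auto simp: coreR_def)
    have "\<forall>u\<in>Units L. W.pr u f = 0" using f(1) by (auto simp: W.core_def)
    then show "x \<in> perp" using perp_iff[OF core_keys[OF f(1)]] f(2) by simp
  qed
  then show "ideal coreR RR \<and> coreR \<subseteq> perp" using coreR_ideal by blast
  fix N assume N: "ideal N RR \<and> N \<subseteq> perp"
  show "N \<subseteq> coreR"
  proof
    fix x assume x: "x \<in> N"
    then have "x \<in> carrier RR" using ideal.Icarr N by metis
    then obtain f where f: "Poly_Mapping.keys f \<subseteq> carrier L" "x = rs f" by (rule rs_cases)
    have "W.pr y f = 0" if y: "y \<in> carrier L" for y
    proof -
      have "rs (monomial y) \<otimes>\<^bsub>RR\<^esub> x \<in> N"
        using ideal.I_l_closed[of N RR x] N x rs_closed[of "monomial y"] y by simp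
      then have "rs (conv L (monomial y) f) \<in> perp" using rs_mult[of "monomial y" f] y f N by auto
      moreover have "Poly_Mapping.keys (conv L (monomial y) f) \<subseteq> carrier L"
        using y f(1) by (intro L.conv_closed) auto
      ultimately have "W.pr \<one>\<^bsub>L\<^esub> (conv L (monomial y) f) = 0" using perp_iff by blast
      then show ?thesis using W.pr_conv[of "\<one>\<^bsub>L\<^esub>" y f 1] y f(1) by simp
    qed
    then show "x \<in> coreR" using f by (simp add: coreR_def W.core_def)
  qed
qed

theorem irreducible_closure_eq:
  "irreducible_closure Q J P w = {f \<in> carrier (monoid_algebra Q). loc_map Q P f \<in> W.core}"
proof -
  interpret RR: cring RR by (rule rs_cring)
  interpret C: ideal coreR RR by (rule coreR_ideal)
  have z: "\<zero>\<^bsub>RR Quot coreR\<^esub> = coreR" by (simp add: FactRing_def)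
  have "coreR +>\<^bsub>RR\<^esub> rs (loc_map Q P f) = coreR \<longleftrightarrow> loc_map Q P f \<in> W.core"
    if "Poly_Mapping.keys f \<subseteq> carrier Q" for f
    using C.rcos_const_imp_mem[OF rs_closed[OF loc_map_closed[OF that]]]
      RR.a_rcos_zero[OF coreR_ideal] coreR_iff[OF loc_map_closed[OF that]] by blast
  then show ?thesis
    unfolding irreducible_closure_def a_kernel_def' witness_perp_core_eq z by auto
qed

end

end

section \<open>Coprincipal components\<close>

context prime_localization
begin

context
  fixes I :: "('a \<Rightarrow>\<^sub>0 'k::field) set"
  assumes bin: "binomial_ideal Q I"
begin

interpretation L: comm_monoid L by (rule L_comm_monoid)
interpretation LA: cring "loc_algebra Q P :: (('a \<times> 'a) set \<Rightarrow>\<^sub>0 'k) ring" by (rule L.monoid_algebra_cring)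

abbreviation "II \<equiv> loc_ideal Q P I"
abbreviation "congI \<equiv> ideal_congruence L (loc_ideal Q P I)"

lemma I_ideal: "ideal I (monoid_algebra Q)"
  by (rule binomial_ideal_ideal[OF bin])

lemma II_ideal: "ideal II (loc_algebra Q P)"
  by (rule loc_ideal_ideal[OF I_ideal])

lemma II_binomial: "binomial_ideal L II"
  by (rule loc_ideal_binomial[OF bin])

lemmas congI = loc_congruence_congruence[OF I_ideal]

lemma green_le_iff:
  assumes "a \<in> carrier L" "b \<in> carrier L"
  shows "green_le (loc_quotient Q (ideal_congruence Q I) P) (congI `` {a}) (congI `` {b}) \<longleftrightarrow>
    (\<exists>x\<in>carrier L. (b, a \<otimes>\<^bsub>L\<^esub> x) \<in> congI)"
proof -
  have pi: "principal_monoid_ideal (loc_quotient Q (ideal_congruence Q I) P) (congI `` {a})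
      = {congI `` {a \<otimes>\<^bsub>L\<^esub> x} | x. x \<in> carrier L}" if "a \<in> carrier L" for a
  proof -
    have "\<exists>x\<in>carrier L. C = congI `` {x}" if "C \<in> carrier (quotient_monoid L congI)" for C
      using that unfolding L.quotient_carrier[OF congI] by blast
    moreover have "congI `` {x} \<in> carrier (quotient_monoid L congI)" if "x \<in> carrier L" for x
      using that unfolding L.quotient_carrier[OF congI] by blast
    ultimately show ?thesis
      unfolding principal_monoid_ideal_def loc_quotient_eq[OF I_ideal]
      using L.quotient_mult[OF congI \<open>a \<in> carrier L\<close>] by blast
  qed
  show ?thesis
  proof
    assume "green_le (loc_quotient Q (ideal_congruence Q I) P) (congI `` {a}) (congI `` {b})"
    moreover have "congI `` {b} \<in> {congI `` {b \<otimes>\<^bsub>L\<^esub> x} | x. x \<in> carrier L}"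
      using assms by (auto intro!: exI[of _ "\<one>\<^bsub>L\<^esub>"])
    ultimately obtain x where "x \<in> carrier L" "congI `` {b} = congI `` {a \<otimes>\<^bsub>L\<^esub> x}"
      unfolding green_le_def pi[OF assms(1)] pi[OF assms(2)] by blast
    then show "\<exists>x\<in>carrier L. (b, a \<otimes>\<^bsub>L\<^esub> x) \<in> congI"
      using L.class_eq_iff[OF congI assms(2), of "a \<otimes>\<^bsub>L\<^esub> x"] assms by auto
  next
    assume "\<exists>x\<in>carrier L. (b, a \<otimes>\<^bsub>L\<^esub> x) \<in> congI"
    then obtain x where x: "x \<in> carrier L" "(b, a \<otimes>\<^bsub>L\<^esub> x) \<in> congI" by blast
    have "congI `` {b \<otimes>\<^bsub>L\<^esub> y} = congI `` {a \<otimes>\<^bsub>L\<^esub> (x \<otimes>\<^bsub>L\<^esub> y)}" if "y \<in> carrier L" for y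
      using L.class_eq_iff[OF congI, of "b \<otimes>\<^bsub>L\<^esub> y" "a \<otimes>\<^bsub>L\<^esub> (x \<otimes>\<^bsub>L\<^esub> y)"]
        L.congruence_mult_right[OF congI x(2) that] assms x(1) that by (simp add: L.m_assoc)
    then show "green_le (loc_quotient Q (ideal_congruence Q I) P) (congI `` {a}) (congI `` {b})"
      unfolding green_le_def pi[OF assms(1)] pi[OF assms(2)] using x(1) by blast
  qed
qed

lemma nonunit_repr:
  assumes "x \<in> carrier L" "x \<notin> Units L"
  obtains p z where "p \<in> P" "z \<in> carrier L" "x = z \<otimes>\<^bsub>L\<^esub> to_loc Q P p"
proof -
  obtain s a where s: "s \<in> F" "a \<in> carrier Q" "to_loc Q P s \<otimes>\<^bsub>L\<^esub> x = to_loc Q P a" using L_repr[OF assms(1)] .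
  have sU: "to_loc Q P s \<in> Units L" by (rule to_loc_Units[OF s(1)])
  have x: "x = inv\<^bsub>L\<^esub> (to_loc Q P s) \<otimes>\<^bsub>L\<^esub> to_loc Q P a"
    using L.Units_inv_cancel[OF sU assms(1)] s(3) by simp
  have "a \<in> P"
  proof (rule ccontr)
    assume "a \<notin> P"
    then have "to_loc Q P a \<in> Units L" using to_loc_Units s(2) by simp
    then have "x \<in> Units L" unfolding x using sU by simp
    then show False using assms(2) by blast
  qed
  then show ?thesis using that[of a "inv\<^bsub>L\<^esub> (to_loc Q P s)"] x sU by simp
qed

context
  fixes w assumes w: "w \<in> carrier Q" and wI: "monomial (to_loc Q P w) \<notin> II"
begin

abbreviation "Wl \<equiv> to_loc Q P w"
abbreviation "\<psi>w \<equiv> L.witness_coeff II Wl"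

lemma wf_I: "witness_form L II Wl \<psi>w"
  using w by (intro L.binomial_witness_form[OF II_binomial wI]) simp

interpretation W: witness_form L II Wl \<psi>w by (rule wf_I)

lemma stabilizer_iff:
  assumes "k \<in> Units L"
  shows "k \<in> witness_stabilizer Q I P w \<longleftrightarrow> \<psi>w (k \<otimes>\<^bsub>L\<^esub> Wl) \<noteq> 0"
proof -
  have k: "k \<in> carrier L" using assms by auto
  have "k \<in> witness_stabilizer Q I P w \<longleftrightarrow> congI `` {k \<otimes>\<^bsub>L\<^esub> Wl} = congI `` {Wl}"
    unfolding witness_stabilizer_def loc_quotient_eq[OF I_ideal] loc_class_eq[OF I_ideal] loc_congruence_eq[OF I_ideal]
    using assms L.quotient_mult[OF congI k] by simp
  then show ?thesis
    using L.class_eq_iff[OF congI, of "k \<otimes>\<^bsub>L\<^esub> Wl" Wl] W.\<psi>_congruence_iff[of "k \<otimes>\<^bsub>L\<^esub> Wl"] k by simp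
qed

text \<open>The equation defining the character says that \<open>t^k t^w\<close> and
  \<open>c t^w\<close> agree modulo the localized ideal. This determines \<open>c\<close>, because
  \<open>t^w\<close> is nonzero there.\<close>

lemma character_eq:
  assumes "k \<in> witness_stabilizer Q I P w"
  shows "witness_character Q I P w k = \<psi>w (k \<otimes>\<^bsub>L\<^esub> Wl)"
proof -
  have kU: "k \<in> Units L" using assms by (simp add: witness_stabilizer_def)
  then have k: "k \<in> carrier L" by auto
  have ne: "\<psi>w (k \<otimes>\<^bsub>L\<^esub> Wl) \<noteq> 0" using stabilizer_iff[OF kU] assms by simp
  have iff: "loc_residue Q P I (monomial k - Poly_Mapping.single \<one>\<^bsub>L\<^esub> c)
      \<otimes>\<^bsub>loc_residue_ring Q P I\<^esub> loc_residue Q P I (monomial Wl) = \<zero>\<^bsub>loc_residue_ring Q P I\<^esub>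
    \<longleftrightarrow> monomial (k \<otimes>\<^bsub>L\<^esub> Wl) - Poly_Mapping.single Wl c \<in> II" for c
  proof -
    have kc: "Poly_Mapping.keys (monomial k - Poly_Mapping.single \<one>\<^bsub>L\<^esub> c) \<subseteq> carrier L"
      using k by (intro keys_diff_single_subset) auto
    have "conv L (monomial k - Poly_Mapping.single \<one>\<^bsub>L\<^esub> c) (monomial Wl)
        = monomial (k \<otimes>\<^bsub>L\<^esub> Wl) - Poly_Mapping.single Wl c" by (simp add: conv_diff_left)
    then show ?thesis
      unfolding loc_residue_def loc_residue_ring_def
      using L.res_mult[OF II_ideal kc, of "monomial Wl"] L.res_eq_zero_iff[OF II_ideal, of "conv L (monomial k - Poly_Mapping.single \<one>\<^bsub>L\<^esub> c) (monomial Wl)"]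
        L.conv_closed[OF kc, of "monomial Wl"] by simp
  qed
  show ?thesis
    unfolding witness_character_def iff
  proof (rule the_equality)
    show "\<psi>w (k \<otimes>\<^bsub>L\<^esub> Wl) \<noteq> 0 \<and> monomial (k \<otimes>\<^bsub>L\<^esub> Wl) - Poly_Mapping.single Wl (\<psi>w (k \<otimes>\<^bsub>L\<^esub> Wl)) \<in> II"
      using ne W.\<psi>_binomial k by simp
    show "c = \<psi>w (k \<otimes>\<^bsub>L\<^esub> Wl)" if "c \<noteq> 0 \<and> monomial (k \<otimes>\<^bsub>L\<^esub> Wl) - Poly_Mapping.single Wl c \<in> II" for c
      using L.binomial_unique[OF II_ideal wI, of "k \<otimes>\<^bsub>L\<^esub> Wl" c] that ne W.\<psi>_binomial k by simp
  qed
qed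

abbreviation "char_gens \<equiv> {monomial u - Poly_Mapping.single v
            (witness_character Q I P w (u \<otimes>\<^bsub>L\<^esub> inv\<^bsub>L\<^esub> v)) | u v.
          u \<in> Units L \<and> v \<in> Units L \<and> u \<otimes>\<^bsub>L\<^esub> inv\<^bsub>L\<^esub> v \<in> witness_stabilizer Q I P w}"
abbreviation "mon_gens \<equiv> {monomial (to_loc Q P u) | u.
          u \<in> carrier Q \<and>
          loc_class Q (ideal_congruence Q I) P w \<notin>
            principal_monoid_ideal (loc_quotient Q (ideal_congruence Q I) P)
              (loc_class Q (ideal_congruence Q I) P u)}"

lemma char_gens_binomials: "char_gens \<subseteq> binomials L"
  unfolding binomials_def using L.Units_closed by blast

lemma mon_gens_binomials: "(mon_gens :: (('a \<times> 'a) set \<Rightarrow>\<^sub>0 'k) set) \<subseteq> binomials L"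
proof
  fix f :: "('a \<times> 'a) set \<Rightarrow>\<^sub>0 'k" assume "f \<in> mon_gens"
  then obtain u where u: "u \<in> carrier Q" "f = monomial (to_loc Q P u)" by blast
  then have "f = monomial (to_loc Q P u) - Poly_Mapping.single \<one>\<^bsub>L\<^esub> 0" by simp
  then show "f \<in> binomials L" unfolding binomials_def using u(1) L.one_closed to_loc_closed by blast
qed

text \<open>Multiplication by \<open>k\<close> in the stabilizer scales \<open>\<psi>\<close> by the
  character value on the class of \<open>w\<close>, and being invertible it moves no other class
  into this one. So every shift of a generator has value 0.\<close>

lemma char_gens_core: "char_gens \<subseteq> W.core"
proof
  fix f assume "f \<in> char_gens"
  then obtain u v where uv: "u \<in> Units L" "v \<in> Units L" "u \<otimes>\<^bsub>L\<^esub> inv\<^bsub>L\<^esub> v \<in> witness_stabilizer Q I P w"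
    and f: "f = monomial u - Poly_Mapping.single v (witness_character Q I P w (u \<otimes>\<^bsub>L\<^esub> inv\<^bsub>L\<^esub> v))" by blast
  define k where "k = u \<otimes>\<^bsub>L\<^esub> inv\<^bsub>L\<^esub> v"
  have kU: "k \<in> Units L" using uv by (simp add: k_def)
  have c: "u \<in> carrier L" "v \<in> carrier L" "inv\<^bsub>L\<^esub> v \<in> carrier L" "k \<in> carrier L" "inv\<^bsub>L\<^esub> k \<in> carrier L" using uv kU by auto
  have kv: "u = k \<otimes>\<^bsub>L\<^esub> v" using uv c by (simp add: k_def L.m_assoc)
  have ne: "\<psi>w (k \<otimes>\<^bsub>L\<^esub> Wl) \<noteq> 0" using stabilizer_iff[OF kU] uv(3) k_def by simp
  have f': "f = monomial u - Poly_Mapping.single v (\<psi>w (k \<otimes>\<^bsub>L\<^esub> Wl))"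
    unfolding f k_def[symmetric] using character_eq uv(3) k_def by simp
  have Wc: "Wl \<in> carrier L" using w by simp
  have ne': "\<psi>w (inv\<^bsub>L\<^esub> k \<otimes>\<^bsub>L\<^esub> Wl) \<noteq> 0"
    using W.\<psi>_shift[of "inv\<^bsub>L\<^esub> k" "k \<otimes>\<^bsub>L\<^esub> Wl"] ne c Wc L.Units_inv_cancel[OF kU Wc] by auto
  have "\<psi>w (x \<otimes>\<^bsub>L\<^esub> u) = \<psi>w (k \<otimes>\<^bsub>L\<^esub> Wl) * \<psi>w (x \<otimes>\<^bsub>L\<^esub> v)" if x: "x \<in> carrier L" for x
  proof -
    have e: "x \<otimes>\<^bsub>L\<^esub> u = k \<otimes>\<^bsub>L\<^esub> (x \<otimes>\<^bsub>L\<^esub> v)" unfolding kv using c x by (simp add: L.m_ac)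
    show ?thesis
    proof (cases "\<psi>w (x \<otimes>\<^bsub>L\<^esub> v) = 0")
      case False
      then show ?thesis unfolding e using W.\<psi>_shift[of k "x \<otimes>\<^bsub>L\<^esub> v"] c x by simp
    next
      case True
      have "\<psi>w (k \<otimes>\<^bsub>L\<^esub> (x \<otimes>\<^bsub>L\<^esub> v)) = 0"
      proof (rule ccontr)
        assume "\<psi>w (k \<otimes>\<^bsub>L\<^esub> (x \<otimes>\<^bsub>L\<^esub> v)) \<noteq> 0"
        then have "\<psi>w (inv\<^bsub>L\<^esub> k \<otimes>\<^bsub>L\<^esub> (k \<otimes>\<^bsub>L\<^esub> (x \<otimes>\<^bsub>L\<^esub> v))) \<noteq> 0"
          using W.\<psi>_shift[of "inv\<^bsub>L\<^esub> k" "k \<otimes>\<^bsub>L\<^esub> (x \<otimes>\<^bsub>L\<^esub> v)"] c x ne' by simp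
        then show False using True L.Units_inv_cancel[OF kU, of "x \<otimes>\<^bsub>L\<^esub> v"] c x by simp
      qed
      then show ?thesis using True e by simp
    qed
  qed
  then show "f \<in> W.core"
    unfolding f' W.core_def using c keys_diff_single_subset[of u "carrier L" v 1 "\<psi>w (k \<otimes>\<^bsub>L\<^esub> Wl)"]
    by (simp add: W.pr_diff)
qed

text \<open>A nonzero value of \<open>\<psi>\<close> on a multiple of \<open>u\<close> would exhibit
  the class of \<open>w\<close> as a multiple of the class of \<open>u\<close>, which the choice of
  the generators excludes.\<close>

lemma mon_gens_core: "(mon_gens :: (('a \<times> 'a) set \<Rightarrow>\<^sub>0 'k) set) \<subseteq> W.core"
proof
  fix f :: "('a \<times> 'a) set \<Rightarrow>\<^sub>0 'k" assume "f \<in> mon_gens"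
  then obtain u where u: "u \<in> carrier Q" "f = monomial (to_loc Q P u)"
    "congI `` {Wl} \<notin> principal_monoid_ideal (quotient_monoid L congI) (congI `` {to_loc Q P u})"
    unfolding loc_class_eq[OF I_ideal] loc_quotient_eq[OF I_ideal] by blast
  have "\<psi>w (x \<otimes>\<^bsub>L\<^esub> to_loc Q P u) = 0" if x: "x \<in> carrier L" for x
  proof (rule ccontr)
    assume "\<psi>w (x \<otimes>\<^bsub>L\<^esub> to_loc Q P u) \<noteq> 0"
    then have "(x \<otimes>\<^bsub>L\<^esub> to_loc Q P u, Wl) \<in> congI" using W.\<psi>_congruence_iff x u by simp
    then have "congI `` {Wl} = congI `` {x \<otimes>\<^bsub>L\<^esub> to_loc Q P u}"
      using L.class_eq_iff[OF congI, of "x \<otimes>\<^bsub>L\<^esub> to_loc Q P u" Wl] x u w by simp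
    also have "\<dots> = congI `` {to_loc Q P u} \<otimes>\<^bsub>quotient_monoid L congI\<^esub> congI `` {x}"
      using L.quotient_mult[OF congI, of "to_loc Q P u" x] L.m_comm[of x "to_loc Q P u"] x u by simp
    finally show False
      using u(3) x unfolding principal_monoid_ideal_def L.quotient_carrier[OF congI] by blast
  qed
  then show "f \<in> W.core" using u by (simp add: W.core_def)
qed

abbreviation "JJw \<equiv> II <+>\<^bsub>loc_algebra Q P\<^esub> character_ideal Q I P w <+>\<^bsub>loc_algebra Q P\<^esub> witness_monomial_ideal Q I P w"

lemma character_ideal_binomial: "binomial_ideal L (character_ideal Q I P w)"
  unfolding binomial_ideal_def character_ideal_def using char_gens_binomials by blast

lemma monomial_ideal_binomial: "binomial_ideal L (witness_monomial_ideal Q I P w :: (('a \<times> 'a) set \<Rightarrow>\<^sub>0 'k) set)"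
  unfolding binomial_ideal_def witness_monomial_ideal_def using mon_gens_binomials by blast

lemma JJw_binomial: "binomial_ideal L JJw"
  by (intro L.binomial_ideal_sum II_binomial character_ideal_binomial monomial_ideal_binomial)

lemma JJw_ideal: "ideal JJw (loc_algebra Q P)"
  by (rule L.binomial_ideal_ideal[OF JJw_binomial])

text \<open>All three summands lie in the kernel of the pairing for \<open>I\<close>. The functional
  of \<open>I\<close> therefore still vanishes on the larger ideal, and both ideals share the same
  functional and kernel.\<close>

lemma JJw_core: "JJw \<subseteq> W.core"
proof -
  have "II \<subseteq> W.core" using W.pr_I L.ideal_keys[OF II_ideal] by (auto simp: W.core_def)
  moreover have "character_ideal Q I P w \<subseteq> W.core"
    unfolding character_ideal_def by (rule LA.genideal_minimal[OF W.core_ideal char_gens_core])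
  moreover have "witness_monomial_ideal Q I P w \<subseteq> W.core"
    unfolding witness_monomial_ideal_def by (rule LA.genideal_minimal[OF W.core_ideal mon_gens_core])
  moreover have "f \<oplus>\<^bsub>loc_algebra Q P\<^esub> g \<in> W.core" if "f \<in> W.core" "g \<in> W.core" for f g
    using L.ideal_add[OF W.core_ideal that] by simp
  ultimately show ?thesis unfolding set_add_def' by blast
qed

lemma II_JJw: "II \<subseteq> JJw"
  using L.ideal_sum_superset(1)[OF II_ideal L.binomial_ideal_ideal[OF character_ideal_binomial]]
    L.ideal_sum_superset(1)[OF L.binomial_ideal_ideal[OF L.binomial_ideal_sum[OF II_binomial character_ideal_binomial]]
      L.binomial_ideal_ideal[OF monomial_ideal_binomial]] by blast

lemma coprincipal_ideal: "ideal (coprincipal_component Q I P w) (monoid_algebra Q)"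
proof -
  interpret S: cring "monoid_algebra Q :: ('a \<Rightarrow>\<^sub>0 'k) ring" by (rule monoid_algebra_cring)
  interpret h: ring_hom_ring "monoid_algebra Q :: ('a \<Rightarrow>\<^sub>0 'k) ring" "loc_algebra Q P" "loc_map Q P"
    by (rule ring_hom_ringI2[OF S.ring_axioms LA.ring_axioms loc_map_hom])
  show ?thesis unfolding coprincipal_component_def by (rule h.ideal_vimage[OF JJw_ideal])
qed

text \<open>Localizing a contraction recovers the ideal: every element becomes an image from the
  algebra of \<open>Q\<close> after multiplication by a unit monomial.\<close>

lemma loc_coprincipal: "loc_ideal Q P (coprincipal_component Q I P w) = JJw"
proof
  show "loc_ideal Q P (coprincipal_component Q I P w) \<subseteq> JJw"
    unfolding loc_ideal_def[of Q P "coprincipal_component Q I P w"]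
    by (rule LA.genideal_minimal[OF JJw_ideal]) (auto simp: coprincipal_component_def)
  show "JJw \<subseteq> loc_ideal Q P (coprincipal_component Q I P w)"
  proof
    fix x assume x: "x \<in> JJw"
    have xk: "Poly_Mapping.keys x \<subseteq> carrier L" by (rule L.ideal_keys[OF JJw_ideal x])
    obtain s g where s: "s \<in> F" "Poly_Mapping.keys g \<subseteq> carrier Q" "conv L (monomial (to_loc Q P s)) x = loc_map Q P g"
      using loc_map_surj[OF xk] by blast
    have "conv L (monomial (to_loc Q P s)) x \<in> JJw" using s(1) by (intro L.ideal_conv[OF JJw_ideal x]) auto
    then have "g \<in> coprincipal_component Q I P w" using s by (simp add: coprincipal_component_def)
    then show "x \<in> loc_ideal Q P (coprincipal_component Q I P w)"
      unfolding loc_ideal_iff[OF coprincipal_ideal] using xk s(1,3) by blast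
  qed
qed

lemma irreducible_closure_coprincipal:
  "irreducible_closure Q (coprincipal_component Q I P w) P w
    = {f \<in> carrier (monoid_algebra Q). loc_map Q P f \<in> W.core}"
proof (rule irreducible_closure_eq[OF coprincipal_ideal w])
  show "binomial_ideal L (loc_ideal Q P (coprincipal_component Q I P w))"
    unfolding loc_coprincipal by (rule JJw_binomial)
  show "witness_form L (loc_ideal Q P (coprincipal_component Q I P w)) Wl \<psi>w"
    unfolding loc_coprincipal
  proof (intro witness_form.intro witness_form_axioms.intro)
    show "comm_monoid L" by (rule L_comm_monoid)
    show "ideal JJw (loc_algebra Q P)" by (rule JJw_ideal)
    show "W.\<kappa> f = 0" if f: "f \<in> JJw" for f
    proof -
      have fc: "f \<in> W.core" using JJw_core f by blast
      then have "W.pr \<one>\<^bsub>L\<^esub> f = 0" by (simp add: W.core_def)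
      moreover have "W.pr \<one>\<^bsub>L\<^esub> f = W.\<kappa> f"
        using L.ideal_keys[OF W.core_ideal fc] by (intro keysum_cong) auto
      ultimately show ?thesis by simp
    qed
    show "monomial u - Poly_Mapping.single Wl (\<psi>w u) \<in> JJw" if "u \<in> carrier L" "\<psi>w u \<noteq> 0" for u
      using W.\<psi>_binomial[OF that] II_JJw by blast
  qed (use w in simp_all)
qed

end

section \<open>Essential witnesses\<close>

lemma both_in_congruent:
  assumes "a \<in> carrier L" "b \<in> carrier L" "monomial a \<in> II" "monomial b \<in> II"
  shows "(a, b) \<in> congI"
  using assms L.ideal_diff[OF II_ideal assms(3,4)] by (auto simp: ideal_congruence_def intro!: exI[of _ 1])

text \<open>If \<open>t^w\<close> were zero, \<open>w\<close> would be congruent to a multiple of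
  the aide \<open>q\<close>; since \<open>q\<close> is not strictly below \<open>w\<close>, it would
  be congruent to a multiple of \<open>w\<close>, hence also zero and congruent to \<open>w\<close>.
  If \<open>x w\<close> were congruent to \<open>w\<close> for a nonunit \<open>x\<close>, the aide
  property gives that \<open>x w\<close> and \<open>x q\<close> are congruent, so again
  \<open>q\<close> is congruent to some \<open>w y\<close>, and \<open>q\<close>,
  \<open>w y\<close>, \<open>x w y\<close>, \<open>x q\<close>, \<open>x w\<close>, \<open>w\<close>
  would all be congruent.\<close>

lemma key_witness_properties:
  assumes kw: "key_witness Q (ideal_congruence Q I) P w"
  shows "monomial (to_loc Q P w) \<notin> II"
    and "\<And>x. x \<in> carrier L \<Longrightarrow> x \<notin> Units L \<Longrightarrow> (x \<otimes>\<^bsub>L\<^esub> to_loc Q P w, to_loc Q P w) \<notin> congI"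
proof -
  let ?W = "to_loc Q P w"
  obtain q where w: "w \<in> carrier Q" and q: "q \<in> carrier Q" "key_aide Q (ideal_congruence Q I) P w q"
    using kw by (auto simp: key_witness_def)
  let ?q = "to_loc Q P q"
  have c: "?W \<in> carrier L" "?q \<in> carrier L" using w q by auto
  have ne: "(?W, ?q) \<notin> congI"
    using q(2) L.class_eq_iff[OF congI c] by (simp add: key_aide_def loc_class_eq[OF I_ideal])
  have eqP: "(?W \<otimes>\<^bsub>L\<^esub> to_loc Q P p, ?q \<otimes>\<^bsub>L\<^esub> to_loc Q P p) \<in> congI" if p: "p \<in> P" for p
  proof -
    have pc: "to_loc Q P p \<in> carrier L" using p P_subset by auto
    have "congI `` {?W} \<otimes>\<^bsub>quotient_monoid L congI\<^esub> congI `` {to_loc Q P p}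
       = congI `` {?q} \<otimes>\<^bsub>quotient_monoid L congI\<^esub> congI `` {to_loc Q P p}"
      using q(2) p by (simp add: key_aide_def loc_class_eq[OF I_ideal] loc_quotient_eq[OF I_ideal])
    then show ?thesis
      unfolding L.quotient_mult[OF congI c(1) pc] L.quotient_mult[OF congI c(2) pc]
      using L.class_eq_iff[OF congI] c pc by simp
  qed
  have nl: "(\<exists>y\<in>carrier L. (?q, ?W \<otimes>\<^bsub>L\<^esub> y) \<in> congI)" if "x \<in> carrier L" "(?W, ?q \<otimes>\<^bsub>L\<^esub> x) \<in> congI" for x
    using q(2) that green_le_iff[OF c(2,1)] green_le_iff[OF c(1,2)]
    unfolding key_aide_def loc_class_eq[OF I_ideal] green_less_def by blast
  show "monomial ?W \<notin> II"
  proof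
    assume z: "monomial ?W \<in> II"
    have "monomial (?q \<otimes>\<^bsub>L\<^esub> ?W) \<in> II" using L.ideal_conv[OF II_ideal z, of "monomial ?q"] c by simp
    then have "(?W, ?q \<otimes>\<^bsub>L\<^esub> ?W) \<in> congI" using both_in_congruent z c by simp
    then obtain y where y: "y \<in> carrier L" "(?q, ?W \<otimes>\<^bsub>L\<^esub> y) \<in> congI" using nl c by blast
    have "monomial (?W \<otimes>\<^bsub>L\<^esub> y) \<in> II"
      using L.ideal_conv[OF II_ideal z, of "monomial y"] c y(1) by (simp add: L.m_comm)
    then have "monomial ?q \<in> II" using L.ideal_congruence_in_ideal[OF II_ideal y(2)] by simp
    then show False using ne both_in_congruent[OF c z] by blast
  qed
  show "(x \<otimes>\<^bsub>L\<^esub> ?W, ?W) \<notin> congI" if x: "x \<in> carrier L" "x \<notin> Units L" for x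
  proof
    assume xW: "(x \<otimes>\<^bsub>L\<^esub> ?W, ?W) \<in> congI"
    note tr = L.congruence_trans[OF congI] and sy = L.congruence_sym[OF congI]
    obtain p z where pz: "p \<in> P" "z \<in> carrier L" "x = z \<otimes>\<^bsub>L\<^esub> to_loc Q P p" using nonunit_repr[OF x] .
    have pc: "to_loc Q P p \<in> carrier L" using pz P_subset by auto
    have xq: "(x \<otimes>\<^bsub>L\<^esub> ?W, x \<otimes>\<^bsub>L\<^esub> ?q) \<in> congI"
      using L.congruence_mult_left[OF congI eqP[OF pz(1)] pz(2)] pz(2,3) pc c by (simp add: L.m_ac)
    have Wqx: "(?W, ?q \<otimes>\<^bsub>L\<^esub> x) \<in> congI" using tr[OF sy[OF xW] xq] x(1) c by (simp add: L.m_comm)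
    obtain y where y: "y \<in> carrier L" "(?q, ?W \<otimes>\<^bsub>L\<^esub> y) \<in> congI" using nl[OF x(1) Wqx] by blast
    have "(?W \<otimes>\<^bsub>L\<^esub> y, (x \<otimes>\<^bsub>L\<^esub> ?W) \<otimes>\<^bsub>L\<^esub> y) \<in> congI" by (rule L.congruence_mult_right[OF congI sy[OF xW] y(1)])
    moreover have "((x \<otimes>\<^bsub>L\<^esub> ?W) \<otimes>\<^bsub>L\<^esub> y, x \<otimes>\<^bsub>L\<^esub> ?q) \<in> congI"
      using L.congruence_mult_left[OF congI sy[OF y(2)] x(1)] x(1) y(1) c by (simp add: L.m_assoc)
    ultimately have "(?q, ?W) \<in> congI" using tr[OF y(2) tr] sy[OF xq] xW tr by blast
    then show False using ne sy by blast
  qed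
qed

lemma class_of_iff: "x \<in> carrier L \<Longrightarrow> y \<in> congI `` {x} \<longleftrightarrow> congI `` {y} = congI `` {x} \<and> y \<in> carrier L"
  using equiv_class_eq[OF L.congruence_equiv[OF congI], of x y] L.class_eq_iff[OF congI, of y x]
    L.congruence_sym[OF congI] L.congruence_closed[OF congI] by auto

lemma nonzero_degrees_iff:
  assumes f: "Poly_Mapping.keys f \<subseteq> carrier L" and x: "x \<in> carrier L"
  shows "congI `` {x} \<in> nonzero_degrees Q P I (loc_residue Q P I f) \<longleftrightarrow> restrict_support f (congI `` {x}) \<notin> II"
proof -
  have "congI `` {x} \<in> carrier (loc_quotient Q (ideal_congruence Q I) P)"
    unfolding loc_quotient_eq[OF I_ideal] L.quotient_carrier[OF congI] using x by blast
  moreover have "Poly_Mapping.keys (restrict_support f (congI `` {x})) \<subseteq> carrier L"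
    using f by (auto simp: keys_restrict_support)
  ultimately show ?thesis
    unfolding nonzero_degrees_def mem_Collect_eq homogeneous_component_eq[OF I_ideal II_binomial f x refl]
    using L.res_eq_zero_iff[OF II_ideal] by (simp add: loc_residue_def loc_residue_ring_def)
qed

text \<open>Suppose \<open>x w\<close> is congruent to \<open>w\<close> for a nonunit
  \<open>x\<close>. As a multiple of an element of \<open>P\<close>, it kills \<open>X\<close>, so
  the coefficient of \<open>t^w\<close> in \<open>t^x f\<close> is 0. A component in another degree
  \<open>u\<close> contributing to it has \<open>x u\<close> congruent to \<open>w\<close>;
  minimality of \<open>w\<close> makes \<open>u\<close> congruent to some \<open>w y\<close>, hence
  to \<open>x w y\<close>, to \<open>x u\<close> and to \<open>w\<close>. So only the component at
  \<open>w\<close> contributes, and its contribution is nonzero.\<close>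

lemma socle_witness_properties:
  assumes w: "w \<in> carrier Q" and X: "X \<in> carrier (loc_residue_ring Q P I)"
    and kill: "\<forall>g\<in>monomial_prime Q P.
            loc_residue Q P I (loc_map Q P g) \<otimes>\<^bsub>loc_residue_ring Q P I\<^esub> X = \<zero>\<^bsub>loc_residue_ring Q P I\<^esub>"
    and deg: "loc_class Q (ideal_congruence Q I) P w \<in> nonzero_degrees Q P I X"
    and min: "\<forall>d\<in>nonzero_degrees Q P I X.
            \<not> green_less (loc_quotient Q (ideal_congruence Q I) P) d (loc_class Q (ideal_congruence Q I) P w)"
  shows "monomial (to_loc Q P w) \<notin> II"
    and "\<And>x. x \<in> carrier L \<Longrightarrow> x \<notin> Units L \<Longrightarrow> (x \<otimes>\<^bsub>L\<^esub> to_loc Q P w, to_loc Q P w) \<notin> congI"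
proof -
  interpret S: cring "monoid_algebra Q :: ('a \<Rightarrow>\<^sub>0 'k) ring" by (rule monoid_algebra_cring)
  let ?W = "to_loc Q P w"
  let ?D = "congI `` {?W}"
  have c: "?W \<in> carrier L" using w by simp
  obtain f where f: "Poly_Mapping.keys f \<subseteq> carrier L" "X = loc_residue Q P I f"
    using L.res_cases[OF II_ideal, of X] X unfolding loc_residue_def loc_residue_ring_def by blast
  have D: "restrict_support f ?D \<notin> II"
    using deg nonzero_degrees_iff[OF f(1) c] f(2) by (simp add: loc_class_eq[OF I_ideal])
  show wI: "monomial ?W \<notin> II"
  proof
    assume z: "monomial ?W \<in> II"
    have "Poly_Mapping.single a b \<in> II" if "a \<in> ?D" for a b
      using L.ideal_psmult[OF II_ideal, of "monomial a" b] L.ideal_congruence_in_ideal[OF II_ideal, of ?W a] that z by simp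
    then have "restrict_support f ?D \<in> II" unfolding restrict_support_def by (intro L.ideal_sum[OF II_ideal]) auto
    then show False using D by blast
  qed
  interpret W: witness_form L II ?W "L.witness_coeff II ?W" by (rule wf_I[OF w wI])
  let ?\<psi> = "L.witness_coeff II ?W"
  have \<kappa>ne: "W.\<kappa> f \<noteq> 0" using W.restrict_class_w_iff[OF f(1)] D by blast
  show "(x \<otimes>\<^bsub>L\<^esub> ?W, ?W) \<notin> congI" if x: "x \<in> carrier L" "x \<notin> Units L" for x
  proof
    assume xW: "(x \<otimes>\<^bsub>L\<^esub> ?W, ?W) \<in> congI"
    note tr = L.congruence_trans[OF congI] and sy = L.congruence_sym[OF congI]
    obtain p z where pz: "p \<in> P" "z \<in> carrier L" "x = z \<otimes>\<^bsub>L\<^esub> to_loc Q P p" using nonunit_repr[OF x] .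
    have pc: "to_loc Q P p \<in> carrier L" "p \<in> carrier Q" using pz P_subset by auto
    have "(monomial ` P :: ('a \<Rightarrow>\<^sub>0 'k) set) \<subseteq> carrier (monoid_algebra Q)" using P_subset by auto
    then have "(monomial p :: 'a \<Rightarrow>\<^sub>0 'k) \<in> monomial_prime Q P"
      unfolding monomial_prime_def using S.genideal_self pz(1) by blast
    then have "loc_residue Q P I (monomial (to_loc Q P p)) \<otimes>\<^bsub>loc_residue_ring Q P I\<^esub> X = \<zero>\<^bsub>loc_residue_ring Q P I\<^esub>"
      using kill by force
    then have pf: "conv L (monomial (to_loc Q P p)) f \<in> II"
      unfolding f(2) loc_residue_def loc_residue_ring_def
      using L.res_mult[OF II_ideal _ f(1), of "monomial (to_loc Q P p)"]
        L.res_eq_zero_iff[OF II_ideal L.conv_closed[OF _ f(1)], of "monomial (to_loc Q P p)"] pc by simp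
    have "conv L (monomial z) (conv L (monomial (to_loc Q P p)) f) \<in> II"
      using L.ideal_conv[OF II_ideal pf, of "monomial z"] pz(2) by simp
    then have "conv L (monomial x) f \<in> II"
      using L.conv_assoc[of "monomial z" "monomial (to_loc Q P p)" f] pz pc f(1) by simp
    then have pr0: "W.pr x f = 0" using W.\<psi>_I W.\<kappa>_conv[OF x(1) f(1), of 1] by simp
    let ?cl = "\<lambda>u. congI `` {u}"
    have other: "W.pr x (restrict_support f d) = 0" if d: "d \<in> ?cl ` Poly_Mapping.keys f" "d \<noteq> ?D" for d
    proof (rule ccontr)
      assume ne: "W.pr x (restrict_support f d) \<noteq> 0"
      obtain u where u: "u \<in> Poly_Mapping.keys f" "d = ?cl u" using d(1) by blast
      have uc: "u \<in> carrier L" using u(1) f(1) by blast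
      have "restrict_support f d \<notin> II" using ne W.pr_I x(1) by blast
      then have "d \<in> nonzero_degrees Q P I X" using nonzero_degrees_iff[OF f(1) uc] u(2) f(2) by simp
      then have nl: "\<not> green_less (loc_quotient Q (ideal_congruence Q I) P) (?cl u) ?D"
        using min u(2) by (simp add: loc_class_eq[OF I_ideal])
      have "\<exists>v\<in>Poly_Mapping.keys (restrict_support f d). ?\<psi> (x \<otimes>\<^bsub>L\<^esub> v) \<noteq> 0"
      proof (rule ccontr)
        assume "\<not> ?thesis"
        then have "W.pr x (restrict_support f d) = 0" unfolding keysum_def by (intro sum.neutral) auto
        then show False using ne by blast
      qed
      then obtain v where v: "v \<in> Poly_Mapping.keys f" "v \<in> d" "?\<psi> (x \<otimes>\<^bsub>L\<^esub> v) \<noteq> 0"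
        by (auto simp: keys_restrict_support)
      have vc: "v \<in> carrier L" using v(1) f(1) by blast
      have "(x \<otimes>\<^bsub>L\<^esub> v, ?W) \<in> congI" using W.\<psi>_congruence_iff v(3) x(1) vc by simp
      moreover have "(x \<otimes>\<^bsub>L\<^esub> u, x \<otimes>\<^bsub>L\<^esub> v) \<in> congI"
        using L.congruence_mult_left[OF congI, of u v x] v(2) u(2) x(1) by simp
      ultimately have xu: "(x \<otimes>\<^bsub>L\<^esub> u, ?W) \<in> congI" using tr by blast
      then have "(?W, u \<otimes>\<^bsub>L\<^esub> x) \<in> congI" using sy x(1) uc by (simp add: L.m_comm)
      then have "\<exists>y\<in>carrier L. (u, ?W \<otimes>\<^bsub>L\<^esub> y) \<in> congI"
        using nl green_le_iff[OF uc c] green_le_iff[OF c uc] x(1) unfolding green_less_def by blast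
      then obtain y where y: "y \<in> carrier L" "(u, ?W \<otimes>\<^bsub>L\<^esub> y) \<in> congI" by blast
      have 1: "(?W \<otimes>\<^bsub>L\<^esub> y, (x \<otimes>\<^bsub>L\<^esub> ?W) \<otimes>\<^bsub>L\<^esub> y) \<in> congI" by (rule L.congruence_mult_right[OF congI sy[OF xW] y(1)])
      have 2: "((x \<otimes>\<^bsub>L\<^esub> ?W) \<otimes>\<^bsub>L\<^esub> y, x \<otimes>\<^bsub>L\<^esub> u) \<in> congI"
        using L.congruence_mult_left[OF congI sy[OF y(2)] x(1)] x(1) y(1) c by (simp add: L.m_assoc)
      have "(u, ?W) \<in> congI" using tr[OF y(2) tr[OF 1 tr[OF 2 xu]]] .
      then show False using d(2) u(2) L.class_eq_iff[OF congI uc c] by simp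
    qed
    have "?D \<in> ?cl ` Poly_Mapping.keys f"
    proof (rule ccontr)
      assume nin: "?D \<notin> ?cl ` Poly_Mapping.keys f"
      have "Poly_Mapping.keys f \<inter> ?D = {}"
      proof (rule ccontr)
        assume "Poly_Mapping.keys f \<inter> ?D \<noteq> {}"
        then obtain u where "u \<in> Poly_Mapping.keys f" "u \<in> ?D" by blast
        then show False using nin class_of_iff[OF c, of u] by blast
      qed
      then have "restrict_support f ?D = 0" by (simp add: restrict_support_def)
      then show False using D L.ideal_zero[OF II_ideal] by simp
    qed
    then have "(\<Sum>d\<in>?cl ` Poly_Mapping.keys f. W.pr x (restrict_support f d)) = W.pr x (restrict_support f ?D)"
      using sum.mono_neutral_right[of "?cl ` Poly_Mapping.keys f" "{?D}" "\<lambda>d. W.pr x (restrict_support f d)"] other by simp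
    moreover have "W.pr x f = (\<Sum>d\<in>?cl ` Poly_Mapping.keys f. W.pr x (restrict_support f d))"
      by (subst (1) L.class_partition[OF II_ideal f(1)]) (rule W.pr_sum)
    moreover have "W.pr x (restrict_support f ?D) = W.\<kappa> f * ?\<psi> (x \<otimes>\<^bsub>L\<^esub> ?W)"
      using W.pr_I[OF W.restrict_class_w[OF f(1)] x(1)] by (simp add: W.pr_diff)
    moreover have "?\<psi> (x \<otimes>\<^bsub>L\<^esub> ?W) \<noteq> 0" using xW W.\<psi>_congruence_iff x(1) c by simp
    ultimately show False using pr0 \<kappa>ne by simp
  qed
qed

lemma essential_witness_properties:
  assumes "essential_witness Q I P w"
  shows "w \<in> carrier Q" "monomial (to_loc Q P w) \<notin> II"
    and "\<And>x. x \<in> carrier L \<Longrightarrow> x \<notin> Units L \<Longrightarrow> (x \<otimes>\<^bsub>L\<^esub> to_loc Q P w, to_loc Q P w) \<notin> congI"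
  using assms key_witness_properties[of w] socle_witness_properties[of w]
  unfolding essential_witness_def by blast+

lemma witness_socle_form:
  assumes fg: "finitely_generated_monoid Q" and ew: "essential_witness Q I P w"
  shows "socle_form L II (to_loc Q P w) (L.witness_coeff II (to_loc Q P w))"
proof -
  note p = essential_witness_properties[OF ew]
  interpret W: witness_form L II "to_loc Q P w" "L.witness_coeff II (to_loc Q P w)" by (rule wf_I[OF p(1,2)])
  show ?thesis
  proof (intro socle_form.intro socle_form_axioms.intro)
    show "witness_form L II (to_loc Q P w) (L.witness_coeff II (to_loc Q P w))" by (rule wf_I[OF p(1,2)])
    show "L.witness_coeff II (to_loc Q P w) (x \<otimes>\<^bsub>L\<^esub> to_loc Q P w) = 0" if "x \<in> carrier L" "x \<notin> Units L" for x
      using p(3)[OF that] W.\<psi>_congruence_iff[of "x \<otimes>\<^bsub>L\<^esub> to_loc Q P w"] that(1) p(1) by simp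
    show "dickson_property L" by (rule localization_dickson[OF finitely_generated_dickson[OF fg]])
    show "\<exists>Y. finite Y \<and> Y \<subseteq> Units L \<and> (\<forall>H. subgroup H (units_of L) \<and> Y \<subseteq> H \<longrightarrow> H = Units L)"
      by (rule Units_generated[OF fg])
  qed
qed

lemma witness_components_properties:
  assumes fg: "finitely_generated_monoid Q" and ew: "essential_witness Q I P w"
  defines "K \<equiv> irreducible_closure Q (coprincipal_component Q I P w) P w"
  shows "K = {f \<in> carrier (monoid_algebra Q). loc_map Q P f \<in> witness_form.core L (L.witness_coeff II (to_loc Q P w))}"
    and "I \<subseteq> K"
    and "ideal_Inter (monoid_algebra Q) (primary_components (monoid_algebra Q) K) = K"
    and "C \<in> primary_components (monoid_algebra Q) K \<Longrightarrow> irreducible_ideal (monoid_algebra Q) C"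
proof -
  note p = essential_witness_properties[OF ew]
  interpret W: socle_form L II "to_loc Q P w" "L.witness_coeff II (to_loc Q P w)"
    by (rule witness_socle_form[OF fg ew])
  show K: "K = {f \<in> carrier (monoid_algebra Q). loc_map Q P f \<in> W.core}"
    unfolding K_def by (rule irreducible_closure_coprincipal[OF p(1,2)])
  have "loc_map Q P f \<in> W.core" if "f \<in> I" for f
    using loc_map_in_loc_idealI[OF I_ideal that] W.pr_I L.ideal_keys[OF II_ideal] by (auto simp: W.core_def)
  then show "I \<subseteq> K" unfolding K using ideal_keys[OF I_ideal] by auto
  have S: "cring (monoid_algebra Q :: ('a \<Rightarrow>\<^sub>0 'k) ring)" by (rule monoid_algebra_cring)
  have loc: "\<exists>s\<in>carrier (monoid_algebra Q). \<exists>t\<in>carrier (monoid_algebra Q). \<exists>u\<in>Units L.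
      loc_map Q P t = monomial u \<and> loc_map Q P s = conv L (monomial u) f"
    if f: "Poly_Mapping.keys f \<subseteq> carrier L" for f :: "('a \<times> 'a) set \<Rightarrow>\<^sub>0 'k"
  proof -
    obtain s g where s: "s \<in> F" "Poly_Mapping.keys g \<subseteq> carrier Q" "conv L (monomial (to_loc Q P s)) f = loc_map Q P g"
      using loc_map_surj[OF f] by blast
    then show ?thesis
      using to_loc_Units[OF s(1)]
      by (intro bexI[of _ g] bexI[of _ "monomial s"] bexI[of _ "to_loc Q P s"]) auto
  qed
  show "ideal_Inter (monoid_algebra Q) (primary_components (monoid_algebra Q) K) = K"
    unfolding K by (rule W.core_contraction_components(1)[OF S loc_map_hom]) (erule loc)
  show "irreducible_ideal (monoid_algebra Q) C" if "C \<in> primary_components (monoid_algebra Q) K"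
    by (rule W.core_contraction_components(2)[OF S loc_map_hom], erule loc, rule that[unfolded K])
qed

end

end

section \<open>Separating elements from a binomial ideal\<close>

text \<open>Green's relation is a preorder, so minimality refers to its strict part: an element with
  the fewest strictly smaller ones has none.\<close>

lemma finite_minimal_green:
  assumes "finite D" "D \<noteq> {}"
  shows "\<exists>d\<in>D. \<forall>e\<in>D. \<not> green_less M e d"
proof -
  have "\<exists>d. d \<in> D \<and> (\<forall>e. e \<in> D \<longrightarrow> card {c \<in> D. green_less M c d} \<le> card {c \<in> D. green_less M c e})"
    using assms(2) ex_has_least_nat[of "\<lambda>d. d \<in> D" _ "\<lambda>d. card {c \<in> D. green_less M c d}"] by blast
  then obtain d where d: "d \<in> D" "\<And>e. e \<in> D \<Longrightarrow> card {c \<in> D. green_less M c d} \<le> card {c \<in> D. green_less M c e}"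
    by blast
  have "\<not> green_less M e d" if e: "e \<in> D" for e
  proof
    assume l: "green_less M e d"
    have "{c \<in> D. green_less M c e} \<subset> {c \<in> D. green_less M c d}"
      using l e unfolding green_less_def green_le_def by blast
    then have "card {c \<in> D. green_less M c e} < card {c \<in> D. green_less M c d}"
      using assms(1) by (intro psubset_card_mono) auto
    then show False using d(2)[OF e] by simp
  qed
  then show ?thesis using d(1) by blast
qed

lemma (in comm_monoid) separating_witness:
  fixes I :: "('a \<Rightarrow>\<^sub>0 'k::field) set"
  assumes bin: "binomial_ideal G I" and dick: "dickson_property G"
    and f: "Poly_Mapping.keys f \<subseteq> carrier G" "f \<notin> I"
  shows "\<exists>P w. monoid_prime G P \<and> essential_witness G I P w \<and>
    loc_map G P f \<notin> witness_form.core (localization G P)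
      (comm_monoid.witness_coeff (localization G P) (loc_ideal G P I) (to_loc G P w))"
proof -
  have I: "ideal I (monoid_algebra G)" by (rule binomial_ideal_ideal[OF bin])
  \<comment> \<open>These exponents, which multiply \<open>t^b f\<close> into \<open>I\<close>, form
    a monoid ideal. The prime is found as a maximal one among those with \<open>t^b f\<close>
    outside \<open>I\<close>.\<close>
  define ann where "ann b = {a \<in> carrier G. conv G (monomial (a \<otimes> b)) f \<in> I}" for b
  let ?good = "\<lambda>b. b \<in> carrier G \<and> conv G (monomial b) f \<notin> I"
  have mm: "conv G (monomial (a \<otimes> b)) f = conv G (monomial a) (conv G (monomial b) f)"
    if "a \<in> carrier G" "b \<in> carrier G" for a b
    using conv_assoc[of "monomial a" "monomial b" f] that f(1) by simp
  have up: "conv G (monomial (c \<otimes> x)) f \<in> I" if "conv G (monomial x) f \<in> I" "c \<in> carrier G" "x \<in> carrier G" for c x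
    unfolding mm[OF that(2,3)] using ideal_conv[OF I that(1), of "monomial c"] that(2) by simp
  have ann_mono: "ann b \<subseteq> ann (b \<otimes> c)" if "b \<in> carrier G" "c \<in> carrier G" for b c
  proof
    fix a assume a: "a \<in> ann b"
    then have "c \<otimes> (a \<otimes> b) = a \<otimes> (b \<otimes> c)" using that by (auto simp: ann_def m_ac)
    then show "a \<in> ann (b \<otimes> c)" using up[of "a \<otimes> b" c] a that by (simp add: ann_def)
  qed
  \<comment> \<open>Without stabilization, a new exponent \<open>a n\<close> would enter the growing
    annihilators at every step. Some \<open>a j\<close> is divisible by an earlier
    \<open>a i\<close>, so it already belonged to the annihilator it was supposed to
    enlarge.\<close>
  have "\<exists>b. ?good b \<and> (\<forall>c\<in>carrier G. ?good (b \<otimes> c) \<longrightarrow> ann (b \<otimes> c) = ann b)"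
  proof (rule ccontr)
    assume not: "\<not> ?thesis"
    have step: "\<exists>y. ?good y \<and> ((\<exists>c\<in>carrier G. y = b \<otimes> c) \<and> ann b \<noteq> ann y)" if b: "?good b" for b
    proof -
      have "\<not> (\<forall>c\<in>carrier G. ?good (b \<otimes> c) \<longrightarrow> ann (b \<otimes> c) = ann b)" using not b by blast
      then show ?thesis by metis
    qed
    have "\<exists>h. \<forall>n::nat. ?good (h n) \<and> ((\<exists>c\<in>carrier G. h (Suc n) = h n \<otimes> c) \<and> ann (h n) \<noteq> ann (h (Suc n)))"
    proof (rule dependent_nat_choice)
      show "\<exists>x. ?good x" using f by (intro exI[of _ \<one>]) (simp add: conv_one)
    qed (use step in blast)
    then obtain h where h: "\<And>n::nat. ?good (h n)" "\<And>n. \<exists>c\<in>carrier G. h (Suc n) = h n \<otimes> c"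
      "\<And>n. ann (h n) \<noteq> ann (h (Suc n))" by blast
    have sub: "ann (h n) \<subseteq> ann (h (Suc n))" for n
    proof -
      obtain c where "c \<in> carrier G" "h (Suc n) = h n \<otimes> c" using h(2) by blast
      then show ?thesis using ann_mono[of "h n" c] h(1)[of n] by simp
    qed
    then have mono: "i \<le> j \<Longrightarrow> ann (h i) \<subseteq> ann (h j)" for i j by (rule lift_Suc_mono_le)
    have "\<exists>a. a \<in> ann (h (Suc n)) \<and> a \<notin> ann (h n)" for n using sub[of n] h(3)[of n] by blast
    then obtain a where a: "\<And>n. a n \<in> ann (h (Suc n))" "\<And>n. a n \<notin> ann (h n)" by metis
    have ac: "range a \<subseteq> carrier G" using a(1) by (auto simp: ann_def)
    obtain i j z where ij: "i < j" "z \<in> carrier G" "a j = a i \<otimes> z"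
      using dick ac unfolding dickson_property_def by blast
    have "a i \<in> ann (h j)" using a(1)[of i] mono[of "Suc i" j] ij(1) by auto
    then have ai: "a i \<in> carrier G" "conv G (monomial (a i \<otimes> h j)) f \<in> I" by (auto simp: ann_def)
    have hj: "h j \<in> carrier G" using h(1) by blast
    have "a j \<otimes> h j = z \<otimes> (a i \<otimes> h j)" unfolding ij(3) using ai(1) ij(2) hj by (simp add: m_ac)
    then have "conv G (monomial (a j \<otimes> h j)) f \<in> I" using up[OF ai(2) ij(2)] ai(1) hj by simp
    then show False using a(2)[of j] ij ai(1) by (simp add: ann_def)
  qed
  then obtain b where b: "b \<in> carrier G" "conv G (monomial b) f \<notin> I"
    and max: "\<And>c. c \<in> carrier G \<Longrightarrow> conv G (monomial (b \<otimes> c)) f \<notin> I \<Longrightarrow> ann (b \<otimes> c) = ann b" by auto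
  define P where "P = ann b"
  define h where "h = conv G (monomial b) f"
  have hk: "Poly_Mapping.keys h \<subseteq> carrier G" unfolding h_def using b(1) f(1) by (intro conv_closed) auto
  have Pc: "P \<subseteq> carrier G" by (auto simp: P_def ann_def)
  have P_iff: "a \<in> P \<longleftrightarrow> conv G (monomial a) h \<in> I" if "a \<in> carrier G" for a
    using mm[OF that b(1)] that by (simp add: P_def ann_def h_def)
  have one: "\<one> \<notin> P" using b by (simp add: P_def ann_def)
  have prime: "monoid_prime G P"
    unfolding monoid_prime_def
  proof (intro conjI ballI)
    show "P \<subset> carrier G" using Pc one by blast
    show "p \<otimes> q \<in> P" if "p \<in> P" "q \<in> carrier G" for p q
    proof -
      have pc: "p \<in> carrier G" using that Pc by blast
      then have "q \<otimes> (p \<otimes> b) = (p \<otimes> q) \<otimes> b" using that b(1) by (simp add: m_ac)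
      then show ?thesis using up[of "p \<otimes> b" q] that pc b(1) by (simp add: P_def ann_def)
    qed
    \<comment> \<open>Primality from maximality: for \<open>x\<close> outside \<open>P\<close>,
      multiplying \<open>t^b f\<close> by \<open>t^x\<close> leaves it outside \<open>I\<close> with
      the same annihilator, so no \<open>y\<close> outside \<open>P\<close> kills it.\<close>
    show "submonoid (carrier G - P) G"
    proof
      show "\<one> \<in> carrier G - P" using one by simp
      show "x \<otimes> y \<in> carrier G - P" if xy: "x \<in> carrier G - P" "y \<in> carrier G - P" for x y
      proof -
        have c: "x \<in> carrier G" "y \<in> carrier G" using xy by auto
        have "conv G (monomial (b \<otimes> x)) f \<notin> I" using xy c b(1) by (simp add: P_def ann_def m_comm)
        then have "ann (b \<otimes> x) = P" using max[OF c(1)] by (simp add: P_def)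
        then have "y \<notin> ann (b \<otimes> x)" using xy by blast
        moreover have "y \<otimes> (b \<otimes> x) = (x \<otimes> y) \<otimes> b" using c b(1) by (simp add: m_ac)
        ultimately have "x \<otimes> y \<notin> P" using c by (simp add: P_def ann_def)
        then show ?thesis using c by simp
      qed
    qed auto
  qed
  interpret PL: prime_localization G P
    by (intro prime_localization.intro prime_localization_axioms.intro comm_monoid_axioms prime)
  interpret L: comm_monoid PL.L by (rule PL.L_comm_monoid)
  let ?II = "loc_ideal G P I"
  let ?h = "loc_map G P h"
  let ?cl = "\<lambda>u. ideal_congruence PL.L ?II `` {u}"
  have lk: "Poly_Mapping.keys ?h \<subseteq> carrier PL.L" by (rule PL.loc_map_closed[OF hk])
  \<comment> \<open>Localization does not kill \<open>h\<close>, because a multiplier that carries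
    it into \<open>I\<close> belongs to \<open>P\<close> and never to the complement.\<close>
  have hI: "?h \<notin> ?II"
    using PL.loc_map_in_loc_ideal_iff[OF I hk] P_iff by blast
  let ?ND = "{d \<in> ?cl ` Poly_Mapping.keys ?h. restrict_support ?h d \<notin> ?II}"
  have "?ND \<noteq> {}" using L.exists_class_not_in_ideal[OF PL.II_ideal[OF bin] lk hI] by blast
  moreover have "finite ?ND" by simp
  ultimately obtain d where d: "d \<in> ?ND"
    "\<And>e. e \<in> ?ND \<Longrightarrow> \<not> green_less (loc_quotient G (ideal_congruence G I) P) e d"
    using finite_minimal_green[of ?ND "loc_quotient G (ideal_congruence G I) P"] by blast
  obtain u where u: "u \<in> Poly_Mapping.keys ?h" "d = ?cl u" using d(1) by blast
  \<comment> \<open>Every exponent of the localized \<open>h\<close> is the image of an element of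
    the original monoid, as required of a witness.\<close>
  obtain w where w: "w \<in> carrier G" "u = to_loc G P w" using PL.loc_map_keys[OF hk] u(1) by blast
  have dw: "d = loc_class G (ideal_congruence G I) P w" using PL.loc_class_eq[OF I] u(2) w(2) by simp
  let ?X = "loc_residue G P I ?h"
  have nd: "nonzero_degrees G P I ?X \<subseteq> ?ND"
  proof
    fix e assume e: "e \<in> nonzero_degrees G P I ?X"
    then have "e \<in> carrier (loc_quotient G (ideal_congruence G I) P)" by (simp add: nonzero_degrees_def)
    then obtain x where x: "x \<in> carrier PL.L" "e = ?cl x"
      unfolding PL.loc_quotient_eq[OF I] L.quotient_carrier[OF PL.loc_congruence_congruence[OF I]] by blast
    have ne: "restrict_support ?h e \<notin> ?II" using PL.nonzero_degrees_iff[OF bin lk x(1)] e x(2) by simp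
    have "\<exists>v\<in>Poly_Mapping.keys ?h. v \<in> e"
    proof (rule ccontr)
      assume "\<not> ?thesis"
      then have "restrict_support ?h e = 0" by (auto simp: restrict_support_def intro!: sum.neutral)
      then show False using ne L.ideal_zero[OF PL.II_ideal[OF bin]] by simp
    qed
    then obtain v where v: "v \<in> Poly_Mapping.keys ?h" "v \<in> e" by blast
    then have "e = ?cl v" using PL.class_of_iff[OF bin x(1), of v] x(2) by simp
    then show "e \<in> ?ND" using v(1) ne by blast
  qed
  have ew: "essential_witness G I P w"
    unfolding essential_witness_def
  proof (intro conjI disjI2 bexI[of _ ?X] ballI)
    show "w \<in> carrier G" by (rule w(1))
    show "?X \<in> carrier (loc_residue_ring G P I)"
      unfolding loc_residue_def loc_residue_ring_def by (rule L.res_closed[OF PL.II_ideal[OF bin] lk])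
    show "loc_class G (ideal_congruence G I) P w \<in> nonzero_degrees G P I ?X"
      using PL.nonzero_degrees_iff[OF bin lk, of "to_loc G P w"] d(1) u(2) w dw by simp
    show "\<not> green_less (loc_quotient G (ideal_congruence G I) P) e (loc_class G (ideal_congruence G I) P w)"
      if "e \<in> nonzero_degrees G P I ?X" for e
      using d(2) nd that dw by blast
    fix g :: "'a \<Rightarrow>\<^sub>0 'k" assume g: "g \<in> monomial_prime G P"
    interpret S: cring "monoid_algebra G :: ('a \<Rightarrow>\<^sub>0 'k) ring" by (rule monoid_algebra_cring)
    let ?Y = "{g. Poly_Mapping.keys g \<subseteq> carrier G \<and> conv G g h \<in> I}"
    \<comment> \<open>Monomials in \<open>P\<close> carry \<open>h\<close> into \<open>I\<close> by
      construction. The multipliers with this property form an ideal, so the whole monomial prime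
      does the same.\<close>
    have Y: "ideal ?Y (monoid_algebra G)"
    proof (rule monoid_algebra_idealI)
      show "f + g \<in> ?Y" if "f \<in> ?Y" "g \<in> ?Y" for f g
        using that ideal_add[OF I] order_trans[OF keys_add[of f g]] by (auto simp: conv_add_left)
      show "conv G (Poly_Mapping.single a c) f \<in> ?Y" if "a \<in> carrier G" "f \<in> ?Y" for a c f
      proof -
        have fk: "Poly_Mapping.keys f \<subseteq> carrier G" "conv G f h \<in> I" using that(2) by auto
        have sk: "Poly_Mapping.keys (Poly_Mapping.single a c) \<subseteq> carrier G" using that(1) by simp
        show ?thesis
          using conv_closed[OF sk fk(1)] conv_assoc[OF sk fk(1) hk] ideal_conv[OF I fk(2) sk] by simp
      qed
    qed (use ideal_zero[OF I] in auto)
    have "(monomial ` P :: ('a \<Rightarrow>\<^sub>0 'k) set) \<subseteq> ?Y" using P_iff Pc by auto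
    then have "monomial_prime G P \<subseteq> ?Y"
      unfolding monomial_prime_def by (rule S.genideal_minimal[OF Y])
    then have gk: "Poly_Mapping.keys g \<subseteq> carrier G" "conv G g h \<in> I" using g by auto
    have "conv PL.L (loc_map G P g) ?h \<in> ?II"
      using PL.loc_map_in_loc_idealI[OF I gk(2)] PL.loc_map_conv[OF gk(1) hk] by simp
    then show "loc_residue G P I (loc_map G P g) \<otimes>\<^bsub>loc_residue_ring G P I\<^esub> ?X = \<zero>\<^bsub>loc_residue_ring G P I\<^esub>"
      unfolding loc_residue_def loc_residue_ring_def
      using L.res_mult[OF PL.II_ideal[OF bin] PL.loc_map_closed[OF gk(1)] lk]
        L.res_eq_zero_iff[OF PL.II_ideal[OF bin] L.conv_closed[OF PL.loc_map_closed[OF gk(1)] lk]] by simp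
  qed
  note p = PL.essential_witness_properties[OF bin ew]
  interpret W: witness_form PL.L ?II "to_loc G P w" "L.witness_coeff ?II (to_loc G P w)"
    by (rule PL.wf_I[OF bin p(1,2)])
  have "loc_map G P f \<notin> W.core"
  proof
    assume fc: "loc_map G P f \<in> W.core"
    \<comment> \<open>Multiplication by \<open>t^b\<close> leads from \<open>f\<close> to
      \<open>h\<close>, whose component in the degree of \<open>w\<close> was chosen
      nonzero.\<close>
    have "conv PL.L (loc_map G P (monomial b)) (loc_map G P f) \<in> W.core"
      using b(1) by (intro L.ideal_conv[OF W.core_ideal fc]) auto
    then have hc: "?h \<in> W.core" using PL.loc_map_conv[of "monomial b" f] b(1) f(1) by (simp add: h_def)
    then have "W.pr \<one>\<^bsub>PL.L\<^esub> ?h = 0" by (simp add: W.core_def)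
    moreover have "W.pr \<one>\<^bsub>PL.L\<^esub> ?h = W.\<kappa> ?h" using lk by (intro keysum_cong) auto
    ultimately have "restrict_support ?h (?cl (to_loc G P w)) \<in> ?II" using W.restrict_class_w_iff[OF lk] by simp
    then show False using d(1) u(2) w(2) by simp
  qed
  then show ?thesis using prime ew by blast
qed

theorem corollary7p8:
  fixes Q :: "('q, 'm) monoid_scheme"
    and I :: "('q \<Rightarrow>\<^sub>0 'k::field) set"
  assumes "comm_monoid Q"
    and "finitely_generated_monoid Q"
    and "binomial_ideal Q I"
  shows "(\<forall>C\<in>witness_components Q I. irreducible_ideal (monoid_algebra Q) C) \<and>
         ideal_Inter (monoid_algebra Q) (witness_components Q I) = I"
proof
  interpret comm_monoid Q by fact
  have PL: "prime_localization Q P" if "monoid_prime Q P" for P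
    by (intro prime_localization.intro prime_localization_axioms.intro assms(1) that)
  note props = prime_localization.witness_components_properties[OF PL assms(3,2)]
  let ?S = "monoid_algebra Q :: ('q \<Rightarrow>\<^sub>0 'k) ring"
  let ?K = "\<lambda>P w. irreducible_closure Q (coprincipal_component Q I P w) P w"
  show "\<forall>C\<in>witness_components Q I. irreducible_ideal ?S C"
    unfolding witness_components_def using props(4) by blast
  have Ik: "I \<subseteq> carrier ?S" using ideal_keys[OF binomial_ideal_ideal[OF assms(3)]] by auto
  show "ideal_Inter ?S (witness_components Q I) = I"
  proof
    show "I \<subseteq> ideal_Inter ?S (witness_components Q I)"
    proof
      fix f assume f: "f \<in> I"
      have "f \<in> C" if C: "C \<in> witness_components Q I" for C
      proof -
        obtain P w where Pw: "monoid_prime Q P" "essential_witness Q I P w" "C \<in> primary_components ?S (?K P w)"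
          using C unfolding witness_components_def by blast
        have "f \<in> ideal_Inter ?S (primary_components ?S (?K P w))"
          unfolding props(3)[OF Pw(1,2)] using props(2)[OF Pw(1,2)] f by blast
        then show ?thesis using Pw(3) by (simp add: ideal_Inter_def)
      qed
      then show "f \<in> ideal_Inter ?S (witness_components Q I)" using f Ik by (auto simp: ideal_Inter_def)
    qed
    show "ideal_Inter ?S (witness_components Q I) \<subseteq> I"
    proof (rule subsetI, rule ccontr)
      fix f assume f: "f \<in> ideal_Inter ?S (witness_components Q I)" and fI: "f \<notin> I"
      have fk: "Poly_Mapping.keys f \<subseteq> carrier Q" using f by (simp add: ideal_Inter_def)
      obtain P w where Pw: "monoid_prime Q P" "essential_witness Q I P w"
        "loc_map Q P f \<notin> witness_form.core (localization Q P)
          (comm_monoid.witness_coeff (localization Q P) (loc_ideal Q P I) (to_loc Q P w))"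
        using separating_witness[OF assms(3) finitely_generated_dickson[OF assms(2)] fk fI] by blast
      \<comment> \<open>Lying in the components at all witnesses, \<open>f\<close> lies in those at
        this witness, and their intersection is the closure that excludes it.\<close>
      have "f \<in> ideal_Inter ?S (primary_components ?S (?K P w))"
        using f Pw(1,2) unfolding witness_components_def ideal_Inter_def by blast
      then have "f \<in> ?K P w" unfolding props(3)[OF Pw(1,2)] .
      then show False using Pw(3) unfolding props(1)[OF Pw(1,2)] by blast
    qed
  qed
qed

end
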